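(* Let $N$ be a positive integer, $0<s<1$ with $N>2s$, and $p^*_{\alpha,s}=\frac{N+2\alpha+2s}{N-2s}$. Assume either (i) $1/2\le s<1$ and $\alpha>-2s$, or (ii) $0<s<1/2$ and $-2s<\alpha<\frac{2s(N-1)}{1-2s}$. Then the problem $$\mathcal{T}\bar v+\mathcal{A}_{s,N}\bar v=\bar v^{\,p^*_{\alpha,s}}\quad\text{in }\mathbb{R}$$ has a nonnegative, nontrivial variational solution $\bar v\in H^s_K(\mathbb{R})$. Moreover, this solution is classical and positive.
   Context: Fix $\theta\in\mathbb{S}^{N-1}$. Define $K(t)=e^{-t\frac{N+2s}{2}}\int_{\mathbb{S}^{N-1}}|1+e^{-2t}-2e^{-t}\langle\theta,\sigma\rangle|^{-\frac{N+2s}{2}}d\sigma$ for $t\in\mathbb{R}$, and $\mathcal{T}\bar v(\kappa)=\mathrm{P.V.}\int_{\mathbb{R}}(\bar v(\kappa)-\bar v(\tau))K(\kappa-\tau)\,d\tau$. With $\beta=-\frac{N-2s}{2}$, let $$\mathcal{A}_{s,N}=\int_0^\infty\int_{\mathbb{S}^{N-1}}\rho^{N-1}\frac{1-\rho^{\beta}}{|1+\rho^2-2\rho\langle\theta,\sigma\rangle|^{\frac{N+2s}{2}}}\,d\sigma\,d\rho$$ (a positive constant). $H^s_K(\mathbb{R})=\{u\in L^2(\mathbb{R}) : \int_{\mathbb{R}}\int_{\mathbb{R}}(u(\kappa)-u(\tau))^2K(\kappa-\tau)d\tau d\kappa<\infty\}$. A variational solution is $\bar v\in H^s_K(\mathbb{R})$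 with $\frac12\iint(\bar v(\kappa)-\bar v(\tau))(\varphi(\kappa)-\varphi(\tau))K(\kappa-\tau)\,d\tau d\kappa+\mathcal{A}_{s,N}\int\bar v\varphi=\int\bar v^{p^*_{\alpha,s}}\varphi$ for all $\varphi\in H^s_K(\mathbb{R})$. *)

theory Defs
  imports "HOL-Analysis.Analysis"
begin

text \<open>Integration over the unit sphere S^{N-1} of R^N (N = CARD('n)) with respect to the
  standard surface measure, via the polar-coordinate identity
  \<open>\<integral>_{S^{N-1}} f d\<sigma> = N \<integral>_{B_1} f(x/|x|) dx\<close>.\<close>
definition sphere_int :: "(real^'n \<Rightarrow> real) \<Rightarrow> real" where
  "sphere_int f = real CARD('n) * (LINT x : ball 0 1 | lborel. f (x /\<^sub>R norm x))"

definition kernK :: "real \<Rightarrow> real^'n \<Rightarrow> real \<Rightarrow> real" where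
  "kernK s \<theta> t = exp (- t * ((real CARD('n) + 2 * s) / 2)) *
     sphere_int (\<lambda>\<sigma>. \<bar>1 + exp (-2 * t) - 2 * exp (- t) * (\<theta> \<bullet> \<sigma>)\<bar>
                         powr (- (real CARD('n) + 2 * s) / 2))"

definition A_const :: "real \<Rightarrow> real^'n \<Rightarrow> real" where
  "A_const s \<theta> = Lim (at_right 0) (\<lambda>\<epsilon>.
     LINT \<rho> : {\<rho>. 0 < \<rho> \<and> \<bar>\<rho> - 1\<bar> > \<epsilon>} | lborel.
       sphere_int (\<lambda>\<sigma>. \<rho> ^ (CARD('n) - 1) * (1 - \<rho> powr (- (real CARD('n) - 2 * s) / 2))
                     / \<bar>1 + \<rho>\<^sup>2 - 2 * \<rho> * (\<theta> \<bullet> \<sigma>)\<bar> powr ((real CARD('n) + 2 * s) / 2)))"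

definition HsK :: "real \<Rightarrow> real^'n \<Rightarrow> (real \<Rightarrow> real) set" where
  "HsK s \<theta> = {u. u \<in> borel_measurable lborel \<and> integrable lborel (\<lambda>x. (u x)\<^sup>2) \<and>
      (\<integral>\<^sup>+ \<kappa>. \<integral>\<^sup>+ \<tau>. ennreal ((u \<kappa> - u \<tau>)\<^sup>2 * kernK s \<theta> (\<kappa> - \<tau>)) \<partial>lborel \<partial>lborel) < \<infinity>}"

definition variational_solution :: "real \<Rightarrow> real^'n \<Rightarrow> real \<Rightarrow> (real \<Rightarrow> real) \<Rightarrow> bool" where
  "variational_solution s \<theta> p v \<longleftrightarrow> v \<in> HsK s \<theta> \<and>
     (\<forall>\<phi> \<in> HsK s \<theta>.
        1/2 * (LINT \<kappa>|lborel. LINT \<tau>|lborel. (v \<kappa> - v \<tau>) * (\<phi> \<kappa> - \<phi> \<tau>) * kernK s \<theta> (\<kappa> - \<tau>))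
        + A_const s \<theta> * (LINT \<kappa>|lborel. v \<kappa> * \<phi> \<kappa>)
        = (LINT \<kappa>|lborel. v \<kappa> powr p * \<phi> \<kappa>))"

definition classical_solution :: "real \<Rightarrow> real^'n \<Rightarrow> real \<Rightarrow> (real \<Rightarrow> real) \<Rightarrow> bool" where
  "classical_solution s \<theta> p v \<longleftrightarrow> continuous_on UNIV v \<and>
     (\<forall>\<kappa>. \<exists>Tv.
        (\<forall>\<epsilon>>0. set_integrable lborel {\<tau>. \<bar>\<kappa> - \<tau>\<bar> > \<epsilon>} (\<lambda>\<tau>. (v \<kappa> - v \<tau>) * kernK s \<theta> (\<kappa> - \<tau>))) \<and>
        ((\<lambda>\<epsilon>. LINT \<tau> : {\<tau>. \<bar>\<kappa> - \<tau>\<bar> > \<epsilon>} | lborel. (v \<kappa> - v \<tau>) * kernK s \<theta> (\<kappa> - \<tau>))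
            \<longlongrightarrow> Tv) (at_right 0) \<and>
        Tv + A_const s \<theta> * v \<kappa> = v \<kappa> powr p)"

end

theory Submission
  imports Defs "HOL-Library.Diagonal_Subsequence"
begin

text \<open>
  Let \<open>L = T + A\<close>. As \<open>K\<close> is even and decreasing on the half-line and \<open>A > 0\<close>, the inverse of \<open>L\<close> is
  convolution with a function \<open>g\<close> that is again even, decreasing on the half-line, integrable and positive
  definite. It is the limit of Neumann series for the truncated kernels \<open>K(max \<bar>t\<bar> d)\<close>; the lower bound
  \<open>K(t) \<ge> c t powr (-1 - 2 s)\<close> prevents concentration at the origin and yields
  \<open>g(x) \<le> B \<bar>x\<bar> powr (b - 1)\<close> for \<open>b < min 1 (2 s)\<close>.

  One maximizes \<open>J w = \<integral>\<integral> w(x) g(x - y) w(y)\<close> over the even decreasing \<open>w \<ge> 0\<close> with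
  \<open>\<integral> w powr (1 + 1 / p) \<le> 1\<close>. On this cone \<open>w(x) \<le> \<bar>x\<bar> powr (- p / (p + 1))\<close>, which for
  \<open>1 < p\<close>, \<open>p (1 - 2 s) < 1 + 2 s\<close> makes the integrand of \<open>J\<close> uniformly dominated, so Helly's theorem
  gives a maximizer. Convolution with \<open>g\<close> preserves the cone, so by positive definiteness the maximizer
  realizes equality in Hoelder's inequality, i.e. \<open>w\<close> is a multiple of \<open>(g * w) powr p\<close>; rescaling,
  \<open>V = g * V powr p\<close>.

  For regularity, write the second difference of \<open>V = g * f\<close> as the convolution of a first difference of
  \<open>g\<close> with one of \<open>f\<close>: it is \<open>O(h powr (2 b))\<close> with \<open>2 b > 2 s\<close>, so \<open>T V\<close> converges absolutely
  after symmetrization.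
\<close>

section \<open>Symmetric decreasing functions and convolution\<close>

text \<open>A maximizing sequence can be lost by translation, by concentration or by spreading.
  Working inside a cone of functions centred at the origin excludes the first without any
  rearrangement inequality, and the power bound valid on the cone excludes the others. The price is
  that a cone allows no free variations: the Euler-Lagrange equation has to come from comparison
  with a single competitor that lies in the cone itself. One exponent \<open>b\<close> measures how
  little mass \<open>g\<close> has near the origin, and every restriction on the data is a
  restriction on \<open>b\<close>: the mass estimate yields \<open>b < 1\<close> and
  \<open>b \<le> 2 * s\<close>, regularity asks for \<open>b > s\<close>, compactness for
  \<open>b > (p - 1) / (p + 1)\<close>. For \<open>p > 1\<close> such a \<open>b\<close> exists iff
  \<open>(p - 1) / (p + 1) < 2 * s\<close>, and this is what the two cases for \<alpha> express.
  \<open>symdec\<close> leaves the value at the origin free: the kernels are singular there, and a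
  divergent Bochner integral returns the default 0.\<close>

definition symdec :: "(real \<Rightarrow> real) \<Rightarrow> bool" where
  "symdec f \<longleftrightarrow> (\<forall>x. 0 \<le> f x) \<and> (\<forall>x y. x \<noteq> 0 \<longrightarrow> \<bar>x\<bar> \<le> \<bar>y\<bar> \<longrightarrow> f y \<le> f x)"

definition conv :: "(real \<Rightarrow> real) \<Rightarrow> (real \<Rightarrow> real) \<Rightarrow> real \<Rightarrow> real" where
  "conv f g x = (LINT y|lborel. f (x - y) * g y)"

definition mass :: "(real \<Rightarrow> real) \<Rightarrow> real \<Rightarrow> real" where
  "mass f h = (LINT x|lborel. f x * indicator {-h..h} x)"

lemma symdec_nonneg: "symdec f \<Longrightarrow> 0 \<le> f x"
  by (simp add: symdec_def)

lemma symdec_le: "symdec f \<Longrightarrow> x \<noteq> 0 \<Longrightarrow> \<bar>x\<bar> \<le> \<bar>y\<bar> \<Longrightarrow> f y \<le> f x"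
  by (simp add: symdec_def)

lemma symdec_minus [simp]: "symdec f \<Longrightarrow> f (- x) = f x"
  by (cases "x = 0") (auto simp: symdec_def intro!: antisym)

lemma symdec_abs: "symdec f \<Longrightarrow> f \<bar>x\<bar> = f x"
  by (simp add: abs_if)

lemma symdec_swap: "symdec f \<Longrightarrow> f (x - y) = f (y - x)"
  using symdec_minus[of f "x - y"] by simp

lemma symdec_borel:
  assumes "symdec f" shows "f \<in> borel_measurable borel"
proof -
  have "mono_on {0<..} (\<lambda>x. - f x)"
    by (auto simp: mono_on_def intro: symdec_le[OF assms])
  then have "(\<lambda>x. - f x) \<in> borel_measurable (restrict_space borel {0<..})"
    by (rule borel_measurable_mono_on_fnc)
  then have "(\<lambda>x. - (- f x)) \<in> borel_measurable (restrict_space borel {0<..})"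
    by (rule borel_measurable_uminus)
  then have 1: "(\<lambda>x. if x \<in> {0<..} then f x else 0) \<in> borel_measurable borel"
    by (subst (asm) measurable_restrict_space_iff[where c=0]) (simp_all only: minus_minus, auto)
  have "(\<lambda>x. if x = 0 then f 0 else (if \<bar>x\<bar> \<in> {0<..} then f \<bar>x\<bar> else 0)) \<in> borel_measurable borel"
    by (intro measurable_If measurable_compose[OF _ 1, of abs borel]) auto
  also have "(\<lambda>x. if x = 0 then f 0 else (if \<bar>x\<bar> \<in> {0<..} then f \<bar>x\<bar> else 0)) = f"
    using symdec_abs[OF assms] by (auto simp: fun_eq_iff)
  finally show ?thesis .
qed

lemma symdec_mult: "symdec f \<Longrightarrow> 0 \<le> c \<Longrightarrow> symdec (\<lambda>x. c * f x)"
  by (auto simp: symdec_def intro: mult_left_mono)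

lemma symdec_add: "symdec f \<Longrightarrow> symdec g \<Longrightarrow> symdec (\<lambda>x. f x + g x)"
  by (auto simp: symdec_def intro: add_mono)

lemma symdec_times: "symdec f \<Longrightarrow> symdec g \<Longrightarrow> symdec (\<lambda>x. f x * g x)"
  by (auto simp: symdec_def intro: mult_mono)

lemma symdec_powr: "symdec f \<Longrightarrow> 0 \<le> p \<Longrightarrow> symdec (\<lambda>x. f x powr p)"
  by (auto simp: symdec_def intro: powr_mono2)

lemma symdec_indicator: "symdec (indicator {-h..h})"
  by (auto simp: symdec_def indicator_def abs_le_iff split: if_splits)

lemma symdec_LIMSEQ:
  assumes "\<And>n. symdec (f n)" "\<And>x. (\<lambda>n. f n x) \<longlonglongrightarrow> g x"
  shows "symdec g"
  unfolding symdec_def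
proof (intro conjI allI impI)
  show "0 \<le> g x" for x
    using assms(2)[of x] by (rule LIMSEQ_le_const) (auto intro: symdec_nonneg[OF assms(1)])
  show "g y \<le> g x" if "x \<noteq> 0" "\<bar>x\<bar> \<le> \<bar>y\<bar>" for x y
    using assms(2)[of y] assms(2)[of x]
    by (rule LIMSEQ_le) (intro exI[of _ 0] allI impI symdec_le[OF assms(1)] that)
qed

section \<open>Null sets and affine changes of variable on the line\<close>

lemma AE_nonzero: "AE x in lborel. x \<noteq> (0::real)"
  using AE_not_in[OF countable_imp_null_set_lborel, of "{0::real}"] by simp

lemma lborel_integral_translate:
  fixes f :: "real \<Rightarrow> real"
  shows "(LINT x|lborel. f (x + a)) = (LINT x|lborel. f x)"
  using lborel_integral_real_affine[of 1 f a] by (simp add: add.commute)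

lemma lborel_integral_reflect:
  fixes f :: "real \<Rightarrow> real"
  shows "(LINT x|lborel. f (a - x)) = (LINT x|lborel. f x)"
  using lborel_integral_real_affine[of "-1" f a] by simp

lemma lborel_integrable_translate_iff:
  fixes f :: "real \<Rightarrow> real"
  shows "integrable lborel (\<lambda>x. f (x + a)) \<longleftrightarrow> integrable lborel f"
  using lborel_integrable_real_affine_iff[of 1 f a] by (simp add: add.commute)

lemma lborel_integrable_reflect_iff:
  fixes f :: "real \<Rightarrow> real"
  shows "integrable lborel (\<lambda>x. f (a - x)) \<longleftrightarrow> integrable lborel f"
  using lborel_integrable_real_affine_iff[of "-1" f a] by simp

lemma nn_integral_translate:
  fixes a :: real
  assumes [measurable]: "f \<in> borel_measurable borel"
  shows "(\<integral>\<^sup>+x. f (x + a) \<partial>lborel) = (\<integral>\<^sup>+x. f x \<partial>lborel)"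
  using nn_integral_real_affine[of f 1 a] by (simp add: add.commute)

lemma nn_integral_reflect:
  fixes a :: real
  assumes [measurable]: "f \<in> borel_measurable borel"
  shows "(\<integral>\<^sup>+x. f (a - x) \<partial>lborel) = (\<integral>\<^sup>+x. f x \<partial>lborel)"
  using nn_integral_real_affine[of f "-1" a] by simp

section \<open>Convolution of even decreasing functions\<close>

lemma conv_commute: "conv f g x = conv g f x"
  unfolding conv_def using lborel_integral_reflect[of "\<lambda>y. f (x - y) * g y" x]
  by (simp add: mult.commute)

lemma conv_alt: "conv f g x = (LINT y|lborel. f y * g (x - y))"
  using conv_commute[of f g x] by (simp add: conv_def mult.commute)

lemma conv_minus: "symdec f \<Longrightarrow> symdec g \<Longrightarrow> conv f g (- x) = conv f g x"
  unfolding conv_def using lborel_integral_reflect[of "\<lambda>y. f (- x - y) * g y" 0]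
  by (simp add: symdec_swap[of f x])

lemma conv_nonneg: "symdec f \<Longrightarrow> symdec g \<Longrightarrow> 0 \<le> conv f g x"
  unfolding conv_def by (intro Bochner_Integration.integral_nonneg) (simp add: symdec_nonneg)

lemma conv_integrable_minus:
  assumes "symdec f" "symdec g" "integrable lborel (\<lambda>y. f (x - y) * g y)"
  shows "integrable lborel (\<lambda>y. f (- x - y) * g y)"
  using assms(3) lborel_integrable_reflect_iff[of "\<lambda>y. f (x - y) * g y" 0]
  by (simp add: assms symdec_swap[OF assms(1), of "-x"] add.commute)

text \<open>Reflection in the midpoint \<open>m\<close> of \<open>x\<close> and \<open>x'\<close>:
  the integrand \<open>D\<close> at \<open>y\<close> plus \<open>D\<close> at the mirror image
  \<open>2 * m - y\<close> factors into a difference of \<open>f\<close> times a difference of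
  \<open>g\<close>. On either side of \<open>m\<close> both factors have the same sign, so the
  folded integrand is nonnegative.\<close>

lemma conv_decreasing_pos:
  assumes f: "symdec f" and g: "symdec g" and "0 \<le> x" "x \<le> x'"
    and ix: "integrable lborel (\<lambda>y. f (x - y) * g y)"
    and ix': "integrable lborel (\<lambda>y. f (x' - y) * g y)"
  shows "conv f g x' \<le> conv f g x"
proof -
  define m where "m = (x + x') / 2"
  have m: "x + x' = 2 * m" by (simp add: m_def)
  define D where "D y = f (x - y) * g y - f (x' - y) * g y" for y
  have iD: "integrable lborel D"
    unfolding D_def using ix ix' by (rule Bochner_Integration.integrable_diff)
  have iD': "integrable lborel (\<lambda>y. D (2 * m - y))"
    using iD by (subst lborel_integrable_reflect_iff)
  have "0 \<le> (LINT y|lborel. D y + D (2 * m - y))"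
  proof (rule integral_nonneg_AE)
    have "AE y in lborel. y \<notin> {0, x, x', 2 * m}"
      by (intro AE_not_in countable_imp_null_set_lborel) auto
    then show "AE y in lborel. 0 \<le> D y + D (2 * m - y)"
    proof eventually_elim
      case (elim y)
      have "x - (2 * m - y) = y - x'" "x' - (2 * m - y) = y - x" by (auto simp: m_def field_simps)
      then have "D y + D (2 * m - y) = (f (x - y) - f (x' - y)) * (g y - g (2 * m - y))"
        unfolding D_def using symdec_swap[OF f, of y x'] symdec_swap[OF f, of y x]
        by (simp only: left_diff_distrib right_diff_distrib)
      moreover have "0 \<le> (f (x - y) - f (x' - y)) * (g y - g (2 * m - y))"
      proof (cases "y \<le> m")
        case True
        then have "f (x' - y) \<le> f (x - y)" "g (2 * m - y) \<le> g y"
          using elim m \<open>0 \<le> x\<close> \<open>x \<le> x'\<close> by (auto intro!: symdec_le[OF f] symdec_le[OF g])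
        then show ?thesis by simp
      next
        case False
        then have "f (x - y) \<le> f (x' - y)" "g y \<le> g (2 * m - y)"
          using elim m \<open>0 \<le> x\<close> \<open>x \<le> x'\<close> by (auto intro!: symdec_le[OF f] symdec_le[OF g])
        then show ?thesis by (simp add: mult_nonpos_nonpos)
      qed
      ultimately show ?case by simp
    qed
  qed
  also have "\<dots> = 2 * (LINT y|lborel. D y)"
    using iD iD' lborel_integral_reflect[of D "2 * m"] by simp
  also have "(LINT y|lborel. D y) = conv f g x - conv f g x'"
    unfolding D_def conv_def using ix ix' by simp
  finally show ?thesis by simp
qed

text \<open>Integrability is asked only at the two points compared, so that the origin can take part
  as soon as convergence there is known.\<close>

lemma conv_decreasing:
  assumes f: "symdec f" and g: "symdec g" and "\<bar>x\<bar> \<le> \<bar>x'\<bar>"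
    and ix: "integrable lborel (\<lambda>y. f (x - y) * g y)"
    and ix': "integrable lborel (\<lambda>y. f (x' - y) * g y)"
  shows "conv f g x' \<le> conv f g x"
proof -
  have "integrable lborel (\<lambda>y. f (\<bar>x\<bar> - y) * g y)" "integrable lborel (\<lambda>y. f (\<bar>x'\<bar> - y) * g y)"
    using ix ix' conv_integrable_minus[OF f g] by (auto simp: abs_if)
  then have "conv f g \<bar>x'\<bar> \<le> conv f g \<bar>x\<bar>"
    using assms by (intro conv_decreasing_pos) auto
  then show ?thesis
    using conv_minus[OF f g] by (auto simp: abs_if split: if_splits)
qed

lemma symdec_conv:
  assumes "symdec f" "symdec g" "\<And>x. x \<noteq> 0 \<Longrightarrow> integrable lborel (\<lambda>y. f (x - y) * g y)"
  shows "symdec (conv f g)"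
  unfolding symdec_def
  using conv_nonneg[OF assms(1,2)] conv_decreasing[OF assms(1,2) _ assms(3) assms(3)] by auto

text \<open>Chebyshev's inequality for decreasing functions. It turns every integral bound below
  into a pointwise one.\<close>

lemma symdec_le_mass:
  assumes f: "symdec f" and i: "integrable lborel (\<lambda>y. f y * indicator {-\<bar>x\<bar>..\<bar>x\<bar>} y)" and "x \<noteq> 0"
  shows "2 * \<bar>x\<bar> * f x \<le> mass f \<bar>x\<bar>"
proof -
  have "2 * \<bar>x\<bar> * f x = (LINT y|lborel. f x * indicator {-\<bar>x\<bar>..\<bar>x\<bar>} y)"
    by (simp add: measure_def)
  also have "\<dots> \<le> mass f \<bar>x\<bar>"
    unfolding mass_def
  proof (rule integral_mono_AE)
    show "integrable lborel (\<lambda>y. f x * indicator {-\<bar>x\<bar>..\<bar>x\<bar>} y)"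
      by simp
    have "AE y in lborel. y \<notin> {0::real}"
      by (intro AE_not_in countable_imp_null_set_lborel) auto
    then show "AE y in lborel. f x * indicator {-\<bar>x\<bar>..\<bar>x\<bar>} y \<le> f y * indicator {-\<bar>x\<bar>..\<bar>x\<bar>} y"
      by eventually_elim (auto simp: indicator_def intro!: symdec_le[OF f])
  qed (use i in simp)
  finally show ?thesis .
qed

lemma mass_nonneg: "symdec f \<Longrightarrow> 0 \<le> mass f h"
  unfolding mass_def by (intro Bochner_Integration.integral_nonneg) (simp add: symdec_nonneg)

lemma integrable_times_indicator:
  fixes f :: "real \<Rightarrow> real"
  assumes "integrable lborel f" "S \<in> sets borel"
  shows "integrable lborel (\<lambda>x. f x * indicator S x)"
  using assms by (intro integrable_real_mult_indicator) auto

lemma mass_le_integral: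
  assumes "symdec f" "integrable lborel f"
  shows "mass f h \<le> (LINT x|lborel. f x)"
  unfolding mass_def
  using assms by (intro integral_mono integrable_times_indicator)
    (auto split: split_indicator simp: symdec_nonneg)

lemma mass_mono:
  assumes "symdec f" "integrable lborel f" "h \<le> k"
  shows "mass f h \<le> mass f k"
  unfolding mass_def
  using assms by (intro integral_mono integrable_times_indicator)
    (auto split: split_indicator simp: symdec_nonneg)

text \<open>\<open>f (x + h) - f x\<close> changes sign only at \<open>- h / 2\<close>, so its
  absolute value integrates to half-line integrals of \<open>f\<close> that cancel except on
  \<open>[- h / 2, h / 2]\<close>. The L1 modulus of continuity is thus controlled by the mass near
  the origin, which is why that mass is the quantity estimated for the Green functions.\<close>

lemma symdec_diff_L1:
  assumes f: "symdec f" and i: "integrable lborel f" and h: "0 \<le> h"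
  shows "(LINT x|lborel. \<bar>f (x + h) - f x\<bar>) \<le> 2 * mass f h"
proof -
  have it: "integrable lborel (\<lambda>x. f (x + h))"
    using i by (simp add: lborel_integrable_translate_iff)
  have [measurable]: "f \<in> borel_measurable borel"
    using f by (rule symdec_borel)
  define I where "I = (\<lambda>S::real set. LINT x|lborel. f x * indicator S x)"
  have ii: "integrable lborel (\<lambda>x. f x * indicator S x)" if "S \<in> sets borel" for S
    using i that by (rule integrable_times_indicator)
  have iit: "integrable lborel (\<lambda>x. f (x + h) * indicator S x)" if "S \<in> sets borel" for S
    using it that by (rule integrable_times_indicator)
  have sh: "(LINT x|lborel. f (x + h) * indicator {-h/2<..} x) = I {h/2<..}"
  proof -
    have "indicator {-h/2<..} x = (indicator {h/2<..} (x + h) :: real)" for x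
      by (auto simp: indicator_def)
    then show ?thesis
      using lborel_integral_translate[of "\<lambda>x. f x * indicator {h/2<..} x" h] unfolding I_def by simp
  qed
  have sh': "(LINT x|lborel. f (x + h) * indicator {..-h/2} x) = I {..h/2}"
  proof -
    have "indicator {..-h/2} x = (indicator {..h/2} (x + h) :: real)" for x
      by (auto simp: indicator_def)
    then show ?thesis
      using lborel_integral_translate[of "\<lambda>x. f x * indicator {..h/2} x" h] unfolding I_def by simp
  qed
  have "AE x in lborel. x \<notin> {0::real, -h}"
    by (intro AE_not_in countable_imp_null_set_lborel) auto
  then have eq: "AE x in lborel. \<bar>f (x + h) - f x\<bar> =
     (f x * indicator {-h/2<..} x - f (x + h) * indicator {-h/2<..} x)
     + (f (x + h) * indicator {..-h/2} x - f x * indicator {..-h/2} x)"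
  proof eventually_elim
    case (elim x)
    show ?case
    proof (cases "-h/2 < x")
      case True
      then have "f (x + h) \<le> f x" using elim h by (intro symdec_le[OF f]) auto
      then show ?thesis using True by (simp add: indicator_def)
    next
      case False
      then have "f x \<le> f (x + h)" using elim h by (intro symdec_le[OF f]) auto
      then show ?thesis using False by (simp add: indicator_def)
    qed
  qed
  have "(LINT x|lborel. \<bar>f (x + h) - f x\<bar>) = (LINT x|lborel. 
     (f x * indicator {-h/2<..} x - f (x + h) * indicator {-h/2<..} x)
     + (f (x + h) * indicator {..-h/2} x - f x * indicator {..-h/2} x))"
    by (intro integral_cong_AE eq) measurable
  also have "\<dots> = (I {-h/2<..} - I {h/2<..}) + (I {..h/2} - I {..-h/2})"
    using sh sh' ii iit unfolding I_def by simp
  also have "\<dots> = (LINT x|lborel. (f x * indicator {-h/2<..} x - f x * indicator {h/2<..} x)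
     + (f x * indicator {..h/2} x - f x * indicator {..-h/2} x))"
    using ii unfolding I_def by simp
  also have "\<dots> \<le> (LINT x|lborel. 2 * (f x * indicator {-h..h} x))"
    using ii h symdec_nonneg[OF f]
    by (intro integral_mono Bochner_Integration.integrable_add Bochner_Integration.integrable_diff
        Bochner_Integration.integrable_mult_right ii) (auto simp: indicator_def)
  finally show ?thesis by (simp add: mass_def)
qed

lemma conv_bdd_integrable:
  fixes f u :: "real \<Rightarrow> real"
  assumes f: "integrable lborel f" and [measurable]: "u \<in> borel_measurable borel"
    and u: "\<And>y. \<bar>u y\<bar> \<le> U"
  shows "integrable lborel (\<lambda>y. f (x - y) * u y)"
proof (rule Bochner_Integration.integrable_bound)
  have fx: "integrable lborel (\<lambda>y. f (x - y))"
    using f by (subst lborel_integrable_reflect_iff)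
  then show "integrable lborel (\<lambda>y. U * f (x - y))"
    by simp
  show "(\<lambda>y. f (x - y) * u y) \<in> borel_measurable lborel"
    using borel_measurable_integrable[OF fx] by simp
  show "AE y in lborel. norm (f (x - y) * u y) \<le> norm (U * f (x - y))"
    using order_trans[OF u abs_ge_self] by (auto simp: abs_mult mult.commute[of "\<bar>U\<bar>"] intro!: mult_left_mono)
qed

lemma conv_bdd_le:
  fixes f u :: "real \<Rightarrow> real"
  assumes f: "integrable lborel f" and "u \<in> borel_measurable borel"
    and u: "\<And>y. \<bar>u y\<bar> \<le> U"
  shows "\<bar>conv f u x\<bar> \<le> U * (LINT y|lborel. \<bar>f y\<bar>)"
proof -
  have fx: "integrable lborel (\<lambda>y. f (x - y))"
    using f by (subst lborel_integrable_reflect_iff)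
  have "\<bar>conv f u x\<bar> \<le> (LINT y|lborel. \<bar>f (x - y) * u y\<bar>)"
    unfolding conv_def by (rule integral_abs_bound)
  also have "\<dots> \<le> (LINT y|lborel. U * \<bar>f (x - y)\<bar>)"
    using conv_bdd_integrable[OF assms] fx
    by (intro integral_mono integrable_abs) (auto simp: abs_mult mult.commute[of U] intro!: mult_left_mono u)
  also have "\<dots> = U * (LINT y|lborel. \<bar>f y\<bar>)"
    using lborel_integral_reflect[of "\<lambda>y. \<bar>f y\<bar>" x] by simp
  finally show ?thesis .
qed

lemma conv_measurable [measurable]:
  fixes f g :: "real \<Rightarrow> real"
  assumes [measurable]: "f \<in> borel_measurable borel" "g \<in> borel_measurable borel"
  shows "conv f g \<in> borel_measurable borel"
  unfolding conv_def by measurable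

lemma pair_integrable_conv:
  fixes f g :: "real \<Rightarrow> real"
  assumes f: "integrable lborel f" and g: "integrable lborel g"
  shows "integrable (lborel \<Otimes>\<^sub>M lborel) (\<lambda>(y, x). f (x - y) * g y)"
proof (rule lborel_pair.Fubini_integrable)
  have [measurable]: "f \<in> borel_measurable borel" "g \<in> borel_measurable borel"
    using f g by auto
  show "(\<lambda>(y, x). f (x - y) * g y) \<in> borel_measurable (lborel \<Otimes>\<^sub>M lborel)"
    by measurable
  have ft: "integrable lborel (\<lambda>x. f (x - y))" for y
    using lborel_integrable_translate_iff[of f "-y"] f by simp
  then show "AE y in lborel. integrable lborel (\<lambda>x. case (y, x) of (y, x) \<Rightarrow> f (x - y) * g y)"
    by simp
  have "(LINT x|lborel. norm (case (y, x) of (y, x) \<Rightarrow> f (x - y) * g y)) = (LINT x|lborel. \<bar>f x\<bar>) * \<bar>g y\<bar>" for y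
    using lborel_integral_translate[of "\<lambda>x. \<bar>f x\<bar>" "-y"] by (simp add: abs_mult)
  then show "integrable lborel (\<lambda>y. LINT x|lborel. norm (case (y, x) of (y, x) \<Rightarrow> f (x - y) * g y))"
    using g by simp
qed

lemma conv_integrable:
  fixes f g :: "real \<Rightarrow> real"
  assumes f: "integrable lborel f" and g: "integrable lborel g"
  shows "integrable lborel (conv f g)"
    and "(LINT x|lborel. conv f g x) = (LINT x|lborel. f x) * (LINT x|lborel. g x)"
proof -
  note i = pair_integrable_conv[OF assms]
  have "integrable lborel (\<lambda>x. LINT y|lborel. (\<lambda>y x. f (x - y) * g y) y x)"
    by (rule lborel_pair.integrable_snd[OF i])
  then show "integrable lborel (conv f g)"
    by (simp add: conv_def[abs_def])
  have "(LINT x|lborel. conv f g x) = (LINT y|lborel. LINT x|lborel. f (x - y) * g y)"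
    unfolding conv_def by (rule lborel_pair.Fubini_integral[OF i])
  also have "\<dots> = (LINT y|lborel. (LINT x|lborel. f x) * g y)"
    using lborel_integral_translate[of f "- y" for y] by simp
  finally show "(LINT x|lborel. conv f g x) = (LINT x|lborel. f x) * (LINT x|lborel. g x)"
    by simp
qed

text \<open>Fubini with \<open>u\<close> merely bounded: absolute convergence comes from
  \<open>g\<close> in the inner variable and from \<open>f\<close> in the outer one.\<close>

lemma conv_assoc:
  fixes f g u :: "real \<Rightarrow> real"
  assumes f: "integrable lborel f" and g: "integrable lborel g"
    and [measurable]: "u \<in> borel_measurable borel" and u: "\<And>y. \<bar>u y\<bar> \<le> U"
  shows "conv f (conv g u) x = conv (conv f g) u x"
proof -
  have [measurable]: "f \<in> borel_measurable borel" "g \<in> borel_measurable borel"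
    using f g by auto
  have U: "0 \<le> U" using u[of 0] by linarith
  define h where "h = (\<lambda>y z. f (x - y) * (g (y - z) * u z))"
  have gu: "integrable lborel (\<lambda>z. g (y - z) * u z)" for y
    using conv_bdd_integrable[OF g _ u] by simp
  have i: "integrable (lborel \<Otimes>\<^sub>M lborel) (case_prod h)"
  proof (rule lborel_pair.Fubini_integrable)
    show "case_prod h \<in> borel_measurable (lborel \<Otimes>\<^sub>M lborel)"
      unfolding h_def by measurable
    show "AE y in lborel. integrable lborel (\<lambda>z. case (y, z) of (y, z) \<Rightarrow> h y z)"
      using gu unfolding h_def by auto
    show "integrable lborel (\<lambda>y. LINT z|lborel. norm (case (y, z) of (y, z) \<Rightarrow> h y z))"
    proof (rule Bochner_Integration.integrable_bound)
      have "integrable lborel (\<lambda>y. f (x - y))"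
        using f by (subst lborel_integrable_reflect_iff)
      then show "integrable lborel (\<lambda>y. (U * (LINT z|lborel. \<bar>g z\<bar>)) * f (x - y))"
        by simp
      show "(\<lambda>y. LINT z|lborel. norm (case (y, z) of (y, z) \<Rightarrow> h y z)) \<in> borel_measurable lborel"
        unfolding h_def by measurable
      have "(LINT z|lborel. norm (h y z)) \<le> U * (LINT z|lborel. \<bar>g z\<bar>) * \<bar>f (x - y)\<bar>" for y
      proof -
        have "integrable lborel (\<lambda>z. \<bar>g z\<bar>)" using g by simp
        then have "\<bar>conv (\<lambda>z. \<bar>g z\<bar>) (\<lambda>z. \<bar>u z\<bar>) y\<bar> \<le> U * (LINT z|lborel. \<bar>\<bar>g z\<bar>\<bar>)"
          using u by (intro conv_bdd_le) auto
        then have "(LINT z|lborel. \<bar>g (y - z)\<bar> * \<bar>u z\<bar>) \<le> U * (LINT z|lborel. \<bar>g z\<bar>)"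
          unfolding conv_def by simp
        then have "\<bar>f (x - y)\<bar> * (LINT z|lborel. \<bar>g (y - z)\<bar> * \<bar>u z\<bar>) \<le> \<bar>f (x - y)\<bar> * (U * (LINT z|lborel. \<bar>g z\<bar>))"
          by (rule mult_left_mono) simp
        then show ?thesis
          unfolding h_def by (simp add: abs_mult mult.assoc mult.left_commute) (simp add: mult_ac)
      qed
      then show "AE y in lborel. norm (LINT z|lborel. norm (case (y, z) of (y, z) \<Rightarrow> h y z))
          \<le> norm (U * (LINT z|lborel. \<bar>g z\<bar>) * f (x - y))"
        using U by (auto simp: abs_mult)
    qed
  qed
  have "conv f (conv g u) x = (LINT y|lborel. LINT z|lborel. h y z)"
    unfolding conv_def h_def by simp
  also have "\<dots> = (LINT z|lborel. LINT y|lborel. h y z)"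
    by (rule lborel_pair.Fubini_integral[OF i, symmetric])
  also have "\<dots> = conv (conv f g) u x"
    unfolding conv_def h_def
  proof (rule Bochner_Integration.integral_cong[OF refl])
    fix z
    have "(LINT y|lborel. f (x - y) * (g (y - z) * u z)) = (LINT y|lborel. f (x - y) * g (y - z)) * u z"
      by (simp add: mult.assoc[symmetric])
    also have "(LINT y|lborel. f (x - y) * g (y - z)) = (LINT y|lborel. f (x - z - y) * g y)"
      using lborel_integral_translate[of "\<lambda>y. f (x - y) * g (y - z)" z]
      by (simp add: algebra_simps)
    finally show "(LINT y|lborel. f (x - y) * (g (y - z) * u z)) = (LINT y|lborel. f (x - z - y) * g y) * u z" .
  qed
  finally show ?thesis .
qed

text \<open>The Neumann series of \<open>(1 - Q *)\<^sup>-\<^sup>1 - 1\<close>, obtained as the increasing limit of its partial sums.\<close>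

lemma resolvent_exists:
  assumes Q: "symdec Q" "integrable lborel Q" "\<And>x. Q x \<le> B" and r1: "(LINT x|lborel. Q x) < 1"
  obtains R where "symdec R" "integrable lborel R" "\<And>x. R x \<le> B / (1 - (LINT x|lborel. Q x))"
    "(LINT x|lborel. R x) \<le> (LINT x|lborel. Q x) / (1 - (LINT x|lborel. Q x))"
    "\<And>x. R x = Q x + conv Q R x"
proof -
  define \<rho> where "\<rho> = (LINT x|lborel. Q x)"
  \<comment> \<open>\<open>C\<close> and \<open>D\<close> are the fixed points of the affine maps
    that bound the supremum and the integral from one iterate to the next.\<close>
  define C where "C = B / (1 - \<rho>)"
  define D where "D = \<rho> / (1 - \<rho>)"
  have r: "0 \<le> \<rho>" "\<rho> < 1" unfolding \<rho>_def using r1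
    by (auto intro!: Bochner_Integration.integral_nonneg simp: symdec_nonneg[OF Q(1)])
  have B: "0 \<le> B" using Q(3)[of 0] symdec_nonneg[OF Q(1), of 0] by linarith
  have CB: "B + \<rho> * C = C" and DB: "\<rho> + \<rho> * D = D" and C0: "0 \<le> C"
    using r B by (auto simp: C_def D_def field_simps)
  have absQ: "(LINT x|lborel. \<bar>Q x\<bar>) = \<rho>"
    unfolding \<rho>_def by (simp add: symdec_nonneg[OF Q(1)])
  define r where "r = rec_nat (\<lambda>_::real. 0::real) (\<lambda>_ r x. Q x + conv Q r x)"
  have r0: "r 0 = (\<lambda>_. 0)" and rS: "r (Suc j) = (\<lambda>x. Q x + conv Q (r j) x)" for j
    by (auto simp: r_def)
  have inv: "symdec (r j) \<and> integrable lborel (r j) \<and> (\<forall>x. r j x \<le> C) \<and> (LINT x|lborel. r j x) \<le> D" for j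
  proof (induction j)
    case 0
    show ?case using C0 r by (auto simp: r0 symdec_def D_def)
  next
    case (Suc j)
    then have j: "symdec (r j)" "integrable lborel (r j)" "\<And>x. r j x \<le> C" "(LINT x|lborel. r j x) \<le> D"
      by auto
    have b: "\<bar>r j x\<bar> \<le> C" for x using j(3)[of x] symdec_nonneg[OF j(1)] by simp
    have ic: "integrable lborel (\<lambda>y. Q (x - y) * r j y)" for x
      by (rule conv_bdd_integrable[OF Q(2) symdec_borel[OF j(1)] b])
    have "conv Q (r j) x \<le> \<rho> * C" for x
      using conv_bdd_le[OF Q(2) symdec_borel[OF j(1)] b, of x] absQ by (simp add: mult.commute)
    moreover have "symdec (conv Q (r j))"
      using Q(1) j(1) ic by (rule symdec_conv)
    moreover have "(LINT x|lborel. Q x + conv Q (r j) x) \<le> D"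
    proof -
      have "(LINT x|lborel. Q x + conv Q (r j) x) = \<rho> + \<rho> * (LINT x|lborel. r j x)"
        using conv_integrable[OF Q(2) j(2)] Q(2) by (simp add: \<rho>_def)
      also have "\<dots> \<le> \<rho> + \<rho> * D"
        using r j(4) by (intro add_left_mono mult_left_mono) auto
      finally show ?thesis using DB by simp
    qed
    ultimately show ?case
      unfolding rS using Q conv_integrable(1)[OF Q(2) j(2)] CB
      by (auto intro!: symdec_add) (metis add_mono)
  qed
  have b: "\<bar>r j x\<bar> \<le> C" for j x using inv[of j] symdec_nonneg[of "r j" x] by simp
  have bor: "r j \<in> borel_measurable borel" for j using inv symdec_borel by blast
  have ic: "integrable lborel (\<lambda>y. Q (x - y) * r j y)" for x j
    using conv_bdd_integrable[OF Q(2) bor b] .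
  have inc: "r j x \<le> r (Suc j) x" for j x
  proof (induction j arbitrary: x)
    case 0
    show ?case using inv[of 1] by (simp add: r0 symdec_nonneg)
  next
    case (Suc j)
    have "conv Q (r j) x \<le> conv Q (r (Suc j)) x"
      unfolding conv_def by (intro integral_mono mult_left_mono Suc symdec_nonneg[OF Q(1)] ic)
    then show ?case unfolding rS[of "Suc j"] rS[of j] using rS[of j] by simp
  qed
  define R where "R x = lim (\<lambda>j. r j x)" for x
  have lim: "(\<lambda>j. r j x) \<longlonglongrightarrow> R x" for x
  proof -
    have "incseq (\<lambda>j. r j x)" using inc by (rule incseq_SucI)
    then obtain L where "(\<lambda>j. r j x) \<longlonglongrightarrow> L"
      using b by (metis incseq_convergent abs_le_D1)
    then show ?thesis unfolding R_def by (rule convergentI[THEN convergent_LIMSEQ_iff[THEN iffD1]])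
  qed
  have symR: "symdec R"
    using inv lim by (auto intro: symdec_LIMSEQ)
  have RC: "R x \<le> C" for x
    using lim by (rule LIMSEQ_le_const2) (use inv in auto)
  have ge: "r j x \<le> R x" for j x
    by (rule incseq_le[OF incseq_SucI lim]) (rule inc)
  have fin: "(\<integral>\<^sup>+x. R x \<partial>lborel) \<le> ennreal D"
  proof -
    have "(\<integral>\<^sup>+x. R x \<partial>lborel) = (\<integral>\<^sup>+x. liminf (\<lambda>j. ennreal (r j x)) \<partial>lborel)"
      by (intro nn_integral_cong) (metis lim lim_imp_Liminf sequentially_bot tendsto_ennrealI)
    also have "\<dots> \<le> liminf (\<lambda>j. \<integral>\<^sup>+x. r j x \<partial>lborel)"
      using bor by (intro nn_integral_liminf) auto
    also have "\<dots> \<le> liminf (\<lambda>j. ennreal D)"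
    proof (intro Liminf_mono always_eventually allI)
      fix j
      have "(\<integral>\<^sup>+x. r j x \<partial>lborel) = ennreal (LINT x|lborel. r j x)"
        using inv by (intro nn_integral_eq_integral) (auto intro: symdec_nonneg)
      then show "(\<integral>\<^sup>+x. r j x \<partial>lborel) \<le> ennreal D"
        using inv by (simp add: ennreal_leI)
    qed
    finally show ?thesis by (simp add: Liminf_const)
  qed
  have iR: "integrable lborel R"
    using symR fin by (intro integrableI_bounded)
      (auto simp: symdec_borel symdec_nonneg order_le_less_trans[OF fin])
  have intR: "(LINT x|lborel. R x) \<le> D"
  proof -
    have "ennreal (LINT x|lborel. R x) \<le> ennreal D"
      using fin iR symR by (subst nn_integral_eq_integral[symmetric]) (auto intro: symdec_nonneg)
    moreover have "0 \<le> D" using r by (simp add: D_def)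
    ultimately show ?thesis by simp
  qed
  have eq: "R x = Q x + conv Q R x" for x
  proof -
    have "integrable lborel (\<lambda>y. Q (x - y))"
      using Q(2) by (subst lborel_integrable_reflect_iff)
    then have iC: "integrable lborel (\<lambda>y. C * Q (x - y))" by simp
    have "(\<lambda>j. conv Q (r j) x) \<longlonglongrightarrow> conv Q R x"
      unfolding conv_def
    proof (rule integral_dominated_convergence[OF _ _ iC])
      have [measurable]: "Q \<in> borel_measurable borel" "R \<in> borel_measurable borel"
        using Q(1) symR by (auto intro: symdec_borel)
      note bor[measurable]
      show "(\<lambda>y. Q (x - y) * R y) \<in> borel_measurable lborel"
        "\<And>j. (\<lambda>y. Q (x - y) * r j y) \<in> borel_measurable lborel" by measurable
      show "AE y in lborel. (\<lambda>j. Q (x - y) * r j y) \<longlonglongrightarrow> Q (x - y) * R y"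
        by (intro AE_I2 tendsto_mult tendsto_const lim)
      show "AE y in lborel. norm (Q (x - y) * r j y) \<le> C * Q (x - y)" for j
        using b symdec_nonneg[OF Q(1)]
        by (intro AE_I2) (auto simp: abs_mult mult.commute[of C] intro!: mult_left_mono)
    qed
    then have "(\<lambda>j. r (Suc j) x) \<longlonglongrightarrow> Q x + conv Q R x"
      unfolding rS by (intro tendsto_intros)
    moreover have "(\<lambda>j. r (Suc j) x) \<longlonglongrightarrow> R x"
      using lim by (rule LIMSEQ_Suc)
    ultimately show ?thesis using LIMSEQ_unique by blast
  qed
  show ?thesis
    using that[OF symR iR] RC intR eq unfolding C_def D_def \<rho>_def by blast
qed

text \<open>\<open>B\<close> may blow up at the origin, so compactness is used at each positive
  rational separately and a diagonal subsequence combines the results. The decreasing limit on the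
  rationals determines the limit wherever \<open>F\<close> is continuous, that is off a countable
  set; evenness covers the negative half-line.\<close>

lemma helly_symdec:
  fixes f :: "nat \<Rightarrow> real \<Rightarrow> real"
  assumes f: "\<And>n. symdec (f n)" and B: "\<And>n x. x \<noteq> 0 \<Longrightarrow> f n x \<le> B x"
  obtains r F where "strict_mono r" "symdec F" "AE x in lborel. (\<lambda>n. f (r n) x) \<longlonglongrightarrow> F x"
proof -
  define Qs where "Qs = \<rat> \<inter> {0::real<..}"
  have Qs: "countable Qs" "Qs \<noteq> {}"
    using countable_rat by (auto simp: Qs_def intro!: exI[of _ 1])
  define q where "q = from_nat_into Qs"
  have rq: "range q = Qs" unfolding q_def by (rule range_from_nat_into[OF Qs(2,1)])
  have qpos: "0 < q n" for n using rq by (auto simp: Qs_def)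
  have dense: "\<exists>n. a < q n \<and> q n < b" if a0: "0 \<le> a" and ab: "a < b" for a b
  proof -
    obtain c where "c \<in> \<rat>" "a < c" "c < b" using Rats_dense_in_real[OF ab] by blast
    then have "c \<in> range q" using a0 rq by (auto simp: Qs_def)
    then show ?thesis using \<open>a < c\<close> \<open>c < b\<close> by auto
  qed
  interpret s: subseqs "\<lambda>n s. convergent (\<lambda>k. f (s k) (q n))"
  proof
    fix n and s :: "nat \<Rightarrow> nat"
    have "f (s k) (q n) \<in> {0..B (q n)}" for k
      using f B qpos[of n] by (auto intro: symdec_nonneg simp: less_imp_neq[symmetric])
    then obtain l t where "strict_mono t" "((\<lambda>k. f (s k) (q n)) \<circ> t) \<longlonglongrightarrow> l"
      using compact_imp_seq_compact[OF compact_Icc] seq_compactE by (metis (no_types, lifting))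
    then show "\<exists>t. strict_mono t \<and> convergent (\<lambda>k. f ((s \<circ> t) k) (q n))"
      by (auto simp: convergent_def comp_def)
  qed
  define r where "r = s.diagseq"
  have sr: "strict_mono r" unfolding r_def by (rule s.subseq_diagseq)
  have "convergent (\<lambda>k. f (r k) (q n))" for n
  proof -
    have "convergent (\<lambda>k. f ((s.diagseq \<circ> ((+) (Suc n))) k) (q n))"
    proof (rule s.diagseq_holds)
      fix r s :: "nat \<Rightarrow> nat" and n
      assume "strict_mono r" "convergent (\<lambda>k. f (s k) (q n))"
      then show "convergent (\<lambda>k. f ((s \<circ> r) k) (q n))"
        using convergent_subseq_convergent[of "\<lambda>k. f (s k) (q n)" r] by (simp add: comp_def)
    qed
    then obtain l where "(\<lambda>k. f (r (k + Suc n)) (q n)) \<longlonglongrightarrow> l"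
      by (auto simp: convergent_def r_def add.commute)
    then have "(\<lambda>k. f (r k) (q n)) \<longlonglongrightarrow> l" by (rule LIMSEQ_offset)
    then show ?thesis by (auto simp: convergent_def)
  qed
  then obtain l where l: "\<And>n. (\<lambda>k. f (r k) (q n)) \<longlonglongrightarrow> l n"
    unfolding convergent_def by metis
  have l0: "0 \<le> l n" for n
    using l by (rule LIMSEQ_le_const) (auto intro: symdec_nonneg[OF f])
  have lanti: "l m \<le> l n" if "q n \<le> q m" for m n
    using l l by (rule LIMSEQ_le) (use that qpos[of n] in \<open>auto intro!: symdec_le[OF f]\<close>)
  define S where "S x = {l n | n. \<bar>x\<bar> < q n}" for x
  \<comment> \<open>The limit of \<open>l\<close> from the right. At 0 the supremum may be infinite,
    so 0 is put there, which \<open>symdec\<close> permits.\<close>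
  define F where "F x = (if x = 0 then 0 else Sup (S x))" for x
  have Sne: "S x \<noteq> {}" for x
    using dense[of "\<bar>x\<bar>" "\<bar>x\<bar> + 1"] by (auto simp: S_def)
  have Sbdd: "bdd_above (S x)" if x: "x \<noteq> 0" for x
  proof (rule bdd_aboveI)
    fix y assume "y \<in> S x"
    then obtain n where n: "y = l n" "\<bar>x\<bar> < q n" by (auto simp: S_def)
    have "l n \<le> B x"
      using l by (rule LIMSEQ_le_const2)
        (use n x in \<open>auto intro!: order_trans[OF symdec_le[OF f, of x] B[OF x]]\<close>)
    then show "y \<le> B x" using n by simp
  qed
  have F0: "0 \<le> F x" for x
  proof (cases "x = 0")
    case False
    obtain n where "l n \<in> S x" using Sne[of x] by (auto simp: S_def)
    then have "l n \<le> Sup (S x)" using Sbdd[OF False] by (rule cSup_upper)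
    then show ?thesis using l0[of n] False by (simp add: F_def)
  qed (simp add: F_def)
  have Fanti: "F y \<le> F x" if "x \<noteq> 0" "\<bar>x\<bar> \<le> \<bar>y\<bar>" for x y
  proof -
    have "S y \<subseteq> S x" using that by (auto simp: S_def)
    then have "Sup (S y) \<le> Sup (S x)" by (rule cSup_subset_mono[OF Sne Sbdd[OF that(1)]])
    then show ?thesis using that by (auto simp: F_def)
  qed
  have symF: "symdec F" using F0 Fanti by (auto simp: symdec_def)
  define G where "G x = - F x" for x
  have mG: "mono_on {0<..} G"
    using Fanti by (auto simp: mono_on_def G_def)
  define N where "N = {a \<in> {0<..}. \<not> isCont G a}"
  have cN: "countable N" unfolding N_def using mG by (intro mono_on_ctble_discont_open) auto
  have conv: "(\<lambda>n. f (r n) x) \<longlonglongrightarrow> F x" if x0: "0 < x" and xN: "x \<notin> N" for x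
  proof -
    have cF: "isCont F x" using that continuous_minus[of "at x" G] by (auto simp: N_def G_def)
    show ?thesis
    proof (rule LIMSEQ_I)
      fix e :: real assume "0 < e"
      then obtain d where d: "0 < d" "\<And>y. \<bar>y - x\<bar> < d \<Longrightarrow> \<bar>F y - F x\<bar> < e / 2"
        using cF[unfolded continuous_at_eps_delta, rule_format, of "e/2"] by (auto simp: dist_real_def)
      \<comment> \<open>Rationals \<open>q m < x < q n\<close>, both within \<open>d / 2\<close> of
        \<open>x\<close>, squeeze \<open>f (r k) x\<close> between two convergent sequences.\<close>
      define y where "y = max (x/2) (x - d/2)"
      have y: "0 < y" "y < x" "\<bar>y - x\<bar> < d" using d x0 by (auto simp: y_def)
      obtain m where m: "y < q m" "q m < x" using dense[of y x] y by auto
      define z where "z = x + d/2"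
      have z: "x < z" "\<bar>z - x\<bar> < d" using d by (auto simp: z_def)
      obtain n where n: "x < q n" "q n < z" using dense[of x z] z x0 by auto
      have "l m \<le> F y" using m y Sbdd[of y] by (auto simp: F_def S_def intro!: cSup_upper)
      then have lm: "l m < F x + e/2" using d(2)[OF y(3)] by linarith
      have "F z \<le> l n" unfolding F_def using z n that Sne[of z]
        by (auto simp: S_def intro!: cSup_least lanti)
      then have ln: "F x - e/2 < l n" using d(2)[OF z(2)] by linarith
      have "eventually (\<lambda>k. f (r k) (q m) < F x + e) sequentially"
        using l[of m] by (rule order_tendstoD) (use lm \<open>0 < e\<close> in auto)
      moreover have "eventually (\<lambda>k. F x - e < f (r k) (q n)) sequentially"
        using l[of n] by (rule order_tendstoD) (use ln \<open>0 < e\<close> in auto)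
      ultimately have "eventually (\<lambda>k. norm (f (r k) x - F x) < e) sequentially"
      proof eventually_elim
        case (elim k)
        have "f (r k) x \<le> f (r k) (q m)" "f (r k) (q n) \<le> f (r k) x"
          using m n that qpos[of m] by (auto intro!: symdec_le[OF f])
        then show ?case using elim by auto
      qed
      then show "\<exists>no. \<forall>k\<ge>no. norm (f (r k) x - F x) < e"
        by (simp add: eventually_sequentially)
    qed
  qed
  have "AE x in lborel. x \<notin> insert 0 (N \<union> uminus ` N)"
    using cN by (intro AE_not_in countable_imp_null_set_lborel) auto
  then have "AE x in lborel. (\<lambda>n. f (r n) x) \<longlonglongrightarrow> F x"
  proof eventually_elim
    case (elim x)
    have "\<bar>x\<bar> \<notin> N" using elim by (auto simp: abs_if image_iff split: if_splits)
    then have "(\<lambda>n. f (r n) \<bar>x\<bar>) \<longlonglongrightarrow> F \<bar>x\<bar>" using elim by (intro conv) auto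
    then show ?case using symdec_abs[OF f] symdec_abs[OF symF] by simp
  qed
  then show ?thesis using that sr symF by blast
qed

section \<open>The Green function of the truncated operators\<close>

lemma integrable_Icc_indicator [simp]: "integrable lborel (indicator {a..b} :: real \<Rightarrow> real)"
  by (cases "a \<le> b") (auto intro: integrable_real_indicator)

section \<open>Integrability of powers at the origin and at infinity\<close>

lemma powr_near_zero_integrable:
  assumes "-1 < a" "0 \<le> r"
  shows "integrable lborel (\<lambda>x::real. \<bar>x\<bar> powr a * indicator {-r..r} x)"
proof -
  have "(\<integral>\<^sup>+x. indicator {0..r} x * x powr a \<partial>lborel) = r powr (a + 1) / (a + 1)"
    by (rule nn_integral_has_integral_lebesgue[OF _ has_integral_powr_from_0[OF assms]]) auto
  then have i: "integrable lborel (\<lambda>x. indicator {0..r} x * x powr a)"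
    by (intro integrableI_bounded) (auto simp: abs_mult)
  then have "integrable lborel (\<lambda>x. indicator {0..r} (0 - x) * (0 - x) powr a)"
    by (subst lborel_integrable_reflect_iff)
  then have "integrable lborel (\<lambda>x. indicator {0..r} x * x powr a + indicator {0..r} (0 - x) * (0 - x) powr a)"
    using i by (rule Bochner_Integration.integrable_add[rotated])
  moreover have "(\<lambda>x. indicator {0..r} x * x powr a + indicator {0..r} (0 - x) * (0 - x) powr a)
      = (\<lambda>x. \<bar>x\<bar> powr a * indicator {-r..r} x)"
    by (intro ext) (auto split: split_indicator)
  ultimately show ?thesis by simp
qed

lemma powr_at_infinity_integrable:
  assumes "a < -1" "0 < r"
  shows "integrable lborel (\<lambda>x::real. \<bar>x\<bar> powr a * indicator {x. r \<le> \<bar>x\<bar>} x)"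
proof -
  have "(\<integral>\<^sup>+x. indicator {r..} x * x powr a \<partial>lborel) = - (r powr (a + 1)) / (a + 1)"
    using assms by (intro nn_integral_has_integral_lebesgue[OF _ has_integral_powr_to_inf[OF assms]]) auto
  then have i: "integrable lborel (\<lambda>x. indicator {r..} x * x powr a)"
    by (intro integrableI_bounded) (auto simp: abs_mult)
  then have "integrable lborel (\<lambda>x. indicator {r..} (0 - x) * (0 - x) powr a)"
    by (subst lborel_integrable_reflect_iff)
  then have "integrable lborel (\<lambda>x. indicator {r..} x * x powr a + indicator {r..} (0 - x) * (0 - x) powr a)"
    using i by (rule Bochner_Integration.integrable_add[rotated])
  moreover have "(\<lambda>x. indicator {r..} x * x powr a + indicator {r..} (0 - x) * (0 - x) powr a)
      = (\<lambda>x. \<bar>x\<bar> powr a * indicator {x. r \<le> \<bar>x\<bar>} x)"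
    using assms by (intro ext) (auto split: split_indicator)
  ultimately show ?thesis by simp
qed

text \<open>The properties of \<open>kernK\<close> and \<open>A_const\<close> on which existence
  rests. \<open>lower\<close> stops at \<open>t = 1\<close> because the spherical kernel decays
  exponentially.\<close>

locale levy_kernel =
  fixes K :: "real \<Rightarrow> real" and s A c C :: real
  assumes K: "symdec K" and s: "0 < s" "s < 1" and A: "0 < A" and c: "0 < c"
    and lower: "\<And>t. 0 < t \<Longrightarrow> t \<le> 1 \<Longrightarrow> c * t powr (-1 - 2 * s) \<le> K t"
    and upper: "\<And>t. 0 < t \<Longrightarrow> K t \<le> C * t powr (-1 - 2 * s)"
begin

lemma C: "0 < C"
  using lower[of 1] upper[of 1] c by simp

lemma K_borel [measurable]: "K \<in> borel_measurable borel"
  using K by (rule symdec_borel)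

lemma K_upper_abs: "t \<noteq> 0 \<Longrightarrow> K t \<le> C * \<bar>t\<bar> powr (-1 - 2 * s)"
  using upper[of "\<bar>t\<bar>"] symdec_abs[OF K] by simp

text \<open>Flattening \<open>K\<close> near the origin, instead of cutting it to 0, keeps the
  kernel decreasing and hence \<open>symdec\<close>.\<close>

definition Kd :: "real \<Rightarrow> real \<Rightarrow> real" where
  "Kd d t = K (max \<bar>t\<bar> d)"

definition k :: "real \<Rightarrow> real" where
  "k d = (LINT t|lborel. Kd d t)"

text \<open>\<open>A + k d\<close> is the coefficient of the identity in the truncated operator; its
  inverse is the factor in front of the Neumann series.\<close>

definition kap :: "real \<Rightarrow> real" where
  "kap d = 1 / (A + k d)"

lemma symdec_Kd: "0 < d \<Longrightarrow> symdec (Kd d)"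
  unfolding symdec_def Kd_def using symdec_nonneg[OF K] by (auto intro!: symdec_le[OF K])

lemma Kd_borel: "0 < d \<Longrightarrow> Kd d \<in> borel_measurable borel"
  by (intro symdec_borel symdec_Kd)

lemma Kd_le: "0 < d \<Longrightarrow> Kd d t \<le> K d"
  unfolding Kd_def by (intro symdec_le[OF K]) auto

lemma Kd_le_K: "0 < d \<Longrightarrow> t \<noteq> 0 \<Longrightarrow> Kd d t \<le> K t"
  unfolding Kd_def by (intro symdec_le[OF K]) auto

lemma Kd_upper: "0 < d \<Longrightarrow> Kd d t \<le> C * (max \<bar>t\<bar> d) powr (-1 - 2 * s)"
  unfolding Kd_def by (intro upper) auto

lemma Kd_eq: "d \<le> \<bar>t\<bar> \<Longrightarrow> Kd d t = K t"
  using symdec_abs[OF K] by (simp add: Kd_def max_def)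

lemma K_tail_integrable:
  assumes "0 < r" shows "integrable lborel (\<lambda>t. K t * indicator {t. r \<le> \<bar>t\<bar>} t)"
proof (rule Bochner_Integration.integrable_bound)
  have "-1 - 2 * s < -1" using s by simp
  then show "integrable lborel (\<lambda>t. C * (\<bar>t\<bar> powr (-1 - 2 * s) * indicator {t. r \<le> \<bar>t\<bar>} t))"
    using assms by (intro integrable_mult_right powr_at_infinity_integrable)
  show "AE t in lborel. norm (K t * indicator {t. r \<le> \<bar>t\<bar>} t) \<le> norm (C * (\<bar>t\<bar> powr (-1 - 2 * s) * indicator {t. r \<le> \<bar>t\<bar>} t))"
    using K_upper_abs C symdec_nonneg[OF K] assms
    by (auto split: split_indicator simp: abs_mult)
qed measurable

lemma Kd_integrable:
  assumes d: "0 < d"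
  shows "integrable lborel (Kd d)"
proof (rule Bochner_Integration.integrable_bound)
  show "integrable lborel (\<lambda>t. K d * indicator {-d..d} t + K t * indicator {t. d \<le> \<bar>t\<bar>} t)"
    using K_tail_integrable[OF d]
    by (intro Bochner_Integration.integrable_add integrable_mult_right integrable_real_indicator)
      (use d in simp_all)
  show "AE t in lborel. norm (Kd d t) \<le> norm (K d * indicator {-d..d} t + K t * indicator {t. d \<le> \<bar>t\<bar>} t)"
  proof (intro AE_I2)
    fix t
    show "norm (Kd d t) \<le> norm (K d * indicator {-d..d} t + K t * indicator {t. d \<le> \<bar>t\<bar>} t)"
      using Kd_le[OF d, of t] Kd_eq[of d t] symdec_nonneg[OF K] symdec_nonneg[OF symdec_Kd[OF d]] d
      by (cases "d \<le> \<bar>t\<bar>") (auto split: split_indicator simp: abs_le_iff)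
  qed
qed (use Kd_borel[OF d] in simp)

text \<open>The flattened kernel equals \<open>K d\<close> on \<open>[- d, d]\<close>. Hence
  \<open>k d\<close> diverges at least like \<open>d powr (- 2 * s)\<close>, and the atom
  \<open>kap d\<close> disappears as \<open>d\<close> tends to 0.\<close>

lemma k_lower: "0 < d \<Longrightarrow> d \<le> 1 \<Longrightarrow> 2 * c * d powr (- 2 * s) \<le> k d"
proof -
  assume d: "0 < d" "d \<le> 1"
  have "2 * c * d powr (- 2 * s) = 2 * d * (c * d powr (-1 - 2 * s))"
    using d by (simp add: powr_diff powr_minus field_simps)
  also have "\<dots> \<le> 2 * d * K d" using lower[OF d] d by (intro mult_left_mono) auto
  also have "\<dots> = (LINT t|lborel. K d * indicator {-d..d} t)"
    using d by (simp add: measure_def)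
  also have "\<dots> \<le> k d"
    unfolding k_def
  proof (rule integral_mono)
    fix t show "K d * indicator {-d..d} t \<le> Kd d t"
      using d symdec_nonneg[OF symdec_Kd[OF d(1)], of t]
      by (auto split: split_indicator simp: Kd_def max_def abs_le_iff)
  qed (use d Kd_integrable in simp_all)
  finally show ?thesis .
qed

lemma k_nonneg: "0 < d \<Longrightarrow> 0 \<le> k d"
  unfolding k_def by (intro Bochner_Integration.integral_nonneg symdec_nonneg[OF symdec_Kd])

lemma kap_pos: "0 < d \<Longrightarrow> 0 < kap d"
  unfolding kap_def using A k_nonneg[of d] by (intro divide_pos_pos) auto

lemma kap_k: "0 < d \<Longrightarrow> kap d * k d = 1 - A * kap d" "0 < d \<Longrightarrow> kap d * k d \<le> 1"
  unfolding kap_def using A k_nonneg[of d] by (auto simp: field_simps)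

lemma kap_le: "0 < d \<Longrightarrow> d \<le> 1 \<Longrightarrow> kap d \<le> 1 / (2 * c) * d powr (2 * s)"
proof -
  assume d: "0 < d" "d \<le> 1"
  have "kap d \<le> 1 / (2 * c * d powr (- 2 * s))"
    unfolding kap_def using k_lower[OF d] k_nonneg[OF d(1)] A c d by (intro divide_left_mono mult_pos_pos add_pos_nonneg) auto
  also have "\<dots> = 1 / (2 * c) * d powr (2 * s)"
    using d c by (simp add: powr_minus field_simps)
  finally show ?thesis .
qed

text \<open>\<open>g\<close> is the density of the inverse of \<open>A + k d - Kd d *\<close>, up to the atom of weight \<open>kap d\<close> at the origin.\<close>

definition green_d :: "real \<Rightarrow> (real \<Rightarrow> real) \<Rightarrow> bool" where
  "green_d d g \<longleftrightarrow> symdec g \<and> integrable lborel g \<and> (LINT x|lborel. g x) \<le> 1 / A \<and> (\<exists>b. \<forall>x. g x \<le> b) \<and>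
     (\<forall>x. (A + k d) * g x = kap d * Kd d x + conv (Kd d) g x)"

text \<open>Factoring \<open>A + k d\<close> out of the operator leaves the identity minus
  convolution with \<open>Q\<close>, whose integral \<open>1 - A * kap d\<close> is below 1 because
  \<open>A > 0\<close>. \<open>kap d\<close> times the resolvent of \<open>Q\<close> has integral at
  most \<open>kap d * k d / A\<close>, hence at most \<open>1 / A\<close> uniformly in
  \<open>d\<close>.\<close>

lemma green_d_exists:
  assumes d: "0 < d" shows "\<exists>g. green_d d g"
proof -
  define Q where "Q t = kap d * Kd d t" for t
  have kp: "0 < kap d" using kap_pos[OF d] .
  have Q: "symdec Q" "integrable lborel Q" "\<And>x. Q x \<le> kap d * K d"
    using symdec_Kd[OF d] Kd_integrable[OF d] Kd_le[OF d] kp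
    by (auto simp: Q_def[abs_def] intro!: symdec_mult mult_left_mono)
  have rho: "(LINT x|lborel. Q x) = kap d * k d" by (simp add: Q_def k_def)
  have "kap d * k d < 1" using kap_k(1)[OF d] A kp by simp
  then obtain R where R: "symdec R" "integrable lborel R" "\<And>x. R x \<le> kap d * K d / (1 - kap d * k d)"
    "(LINT x|lborel. R x) \<le> kap d * k d / (1 - kap d * k d)" "\<And>x. R x = Q x + conv Q R x"
    using resolvent_exists[OF Q] unfolding rho by metis
  have Ak: "kap d * (A + k d) = 1" using kap_k(1)[OF d] by (simp add: algebra_simps)
  have "green_d d (\<lambda>x. kap d * R x)"
    unfolding green_d_def
  proof (intro conjI allI)
    show "symdec (\<lambda>x. kap d * R x)" using R(1) kp by (intro symdec_mult) auto
    show "integrable lborel (\<lambda>x. kap d * R x)" using R(2) by simp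
    have "kap d * (LINT x|lborel. R x) \<le> kap d * (kap d * k d / (1 - kap d * k d))"
      using R(4) kp by (intro mult_left_mono) auto
    also have "\<dots> = kap d * k d / A" using kp A by (simp add: kap_k(1)[OF d])
    also have "\<dots> \<le> 1 / A" using kap_k(2)[OF d] A by (simp add: divide_right_mono)
    finally show "(LINT x|lborel. kap d * R x) \<le> 1 / A" by simp
    show "\<exists>b. \<forall>x. kap d * R x \<le> b"
      using R(3) kp by (intro exI[of _ "kap d * (kap d * K d / (1 - kap d * k d))"] allI mult_left_mono) auto
    fix x
    have "(A + k d) * (kap d * R x) = (kap d * (A + k d)) * R x" by (simp add: algebra_simps)
    also have "\<dots> = kap d * Kd d x + conv Q R x" unfolding Ak using R(5)[of x] by (simp add: Q_def)
    also have "conv Q R x = conv (Kd d) (\<lambda>x. kap d * R x) x"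
      unfolding conv_def Q_def by (simp add: mult_ac)
    finally show "(A + k d) * (kap d * R x) = kap d * Kd d x + conv (Kd d) (\<lambda>x. kap d * R x) x" .
  qed
  then show ?thesis by blast
qed

lemma green_dD:
  assumes "green_d d g"
  shows "symdec g" "integrable lborel g" "(LINT x|lborel. g x) \<le> 1 / A" "g \<in> borel_measurable borel"
    "(LINT x|lborel. \<bar>g x\<bar>) \<le> 1 / A"
    "(A + k d) * g x = kap d * Kd d x + conv (Kd d) g x"
  using assms by (auto simp: green_d_def symdec_borel symdec_nonneg)

lemma green_d_conv_le:
  assumes g: "green_d d g" and u: "u \<in> borel_measurable borel" "\<And>y. \<bar>u y\<bar> \<le> U"
  shows "\<bar>conv g u x\<bar> \<le> U / A"
proof -
  have "0 \<le> U" using u(2)[of 0] by simp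
  have "\<bar>conv g u x\<bar> \<le> U * (LINT x|lborel. \<bar>g x\<bar>)"
    using conv_bdd_le[OF green_dD(2)[OF g] u] .
  also have "\<dots> \<le> U * (1 / A)" using green_dD(5)[OF g] \<open>0 \<le> U\<close> by (rule mult_left_mono)
  finally show ?thesis by simp
qed

text \<open>The full inverse maps \<open>u\<close> to \<open>kap d * u + conv g u\<close>. Since
  \<open>(A + k d) * kap d = 1\<close>, applying the operator to the atomic part gives
  \<open>u - kap d * conv (Kd d) u\<close>; this is the identity left for the density.\<close>

lemma green_d_resolvent:
  assumes d: "0 < d" and g: "green_d d g" and u: "u \<in> borel_measurable borel" "\<And>y. \<bar>u y\<bar> \<le> U"
  shows "(A + k d) * conv g u x - conv (Kd d) (conv g u) x = kap d * conv (Kd d) u x"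
proof -
  note G = green_dD[OF g]
  note iK = Kd_integrable[OF d]
  have bK: "Kd d \<in> borel_measurable borel" using Kd_borel[OF d] .
  have "conv (Kd d) (conv g u) x = conv (conv (Kd d) g) u x"
    by (rule conv_assoc[OF iK G(2) u])
  moreover have "(A + k d) * conv g u x = (LINT y|lborel. ((A + k d) * g (x - y)) * u y)"
    unfolding conv_def by (simp add: mult.assoc)
  moreover have "\<dots> = (LINT y|lborel. kap d * (Kd d (x - y) * u y) + conv (Kd d) g (x - y) * u y)"
    unfolding G(6) by (simp add: algebra_simps)
  moreover have "\<dots> = kap d * conv (Kd d) u x + conv (conv (Kd d) g) u x"
    using conv_bdd_integrable[OF iK u] conv_bdd_integrable[OF conv_integrable(1)[OF iK G(2)] u]
    unfolding conv_def[of "Kd d" u] conv_def[of _ u] by simp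
  ultimately show ?thesis by simp
qed

lemma Kd_diff_integral:
  assumes d: "0 < d" and z: "z \<in> borel_measurable borel" "\<And>y. \<bar>z y\<bar> \<le> Z"
  shows "integrable lborel (\<lambda>y. (z x - z (x - y)) * Kd d y)"
    and "(LINT y|lborel. (z x - z (x - y)) * Kd d y) = k d * z x - conv (Kd d) z x"
proof -
  note iK = Kd_integrable[OF d]
  have i: "integrable lborel (\<lambda>y. z (x - y) * Kd d y)"
    using conv_bdd_integrable[OF iK z, of x] lborel_integrable_reflect_iff[of "\<lambda>y. Kd d (x - y) * z y" x]
    by (simp add: mult.commute)
  then show "integrable lborel (\<lambda>y. (z x - z (x - y)) * Kd d y)"
    using iK by (simp add: left_diff_distrib)
  have "conv (Kd d) z x = (LINT y|lborel. z (x - y) * Kd d y)"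
    unfolding conv_alt by (simp add: mult.commute)
  then show "(LINT y|lborel. (z x - z (x - y)) * Kd d y) = k d * z x - conv (Kd d) z x"
    using iK i by (simp only: left_diff_distrib Bochner_Integration.integral_diff integrable_mult_right
        integral_mult_right_zero k_def mult.commute[of "z x"])
       (subst Bochner_Integration.integral_diff, auto simp: mult.commute)
qed

lemma green_d_equation:
  assumes d: "0 < d" and g: "green_d d g" and u: "u \<in> borel_measurable borel" "\<And>y. \<bar>u y\<bar> \<le> U"
  shows "A * conv g u x + (LINT y|lborel. (conv g u x - conv g u (x - y)) * Kd d y) = kap d * conv (Kd d) u x"
proof -
  have "conv g u \<in> borel_measurable borel"
    using green_dD(4)[OF g] u(1) by measurable
  from Kd_diff_integral(2)[OF d this green_d_conv_le[OF g u]]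
  have "(LINT y|lborel. (conv g u x - conv g u (x - y)) * Kd d y) = k d * conv g u x - conv (Kd d) (conv g u) x" .
  with green_d_resolvent[OF assms, of x] show ?thesis by (simp only: distrib_right)
qed

text \<open>A maximum principle for \<open>z = conv g (indicator {-h..h})\<close>, which is largest
  at 0 with \<open>z 0 = mass g h\<close>. If the second alternative fails, \<open>z\<close> has
  fallen to half its maximum at distance \<open>X = (l + 1) * h\<close>, so jumps of length between
  \<open>X\<close> and \<open>2 * X\<close> alone contribute at least
  \<open>z 0 / 2 * K (2 * X) * X\<close> to the equation at 0, whose right-hand side is at most 1.
  The lower bound on \<open>K\<close> then bounds \<open>z 0\<close>; \<open>small\<close> keeps
  \<open>2 * X\<close> in the range of that bound.\<close>

lemma mass_dichotomy:
  assumes d: "0 < d" "d \<le> h" and g: "green_d d g" and l: "0 < l" and small: "2 * (l + 1) * h \<le> 1"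
  shows "mass g h \<le> 4 / c * (2 * (l + 1) * h) powr (2 * s) \<or> mass g h \<le> 2 / l * mass g (l * h)"
proof (rule disjCI)
  assume "\<not> mass g h \<le> 2 / l * mass g (l * h)"
  then have alt: "mass g (l * h) / l < mass g h / 2"
    using l by (simp add: field_simps)
  note G = green_dD[OF g]
  define u where "u = (indicator {-h..h} :: real \<Rightarrow> real)"
  have u: "u \<in> borel_measurable borel" "\<And>y. \<bar>u y\<bar> \<le> 1" and symu: "symdec u"
    by (auto simp: u_def symdec_indicator)
  have h: "0 < h" using d by simp
  define X where "X = (l + 1) * h"
  have X: "0 < X" "d \<le> X" "2 * X \<le> 1" "0 < X - h" "X - h = l * h"
    using h d small mult_pos_pos[OF l h] unfolding X_def by (simp_all add: distrib_right mult.assoc)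
  define z where "z = conv g u"
  have zb: "z \<in> borel_measurable borel" "\<And>y. \<bar>z y\<bar> \<le> 1 / A"
    using G(4) u green_d_conv_le[OF g u] unfolding z_def by auto
  have iz: "integrable lborel (\<lambda>y. g (x - y) * u y)" for x
    by (rule conv_bdd_integrable[OF G(2) u])
  have symz: "symdec z" unfolding z_def using G(1) symu iz by (rule symdec_conv)
  have z0: "z 0 = mass g h"
    unfolding z_def conv_def mass_def u_def using G(1) by simp
  have z0ge: "z y \<le> z 0" for y
    unfolding z_def by (rule conv_decreasing[OF G(1) symu _ iz iz]) simp
  have zX: "z X \<le> z 0 / 2"
  proof -
    have "z X \<le> (LINT y|lborel. g (X - h) * u y)"
      unfolding z_def conv_def
    proof (rule integral_mono[OF iz])
      show "integrable lborel (\<lambda>y. g (X - h) * u y)" by (simp add: u_def)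
      show "g (X - y) * u y \<le> g (X - h) * u y" for y
        using X by (auto simp: u_def split: split_indicator intro!: symdec_le[OF G(1)])
    qed
    also have "\<dots> = (2 * \<bar>l * h\<bar> * g (l * h)) / l"
      using h l by (simp add: u_def X(5) measure_def)
    also have "\<dots> \<le> mass g \<bar>l * h\<bar> / l"
      using l h symdec_le_mass[OF G(1) integrable_times_indicator[OF G(2)], of "l * h"]
      by (intro divide_right_mono) auto
    also have "\<dots> \<le> z 0 / 2" using alt l h z0 by simp
    finally show ?thesis .
  qed
  have "z 0 / 2 * K (2 * X) * X = (LINT y|lborel. z 0 / 2 * K (2 * X) * indicator {X..2*X} y)"
    using X by (simp add: measure_def)
  also have "\<dots> \<le> (LINT y|lborel. (z 0 - z (0 - y)) * Kd d y)"
  proof (rule integral_mono)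
    show "integrable lborel (\<lambda>y. (z 0 - z (0 - y)) * Kd d y)"
      by (rule Kd_diff_integral(1)[OF d(1) zb])
    fix y
    have "z 0 / 2 * K (2 * X) \<le> (z 0 - z y) * K y" if "X \<le> y" "y \<le> 2 * X"
    proof (rule mult_mono)
      have "z y \<le> z X" using that X by (intro symdec_le[OF symz]) auto
      then show "z 0 / 2 \<le> z 0 - z y" using zX by simp
      show "K (2 * X) \<le> K y" using that X by (intro symdec_le[OF K]) auto
      show "0 \<le> z 0 - z y" using z0ge[of y] by simp
    qed (use symdec_nonneg[OF K] in auto)
    then show "z 0 / 2 * K (2 * X) * indicator {X..2*X} y \<le> (z 0 - z (0 - y)) * Kd d y"
      using X z0ge[of "-y"] symdec_nonneg[OF symdec_Kd[OF d(1)], of y] symz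
      by (auto split: split_indicator simp: Kd_eq)
  qed simp
  also have "\<dots> \<le> kap d * conv (Kd d) u 0"
  proof -
    have "0 \<le> A * z 0" using symdec_nonneg[OF symz, of 0] A by simp
    with green_d_equation[OF d(1) g u, of 0, folded z_def] show ?thesis by linarith
  qed
  also have "\<dots> \<le> kap d * k d"
  proof (rule mult_left_mono)
    show "conv (Kd d) u 0 \<le> k d"
      using conv_bdd_le[OF Kd_integrable[OF d(1)] u, of 0] symdec_nonneg[OF symdec_Kd[OF d(1)]]
      by (simp add: k_def)
  qed (use kap_pos[OF d(1)] in simp)
  also have "\<dots> \<le> 1" using kap_k(2)[OF d(1)] .
  finally have 1: "z 0 / 2 * K (2 * X) * X \<le> 1" .
  have "z 0 / 2 * (c * (2 * X) powr (-1 - 2 * s)) * X \<le> z 0 / 2 * K (2 * X) * X"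
    using X lower[of "2 * X"] symdec_nonneg[OF symz, of 0] by (intro mult_right_mono mult_left_mono) auto
  also note 1
  also have "(2 * X) powr (-1 - 2 * s) = inverse ((2 * X) powr (2 * s)) / (2 * X)"
    using X by (simp add: powr_diff powr_minus field_simps)
  finally have "z 0 \<le> 4 / c * (2 * X) powr (2 * s)"
    using X c by (simp add: field_simps)
  then show "mass g h \<le> 4 / c * (2 * (l + 1) * h) powr (2 * s)"
    by (simp only: z0 X_def mult.assoc)
qed

text \<open>Induction over scales. For \<open>h \<ge> h0\<close> the total mass \<open>1 / A\<close>
  suffices; below \<open>h0\<close> the dichotomy either yields the power \<open>2 * s\<close>,
  which is stronger than \<open>b\<close>, or passes to the scale \<open>l * h\<close>. The choice
  of \<open>l\<close> gives \<open>2 / l = l powr (- b)\<close>, so the second case reproduces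
  \<open>B\<close> without loss; this is where \<open>b < 1\<close> enters.\<close>

lemma mass_bound:
  assumes b: "0 < b" "b < 1" "b \<le> 2 * s"
  obtains B where "0 < B" "\<And>d g h. 0 < d \<Longrightarrow> d \<le> h \<Longrightarrow> green_d d g \<Longrightarrow> mass g h \<le> B * h powr b"
proof -
  define l where "l = 2 powr (1 / (1 - b))"
  have l: "1 < l" using b by (simp add: l_def)
  have l2: "2 / l = l powr (- b)"
  proof -
    have "l powr (1 - b) = 2" using b by (simp add: l_def powr_powr)
    then have "2 = l * l powr (- b)" using l by (simp add: powr_diff powr_minus field_simps)
    then show ?thesis using l by (simp add: field_simps)
  qed
  define h0 where "h0 = 1 / (2 * (l + 1))"
  have h0: "0 < h0" "h0 < 1" using l by (auto simp: h0_def field_simps)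
  define C1 where "C1 = 4 / c * (2 * (l + 1)) powr (2 * s)"
  have C1: "0 < C1" using c l by (simp add: C1_def)
  define B where "B = h0 powr (- b) / A + C1"
  have B: "0 < B" "C1 \<le> B" "h0 powr (- b) / A \<le> B"
    using h0 A C1 by (auto simp: B_def intro!: add_pos_pos)
  have step: "d \<le> h \<Longrightarrow> h0 * (1 / l) ^ n \<le> h \<Longrightarrow> mass g h \<le> B * h powr b"
    if d: "0 < d" and g: "green_d d g" for d g h n
  proof (induction n arbitrary: h)
    case 0
    have "mass g h \<le> 1 / A"
      using mass_le_integral[OF green_dD(1,2)[OF g], of h] green_dD(3)[OF g] by simp
    also have "1 / A = h0 powr (- b) / A * h0 powr b"
      using h0 by (simp add: powr_minus)
    also have "\<dots> \<le> B * h powr b"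
      using 0 h0 b B A by (intro mult_mono powr_mono2) auto
    finally show ?case .
  next
    case (Suc n)
    have h: "0 < h" using Suc(2) d by simp
    show ?case
    proof (cases "h0 \<le> h")
      case True
      moreover have "h0 * (1 / l) ^ n \<le> h0 * 1"
        using h0 l by (intro mult_left_mono power_le_one) auto
      ultimately show ?thesis using Suc.IH[of h] Suc(2) by simp
    next
      case False
      then have "2 * (l + 1) * h \<le> 1" using l by (simp add: h0_def field_simps)
      from mass_dichotomy[OF d Suc(2) g _ this] l
      consider "mass g h \<le> 4 / c * (2 * (l + 1) * h) powr (2 * s)" | "mass g h \<le> 2 / l * mass g (l * h)"
        by fastforce
      then show ?thesis
      proof cases
        case 1
        also have "4 / c * (2 * (l + 1) * h) powr (2 * s) = C1 * h powr (2 * s)"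
          using h l by (simp add: C1_def powr_mult)
        also have "\<dots> \<le> B * h powr b"
          using B C1 h False h0 b by (intro mult_mono powr_mono') auto
        finally show ?thesis .
      next
        case 2
        have "h0 * (1 / l) ^ n \<le> l * h" using Suc(3) l by (simp add: field_simps)
        moreover have "d \<le> l * h" using Suc(2) h l by (smt (verit) mult_le_cancel_right1)
        ultimately have "mass g (l * h) \<le> B * (l * h) powr b" by (rule Suc.IH[rotated])
        then have "2 / l * mass g (l * h) \<le> 2 / l * (B * (l * h) powr b)"
          using l by (intro mult_left_mono) auto
        also have "\<dots> = B * h powr b"
          unfolding l2 using l h by (simp add: powr_mult powr_minus)
        finally show ?thesis using 2 by simp
      qed
    qed
  qed
  show ?thesis
  proof (rule that[OF B(1)])
    fix d g h assume *: "0 < d" "d \<le> h" "green_d d g"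
    have "(\<lambda>n. h0 * (1 / l) ^ n) \<longlonglongrightarrow> h0 * 0"
      using l by (intro tendsto_intros LIMSEQ_power_zero) auto
    then have "eventually (\<lambda>n. h0 * (1 / l) ^ n < h) sequentially"
      by (rule order_tendstoD) (use * in auto)
    then obtain n where "h0 * (1 / l) ^ n < h" by (auto simp: eventually_sequentially)
    then show "mass g h \<le> B * h powr b"
      using step[OF *(1,3,2), of n] by simp
  qed
qed

end

section \<open>Passage to the limit in the truncation\<close>

lemma AE_exists_between:
  fixes a b :: real
  assumes "AE x in lborel. P x" "a < b"
  shows "\<exists>y. a < y \<and> y < b \<and> P y"
proof (rule ccontr)
  assume "\<not> ?thesis"
  with assms(1) have "AE x in lborel. x \<notin> {a<..<b}"
    by (auto elim: eventually_mono)
  then have "emeasure lborel {x \<in> space lborel. \<not> x \<notin> {a<..<b}} = 0"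
    by (subst (asm) AE_iff_measurable[OF _ refl]) auto
  moreover have "{x \<in> space lborel. \<not> x \<notin> {a<..<b}} = {a<..<b}" by auto
  ultimately have "emeasure lborel {a<..<b} = 0" by simp
  with assms(2) show False by simp
qed

lemma integrable_mult_bounded:
  fixes f h :: "real \<Rightarrow> real"
  assumes f: "integrable lborel f" and [measurable]: "h \<in> borel_measurable borel" and B: "\<And>x. \<bar>h x\<bar> \<le> B"
  shows "integrable lborel (\<lambda>x. f x * h x)"
proof (rule Bochner_Integration.integrable_bound)
  show "integrable lborel (\<lambda>x. B * f x)" using f by simp
  have "\<bar>h x\<bar> * \<bar>f x\<bar> \<le> \<bar>B\<bar> * \<bar>f x\<bar>" for x
    using B[of x] by (intro mult_right_mono) auto
  then show "AE x in lborel. norm (f x * h x) \<le> norm (B * f x)"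
    by (simp add: abs_mult mult.commute[of "\<bar>f _\<bar>"])
qed (use f in measurable)

section \<open>First and second differences of a convolution\<close>

lemma conv_shift_diff:
  fixes G f :: "real \<Rightarrow> real"
  assumes G: "integrable lborel G" and f: "f \<in> borel_measurable borel" "\<And>y. \<bar>f y\<bar> \<le> U"
  shows "integrable lborel (\<lambda>w. (G (w + y) - G w) * f (x - w))"
    and "conv G f (x + y) - conv G f x = (LINT w|lborel. (G (w + y) - G w) * f (x - w))"
proof -
  have 1: "integrable lborel (\<lambda>w. G (w + y) * f (x - w))" for y
    using conv_bdd_integrable[OF G f, of "x + y"]
      lborel_integrable_reflect_iff[of "\<lambda>t. G (x + y - t) * f t" x]
    by (simp add: algebra_simps)
  have 2: "conv G f (x + y) = (LINT w|lborel. G (w + y) * f (x - w))" for y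
    using lborel_integral_reflect[of "\<lambda>t. G (x + y - t) * f t" x]
    by (simp add: conv_def algebra_simps)
  show "integrable lborel (\<lambda>w. (G (w + y) - G w) * f (x - w))"
    using 1[of y] 1[of 0] by (simp add: left_diff_distrib)
  show "conv G f (x + y) - conv G f x = (LINT w|lborel. (G (w + y) - G w) * f (x - w))"
    using 1[of y] 1[of 0] 2[of y] 2[of 0] by (simp add: left_diff_distrib)
qed

lemma conv_diff_le:
  assumes G: "symdec G" "integrable lborel G" and f: "f \<in> borel_measurable borel" "\<And>y. \<bar>f y\<bar> \<le> U"
    and y: "0 \<le> y"
  shows "\<bar>conv G f (x + y) - conv G f x\<bar> \<le> 2 * U * mass G y"
proof -
  note S = conv_shift_diff[OF G(2) f, where x=x and y=y]
  have U: "0 \<le> U" using f(2)[of 0] by simp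
  have "\<bar>conv G f (x + y) - conv G f x\<bar> \<le> (LINT w|lborel. \<bar>(G (w + y) - G w) * f (x - w)\<bar>)"
    unfolding S(2) by (rule integral_abs_bound)
  also have "\<dots> \<le> (LINT w|lborel. U * \<bar>G (w + y) - G w\<bar>)"
  proof (rule integral_mono)
    show "integrable lborel (\<lambda>w. U * \<bar>G (w + y) - G w\<bar>)"
      using G(2) by (intro integrable_mult_right integrable_abs Bochner_Integration.integrable_diff)
        (simp_all add: lborel_integrable_translate_iff)
    show "\<bar>(G (w + y) - G w) * f (x - w)\<bar> \<le> U * \<bar>G (w + y) - G w\<bar>" for w
      using f(2)[of "x - w"] by (simp add: abs_mult mult.commute[of U] mult_left_mono)
  qed (use S(1) in simp)
  also have "\<dots> \<le> U * (2 * mass G y)"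
    using symdec_diff_L1[OF G y] U by (simp add: mult_left_mono)
  finally show ?thesis by simp
qed

text \<open>What remains of the integrand when the principal value is folded at the origin. For the
  solution it is absolutely integrable against \<open>K\<close>, even when
  \<open>2 * s \<ge> 1\<close>.\<close>

definition sdiff :: "(real \<Rightarrow> real) \<Rightarrow> real \<Rightarrow> real \<Rightarrow> real" where
  "sdiff z x y = 2 * z x - z (x - y) - z (x + y)"

lemma sdiff_minus: "sdiff z x (- y) = sdiff z x y"
  by (simp add: sdiff_def)

lemma sdiff_abs: "sdiff z x \<bar>y\<bar> = sdiff z x y"
  by (simp add: abs_if sdiff_minus)

lemma conv_sdiff:
  assumes G: "integrable lborel G" and f: "f \<in> borel_measurable borel" "\<And>y. \<bar>f y\<bar> \<le> U"
  shows "integrable lborel (\<lambda>w. (G (w + y) - G w) * (f (x - w) - f (x - y - w)))"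
    and "sdiff (conv G f) x y = - (LINT w|lborel. (G (w + y) - G w) * (f (x - w) - f (x - y - w)))"
proof -
  note S = conv_shift_diff[OF G f, where x=x and y=y]
  note S' = conv_shift_diff[OF G f, where x="x - y" and y=y]
  show "integrable lborel (\<lambda>w. (G (w + y) - G w) * (f (x - w) - f (x - y - w)))"
    using S(1) S'(1) by (simp add: right_diff_distrib)
  have "sdiff (conv G f) x y = - ((conv G f (x + y) - conv G f x) - (conv G f (x - y + y) - conv G f (x - y)))"
    by (simp add: sdiff_def)
  also have "\<dots> = - (LINT w|lborel. (G (w + y) - G w) * (f (x - w) - f (x - y - w)))"
    unfolding S(2) S'(2) using S(1) S'(1) by (simp add: right_diff_distrib)
  finally show "sdiff (conv G f) x y = - (LINT w|lborel. (G (w + y) - G w) * (f (x - w) - f (x - y - w)))" .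
qed

text \<open>One difference falls on \<open>G\<close> and the other on \<open>f\<close>, so the two moduli of continuity multiply.\<close>

lemma conv_sdiff_le:
  assumes G: "symdec G" "integrable lborel G" and f: "f \<in> borel_measurable borel" "\<And>y. \<bar>f y\<bar> \<le> U"
    and y: "0 \<le> y" and H: "\<And>x. \<bar>f (x + y) - f x\<bar> \<le> H"
  shows "\<bar>sdiff (conv G f) x y\<bar> \<le> 2 * H * mass G y"
proof -
  note S = conv_sdiff[OF G(2) f, where x=x and y=y]
  have H0: "0 \<le> H" using H[of 0] by simp
  have "\<bar>sdiff (conv G f) x y\<bar> \<le> (LINT w|lborel. \<bar>(G (w + y) - G w) * (f (x - w) - f (x - y - w))\<bar>)"
    unfolding S(2) by (simp add: integral_abs_bound)
  also have "\<dots> \<le> (LINT w|lborel. H * \<bar>G (w + y) - G w\<bar>)"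
  proof (rule integral_mono)
    show "integrable lborel (\<lambda>w. H * \<bar>G (w + y) - G w\<bar>)"
      using G(2) by (intro integrable_mult_right integrable_abs Bochner_Integration.integrable_diff)
        (simp_all add: lborel_integrable_translate_iff)
    show "\<bar>(G (w + y) - G w) * (f (x - w) - f (x - y - w))\<bar> \<le> H * \<bar>G (w + y) - G w\<bar>" for w
    proof -
      have "x - y - w + y = x - w" by simp
      then have "\<bar>f (x - w) - f (x - y - w)\<bar> \<le> H" using H[of "x - y - w"] by metis
      then show ?thesis by (simp add: abs_mult mult.commute[of H] mult_left_mono)
    qed
  qed (use S(1) in simp)
  also have "\<dots> \<le> H * (2 * mass G y)"
    using symdec_diff_L1[OF G y] H0 by (simp add: mult_left_mono)
  finally show ?thesis by simp
qed

text \<open>\<open>b > s\<close> lets two moduli of continuity of order \<open>b\<close> beat the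
  singularity of \<open>K\<close>; the other two bounds on \<open>b\<close> are those of
  \<open>mass_bound\<close>. The \<open>G n\<close> converge only almost everywhere, which by itself
  does not exclude a loss of mass.\<close>

locale green_limit = levy_kernel K s A c C for K s A c C +
  fixes d :: "nat \<Rightarrow> real" and G :: "nat \<Rightarrow> real \<Rightarrow> real" and g :: "real \<Rightarrow> real" and b :: real
  assumes d: "\<And>n. 0 < d n" "\<And>n. d n \<le> 1" and d0: "d \<longlonglongrightarrow> 0"
    and G: "\<And>n. green_d (d n) (G n)" and g: "symdec g"
    and G_lim: "AE x in lborel. (\<lambda>n. G n x) \<longlonglongrightarrow> g x"
    and b: "s < b" "b < 1" "b \<le> 2 * s"

text \<open>The uniform total mass \<open>1 / A\<close> gives a pointwise bound of order
  \<open>-1\<close> away from the origin, which is all that Helly selection asks for.\<close>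

lemma (in levy_kernel) green_limit_exists:
  assumes "s < b" "b < 1" "b \<le> 2 * s"
  obtains d G g where "green_limit K s A c C d G g b"
proof -
  define e where "e n = inverse (real (Suc n))" for n
  have e: "0 < e n" "e n \<le> 1" for n by (auto simp: e_def inverse_le_1_iff)
  have e0: "e \<longlonglongrightarrow> 0" unfolding e_def by (rule LIMSEQ_inverse_real_of_nat)
  obtain G where G: "\<And>n. green_d (e n) (G n)"
    using green_d_exists[OF e(1)] by metis
  have le: "G n x \<le> 1 / A / (2 * \<bar>x\<bar>)" if "x \<noteq> 0" for n x
  proof -
    have "2 * \<bar>x\<bar> * G n x \<le> mass (G n) \<bar>x\<bar>"
      by (intro symdec_le_mass integrable_times_indicator green_dD(1,2)[OF G] that) simp
    also have "\<dots> \<le> 1 / A"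
      using mass_le_integral[OF green_dD(1,2)[OF G]] green_dD(3)[OF G] order_trans by blast
    finally show ?thesis using that by (subst pos_le_divide_eq) (auto simp: mult.commute)
  qed
  from helly_symdec[OF green_dD(1)[OF G] le]
  obtain r F where r: "strict_mono r" "symdec F" "AE x in lborel. (\<lambda>n. G (r n) x) \<longlonglongrightarrow> F x" .
  have "green_limit K s A c C (\<lambda>n. e (r n)) (\<lambda>n. G (r n)) F b"
    using e G r assms LIMSEQ_subseq_LIMSEQ[OF e0 r(1)]
    by unfold_locales (auto simp: comp_def)
  then show ?thesis using that by blast
qed

context green_limit
begin

lemmas G_sym = green_dD(1)[OF G] and G_int = green_dD(2)[OF G] and G_int_le = green_dD(3)[OF G]
  and G_borel [measurable] = green_dD(4)[OF G]

lemma g_borel [measurable]: "g \<in> borel_measurable borel"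
  using g by (rule symdec_borel)

lemma mass_le_A: "mass (G n) h \<le> 1 / A"
  using mass_le_integral[OF G_sym G_int] G_int_le order_trans by blast

lemma G_le_mass: "x \<noteq> 0 \<Longrightarrow> G n x \<le> mass (G n) \<bar>x\<bar> / (2 * \<bar>x\<bar>)"
proof -
  assume x: "x \<noteq> 0"
  have "2 * \<bar>x\<bar> * G n x \<le> mass (G n) \<bar>x\<bar>"
    by (intro symdec_le_mass integrable_times_indicator G_sym G_int x) simp
  then show ?thesis using x by (simp add: field_simps)
qed

lemma G_le: "x \<noteq> 0 \<Longrightarrow> G n x \<le> 1 / A / (2 * \<bar>x\<bar>)"
  by (rule order_trans[OF G_le_mass divide_right_mono[OF mass_le_A]]) auto

lemma mass_G:
  obtains B where "0 < B" "\<And>n h. d n \<le> h \<Longrightarrow> mass (G n) h \<le> B * h powr b"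
proof -
  have "0 < b" using b s by simp
  then obtain B where
    "0 < B" "\<And>d g h. 0 < d \<Longrightarrow> d \<le> h \<Longrightarrow> green_d d g \<Longrightarrow> mass g h \<le> B * h powr b"
    using mass_bound[OF _ b(2,3)] by blast
  then show ?thesis using that d(1) G by blast
qed

text \<open>Fatou's lemma, so only upper bounds reach \<open>g\<close> this way. That the limit
  still inverts the operator is the content of \<open>conv_G_lim\<close> and
  \<open>green_equation\<close>.\<close>

lemma nn_integral_g_le:
  assumes S: "S \<in> sets borel" and le: "eventually (\<lambda>n. (LINT x|lborel. G n x * indicator S x) \<le> M) sequentially"
  shows "(\<integral>\<^sup>+x. g x * indicator S x \<partial>lborel) \<le> ennreal M"
proof -
  have [measurable]: "S \<in> sets borel" by fact
  have "(\<integral>\<^sup>+x. g x * indicator S x \<partial>lborel) = (\<integral>\<^sup>+x. liminf (\<lambda>n. ennreal (G n x * indicator S x)) \<partial>lborel)"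
    using G_lim
  proof (intro nn_integral_cong_AE, eventually_elim)
    case (elim x)
    then have "(\<lambda>n. ennreal (G n x * indicator S x)) \<longlonglongrightarrow> ennreal (g x * indicator S x)"
      by (intro tendsto_ennrealI tendsto_intros)
    then show ?case by (metis lim_imp_Liminf sequentially_bot)
  qed
  also have "\<dots> \<le> liminf (\<lambda>n. \<integral>\<^sup>+x. ennreal (G n x * indicator S x) \<partial>lborel)"
    by (intro nn_integral_liminf) measurable
  also have "\<dots> \<le> liminf (\<lambda>n. ennreal M)"
  proof (intro Liminf_mono eventually_mono[OF le])
    fix n assume "(LINT x|lborel. G n x * indicator S x) \<le> M"
    moreover have "(\<integral>\<^sup>+x. ennreal (G n x * indicator S x) \<partial>lborel) = ennreal (LINT x|lborel. G n x * indicator S x)"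
      using integrable_times_indicator[OF G_int S]
      by (intro nn_integral_eq_integral) (auto simp: symdec_nonneg[OF G_sym])
    ultimately show "(\<integral>\<^sup>+x. ennreal (G n x * indicator S x) \<partial>lborel) \<le> ennreal M"
      by (simp add: ennreal_leI)
  qed
  finally show ?thesis by (simp add: Liminf_const)
qed

lemma g_int: "integrable lborel g"
proof -
  have "(\<integral>\<^sup>+x. ennreal (g x * indicator UNIV x) \<partial>lborel) \<le> ennreal (1 / A)"
    using G_int_le by (intro nn_integral_g_le) auto
  then have "(\<integral>\<^sup>+x. ennreal (norm (g x)) \<partial>lborel) < \<infinity>"
    using symdec_nonneg[OF g] by (auto simp: order_le_less_trans)
  then show ?thesis by (intro integrableI_bounded) auto
qed

lemma mass_g:
  obtains B where "0 < B" "\<And>h. 0 \<le> h \<Longrightarrow> mass g h \<le> B * h powr b"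
proof -
  obtain B where B: "0 < B" "\<And>n h. d n \<le> h \<Longrightarrow> mass (G n) h \<le> B * h powr b"
    using mass_G by blast
  have "mass g h \<le> B * h powr b" if h: "0 < h" for h
  proof -
    have "eventually (\<lambda>n. d n < h) sequentially"
      using d0 h by (rule order_tendstoD)
    then have "eventually (\<lambda>n. (LINT x|lborel. G n x * indicator {-h..h} x) \<le> B * h powr b) sequentially"
      by eventually_elim (use B(2) in \<open>auto simp: mass_def[symmetric]\<close>)
    then have "(\<integral>\<^sup>+x. g x * indicator {-h..h} x \<partial>lborel) \<le> ennreal (B * h powr b)"
      by (intro nn_integral_g_le) auto
    moreover have "(\<integral>\<^sup>+x. g x * indicator {-h..h} x \<partial>lborel) = ennreal (mass g h)"
      unfolding mass_def using integrable_times_indicator[OF g_int]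
      by (intro nn_integral_eq_integral) (auto simp: symdec_nonneg[OF g])
    ultimately show ?thesis using B(1) by (simp add: ennreal_le_iff)
  qed
  moreover have "mass g 0 = 0"
  proof -
    have "AE x in lborel. x \<notin> {0::real}"
      by (intro AE_not_in countable_imp_null_set_lborel) auto
    then have "AE x in lborel. g x * indicator {-0..0} x = 0"
      by eventually_elim (auto split: split_indicator)
    then show ?thesis unfolding mass_def by (rule integral_eq_zero_AE)
  qed
  ultimately show ?thesis using that[OF B(1)] by (metis order_le_less powr_0 mult_zero_right order_refl)
qed

lemma g_le_inverse: "x \<noteq> 0 \<Longrightarrow> g x \<le> (LINT x|lborel. g x) / (2 * \<bar>x\<bar>)"
proof -
  assume x: "x \<noteq> 0"
  have "2 * \<bar>x\<bar> * g x \<le> mass g \<bar>x\<bar>"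
    using x by (intro symdec_le_mass integrable_times_indicator g g_int) auto
  also have "\<dots> \<le> (LINT x|lborel. g x)" by (rule mass_le_integral[OF g g_int])
  finally show ?thesis using x by (simp add: field_simps)
qed

text \<open>Near the origin the mass bound gives the power \<open>b - 1\<close>, at infinity
  integrability gives the power \<open>-1\<close>. A power \<open>b' - 1\<close> between these is
  weaker at both ends; the freedom in \<open>b'\<close> is used to tune the behaviour at either end
  separately.\<close>

lemma g_le_powr:
  assumes b': "0 < b'" "b' \<le> b"
  obtains B where "0 < B" "\<And>x. x \<noteq> 0 \<Longrightarrow> g x \<le> B * \<bar>x\<bar> powr (b' - 1)"
proof -
  obtain B where B: "0 < B" "\<And>h. 0 \<le> h \<Longrightarrow> mass g h \<le> B * h powr b"
    using mass_g by blast
  define I where "I = (LINT x|lborel. g x)"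
  have I: "0 \<le> I" unfolding I_def by (intro Bochner_Integration.integral_nonneg symdec_nonneg[OF g])
  show ?thesis
  proof (rule that[of "B + I"])
    show "0 < B + I" using B I by simp
    fix x :: real assume x: "x \<noteq> 0"
    show "g x \<le> (B + I) * \<bar>x\<bar> powr (b' - 1)"
    proof (cases "\<bar>x\<bar> \<le> 1")
      case True
      have "2 * \<bar>x\<bar> * g x \<le> mass g \<bar>x\<bar>"
        using x by (intro symdec_le_mass integrable_times_indicator g g_int) auto
      also have "\<dots> \<le> B * \<bar>x\<bar> powr b" using B(2) by simp
      finally have "g x \<le> B * \<bar>x\<bar> powr b / (2 * \<bar>x\<bar>)" using x by (simp add: field_simps)
      also have "\<dots> \<le> B * \<bar>x\<bar> powr (b - 1)"
        using x B(1) by (simp add: powr_diff field_simps)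
      also have "\<dots> \<le> (B + I) * \<bar>x\<bar> powr (b' - 1)"
        using B(1) I True x b' by (intro mult_mono powr_mono') auto
      finally show ?thesis .
    next
      case False
      have "g x \<le> I / (2 * \<bar>x\<bar>)" unfolding I_def by (rule g_le_inverse[OF x])
      also have "\<dots> \<le> I * \<bar>x\<bar> powr (-1)"
        using x I by (simp add: powr_minus field_simps)
      also have "\<dots> \<le> (B + I) * \<bar>x\<bar> powr (b' - 1)"
        using B(1) I False b' by (intro mult_mono powr_mono) auto
      finally show ?thesis .
    qed
  qed
qed

text \<open>Loss of mass is excluded at both ends. For \<open>\<bar>y\<bar> < d n\<close>, out of
  reach of the pointwise majorant, the whole contribution is small by \<open>mass_G\<close> at
  \<open>h = d n\<close>. At infinity, where \<open>G n\<close> has only the non-integrable bound of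
  order \<open>-1\<close>, the square integrability of \<open>u\<close> supplies the
  majorant.\<close>

lemma conv_G_lim:
  assumes [measurable]: "u \<in> borel_measurable borel" and U: "\<And>y. \<bar>u y\<bar> \<le> U"
    and sq: "integrable lborel (\<lambda>y. (u y)\<^sup>2)"
  shows "(\<lambda>n. conv (G n) u x) \<longlonglongrightarrow> conv g u x"
proof -
  have U0: "0 \<le> U" using U[of 0] by simp
  obtain B where B: "0 < B" "\<And>n h. d n \<le> h \<Longrightarrow> mass (G n) h \<le> B * h powr b"
    using mass_G by blast
  define far where "far n = (indicator {y. d n \<le> \<bar>y\<bar>} :: real \<Rightarrow> real)" for n
  define near where "near n = (indicator {y. \<bar>y\<bar> < d n} :: real \<Rightarrow> real)" for n
  have [measurable]: "far n \<in> borel_measurable borel" "near n \<in> borel_measurable borel" for n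
    unfolding far_def near_def by measurable
  have iG: "integrable lborel (\<lambda>y. G n y * u (x - y))" for n
    using conv_bdd_integrable[OF G_int[of n], of u U x] U
      lborel_integrable_reflect_iff[of "\<lambda>y. G n (x - y) * u y" x] by simp
  define w where "w y = U * B * (\<bar>y\<bar> powr (b - 1) * indicator {-1..1} y) +
     ((1 / (2 * A))\<^sup>2 * (\<bar>y\<bar> powr (-2) * indicator {y. 1 \<le> \<bar>y\<bar>} y) + (u (x - y))\<^sup>2)" for y
  have iw: "integrable lborel w"
    unfolding w_def[abs_def] using b s sq lborel_integrable_reflect_iff[of "\<lambda>y. (u y)\<^sup>2" x]
    by (intro Bochner_Integration.integrable_add integrable_mult_right powr_near_zero_integrable powr_at_infinity_integrable) auto
  have dom: "norm (G n y * far n y * u (x - y)) \<le> w y" for n y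
  proof (cases "y = 0 \<or> \<bar>y\<bar> < d n")
    case True
    then show ?thesis using d(1)[of n] U0 B(1)
      by (auto simp: far_def w_def intro!: add_nonneg_nonneg mult_nonneg_nonneg)
  next
    case False
    then have y: "y \<noteq> 0" "d n \<le> \<bar>y\<bar>" by auto
    have nn: "0 \<le> G n y" by (rule symdec_nonneg[OF G_sym])
    show ?thesis
    proof (cases "\<bar>y\<bar> \<le> 1")
      case True
      have "G n y \<le> mass (G n) \<bar>y\<bar> / (2 * \<bar>y\<bar>)" by (rule G_le_mass[OF y(1)])
      also have "\<dots> \<le> B * \<bar>y\<bar> powr b / (2 * \<bar>y\<bar>)"
        using B(2)[OF y(2)] by (intro divide_right_mono) auto
      also have "\<dots> \<le> B * \<bar>y\<bar> powr (b - 1)"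
        using y B(1) by (simp add: powr_diff field_simps)
      finally have "G n y * \<bar>u (x - y)\<bar> \<le> B * \<bar>y\<bar> powr (b - 1) * U"
        using U B(1) nn by (intro mult_mono) auto
      moreover have "norm (G n y * far n y * u (x - y)) = G n y * \<bar>u (x - y)\<bar>"
        using y nn by (simp add: far_def abs_mult)
      moreover have "B * \<bar>y\<bar> powr (b - 1) * U \<le> w y"
        using True by (simp add: w_def abs_le_iff mult_ac)
      ultimately show ?thesis by linarith
    next
      case False
      have e1: "\<bar>y\<bar> powr (-2) = (1 / \<bar>y\<bar>)\<^sup>2"
        using y by (simp add: powr_minus powr_numeral power_divide field_simps)
      have e2: "G n y * \<bar>u (x - y)\<bar> \<le> 1 / A / (2 * \<bar>y\<bar>) * \<bar>u (x - y)\<bar>"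
        using G_le[OF y(1)] by (intro mult_right_mono) auto
      have e3: "1 / A / (2 * \<bar>y\<bar>) * \<bar>u (x - y)\<bar> \<le> (1 / (2 * A))\<^sup>2 * (1 / \<bar>y\<bar>)\<^sup>2 + (u (x - y))\<^sup>2"
      proof -
        define P where "P = 1 / (2 * A) * (1 / \<bar>y\<bar>)"
        have "2 * P * \<bar>u (x - y)\<bar> \<le> P\<^sup>2 + \<bar>u (x - y)\<bar>\<^sup>2"
          by (rule sum_squares_bound)
        moreover have "0 \<le> P * \<bar>u (x - y)\<bar>" using A by (simp add: P_def)
        ultimately have "P * \<bar>u (x - y)\<bar> \<le> P\<^sup>2 + (u (x - y))\<^sup>2" by simp
        moreover have "P = 1 / A / (2 * \<bar>y\<bar>)" "P\<^sup>2 = (1 / (2 * A))\<^sup>2 * (1 / \<bar>y\<bar>)\<^sup>2"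
          by (simp add: P_def) (simp only: P_def power_mult_distrib)
        ultimately show ?thesis by simp
      qed
      have "G n y * \<bar>u (x - y)\<bar> \<le> (1 / (2 * A))\<^sup>2 * \<bar>y\<bar> powr (-2) + (u (x - y))\<^sup>2"
        unfolding e1 using e2 e3 by (rule order_trans)
      moreover have "norm (G n y * far n y * u (x - y)) = G n y * \<bar>u (x - y)\<bar>"
        using y nn by (simp add: far_def abs_mult)
      moreover have "w y = (1 / (2 * A))\<^sup>2 * \<bar>y\<bar> powr (-2) + (u (x - y))\<^sup>2"
      proof -
        have "y \<notin> {-1..1}" "1 \<le> \<bar>y\<bar>" using False by auto
        then show ?thesis by (simp add: w_def)
      qed
      ultimately show ?thesis by simp
    qed
  qed
  have lim1: "(\<lambda>n. LINT y|lborel. G n y * far n y * u (x - y)) \<longlonglongrightarrow> (LINT y|lborel. g y * u (x - y))"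
  proof (rule integral_dominated_convergence[OF _ _ iw])
    have "AE y in lborel. y \<notin> {0::real}"
      by (intro AE_not_in countable_imp_null_set_lborel) auto
    then show "AE y in lborel. (\<lambda>n. G n y * far n y * u (x - y)) \<longlonglongrightarrow> g y * u (x - y)"
      using G_lim
    proof eventually_elim
      case (elim y)
      have "eventually (\<lambda>n. d n < \<bar>y\<bar>) sequentially"
        using d0 by (rule order_tendstoD) (use elim in auto)
      then have "eventually (\<lambda>n. G n y * u (x - y) = G n y * far n y * u (x - y)) sequentially"
        by eventually_elim (auto simp: far_def)
      moreover have "(\<lambda>n. G n y * u (x - y)) \<longlonglongrightarrow> g y * u (x - y)"
        using elim by (intro tendsto_intros)
      ultimately show ?case by (rule Lim_transform_eventually[rotated])
    qed
    show "AE y in lborel. norm (G n y * far n y * u (x - y)) \<le> w y" for n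
      using dom by simp
  qed measurable
  have lim2: "(\<lambda>n. LINT y|lborel. G n y * near n y * u (x - y)) \<longlonglongrightarrow> 0"
  proof (rule tendsto_rabs_zero_cancel, rule tendsto_sandwich[OF _ _ tendsto_const])
    show "eventually (\<lambda>n. \<bar>LINT y|lborel. G n y * near n y * u (x - y)\<bar> \<le> U * (B * d n powr b)) sequentially"
    proof (rule always_eventually, rule allI)
      fix n
      have "\<bar>LINT y|lborel. G n y * near n y * u (x - y)\<bar> \<le> (LINT y|lborel. \<bar>G n y * near n y * u (x - y)\<bar>)"
        by (rule integral_abs_bound)
      also have "\<dots> \<le> (LINT y|lborel. U * (G n y * indicator {-d n..d n} y))"
      proof (rule integral_mono')
        show "integrable lborel (\<lambda>y. U * (G n y * indicator {-d n..d n} y))"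
          using integrable_times_indicator[OF G_int] by simp
        fix y
        have "G n y * \<bar>u (x - y)\<bar> \<le> G n y * U"
          using U symdec_nonneg[OF G_sym] by (intro mult_left_mono) auto
        then show "\<bar>G n y * near n y * u (x - y)\<bar> \<le> U * (G n y * indicator {-d n..d n} y)"
          using symdec_nonneg[OF G_sym, of n y] U0
          by (auto simp: near_def abs_mult mult_ac split: split_indicator)
        show "0 \<le> U * (G n y * indicator {-d n..d n} y)"
          using symdec_nonneg[OF G_sym, of n y] U0 by simp
      qed
      also have "\<dots> = U * mass (G n) (d n)" by (simp add: mass_def)
      also have "\<dots> \<le> U * (B * d n powr b)" using B(2) U0 by (intro mult_left_mono) auto
      finally show "\<bar>LINT y|lborel. G n y * near n y * u (x - y)\<bar> \<le> U * (B * d n powr b)" .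
    qed
    have "0 < b" using b s by simp
    then have "(\<lambda>n. U * (B * d n powr b)) \<longlonglongrightarrow> U * (B * 0 powr b)"
      using d0 d(1) by (intro tendsto_intros tendsto_powr' ) (auto simp: less_imp_le)
    then show "(\<lambda>n. U * (B * d n powr b)) \<longlonglongrightarrow> 0" by simp
  qed auto
  have "(LINT y|lborel. G n y * far n y * u (x - y)) + (LINT y|lborel. G n y * near n y * u (x - y)) = conv (G n) u x" for n
  proof -
    have i1: "integrable lborel (\<lambda>y. G n y * far n y * u (x - y))"
      by (rule Bochner_Integration.integrable_bound[OF iG[of n]]) (auto simp: far_def split: split_indicator)
    have i2: "integrable lborel (\<lambda>y. G n y * near n y * u (x - y))"
      by (rule Bochner_Integration.integrable_bound[OF iG[of n]]) (auto simp: near_def split: split_indicator)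
    have "(\<lambda>y. G n y * far n y * u (x - y) + G n y * near n y * u (x - y)) = (\<lambda>y. G n y * u (x - y))"
      by (auto simp: far_def near_def split: split_indicator)
    then show ?thesis unfolding conv_alt using i1 i2 by (simp flip: Bochner_Integration.integral_add)
  qed
  with tendsto_add[OF lim1 lim2] show ?thesis by (simp add: conv_alt)
qed

lemma kap_lim: "(\<lambda>n. kap (d n)) \<longlonglongrightarrow> 0"
proof (rule tendsto_sandwich[OF _ _ tendsto_const])
  show "eventually (\<lambda>n. kap (d n) \<le> 1 / (2 * c) * d n powr (2 * s)) sequentially"
    using kap_le d by simp
  have "(\<lambda>n. 1 / (2 * c) * d n powr (2 * s)) \<longlonglongrightarrow> 1 / (2 * c) * 0 powr (2 * s)"
    using d0 d(1) s by (intro tendsto_intros tendsto_powr') (auto simp: less_imp_le)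
  then show "(\<lambda>n. 1 / (2 * c) * d n powr (2 * s)) \<longlonglongrightarrow> 0" by simp
qed (use kap_pos[OF d(1)] in \<open>simp add: less_imp_le\<close>)

text \<open>\<open>v = kap (d n) * u + conv (G n) u\<close> solves the truncated equation with
  right-hand side \<open>u\<close>, so pairing \<open>u\<close> with \<open>v\<close> gives the
  quadratic form of the truncated operator at \<open>v\<close>, which is at least \<open>A\<close>
  times the square norm of \<open>v\<close>. In the limit the atomic term drops out.\<close>

lemma g_posdef:
  assumes um [measurable]: "u \<in> borel_measurable borel" and U: "\<And>y. \<bar>u y\<bar> \<le> U"
    and supp: "\<And>x. R < \<bar>x\<bar> \<Longrightarrow> u x = 0"
  shows "0 \<le> (LINT x|lborel. u x * conv g u x)"
proof -
  have U0: "0 \<le> U" using U[of 0] by simp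
  have le: "\<bar>u x\<bar> \<le> U * indicator {-R..R} x" for x
    using U[of x] supp[of x] by (auto split: split_indicator)
  have iu: "integrable lborel u"
    by (rule Bochner_Integration.integrable_bound[of _ "\<lambda>x. U * indicator {-R..R} x"])
       (use le U0 in \<open>auto simp: abs_mult\<close>)
  have iu2: "integrable lborel (\<lambda>x. (u x)\<^sup>2)"
    unfolding power2_eq_square by (rule integrable_mult_bounded[OF iu um U])
  have pos: "0 \<le> kap (d n) * (LINT x|lborel. (u x)\<^sup>2) + (LINT x|lborel. u x * conv (G n) u x)" for n
  proof -
    define v where "v x = kap (d n) * u x + conv (G n) u x" for x
    define V where "V = kap (d n) * U + U / A"
    have kp: "0 < kap (d n)" using kap_pos d by simp
    have vm [measurable]: "v \<in> borel_measurable borel" unfolding v_def[abs_def] by measurable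
    have cb: "\<bar>conv (G n) u x\<bar> \<le> U / A" for x
      by (rule green_d_conv_le[OF G um U])
    have cm [measurable]: "conv (G n) u \<in> borel_measurable borel" by measurable
    have vb: "\<bar>v x\<bar> \<le> V" for x
    proof -
      have "\<bar>v x\<bar> \<le> kap (d n) * \<bar>u x\<bar> + \<bar>conv (G n) u x\<bar>"
        unfolding v_def using kp by (intro order_trans[OF abs_triangle_ineq]) (simp add: abs_mult)
      also have "\<dots> \<le> V" unfolding V_def using U[of x] cb[of x] kp by (intro add_mono mult_left_mono) auto
      finally show ?thesis .
    qed
    have iv: "integrable lborel v"
      unfolding v_def[abs_def] using iu conv_integrable(1)[OF G_int[of n] iu] by simp
    have iv2: "integrable lborel (\<lambda>x. (v x)\<^sup>2)"
      unfolding power2_eq_square by (rule integrable_mult_bounded[OF iv vm vb])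
    note iK = Kd_integrable[OF d(1)[of n]]
    have Kb [measurable]: "Kd (d n) \<in> borel_measurable borel" by (rule Kd_borel[OF d(1)])
    have ueq: "u x = (A + k (d n)) * v x - conv (Kd (d n)) v x" for x
    proof -
      have "conv (Kd (d n)) v x = kap (d n) * conv (Kd (d n)) u x + conv (Kd (d n)) (conv (G n) u) x"
        using conv_bdd_integrable[OF iK um U, where x=x] conv_bdd_integrable[OF iK cm cb, where x=x]
        unfolding v_def conv_def[of "Kd (d n)"] by (simp add: distrib_left mult.left_commute)
      moreover have "(A + k (d n)) * (kap (d n) * u x) = u x"
        using A k_nonneg[OF d(1)[of n]] by (simp add: kap_def)
      moreover have "(A + k (d n)) * v x = (A + k (d n)) * (kap (d n) * u x) + (A + k (d n)) * conv (G n) u x"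
        unfolding v_def by (rule distrib_left)
      ultimately show ?thesis
        using green_d_resolvent[OF d(1)[of n] G[of n] um U, where x=x] by linarith
    qed
    have Kv: "\<bar>conv (Kd (d n)) v x\<bar> \<le> V * k (d n)" for x
      using conv_bdd_le[OF iK vm vb, where x=x] symdec_nonneg[OF symdec_Kd[OF d(1)]] by (simp add: k_def)
    have ivK: "integrable lborel (\<lambda>x. v x * conv (Kd (d n)) v x)"
      by (rule integrable_mult_bounded[OF iv _ Kv]) measurable
    \<comment> \<open>Schur's test: \<open>2 * v x * v y\<close> is at most the sum of the squares,
      and \<open>Kd (d n)\<close> has integral \<open>k (d n)\<close> in either variable.\<close>
    have "(LINT x|lborel. v x * conv (Kd (d n)) v x)
        \<le> (LINT x|lborel. (k (d n) * (v x)\<^sup>2 + conv (Kd (d n)) (\<lambda>x. (v x)\<^sup>2) x) / 2)"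
    proof (rule integral_mono[OF ivK])
      show "integrable lborel (\<lambda>x. (k (d n) * (v x)\<^sup>2 + conv (Kd (d n)) (\<lambda>x. (v x)\<^sup>2) x) / 2)"
        using iv2 conv_integrable(1)[OF iK iv2] by simp
      fix x
      have iKx: "integrable lborel (\<lambda>y. Kd (d n) (x - y))"
        using iK by (subst lborel_integrable_reflect_iff)
      have v2b: "\<bar>(v y)\<^sup>2\<bar> \<le> V\<^sup>2" for y using vb[of y] by (simp add: abs_le_square_iff[symmetric])
      have iKv2: "integrable lborel (\<lambda>y. Kd (d n) (x - y) * (v y)\<^sup>2)"
        by (rule conv_bdd_integrable[OF iK _ v2b]) measurable
      have "v x * conv (Kd (d n)) v x = (LINT y|lborel. v x * (Kd (d n) (x - y) * v y))"
        by (simp add: conv_def)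
      also have "\<dots> \<le> (LINT y|lborel. (v x)\<^sup>2 / 2 * Kd (d n) (x - y) + Kd (d n) (x - y) * (v y)\<^sup>2 / 2)"
      proof (rule integral_mono)
        show "integrable lborel (\<lambda>y. v x * (Kd (d n) (x - y) * v y))"
          using conv_bdd_integrable[OF iK vm vb, where x=x] by simp
        show "integrable lborel (\<lambda>y. (v x)\<^sup>2 / 2 * Kd (d n) (x - y) + Kd (d n) (x - y) * (v y)\<^sup>2 / 2)"
          using iKx iKv2 by simp
        fix y
        have "2 * v x * v y \<le> (v x)\<^sup>2 + (v y)\<^sup>2" by (rule sum_squares_bound)
        then have "Kd (d n) (x - y) * (v x * v y) \<le> Kd (d n) (x - y) * (((v x)\<^sup>2 + (v y)\<^sup>2) / 2)"
          using symdec_nonneg[OF symdec_Kd[OF d(1)]] by (intro mult_left_mono) auto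
        then show "v x * (Kd (d n) (x - y) * v y) \<le> (v x)\<^sup>2 / 2 * Kd (d n) (x - y) + Kd (d n) (x - y) * (v y)\<^sup>2 / 2"
          by (simp add: algebra_simps add_divide_distrib)
      qed
      also have "\<dots> = (k (d n) * (v x)\<^sup>2 + conv (Kd (d n)) (\<lambda>x. (v x)\<^sup>2) x) / 2"
        using iKx iKv2 lborel_integral_reflect[of "Kd (d n)" x] by (simp add: conv_def k_def add_divide_distrib)
      finally show "v x * conv (Kd (d n)) v x \<le> (k (d n) * (v x)\<^sup>2 + conv (Kd (d n)) (\<lambda>x. (v x)\<^sup>2) x) / 2" .
    qed
    also have "\<dots> = k (d n) * (LINT x|lborel. (v x)\<^sup>2)"
      using iv2 conv_integrable[OF iK iv2] by (simp add: k_def)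
    finally have "(LINT x|lborel. v x * conv (Kd (d n)) v x) \<le> k (d n) * (LINT x|lborel. (v x)\<^sup>2)" .
    moreover have "(LINT x|lborel. u x * v x) = (LINT x|lborel. (A + k (d n)) * (v x)\<^sup>2 - v x * conv (Kd (d n)) v x)"
      by (rule Bochner_Integration.integral_cong) (simp_all add: ueq power2_eq_square algebra_simps)
    moreover have "\<dots> = (A + k (d n)) * (LINT x|lborel. (v x)\<^sup>2) - (LINT x|lborel. v x * conv (Kd (d n)) v x)"
      using iv2 ivK by simp
    moreover have "0 \<le> A * (LINT x|lborel. (v x)\<^sup>2)" using A by simp
    ultimately have "0 \<le> (LINT x|lborel. u x * v x)"
      by (simp only: distrib_right)
    also have "(LINT x|lborel. u x * v x) = (LINT x|lborel. kap (d n) * (u x)\<^sup>2 + u x * conv (G n) u x)"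
      by (simp add: v_def power2_eq_square algebra_simps)
    also have "\<dots> = kap (d n) * (LINT x|lborel. (u x)\<^sup>2) + (LINT x|lborel. u x * conv (G n) u x)"
    proof -
      have "integrable lborel (\<lambda>x. u x * conv (G n) u x)"
        using green_d_conv_le[OF G um U] by (intro integrable_mult_bounded[OF iu]) measurable
      then show ?thesis using iu2 by simp
    qed
    finally show ?thesis .
  qed
  have "(\<lambda>n. LINT x|lborel. u x * conv (G n) u x) \<longlonglongrightarrow> (LINT x|lborel. u x * conv g u x)"
  proof (rule integral_dominated_convergence)
    show "integrable lborel (\<lambda>x. U / A * \<bar>u x\<bar>)" using iu by simp
    show "AE x in lborel. (\<lambda>n. u x * conv (G n) u x) \<longlonglongrightarrow> u x * conv g u x"
      by (intro AE_I2 tendsto_intros conv_G_lim[OF um U iu2])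
    have cb: "\<bar>conv (G n) u x\<bar> \<le> U / A" for n x
      by (rule green_d_conv_le[OF G um U])
    show "AE x in lborel. norm (u x * conv (G n) u x) \<le> U / A * \<bar>u x\<bar>" for n
    proof (intro AE_I2)
      fix x
      have "\<bar>conv (G n) u x\<bar> * \<bar>u x\<bar> \<le> U / A * \<bar>u x\<bar>" using cb by (intro mult_right_mono) auto
      then show "norm (u x * conv (G n) u x) \<le> U / A * \<bar>u x\<bar>" by (simp add: abs_mult mult.commute)
    qed
  qed measurable
  then have "(\<lambda>n. kap (d n) * (LINT x|lborel. (u x)\<^sup>2) + (LINT x|lborel. u x * conv (G n) u x))
      \<longlonglongrightarrow> 0 * (LINT x|lborel. (u x)\<^sup>2) + (LINT x|lborel. u x * conv g u x)"
    by (intro tendsto_intros kap_lim)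
  from LIMSEQ_le_const[OF this, of 0] pos show ?thesis by simp
qed

end

lemma (in levy_kernel) Kd_sdiff_integral:
  assumes d: "0 < d" and z: "z \<in> borel_measurable borel" "\<And>y. \<bar>z y\<bar> \<le> Z"
  shows "(LINT y|lborel. sdiff z x y * Kd d y) = 2 * (k d * z x - conv (Kd d) z x)"
proof -
  note i = Kd_diff_integral(1)[OF d z, where x=x]
  have i': "integrable lborel (\<lambda>y. (z x - z (x + y)) * Kd d y)"
    using i lborel_integrable_reflect_iff[of "\<lambda>y. (z x - z (x - y)) * Kd d y" 0]
    by (simp add: symdec_minus[OF symdec_Kd[OF d]])
  have e': "(LINT y|lborel. (z x - z (x + y)) * Kd d y) = (LINT y|lborel. (z x - z (x - y)) * Kd d y)"
    using lborel_integral_reflect[of "\<lambda>y. (z x - z (x - y)) * Kd d y" 0]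
    by (simp add: symdec_minus[OF symdec_Kd[OF d]])
  have "(LINT y|lborel. sdiff z x y * Kd d y) =
      (LINT y|lborel. (z x - z (x - y)) * Kd d y + (z x - z (x + y)) * Kd d y)"
    by (intro Bochner_Integration.integral_cong) (simp_all add: sdiff_def algebra_simps)
  also have "\<dots> = 2 * (LINT y|lborel. (z x - z (x - y)) * Kd d y)"
    using i i' e' by (subst Bochner_Integration.integral_add) auto
  finally show ?thesis unfolding Kd_diff_integral(2)[OF d z, where x=x] .
qed

section \<open>The equation for the limit of the truncations\<close>

context green_limit
begin

lemma Kd_nn: "0 \<le> Kd (d n) y" by (rule symdec_nonneg[OF symdec_Kd[OF d(1)]])

lemma Kd_meas [measurable]: "Kd (d n) \<in> borel_measurable borel" by (rule Kd_borel[OF d(1)])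

lemma Kd_ev: "y \<noteq> 0 \<Longrightarrow> eventually (\<lambda>n. Kd (d n) y = K y) sequentially"
proof -
  assume y: "y \<noteq> 0"
  have "eventually (\<lambda>n. d n < \<bar>y\<bar>) sequentially"
    using d0 by (rule order_tendstoD) (use y in auto)
  then show ?thesis by eventually_elim (simp add: Kd_eq)
qed

text \<open>The Hoelder bound on \<open>f\<close> is what makes the singular side converge: together
  with the mass bound of \<open>G n\<close> it bounds the second difference by order
  \<open>2 * b\<close>, leaving the power \<open>2 * b - 1 - 2 * s\<close>, integrable at the origin
  as \<open>b > s\<close>.\<close>

lemma green_equation:
  assumes fm: "f \<in> borel_measurable borel" and U: "\<And>y. \<bar>f y\<bar> \<le> U"
    and sq: "integrable lborel (\<lambda>y. (f y)\<^sup>2)"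
    and H: "\<And>x h. 0 \<le> h \<Longrightarrow> \<bar>f (x + h) - f x\<bar> \<le> H * h powr b"
  shows "integrable lborel (\<lambda>y. sdiff (conv g f) x y * K y)"
    and "A * conv g f x + 1 / 2 * (LINT y|lborel. sdiff (conv g f) x y * K y) = f x"
proof -
  note fm [measurable]
  have U0: "0 \<le> U" using U[of 0] by simp
  have H0: "0 \<le> H" using H[of 1 0] by simp
  have b0: "0 < b" using b s by simp
  obtain B where B: "0 < B" "\<And>n h. d n \<le> h \<Longrightarrow> mass (G n) h \<le> B * h powr b"
    using mass_G by blast
  define z where "z n = conv (G n) f" for n
  have zm [measurable]: "z n \<in> borel_measurable borel" for n unfolding z_def by measurable
  have zb: "\<bar>z n y\<bar> \<le> U / A" for n y unfolding z_def by (rule green_d_conv_le[OF G fm U])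
  have zlim: "(\<lambda>n. z n y) \<longlonglongrightarrow> conv g f y" for y
    unfolding z_def by (rule conv_G_lim[OF fm U sq])
  have eqn: "A * z n x + 1 / 2 * (LINT y|lborel. sdiff (z n) x y * Kd (d n) y) = kap (d n) * conv (Kd (d n)) f x" for n
  proof -
    have "(LINT y|lborel. sdiff (z n) x y * Kd (d n) y) = 2 * (LINT y|lborel. (z n x - z n (x - y)) * Kd (d n) y)"
      unfolding Kd_sdiff_integral[OF d(1) zm zb] Kd_diff_integral(2)[OF d(1) zm zb] ..
    then show ?thesis
      using green_d_equation[OF d(1)[of n] G fm U, where x=x] by (simp add: z_def)
  qed
  define w where "w y = 2 * H * B * C * (\<bar>y\<bar> powr (2 * b - 1 - 2 * s) * indicator {-1..1} y)
     + 4 * U / A * C * (\<bar>y\<bar> powr (-1 - 2 * s) * indicator {y. 1 \<le> \<bar>y\<bar>} y)" for y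
  have iw: "integrable lborel w"
    unfolding w_def[abs_def] using b s
    by (intro Bochner_Integration.integrable_add integrable_mult_right powr_near_zero_integrable powr_at_infinity_integrable) auto
  have dom: "norm (sdiff (z n) x y * Kd (d n) y) \<le> w y" if y: "y \<noteq> 0" for n y
  proof (cases "\<bar>y\<bar> \<le> 1")
    case True
    \<comment> \<open>The mass bound holds only from \<open>d n\<close> on and
      \<open>Kd (d n)\<close> is flat below \<open>d n\<close>, so both are evaluated at
      \<open>m\<close>.\<close>
    define m where "m = max \<bar>y\<bar> (d n)"
    have m: "0 < m" "\<bar>y\<bar> \<le> m" "d n \<le> m" using y by (auto simp: m_def)
    have "\<bar>sdiff (z n) x y\<bar> = \<bar>sdiff (z n) x \<bar>y\<bar>\<bar>" by (simp add: sdiff_abs)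
    also have "\<dots> \<le> 2 * (H * \<bar>y\<bar> powr b) * mass (G n) \<bar>y\<bar>"
      unfolding z_def by (rule conv_sdiff_le[OF G_sym G_int fm U _ H]) auto
    also have "\<dots> \<le> 2 * (H * m powr b) * (B * m powr b)"
    proof (intro mult_mono)
      show "mass (G n) \<bar>y\<bar> \<le> B * m powr b"
        using mass_mono[OF G_sym G_int m(2), of n] B(2)[OF m(3)] by linarith
    qed (use m H0 B(1) b0 mass_nonneg[OF G_sym] in \<open>auto intro!: powr_mono2\<close>)
    finally have "\<bar>sdiff (z n) x y\<bar> * Kd (d n) y \<le> 2 * (H * m powr b) * (B * m powr b) * (C * m powr (-1 - 2 * s))"
      using Kd_upper[OF d(1), of n y] Kd_nn H0 B(1) by (intro mult_mono) (auto simp: m_def)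
    also have "\<dots> = 2 * H * B * C * (m powr b * m powr b * m powr (-1 - 2 * s))" by simp
    also have "m powr b * m powr b * m powr (-1 - 2 * s) = m powr (2 * b - 1 - 2 * s)"
      by (simp add: powr_add[symmetric] add_diff_eq)
    \<comment> \<open>Returning from \<open>m\<close> to the smaller \<open>\<bar>y\<bar>\<close>
      requires a nonpositive exponent: \<open>2 * b < 1 + 2 * s\<close> follows from
      \<open>b < 1\<close> and \<open>b \<le> 2 * s\<close>.\<close>
    also have "2 * H * B * C * m powr (2 * b - 1 - 2 * s) \<le> 2 * H * B * C * \<bar>y\<bar> powr (2 * b - 1 - 2 * s)"
      using H0 B(1) C b s m y by (intro mult_left_mono powr_mono2') auto
    also have "\<dots> \<le> w y"
      using True U0 A C by (auto simp: w_def abs_le_iff split: split_indicator)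
    finally show ?thesis using Kd_nn by (simp add: abs_mult)
  next
    case False
    have "\<bar>sdiff (z n) x y\<bar> \<le> 2 * \<bar>z n x\<bar> + \<bar>z n (x - y)\<bar> + \<bar>z n (x + y)\<bar>"
      unfolding sdiff_def by linarith
    also have "\<dots> \<le> 4 * (U / A)" using zb[of n x] zb[of n "x - y"] zb[of n "x + y"] by linarith
    finally have "\<bar>sdiff (z n) x y\<bar> * Kd (d n) y \<le> 4 * (U / A) * (C * \<bar>y\<bar> powr (-1 - 2 * s))"
      using order_trans[OF Kd_le_K[OF d(1) y] K_upper_abs[OF y]] Kd_nn by (intro mult_mono) auto
    also have "\<dots> = w y"
    proof -
      have "y \<notin> {-1..1}" "1 \<le> \<bar>y\<bar>" using False by auto
      then show ?thesis by (simp add: w_def)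
    qed
    finally show ?thesis using Kd_nn by (simp add: abs_mult)
  qed
  have mz: "conv g f \<in> borel_measurable borel" by measurable
  have lim: "AE y in lborel. (\<lambda>n. sdiff (z n) x y * Kd (d n) y) \<longlonglongrightarrow> sdiff (conv g f) x y * K y"
    using AE_nonzero
  proof eventually_elim
    case (elim y)
    have "(\<lambda>n. Kd (d n) y) \<longlonglongrightarrow> K y"
      using tendsto_eventually[OF Kd_ev[OF elim]] .
    then show ?case unfolding sdiff_def by (intro tendsto_intros zlim)
  qed
  have dom': "AE y in lborel. norm (sdiff (z n) x y * Kd (d n) y) \<le> w y" for n
    using AE_nonzero by eventually_elim (rule dom)
  have m1: "(\<lambda>y. sdiff (conv g f) x y * K y) \<in> borel_measurable lborel"
    "(\<lambda>y. sdiff (z n) x y * Kd (d n) y) \<in> borel_measurable lborel" for n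
    unfolding sdiff_def using mz by measurable
  show "integrable lborel (\<lambda>y. sdiff (conv g f) x y * K y)"
    by (rule integrable_dominated_convergence[OF m1 iw lim dom'])
  have L1: "(\<lambda>n. A * z n x + 1 / 2 * (LINT y|lborel. sdiff (z n) x y * Kd (d n) y)) \<longlonglongrightarrow>
      A * conv g f x + 1 / 2 * (LINT y|lborel. sdiff (conv g f) x y * K y)"
    by (intro tendsto_intros zlim integral_dominated_convergence[OF m1 iw lim dom'])
  text \<open>\<open>kap d * Kd d\<close> is an approximate identity.\<close>
  define w' where "w' y = C * H / (2 * c) * (\<bar>y\<bar> powr (b - 1) * indicator {-1..1} y)
    + C * U / c * (\<bar>y\<bar> powr (-1 - 2 * s) * indicator {y. 1 \<le> \<bar>y\<bar>} y)" for y
  have L2: "(\<lambda>n. LINT y|lborel. kap (d n) * Kd (d n) y * (f (x - y) - f x)) \<longlonglongrightarrow> integral\<^sup>L lborel (\<lambda>_::real. 0::real)"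
  proof (rule integral_dominated_convergence[where f="\<lambda>_. 0" and w=w'])
    show "integrable lborel w'"
      unfolding w'_def[abs_def] using b0 s
      by (intro Bochner_Integration.integrable_add integrable_mult_right powr_near_zero_integrable powr_at_infinity_integrable) auto
    have kp: "0 < kap (d n)" for n using kap_pos d by simp
    show "AE y in lborel. (\<lambda>n. kap (d n) * Kd (d n) y * (f (x - y) - f x)) \<longlonglongrightarrow> 0"
      using AE_nonzero
    proof eventually_elim
      case (elim y)
      have "(\<lambda>n. kap (d n) * Kd (d n) y * (f (x - y) - f x)) \<longlonglongrightarrow> 0 * K y * (f (x - y) - f x)"
        by (intro tendsto_intros kap_lim tendsto_eventually Kd_ev elim)
      then show ?case by simp
    qed
    show "AE y in lborel. norm (kap (d n) * Kd (d n) y * (f (x - y) - f x)) \<le> w' y" for n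
      using AE_nonzero
    proof eventually_elim
      case (elim y)
      have nrm: "norm (kap (d n) * Kd (d n) y * (f (x - y) - f x)) = kap (d n) * Kd (d n) y * \<bar>f (x - y) - f x\<bar>"
        using less_imp_le[OF kp] Kd_nn by (simp add: abs_mult)
      have kl: "kap (d n) \<le> 1 / (2 * c) * d n powr (2 * s)" by (rule kap_le[OF d])
      show ?case
      proof (cases "\<bar>y\<bar> \<le> 1")
        case True
        define m where "m = max \<bar>y\<bar> (d n)"
        have m: "0 < m" "\<bar>y\<bar> \<le> m" "d n \<le> m" using elim by (auto simp: m_def)
        have a1: "\<bar>f (x - y) - f x\<bar> \<le> H * \<bar>y\<bar> powr b"
        proof (cases "0 \<le> y")
          case True
          then show ?thesis using H[OF True, of "x - y"] by (simp add: abs_minus_commute)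
        next
          case False
          then show ?thesis using H[of "-y" x] by simp
        qed
        \<comment> \<open>\<open>kap_le\<close> supplies \<open>d n powr (2 * s)\<close>, at most
          \<open>m powr (2 * s)\<close>, which reduces the singularity of \<open>Kd\<close> to order
          \<open>-1\<close>. The Hoelder factor \<open>a1\<close> then makes the product
          integrable.\<close>
        have a2: "kap (d n) * Kd (d n) y \<le> C / (2 * c) * \<bar>y\<bar> powr (-1)"
        proof -
          have "kap (d n) * Kd (d n) y \<le> (1 / (2 * c) * d n powr (2 * s)) * (C * m powr (-1 - 2 * s))"
            using kl Kd_upper[OF d(1), of n y] Kd_nn kp c by (intro mult_mono) (auto simp: m_def)
          also have "\<dots> \<le> (1 / (2 * c) * m powr (2 * s)) * (C * m powr (-1 - 2 * s))"
            using m c C d(1)[of n] s by (intro mult_right_mono mult_left_mono powr_mono2) auto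
          also have "\<dots> = C / (2 * c) * (m powr (2 * s) * m powr (-1 - 2 * s))" by simp
          also have "m powr (2 * s) * m powr (-1 - 2 * s) = m powr (-1)"
            by (simp add: powr_add[symmetric])
          also have "C / (2 * c) * m powr (-1) \<le> C / (2 * c) * \<bar>y\<bar> powr (-1)"
            using C c m elim by (intro mult_left_mono powr_mono2') auto
          finally show ?thesis .
        qed
        have "kap (d n) * Kd (d n) y * \<bar>f (x - y) - f x\<bar> \<le> C / (2 * c) * \<bar>y\<bar> powr (-1) * (H * \<bar>y\<bar> powr b)"
          by (rule mult_mono[OF a2 a1]) (use C c in auto)
        also have "\<dots> = C * H / (2 * c) * (\<bar>y\<bar> powr (-1) * \<bar>y\<bar> powr b)" by simp
        also have "\<bar>y\<bar> powr (-1) * \<bar>y\<bar> powr b = \<bar>y\<bar> powr (b - 1)"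
          by (simp only: powr_add[symmetric]) simp
        also have "C * H / (2 * c) * \<bar>y\<bar> powr (b - 1) \<le> w' y"
          using True U0 C c by (auto simp: w'_def abs_le_iff split: split_indicator)
        finally show ?thesis unfolding nrm .
      next
        case False
        have "kap (d n) \<le> 1 / (2 * c)"
        proof -
          have "d n powr (2 * s) \<le> 1" using d[of n] s by (simp add: powr_le1)
          then have "1 / (2 * c) * d n powr (2 * s) \<le> 1 / (2 * c) * 1" using c by (intro mult_left_mono) auto
          then show ?thesis using kl by simp
        qed
        then have a2: "kap (d n) * Kd (d n) y \<le> 1 / (2 * c) * (C * \<bar>y\<bar> powr (-1 - 2 * s))"
          using order_trans[OF Kd_le_K[OF d(1) elim] K_upper_abs[OF elim]] Kd_nn c by (intro mult_mono) auto
        have a1: "\<bar>f (x - y) - f x\<bar> \<le> 2 * U" using U[of x] U[of "x - y"] by linarith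
        have "kap (d n) * Kd (d n) y * \<bar>f (x - y) - f x\<bar> \<le> 1 / (2 * c) * (C * \<bar>y\<bar> powr (-1 - 2 * s)) * (2 * U)"
          by (rule mult_mono[OF a2 a1]) (use C c in auto)
        also have "\<dots> = w' y"
        proof -
          have "y \<notin> {-1..1}" "1 \<le> \<bar>y\<bar>" using False by auto
          then show ?thesis by (simp add: w'_def)
        qed
        finally show ?thesis unfolding nrm .
      qed
    qed
  qed measurable
  have L2': "(LINT y|lborel. kap (d n) * Kd (d n) y * (f (x - y) - f x)) = kap (d n) * conv (Kd (d n)) f x - (1 - A * kap (d n)) * f x" for n
  proof -
    have i: "integrable lborel (\<lambda>y. Kd (d n) y * f (x - y))"
      using conv_bdd_integrable[OF Kd_integrable[OF d(1)[of n]] fm U, where x=x]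
        lborel_integrable_reflect_iff[of "\<lambda>y. Kd (d n) (x - y) * f y" x] by simp
    have "(LINT y|lborel. kap (d n) * Kd (d n) y * (f (x - y) - f x)) =
        (LINT y|lborel. kap (d n) * (Kd (d n) y * f (x - y)) - (kap (d n) * f x) * Kd (d n) y)"
      by (intro Bochner_Integration.integral_cong) (simp_all add: algebra_simps)
    also have "\<dots> = kap (d n) * conv (Kd (d n)) f x - (kap (d n) * f x) * k (d n)"
      using i Kd_integrable[OF d(1)[of n]] by (simp add: conv_alt k_def)
    also have "(kap (d n) * f x) * k (d n) = (1 - A * kap (d n)) * f x"
      using kap_k(1)[OF d(1), of n] by (metis mult.commute mult.assoc)
    finally show ?thesis .
  qed
  have "(\<lambda>n. (LINT y|lborel. kap (d n) * Kd (d n) y * (f (x - y) - f x)) + (1 - A * kap (d n)) * f x)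
      \<longlonglongrightarrow> integral\<^sup>L lborel (\<lambda>_::real. 0::real) + (1 - A * 0) * f x"
    by (intro tendsto_intros L2 kap_lim)
  then have "(\<lambda>n. kap (d n) * conv (Kd (d n)) f x) \<longlonglongrightarrow> f x"
    unfolding L2' by simp
  then show "A * conv g f x + 1 / 2 * (LINT y|lborel. sdiff (conv g f) x y * K y) = f x"
    using LIMSEQ_unique[OF L1] unfolding eqn by simp
qed

text \<open>Upper bounds from Fatou cannot exclude that \<open>g\<close> vanishes, but the equation
  can: for a tent function \<open>f\<close> with \<open>f 0 = 1\<close> its left-hand side at 0
  would be 0.\<close>

lemma g_nonzero: "\<exists>x. x \<noteq> 0 \<and> 0 < g x"
proof (rule ccontr)
  assume "\<not> ?thesis"
  then have g0: "g x = 0" if "x \<noteq> 0" for x using symdec_nonneg[OF g, of x] that by force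
  define f where "f x = max 0 (1 - \<bar>x\<bar>)" for x :: real
  have fm: "f \<in> borel_measurable borel" unfolding f_def[abs_def] by measurable
  have f1: "\<bar>f y\<bar> \<le> 1" for y by (auto simp: f_def)
  have sq: "integrable lborel (\<lambda>y. (f y)\<^sup>2)"
  proof (rule Bochner_Integration.integrable_bound)
    show "integrable lborel (indicator {-1..1} :: real \<Rightarrow> real)" by simp
    show "AE y in lborel. norm ((f y)\<^sup>2) \<le> norm (indicator {-1..1} y :: real)"
      using f1 by (intro AE_I2) (auto simp: f_def abs_square_le_1 split: split_indicator)
  qed (use fm in measurable)
  have "\<bar>f (x + h) - f x\<bar> \<le> 1 * h powr b" if h: "0 \<le> h" for x h
  proof (cases "h \<le> 1")
    case True
    have "\<bar>f (x + h) - f x\<bar> \<le> h" using h by (auto simp: f_def max_def)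
    also have "h \<le> h powr b"
      using powr_mono'[of b 1 h] b h True by simp
    finally show ?thesis by simp
  next
    case False
    have "\<bar>f (x + h) - f x\<bar> \<le> 1" by (auto simp: f_def max_def)
    also have "1 \<le> h powr b" using False b s by (intro ge_one_powr_ge_zero) auto
    finally show ?thesis by simp
  qed
  from green_equation(2)[OF fm f1 sq this, of 0]
  have "A * conv g f 0 + 1 / 2 * (LINT y|lborel. sdiff (conv g f) 0 y * K y) = f 0" by simp
  moreover have "conv g f x = 0" for x
  proof -
    have "AE y in lborel. y \<noteq> x"
      using AE_not_in[OF countable_imp_null_set_lborel, of "{x}"] by simp
    then have "AE y in lborel. g (x - y) * f y = 0" by eventually_elim (simp add: g0)
    then show ?thesis unfolding conv_def by (rule integral_eq_zero_AE)
  qed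
  ultimately show False by (simp add: sdiff_def f_def)
qed

end

text \<open>\<open>\<beta> > 0\<close> serves the singularity at 1, \<open>e < 1\<close> the one at
  0, and \<open>\<beta> < e\<close> the decay at infinity. Each point is charged to the nearer
  singularity: \<open>a\<close> dominates where 0 is nearer, the reflected \<open>a'\<close> where 1
  is.\<close>

lemma power_conv_integrable:
  assumes "0 < \<beta>" "\<beta> < e" "e < 1"
  shows "integrable lborel (\<lambda>t::real. \<bar>1 - t\<bar> powr (\<beta> - 1) * \<bar>t\<bar> powr (- e))"
proof -
  define a where "a t = 2 * (\<bar>t\<bar> powr (- e) * indicator {-1/2..1/2} t) + \<bar>t\<bar> powr (\<beta> - 1 - e) * indicator {t. 1/2 \<le> \<bar>t\<bar>} t" for t :: real
  define a' where "a' t = 2 * (\<bar>t\<bar> powr (\<beta> - 1) * indicator {-1/2..1/2} t) + \<bar>t\<bar> powr (\<beta> - 1 - e) * indicator {t. 1/2 \<le> \<bar>t\<bar>} t" for t :: real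
  have ia: "integrable lborel a" "integrable lborel a'"
    unfolding a_def[abs_def] a'_def[abs_def] using assms powr_near_zero_integrable[of "-e" "1/2"] powr_near_zero_integrable[of "\<beta>-1" "1/2"]
    by (intro Bochner_Integration.integrable_add integrable_mult_right powr_at_infinity_integrable; simp)+
  have ia': "integrable lborel (\<lambda>t. a' (1 - t))"
    using ia(2) by (subst lborel_integrable_reflect_iff)
  have half: "(1 / 2 :: real) powr (\<beta> - 1) \<le> 2" "(1 / 2 :: real) powr (- e) \<le> 2"
    using assms powr_mono'[of "-1" "\<beta> - 1" "1/2::real"] powr_mono'[of "-1" "-e" "1/2::real"]
    by (auto simp: powr_minus)
  have nn: "0 \<le> a t" "0 \<le> a' t" for t by (auto simp: a_def a'_def)
  have dom: "\<bar>1 - t\<bar> powr (\<beta> - 1) * \<bar>t\<bar> powr (- e) \<le> a t + a' (1 - t)" if t: "t \<noteq> 0" "t \<noteq> 1" for t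
  proof (cases "\<bar>t\<bar> \<le> \<bar>1 - t\<bar>")
    case True
    then have h: "1 / 2 \<le> \<bar>1 - t\<bar>" by arith
    have "\<bar>1 - t\<bar> powr (\<beta> - 1) * \<bar>t\<bar> powr (- e) \<le> a t"
    proof (cases "\<bar>t\<bar> < 1 / 2")
      case True
      have "\<bar>1 - t\<bar> powr (\<beta> - 1) \<le> 2"
        using powr_mono2'[of "\<beta> - 1" "1/2" "\<bar>1 - t\<bar>"] h assms half by simp
      then have "\<bar>1 - t\<bar> powr (\<beta> - 1) * \<bar>t\<bar> powr (- e) \<le> 2 * \<bar>t\<bar> powr (- e)"
        by (rule mult_right_mono) simp
      moreover have "t \<in> {-1/2..1/2}" using True by auto
      ultimately show ?thesis by (auto simp: a_def intro!: add_increasing2)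
    next
      case False
      have "\<bar>1 - t\<bar> powr (\<beta> - 1) \<le> \<bar>t\<bar> powr (\<beta> - 1)"
        using True assms t by (intro powr_mono2') auto
      then have "\<bar>1 - t\<bar> powr (\<beta> - 1) * \<bar>t\<bar> powr (- e) \<le> \<bar>t\<bar> powr (\<beta> - 1) * \<bar>t\<bar> powr (- e)"
        by (rule mult_right_mono) simp
      also have "\<dots> = \<bar>t\<bar> powr (\<beta> - 1 - e)" by (simp add: powr_add[symmetric])
      finally show ?thesis using False by (auto simp: a_def intro!: add_increasing)
    qed
    then show ?thesis using nn(2)[of "1 - t"] by simp
  next
    case False
    then have h: "1 / 2 \<le> \<bar>t\<bar>" by arith
    have "\<bar>1 - t\<bar> powr (\<beta> - 1) * \<bar>t\<bar> powr (- e) \<le> a' (1 - t)"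
    proof (cases "\<bar>1 - t\<bar> < 1 / 2")
      case True
      have "\<bar>t\<bar> powr (- e) \<le> 2"
        using powr_mono2'[of "- e" "1/2" "\<bar>t\<bar>"] h assms half by simp
      then have "\<bar>1 - t\<bar> powr (\<beta> - 1) * \<bar>t\<bar> powr (- e) \<le> \<bar>1 - t\<bar> powr (\<beta> - 1) * 2"
        by (rule mult_left_mono) simp
      moreover have "1 - t \<in> {-1/2..1/2}" using True unfolding atLeastAtMost_iff by arith
      ultimately show ?thesis by (auto simp: a'_def intro!: add_increasing2)
    next
      case F: False
      have "\<bar>t\<bar> powr (- e) \<le> \<bar>1 - t\<bar> powr (- e)"
        using False assms t by (intro powr_mono2') auto
      then have "\<bar>1 - t\<bar> powr (\<beta> - 1) * \<bar>t\<bar> powr (- e) \<le> \<bar>1 - t\<bar> powr (\<beta> - 1) * \<bar>1 - t\<bar> powr (- e)"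
        by (rule mult_left_mono) simp
      also have "\<dots> = \<bar>1 - t\<bar> powr (\<beta> - 1 - e)" by (simp add: powr_add[symmetric])
      finally show ?thesis using F by (auto simp: a'_def intro!: add_increasing)
    qed
    then show ?thesis using nn(1)[of t] by simp
  qed
  show ?thesis
  proof (rule Bochner_Integration.integrable_bound)
    show "integrable lborel (\<lambda>t. a t + a' (1 - t))" using ia ia' by simp
    have "AE t in lborel. t \<notin> {0, 1::real}"
      by (intro AE_not_in countable_imp_null_set_lborel) auto
    then show "AE t in lborel. norm (\<bar>1 - t\<bar> powr (\<beta> - 1) * \<bar>t\<bar> powr (- e)) \<le> norm (a t + a' (1 - t))"
    proof eventually_elim
      case (elim t)
      then show ?case using dom[of t] nn(1)[of t] nn(2)[of "1 - t"] by simp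
    qed
  qed measurable
qed

lemma power_conv_scale:
  fixes x :: real
  assumes "0 < \<beta>" "\<beta> < e" "e < 1" "x \<noteq> 0"
  shows "integrable lborel (\<lambda>y. \<bar>x - y\<bar> powr (\<beta> - 1) * \<bar>y\<bar> powr (- e))"
    and "(LINT y|lborel. \<bar>x - y\<bar> powr (\<beta> - 1) * \<bar>y\<bar> powr (- e)) =
      (LINT t|lborel. \<bar>1 - t\<bar> powr (\<beta> - 1) * \<bar>t\<bar> powr (- e)) * \<bar>x\<bar> powr (\<beta> - e)"
proof -
  define f where "f y = \<bar>x - y\<bar> powr (\<beta> - 1) * \<bar>y\<bar> powr (- e)" for y
  define \<phi> where "\<phi> t = \<bar>1 - t\<bar> powr (\<beta> - 1) * \<bar>t\<bar> powr (- e)" for t :: real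
  have eq: "f (0 + x * t) = \<bar>x\<bar> powr (\<beta> - 1 - e) * \<phi> t" for t
  proof -
    have "\<bar>x - x * t\<bar> = \<bar>x\<bar> * \<bar>1 - t\<bar>" by (simp add: abs_mult[symmetric] right_diff_distrib)
    then have "f (0 + x * t) = (\<bar>x\<bar> powr (\<beta> - 1) * \<bar>x\<bar> powr (- e)) * \<phi> t"
      unfolding f_def \<phi>_def by (simp add: abs_mult powr_mult)
    also have "\<bar>x\<bar> powr (\<beta> - 1) * \<bar>x\<bar> powr (- e) = \<bar>x\<bar> powr (\<beta> - 1 - e)"
      by (simp add: powr_add[symmetric])
    finally show ?thesis .
  qed
  have "integrable lborel \<phi>" unfolding \<phi>_def[abs_def] using power_conv_integrable[OF assms(1-3)] .
  then have "integrable lborel (\<lambda>t. f (0 + x * t))" unfolding eq by simp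
  then have "integrable lborel f" using lborel_integrable_real_affine_iff[of x f 0] assms(4) by simp
  then show "integrable lborel (\<lambda>y. \<bar>x - y\<bar> powr (\<beta> - 1) * \<bar>y\<bar> powr (- e))" by (simp add: f_def[abs_def])
  have "integral\<^sup>L lborel f = \<bar>x\<bar> * (LINT t|lborel. f (0 + x * t))"
    using lborel_integral_real_affine[of x f 0] assms(4) by simp
  also have "\<dots> = integral\<^sup>L lborel \<phi> * (\<bar>x\<bar> * \<bar>x\<bar> powr (\<beta> - 1 - e))"
    unfolding eq by simp
  also have "\<bar>x\<bar> * \<bar>x\<bar> powr (\<beta> - 1 - e) = \<bar>x\<bar> powr (\<beta> - e)"
    using assms(4) powr_add[of "\<bar>x\<bar>" 1 "\<beta> - 1 - e"] by simp
  finally show "(LINT y|lborel. \<bar>x - y\<bar> powr (\<beta> - 1) * \<bar>y\<bar> powr (- e)) =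
      (LINT t|lborel. \<bar>1 - t\<bar> powr (\<beta> - 1) * \<bar>t\<bar> powr (- e)) * \<bar>x\<bar> powr (\<beta> - e)"
    by (simp add: f_def[abs_def] \<phi>_def[abs_def])
qed

text \<open>Both factors are replaced by their power majorants, whose convolution is homogeneous of
  degree \<open>\<beta> - e\<close>.\<close>

lemma conv_power_bound:
  fixes \<phi> w :: "real \<Rightarrow> real"
  assumes e: "0 < \<beta>" "\<beta> < e" "e < 1"
    and [measurable]: "\<phi> \<in> borel_measurable borel" "w \<in> borel_measurable borel"
    and \<phi>: "\<And>z. z \<noteq> 0 \<Longrightarrow> \<bar>\<phi> z\<bar> \<le> B * \<bar>z\<bar> powr (\<beta> - 1)"
    and w: "\<And>y. y \<noteq> 0 \<Longrightarrow> \<bar>w y\<bar> \<le> D * \<bar>y\<bar> powr (- e)"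
  obtains M where "0 \<le> M" "\<And>x. x \<noteq> 0 \<Longrightarrow> integrable lborel (\<lambda>y. \<phi> (x - y) * w y)"
    "\<And>x. x \<noteq> 0 \<Longrightarrow> \<bar>conv \<phi> w x\<bar> \<le> M * \<bar>x\<bar> powr (\<beta> - e)"
proof -
  define I where "I = (LINT t|lborel. \<bar>1 - t\<bar> powr (\<beta> - 1) * \<bar>t\<bar> powr (- e))"
  have I: "0 \<le> I" unfolding I_def by (intro Bochner_Integration.integral_nonneg) simp
  have B: "0 \<le> B" using \<phi>[of 1] by simp
  have D: "0 \<le> D" using w[of 1] by simp
  have dom: "AE y in lborel. \<bar>\<phi> (x - y) * w y\<bar> \<le> B * D * (\<bar>x - y\<bar> powr (\<beta> - 1) * \<bar>y\<bar> powr (- e))" for x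
  proof -
    have "AE y in lborel. y \<notin> {0, x}"
      by (intro AE_not_in countable_imp_null_set_lborel) auto
    then show ?thesis
    proof eventually_elim
      case (elim y)
      have "\<bar>\<phi> (x - y)\<bar> * \<bar>w y\<bar> \<le> (B * \<bar>x - y\<bar> powr (\<beta> - 1)) * (D * \<bar>y\<bar> powr (- e))"
        using elim B by (intro mult_mono \<phi> w) auto
      then show ?case by (simp add: abs_mult mult_ac)
    qed
  qed
  have i: "integrable lborel (\<lambda>y. \<phi> (x - y) * w y)" if "x \<noteq> 0" for x
  proof (rule Bochner_Integration.integrable_bound)
    show "integrable lborel (\<lambda>y. B * D * (\<bar>x - y\<bar> powr (\<beta> - 1) * \<bar>y\<bar> powr (- e)))"
      using power_conv_scale(1)[OF e that] by simp
    show "AE y in lborel. norm (\<phi> (x - y) * w y) \<le> norm (B * D * (\<bar>x - y\<bar> powr (\<beta> - 1) * \<bar>y\<bar> powr (- e)))"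
      using dom[of x] by eventually_elim (simp add: order_trans[OF _ abs_ge_self])
  qed measurable
  show ?thesis
  proof (rule that[of "B * D * I"])
    show "0 \<le> B * D * I" using B D I by simp
    show "integrable lborel (\<lambda>y. \<phi> (x - y) * w y)" if "x \<noteq> 0" for x by (rule i[OF that])
    fix x :: real assume x: "x \<noteq> 0"
    have "\<bar>conv \<phi> w x\<bar> \<le> (LINT y|lborel. \<bar>\<phi> (x - y) * w y\<bar>)"
      unfolding conv_def by (rule integral_abs_bound)
    also have "\<dots> \<le> (LINT y|lborel. B * D * (\<bar>x - y\<bar> powr (\<beta> - 1) * \<bar>y\<bar> powr (- e)))"
      using i[OF x] power_conv_scale(1)[OF e x] dom[of x] by (intro integral_mono_AE) auto
    also have "\<dots> = B * D * I * \<bar>x\<bar> powr (\<beta> - e)"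
      using power_conv_scale(2)[OF e x] by (simp add: I_def)
    finally show "\<bar>conv \<phi> w x\<bar> \<le> B * D * I * \<bar>x\<bar> powr (\<beta> - e)" .
  qed
qed

section \<open>Maximization over the cone of symmetric decreasing functions\<close>

lemma powr_split_integrable:
  fixes f :: "real \<Rightarrow> real"
  assumes [measurable]: "f \<in> borel_measurable borel" and a: "-1 < a1" "a2 < -1"
    and 1: "\<And>x. x \<noteq> 0 \<Longrightarrow> \<bar>x\<bar> \<le> 1 \<Longrightarrow> \<bar>f x\<bar> \<le> M1 * \<bar>x\<bar> powr a1"
    and 2: "\<And>x. 1 \<le> \<bar>x\<bar> \<Longrightarrow> \<bar>f x\<bar> \<le> M2 * \<bar>x\<bar> powr a2"
  shows "integrable lborel f"
proof (rule Bochner_Integration.integrable_bound)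
  define h where "h x = M1 * (\<bar>x\<bar> powr a1 * indicator {-1..1} x) + M2 * (\<bar>x\<bar> powr a2 * indicator {x. 1 \<le> \<bar>x\<bar>} x)" for x
  show "integrable lborel h"
    unfolding h_def[abs_def] using a
    by (intro Bochner_Integration.integrable_add integrable_mult_right powr_near_zero_integrable powr_at_infinity_integrable) auto
  have M: "0 \<le> M1" "0 \<le> M2" using 1[of 1] 2[of 1] by simp_all
  show "AE x in lborel. norm (f x) \<le> norm (h x)"
    using AE_nonzero
  proof eventually_elim
    case (elim x)
    have "\<bar>f x\<bar> \<le> h x"
    proof (cases "\<bar>x\<bar> \<le> 1")
      case True
      then have "x \<in> {-1..1}" by auto
      then show ?thesis using 1[OF elim True] M by (auto simp: h_def intro: add_increasing2)
    next
      case False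
      then have "x \<notin> {-1..1}" "1 \<le> \<bar>x\<bar>" by auto
      then show ?thesis using 2[of x] by (simp add: h_def)
    qed
    then show ?case by simp
  qed
qed measurable

text \<open>Dividing by the weighted geometric mean \<open>r\<close> makes the weighted logarithms
  of \<open>u\<close> and \<open>v\<close> sum to 0. Then \<open>ln u \<le> u - 1\<close>, with
  equality only at 1, yields the inequality and its equality case at once.\<close>

lemma young_eq:
  fixes X Y e :: real
  assumes "0 < e" "e < 1" "0 \<le> X" "0 \<le> Y"
  shows "X powr e * Y powr (1 - e) \<le> e * X + (1 - e) * Y"
    and "X powr e * Y powr (1 - e) = e * X + (1 - e) * Y \<Longrightarrow> X = Y"
proof -
  have *: "X powr e * Y powr (1 - e) \<le> e * X + (1 - e) * Y \<and>
    (X powr e * Y powr (1 - e) = e * X + (1 - e) * Y \<longrightarrow> X = Y)"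
  proof (cases "X = 0 \<or> Y = 0")
    case True
    then show ?thesis using assms by auto
  next
    case False
    then have XY: "0 < X" "0 < Y" using assms by auto
    define r where "r = X powr e * Y powr (1 - e)"
    have r: "0 < r" using XY by (simp add: r_def)
    have lnr: "ln r = e * ln X + (1 - e) * ln Y"
      using XY by (simp add: r_def ln_mult ln_powr)
    define u where "u = X / r"
    define v where "v = Y / r"
    have uv: "0 < u" "0 < v" using XY r by (auto simp: u_def v_def)
    have zero: "e * ln u + (1 - e) * ln v = 0"
      using XY r lnr by (simp add: u_def v_def ln_div algebra_simps)
    have lu: "ln u \<le> u - 1" and lv: "ln v \<le> v - 1" using uv by (auto intro: ln_le_minus_one)
    have "e * ln u \<le> e * (u - 1)" "(1 - e) * ln v \<le> (1 - e) * (v - 1)"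
      using lu lv assms by (auto intro: mult_left_mono)
    then have ge: "1 \<le> e * u + (1 - e) * v" using zero by (simp add: algebra_simps)
    have rr: "e * X + (1 - e) * Y = r * (e * u + (1 - e) * v)"
      using r by (simp add: u_def v_def field_simps)
    have 1: "r \<le> e * X + (1 - e) * Y"
      unfolding rr using ge r by simp
    have 2: "X = Y" if eq: "r = e * X + (1 - e) * Y"
    proof -
      have one: "e * u + (1 - e) * v = 1" using eq r unfolding rr by simp
      have "e * ((u - 1) - ln u) + (1 - e) * ((v - 1) - ln v) = 0"
        using one zero by (simp add: algebra_simps)
      moreover have "0 \<le> e * ((u - 1) - ln u)" "0 \<le> (1 - e) * ((v - 1) - ln v)"
        using lu lv assms by auto
      ultimately have "e * ((u - 1) - ln u) = 0" "(1 - e) * ((v - 1) - ln v) = 0" by linarith+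
      then have "ln u = u - 1" "ln v = v - 1" using assms by auto
      then have "u = 1" "v = 1" using uv ln_eq_minus_one by blast+
      then show ?thesis using r by (simp add: u_def v_def)
    qed
    show ?thesis using 1 2 unfolding r_def by blast
  qed
  then show "X powr e * Y powr (1 - e) \<le> e * X + (1 - e) * Y"
    and "X powr e * Y powr (1 - e) = e * X + (1 - e) * Y \<Longrightarrow> X = Y" by auto
qed

locale green_problem = green_limit K s A c C d G g b for K s A c C d G g b +
  fixes p :: real
  assumes p: "1 < p" and pb: "(p - 1) / (p + 1) < b"
begin

text \<open>\<open>1 / e0 = 1 + 1 / p\<close> is the exponent of the constraint and
  \<open>- e0\<close> the power that the constraint imposes. \<open>th = 2 * e0 - 1\<close> is the
  critical order: two factors of power \<open>- e0\<close> against a kernel of power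
  \<open>th - 1\<close> form a scale invariant double integral.\<close>

definition e0 where "e0 = p / (p + 1)"
definition th where "th = (p - 1) / (p + 1)"

lemma exps: "0 < th" "th < b" "th < e0" "e0 < 1" "2 * e0 = 1 + th" "1 / 2 < e0" "0 < e0"
  "1 - e0 = 1 / (p + 1)" "1 / e0 = (p + 1) / p"
  using p pb by (auto simp: th_def e0_def field_simps)

text \<open>Convolving \<open>\<bar>x\<bar> powr (- e0)\<close> with \<open>\<bar>x\<bar> powr (\<beta> - 1)\<close> and pairing with \<open>\<bar>x\<bar> powr (- e0)\<close> gives a convergent
  integral at the origin iff \<open>\<beta> > th\<close>, at infinity iff \<open>\<beta> < th\<close>; \<open>b1\<close> and \<open>b2\<close> serve these two ends.\<close>

definition b1 where "b1 = (th + min b e0) / 2"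
definition b2 where "b2 = th / 4"

lemma b1: "0 < b1" "b1 \<le> b" "b1 < e0" "th < b1"
  using exps by (auto simp: b1_def min_def)

text \<open>The last inequality serves the solution: it makes the power \<open>b2 - e0\<close>
  square integrable at infinity.\<close>

lemma b2: "0 < b2" "b2 \<le> b" "b2 < e0" "b2 < th" "2 * (e0 - b2) > 1"
  using exps by (auto simp: b2_def)

lemma g_conv_bound:
  assumes "0 < \<beta>" "\<beta> \<le> b" "\<beta> < e" "e < 1" "w \<in> borel_measurable borel"
    "\<And>y. y \<noteq> 0 \<Longrightarrow> \<bar>w y\<bar> \<le> D * \<bar>y\<bar> powr (- e)"
  obtains M where "0 \<le> M" "\<And>x. x \<noteq> 0 \<Longrightarrow> integrable lborel (\<lambda>y. g (x - y) * w y)"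
    "\<And>x. x \<noteq> 0 \<Longrightarrow> \<bar>conv g w x\<bar> \<le> M * \<bar>x\<bar> powr (\<beta> - e)"
proof -
  obtain B where B: "0 < B" "\<And>x. x \<noteq> 0 \<Longrightarrow> g x \<le> B * \<bar>x\<bar> powr (\<beta> - 1)"
    using g_le_powr[OF assms(1,2)] by blast
  show ?thesis
    by (rule conv_power_bound[OF assms(1,3,4) g_borel assms(5) _ assms(6), of B])
       (use B symdec_nonneg[OF g] that in auto)
qed

lemma g_conv_bound_ex:
  assumes "0 < \<beta>" "\<beta> \<le> b" "\<beta> < e" "e < 1" "w \<in> borel_measurable borel"
    "\<And>y. y \<noteq> 0 \<Longrightarrow> \<bar>w y\<bar> \<le> D * \<bar>y\<bar> powr (- e)"
  shows "\<exists>M\<ge>0. \<forall>x. x \<noteq> 0 \<longrightarrow> \<bar>conv g w x\<bar> \<le> M * \<bar>x\<bar> powr (\<beta> - e)"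
proof (rule g_conv_bound[OF assms])
  fix M assume "0 \<le> M" "\<And>x. x \<noteq> 0 \<Longrightarrow> \<bar>conv g w x\<bar> \<le> M * \<bar>x\<bar> powr (\<beta> - e)"
  then show ?thesis by blast
qed

definition W where "W x = \<bar>x\<bar> powr (- e0)"

lemma W_borel [measurable]: "W \<in> borel_measurable borel"
  unfolding W_def[abs_def] by measurable

lemma W_nonneg: "0 \<le> W x"
  by (simp add: W_def)

text \<open>Wider than the cone, because positive definiteness is applied to differences of cone
  functions. Two functions with values between 0 and \<open>W\<close> still differ by at most
  \<open>W\<close>.\<close>

definition adm where "adm z \<longleftrightarrow> z \<in> borel_measurable borel \<and> (\<forall>x. x \<noteq> 0 \<longrightarrow> \<bar>z x\<bar> \<le> W x)"

lemma adm_W: "adm W"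
  by (simp add: adm_def W_nonneg)

lemma adm_conv_integrable:
  assumes "adm w" "x \<noteq> 0" shows "integrable lborel (\<lambda>y. g (x - y) * w y)"
  by (rule g_conv_bound[OF b1(1-3) exps(4), of w 1]) (use assms in \<open>auto simp: adm_def W_def\<close>)

lemma adm_conv_le:
  assumes w: "adm w" and x: "x \<noteq> 0" shows "\<bar>conv g w x\<bar> \<le> conv g W x"
proof -
  have "\<bar>conv g w x\<bar> \<le> (LINT y|lborel. \<bar>g (x - y) * w y\<bar>)"
    unfolding conv_def by (rule integral_abs_bound)
  also have "\<dots> \<le> conv g W x"
    unfolding conv_def
  proof (rule integral_mono_AE)
    show "AE y in lborel. \<bar>g (x - y) * w y\<bar> \<le> g (x - y) * W y"
      using AE_nonzero
      by eventually_elim (use w symdec_nonneg[OF g] in \<open>auto simp: adm_def abs_mult intro!: mult_left_mono\<close>)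
  qed (use adm_conv_integrable[OF w x] adm_conv_integrable[OF adm_W x] in auto)
  finally show ?thesis .
qed

text \<open>This integrand is the common majorant for every limit passage in \<open>J\<close>;
  \<open>b1\<close> bounds it near the origin and \<open>b2\<close> at infinity.\<close>

lemma W_conv_W_integrable: "integrable lborel (\<lambda>x. W x * conv g W x)"
proof -
  have W1: "\<bar>W y\<bar> \<le> 1 * \<bar>y\<bar> powr (- e0)" for y by (simp add: W_def)
  obtain M1 where M1: "\<And>x. x \<noteq> 0 \<Longrightarrow> \<bar>conv g W x\<bar> \<le> M1 * \<bar>x\<bar> powr (b1 - e0)"
    using g_conv_bound_ex[OF b1(1-3) exps(4) W_borel W1] by metis
  obtain M2 where M2: "\<And>x. x \<noteq> 0 \<Longrightarrow> \<bar>conv g W x\<bar> \<le> M2 * \<bar>x\<bar> powr (b2 - e0)"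
    using g_conv_bound_ex[OF b2(1-3) exps(4) W_borel W1] by metis
  have *: "\<bar>W x * conv g W x\<bar> \<le> M * \<bar>x\<bar> powr (\<beta> - 2 * e0)"
    if "x \<noteq> 0" "\<bar>conv g W x\<bar> \<le> M * \<bar>x\<bar> powr (\<beta> - e0)" for x M \<beta>
  proof -
    have "\<bar>W x * conv g W x\<bar> \<le> \<bar>x\<bar> powr (- e0) * (M * \<bar>x\<bar> powr (\<beta> - e0))"
      using that by (simp add: abs_mult W_def mult_left_mono)
    also have "\<dots> = M * (\<bar>x\<bar> powr (- e0) * \<bar>x\<bar> powr (\<beta> - e0))" by simp
    also have "\<bar>x\<bar> powr (- e0) * \<bar>x\<bar> powr (\<beta> - e0) = \<bar>x\<bar> powr (\<beta> - 2 * e0)"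
      by (simp add: powr_add[symmetric])
    finally show ?thesis .
  qed
  show ?thesis
  proof (rule powr_split_integrable)
    show "- 1 < b1 - 2 * e0" "b2 - 2 * e0 < - 1" using b1 b2 exps by auto
    show "\<bar>W x * conv g W x\<bar> \<le> M1 * \<bar>x\<bar> powr (b1 - 2 * e0)" if "x \<noteq> 0" for x
      using *[OF that M1[OF that]] .
    show "\<bar>W x * conv g W x\<bar> \<le> M2 * \<bar>x\<bar> powr (b2 - 2 * e0)" if "1 \<le> \<bar>x\<bar>" for x
      using *[of x] M2[of x] that by force
  qed measurable
qed

definition J where "J z w = (LINT x|lborel. z x * conv g w x)"

lemma adm_borel: "adm z \<Longrightarrow> z \<in> borel_measurable borel"
  by (simp add: adm_def)

lemma adm_J_le:
  assumes "adm z" "adm w"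
  shows "AE x in lborel. norm (z x * conv g w x) \<le> W x * conv g W x"
  using AE_nonzero
proof eventually_elim
  case (elim x)
  then show ?case
    using assms adm_conv_le[OF assms(2) elim] by (auto simp: abs_mult adm_def intro!: mult_mono W_nonneg)
qed

lemma adm_J_integrable:
  assumes "adm z" "adm w"
  shows "integrable lborel (\<lambda>x. z x * conv g w x)"
proof (rule Bochner_Integration.integrable_bound[OF W_conv_W_integrable])
  show "(\<lambda>x. z x * conv g w x) \<in> borel_measurable lborel"
    using assms[THEN adm_borel] by measurable
  show "AE x in lborel. norm (z x * conv g w x) \<le> norm (W x * conv g W x)"
    using adm_J_le[OF assms] by eventually_elim (simp add: order_trans[OF _ abs_ge_self])
qed

lemma J_sym:
  assumes z: "adm z" and w: "adm w" shows "J z w = J w z"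
proof -
  note [measurable] = adm_borel[OF z] adm_borel[OF w]
  have i: "integrable (lborel \<Otimes>\<^sub>M lborel) (case_prod (\<lambda>x y. z x * (g (x - y) * w y)))"
  proof (rule lborel_pair.Fubini_integrable)
    show "(\<lambda>(x, y). z x * (g (x - y) * w y)) \<in> borel_measurable (lborel \<Otimes>\<^sub>M lborel)"
      by measurable
    show "AE x in lborel. integrable lborel (\<lambda>y. case (x, y) of (x, y) \<Rightarrow> z x * (g (x - y) * w y))"
      using AE_nonzero by eventually_elim (use adm_conv_integrable[OF w] in auto)
    have aw: "adm (\<lambda>y. \<bar>w y\<bar>)" and az: "adm (\<lambda>y. \<bar>z y\<bar>)" using w z by (auto simp: adm_def)
    have "(LINT y|lborel. norm (case (x, y) of (x, y) \<Rightarrow> z x * (g (x - y) * w y))) = \<bar>z x\<bar> * conv g (\<lambda>y. \<bar>w y\<bar>) x" for x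
      unfolding conv_def by (simp add: abs_mult symdec_nonneg[OF g])
    then show "integrable lborel (\<lambda>x. LINT y|lborel. norm (case (x, y) of (x, y) \<Rightarrow> z x * (g (x - y) * w y)))"
      using adm_J_integrable[OF az aw] by simp
  qed
  have "J z w = (LINT x|lborel. LINT y|lborel. z x * (g (x - y) * w y))"
    unfolding J_def conv_def by simp
  also have "\<dots> = (LINT y|lborel. LINT x|lborel. z x * (g (x - y) * w y))"
    by (rule lborel_pair.Fubini_integral[OF i, symmetric])
  also have "\<dots> = J w z"
    unfolding J_def conv_def
  proof (rule Bochner_Integration.integral_cong[OF refl])
    fix y
    have "(LINT x|lborel. z x * (g (x - y) * w y)) = (LINT x|lborel. w y * (g (y - x) * z x))"
      by (rule Bochner_Integration.integral_cong) (simp_all add: symdec_swap[OF g, of _ y])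
    then show "(LINT x|lborel. z x * (g (x - y) * w y)) = w y * (LINT x|lborel. g (y - x) * z x)" by simp
  qed
  finally show ?thesis .
qed

lemma J_lim:
  assumes zn: "\<And>n. adm (zn n)" and wn: "\<And>n. adm (wn n)" and z: "adm z" and w: "adm w"
    and lz: "AE x in lborel. (\<lambda>n. zn n x) \<longlonglongrightarrow> z x" and lw: "AE x in lborel. (\<lambda>n. wn n x) \<longlonglongrightarrow> w x"
  shows "(\<lambda>n. J (zn n) (wn n)) \<longlonglongrightarrow> J z w"
  unfolding J_def
proof (rule integral_dominated_convergence[OF _ _ W_conv_W_integrable])
  note [measurable] = adm_borel[OF z] adm_borel[OF w] adm_borel[OF zn] adm_borel[OF wn]
  show "(\<lambda>x. z x * conv g w x) \<in> borel_measurable lborel"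
    "\<And>n. (\<lambda>x. zn n x * conv g (wn n) x) \<in> borel_measurable lborel" by measurable
  show "AE x in lborel. norm (zn n x * conv g (wn n) x) \<le> W x * conv g W x" for n
    by (rule adm_J_le[OF zn wn])
  have cl: "(\<lambda>n. conv g (wn n) x) \<longlonglongrightarrow> conv g w x" if x: "x \<noteq> 0" for x
    unfolding conv_def
  proof (rule integral_dominated_convergence[OF _ _ adm_conv_integrable[OF adm_W x]])
    show "(\<lambda>y. g (x - y) * w y) \<in> borel_measurable lborel"
      "\<And>n. (\<lambda>y. g (x - y) * wn n y) \<in> borel_measurable lborel" by measurable
    show "AE y in lborel. (\<lambda>n. g (x - y) * wn n y) \<longlonglongrightarrow> g (x - y) * w y"
      using lw by eventually_elim (intro tendsto_intros)
    show "AE y in lborel. norm (g (x - y) * wn n y) \<le> g (x - y) * W y" for n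
      using AE_nonzero
      by eventually_elim (use wn[of n] symdec_nonneg[OF g] in \<open>auto simp: adm_def abs_mult intro!: mult_left_mono\<close>)
  qed
  show "AE x in lborel. (\<lambda>n. zn n x * conv g (wn n) x) \<longlonglongrightarrow> z x * conv g w x"
    using AE_nonzero lz by eventually_elim (intro tendsto_intros cl)
qed

text \<open>\<open>g_posdef\<close> speaks of bounded functions with bounded support, so
  \<open>u\<close> is cut at height and radius \<open>n\<close>, and \<open>J_lim\<close> removes
  the cut.\<close>

lemma J_nonneg:
  assumes u: "adm u" shows "0 \<le> J u u"
proof -
  note [measurable] = adm_borel[OF u]
  define un where "un n x = u x * indicator {x. \<bar>x\<bar> \<le> real n \<and> \<bar>u x\<bar> \<le> real n} x" for n x
  have un_m [measurable]: "un n \<in> borel_measurable borel" for n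
    unfolding un_def[abs_def] by measurable
  have un: "adm (un n)" for n
    using u W_nonneg unfolding adm_def un_def[abs_def] by (auto split: split_indicator)
  have "(\<lambda>n. un n x) \<longlonglongrightarrow> u x" for x
  proof -
    obtain m where m: "max \<bar>x\<bar> \<bar>u x\<bar> \<le> real m" using real_arch_simple by blast
    have "eventually (\<lambda>n. un n x = u x) sequentially"
      using eventually_ge_at_top[of m]
      by eventually_elim (use m in \<open>auto simp: un_def split: split_indicator\<close>)
    then show ?thesis by (rule tendsto_eventually)
  qed
  then have "(\<lambda>n. J (un n) (un n)) \<longlonglongrightarrow> J u u"
    by (intro J_lim un u) auto
  moreover have "0 \<le> J (un n) (un n)" for n
    unfolding J_def
    by (rule g_posdef[OF un_m, of n "real n" "real n"]) (auto simp: un_def split: split_indicator)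
  ultimately show ?thesis by (intro LIMSEQ_le_const[of _ _ 0]) auto
qed

lemma J_diff:
  assumes z: "adm z" and w: "adm w" and zw: "adm (\<lambda>x. z x - w x)"
  shows "J (\<lambda>x. z x - w x) (\<lambda>x. z x - w x) = J z z - 2 * J z w + J w w"
proof -
  note [measurable] = adm_borel[OF z] adm_borel[OF w]
  have "J (\<lambda>x. z x - w x) (\<lambda>x. z x - w x) = (LINT x|lborel.
     (z x * conv g z x - z x * conv g w x) - (w x * conv g z x - w x * conv g w x))"
    unfolding J_def
  proof (rule integral_cong_AE)
    show "AE x in lborel. (z x - w x) * conv g (\<lambda>x. z x - w x) x =
       (z x * conv g z x - z x * conv g w x) - (w x * conv g z x - w x * conv g w x)"
      using AE_nonzero
    proof eventually_elim
      case (elim x)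
      have eq: "conv g (\<lambda>x. z x - w x) x = conv g z x - conv g w x"
        unfolding conv_def using adm_conv_integrable[OF z elim] adm_conv_integrable[OF w elim]
        by (simp add: right_diff_distrib)
      show ?case unfolding eq by (simp only: left_diff_distrib right_diff_distrib)
    qed
  qed measurable
  also have "\<dots> = (J z z - J z w) - (J w z - J w w)"
    unfolding J_def using adm_J_integrable[OF z z] adm_J_integrable[OF z w] adm_J_integrable[OF w z] adm_J_integrable[OF w w]
    by (simp only: Bochner_Integration.integral_diff Bochner_Integration.integrable_diff)
  finally show ?thesis using J_sym[OF z w] by simp
qed

text \<open>The constraint is an inequality because Fatou's lemma preserves \<open>\<le> 1\<close>,
  but not equality, under limits almost everywhere.\<close>

definition S where "S = {w. symdec w \<and> integrable lborel (\<lambda>x. w x powr (1 / e0)) \<and> (LINT x|lborel. w x powr (1 / e0)) \<le> 1}"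

lemma S_adm: assumes "w \<in> S" shows "adm w"
  unfolding adm_def
proof (intro conjI allI impI)
  have w: "symdec w" "integrable lborel (\<lambda>x. w x powr (1 / e0))" "(LINT x|lborel. w x powr (1 / e0)) \<le> 1"
    using assms by (auto simp: S_def)
  show "w \<in> borel_measurable borel" using w(1) by (rule symdec_borel)
  fix x :: real assume x: "x \<noteq> 0"
  have sp: "symdec (\<lambda>x. w x powr (1 / e0))" using w(1) exps(7) by (intro symdec_powr) auto
  have "2 * \<bar>x\<bar> * w x powr (1 / e0) \<le> mass (\<lambda>x. w x powr (1 / e0)) \<bar>x\<bar>"
    using x w(2) by (intro symdec_le_mass[OF sp] integrable_times_indicator) auto
  also have "\<dots> \<le> 1" using mass_le_integral[OF sp w(2)] w(3) by (rule order_trans)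
  finally have "w x powr (1 / e0) \<le> inverse \<bar>x\<bar>"
    using x by (simp add: field_simps)
  then have "(w x powr (1 / e0)) powr e0 \<le> inverse \<bar>x\<bar> powr e0"
    using exps(7) by (intro powr_mono2) auto
  then show "\<bar>w x\<bar> \<le> W x"
    using symdec_nonneg[OF w(1), of x] exps(7) x by (simp add: powr_powr W_def powr_minus inverse_powr)
qed

lemma J_maximizer:
  obtains w where "w \<in> S" "\<And>z. z \<in> S \<Longrightarrow> J z z \<le> J w w"
proof -
  define JS where "JS = (\<lambda>w. J w w) ` S"
  have "(\<lambda>_. 0) \<in> S" by (auto simp: S_def symdec_def)
  then have ne: "JS \<noteq> {}" by (auto simp: JS_def)
  have bdd: "bdd_above JS"
  proof (rule bdd_aboveI)
    fix t assume "t \<in> JS"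
    then obtain z where z: "t = J z z" "z \<in> S" by (auto simp: JS_def)
    have a: "adm z" using S_adm[OF z(2)] .
    have "J z z \<le> (LINT x|lborel. W x * conv g W x)"
      unfolding J_def
    proof (rule integral_mono_AE[OF adm_J_integrable[OF a a] W_conv_W_integrable])
      show "AE x in lborel. z x * conv g z x \<le> W x * conv g W x"
        using adm_J_le[OF a a] by eventually_elim auto
    qed
    then show "t \<le> (LINT x|lborel. W x * conv g W x)" using z by simp
  qed
  define M where "M = Sup JS"
  have "\<exists>w\<in>S. M - inverse (real (Suc n)) < J w w" for n
  proof -
    have "M - inverse (real (Suc n)) < Sup JS" unfolding M_def by simp
    then show ?thesis using less_cSup_iff[OF ne bdd] by (auto simp: JS_def)
  qed
  then obtain wn where wn: "\<And>n. wn n \<in> S" "\<And>n. M - inverse (real (Suc n)) < J (wn n) (wn n)" by metis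
  have le: "J z z \<le> M" if "z \<in> S" for z
    unfolding M_def using that bdd by (intro cSup_upper) (auto simp: JS_def)
  have Mlim: "(\<lambda>n. J (wn n) (wn n)) \<longlonglongrightarrow> M"
  proof (rule tendsto_sandwich)
    show "(\<lambda>n. M - inverse (real (Suc n))) \<longlonglongrightarrow> M"
      using tendsto_diff[OF tendsto_const LIMSEQ_inverse_real_of_nat, of M] by simp
  qed (use wn le in \<open>auto simp: less_imp_le\<close>)
  have sym: "symdec (wn n)" for n using wn(1)[of n] by (simp add: S_def)
  have wW: "wn n x \<le> W x" if "x \<noteq> 0" for n x
    using S_adm[OF wn(1)[of n]] that by (force simp: adm_def)
  obtain r F where r: "strict_mono r" and F: "symdec F" and lim: "AE x in lborel. (\<lambda>n. wn (r n) x) \<longlonglongrightarrow> F x"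
    by (rule helly_symdec[OF sym wW])
  have [measurable]: "F \<in> borel_measurable borel" "wn n \<in> borel_measurable borel" for n
    using F sym by (auto intro: symdec_borel)
  have nn: "(\<integral>\<^sup>+x. F x powr (1 / e0) \<partial>lborel) \<le> 1"
  proof -
    have "(\<integral>\<^sup>+x. F x powr (1 / e0) \<partial>lborel) = (\<integral>\<^sup>+x. liminf (\<lambda>n. ennreal (wn (r n) x powr (1 / e0))) \<partial>lborel)"
      using lim
    proof (intro nn_integral_cong_AE, eventually_elim)
      case (elim x)
      then have "(\<lambda>n. ennreal (wn (r n) x powr (1 / e0))) \<longlonglongrightarrow> ennreal (F x powr (1 / e0))"
        using exps(7) symdec_nonneg[OF sym] by (intro tendsto_ennrealI tendsto_powr' tendsto_const) auto
      then show ?case by (metis lim_imp_Liminf sequentially_bot)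
    qed
    also have "\<dots> \<le> liminf (\<lambda>n. \<integral>\<^sup>+x. ennreal (wn (r n) x powr (1 / e0)) \<partial>lborel)"
      by (intro nn_integral_liminf) measurable
    also have "\<dots> \<le> liminf (\<lambda>n. 1)"
    proof (intro Liminf_mono always_eventually allI)
      fix n
      have "(\<integral>\<^sup>+x. ennreal (wn (r n) x powr (1 / e0)) \<partial>lborel) = ennreal (LINT x|lborel. wn (r n) x powr (1 / e0))"
        using wn(1) by (intro nn_integral_eq_integral) (auto simp: S_def)
      then show "(\<integral>\<^sup>+x. ennreal (wn (r n) x powr (1 / e0)) \<partial>lborel) \<le> 1"
        using wn(1)[of "r n"] by (simp add: S_def ennreal_le_1)
    qed
    finally show ?thesis by (simp add: Liminf_const)
  qed
  have iF: "integrable lborel (\<lambda>x. F x powr (1 / e0))"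
    using nn by (intro integrableI_bounded) (auto simp: order_le_less_trans[OF nn])
  have FS: "F \<in> S"
  proof -
    have "ennreal (LINT x|lborel. F x powr (1 / e0)) \<le> 1"
      using nn iF by (subst nn_integral_eq_integral[symmetric]) auto
    then show ?thesis using F iF by (simp add: S_def ennreal_le_1)
  qed
  have "(\<lambda>n. J (wn (r n)) (wn (r n))) \<longlonglongrightarrow> J F F"
    by (intro J_lim S_adm wn FS lim)
  moreover have "(\<lambda>n. J (wn (r n)) (wn (r n))) \<longlonglongrightarrow> M"
    using LIMSEQ_subseq_LIMSEQ[OF Mlim r] by (simp add: comp_def)
  ultimately have "J F F = M" by (rule LIMSEQ_unique)
  then show ?thesis using that[OF FS] le by simp
qed

lemma J_positive: "\<exists>w\<in>S. 0 < J w w"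
proof -
  obtain x1 where x1: "x1 \<noteq> 0" "0 < g x1" using g_nonzero by blast
  \<comment> \<open>\<open>2 * r \<le> \<bar>x1\<bar>\<close> keeps all differences of points of
    \<open>[- r, r]\<close> in the region where \<open>g\<close> is at least \<open>g x1\<close>;
    \<open>2 * r \<le> 1\<close> puts the indicator into \<open>S\<close>.\<close>
  define r where "r = min (1 / 2) (\<bar>x1\<bar> / 2)"
  have r: "0 < r" "2 * r \<le> 1" "2 * r \<le> \<bar>x1\<bar>" using x1 by (auto simp: r_def)
  define w where "w = (indicator {-r..r} :: real \<Rightarrow> real)"
  have pw: "(\<lambda>x. w x powr (1 / e0)) = w" by (auto simp: w_def split: split_indicator)
  have "(LINT x|lborel. w x) = 2 * r" using r by (simp add: w_def measure_def)
  then have wS: "w \<in> S" using r unfolding S_def by (simp only: pw mem_Collect_eq) (simp add: w_def symdec_indicator)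
  note a = S_adm[OF wS]
  have lb: "2 * r * g x1 \<le> conv g w x" if x: "x \<noteq> 0" "x \<in> {-r..r}" for x
  proof -
    have "2 * r * g x1 = (LINT y|lborel. g x1 * w y)" using r by (simp add: w_def measure_def)
    also have "\<dots> \<le> conv g w x"
      unfolding conv_def
    proof (rule integral_mono_AE[OF _ adm_conv_integrable[OF a x(1)]])
      show "integrable lborel (\<lambda>y. g x1 * w y)" by (simp add: w_def)
      have "AE y in lborel. y \<noteq> x"
        using AE_not_in[OF countable_imp_null_set_lborel, of "{x}"] by simp
      then show "AE y in lborel. g x1 * w y \<le> g (x - y) * w y"
      proof eventually_elim
        case (elim y)
        show ?case
        proof (cases "y \<in> {-r..r}")
          case True
          then have "g x1 \<le> g (x - y)" using x r elim by (intro symdec_le[OF g]) auto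
          then show ?thesis by (intro mult_right_mono) (auto simp: w_def)
        qed (simp add: w_def)
      qed
    qed
    finally show ?thesis .
  qed
  have "0 < 2 * r * (2 * r * g x1)" using r x1 by simp
  also have "\<dots> = (LINT x|lborel. 2 * r * g x1 * w x)" using r by (simp add: w_def measure_def)
  also have "\<dots> \<le> J w w"
    unfolding J_def
  proof (rule integral_mono_AE[OF _ adm_J_integrable[OF a a]])
    show "integrable lborel (\<lambda>x. 2 * r * g x1 * w x)" by (simp add: w_def)
    show "AE x in lborel. 2 * r * g x1 * w x \<le> w x * conv g w x"
      using AE_nonzero
      by eventually_elim (use lb in \<open>auto simp: w_def split: split_indicator\<close>)
  qed
  finally show ?thesis using wS by blast
qed

end

section \<open>The Euler-Lagrange equation and boundedness\<close>

context green_problem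
begin

text \<open>The fixed-point identity is imposed at the origin too. Whether the integral converges
  there, or \<open>conv\<close> returns its default, is settled in
  \<open>sol_bounded\<close>.\<close>

definition sol :: "(real \<Rightarrow> real) \<Rightarrow> bool" where
  "sol V \<longleftrightarrow> symdec V \<and> (\<forall>x. V x = conv g (\<lambda>y. V y powr p) x) \<and>
     integrable lborel (\<lambda>x. V x powr (p + 1)) \<and> \<not> (AE x in lborel. V x = 0)"

lemma solD:
  assumes "sol V"
  shows "symdec V" "V x = conv g (\<lambda>y. V y powr p) x" "integrable lborel (\<lambda>x. V x powr (p + 1))"
    "\<not> (AE x in lborel. V x = 0)"
  using assms unfolding sol_def by blast+

lemma p_e0: "(p + 1) * e0 = p" "(p + 1) * (1 - e0) = 1" "p * (1 / e0) = p + 1"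
  using p by (auto simp: e0_def field_simps)

lemma powr_le_scaled:
  fixes x :: real
  assumes "0 \<le> v" "v \<le> M * \<bar>x\<bar> powr a" "0 \<le> M" "0 \<le> q"
  shows "v powr q \<le> M powr q * \<bar>x\<bar> powr (a * q)"
proof -
  have "v powr q \<le> (M * \<bar>x\<bar> powr a) powr q" using assms by (intro powr_mono2) auto
  also have "\<dots> = M powr q * \<bar>x\<bar> powr (a * q)" using assms by (simp add: powr_mult powr_powr)
  finally show ?thesis .
qed

text \<open>With \<open>z = v\<^sup>p / \<parallel>v\<parallel>\<^sup>p\<close>, positive definiteness gives \<open>J z w \<le> M\<close>,
  which turns the Hoelder inequality for \<open>J w w\<close> into an equality.\<close>

lemma sol_exists: "\<exists>V. sol V"
proof -
  obtain w where wS: "w \<in> S" and max: "\<And>z. z \<in> S \<Longrightarrow> J z z \<le> J w w"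
    using J_maximizer by blast
  define M where "M = J w w"
  have M: "0 < M" using J_positive max unfolding M_def by (metis order_less_le_trans)
  note aw = S_adm[OF wS]
  have w: "symdec w" "integrable lborel (\<lambda>x. w x powr (1 / e0))" "(LINT x|lborel. w x powr (1 / e0)) \<le> 1"
    using wS by (auto simp: S_def)
  have w0: "0 \<le> w x" for x by (rule symdec_nonneg[OF w(1)])
  have wm [measurable]: "w \<in> borel_measurable borel" by (rule adm_borel[OF aw])
  define v where "v = conv g w"
  have vm [measurable]: "v \<in> borel_measurable borel" unfolding v_def by measurable
  have v: "symdec v" unfolding v_def
    by (rule symdec_conv[OF g w(1)]) (rule adm_conv_integrable[OF aw])
  have v0: "0 \<le> v x" for x by (rule symdec_nonneg[OF v])
  have wW: "\<And>y. y \<noteq> 0 \<Longrightarrow> \<bar>w y\<bar> \<le> 1 * \<bar>y\<bar> powr (- e0)" using aw by (simp add: adm_def W_def)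
  obtain M1 where M1: "0 \<le> M1" "\<And>x. x \<noteq> 0 \<Longrightarrow> \<bar>v x\<bar> \<le> M1 * \<bar>x\<bar> powr (b1 - e0)"
    using g_conv_bound_ex[OF b1(1-3) exps(4) wm wW] unfolding v_def by metis
  obtain M2 where M2: "0 \<le> M2" "\<And>x. x \<noteq> 0 \<Longrightarrow> \<bar>v x\<bar> \<le> M2 * \<bar>x\<bar> powr (b2 - e0)"
    using g_conv_bound_ex[OF b2(1-3) exps(4) wm wW] unfolding v_def by metis
  \<comment> \<open>The power \<open>(\<beta> - e0) * (p + 1)\<close> passes \<open>-1\<close>
    exactly when \<open>\<beta>\<close> passes \<open>th\<close>, so \<open>b1\<close> gives
    integrability at the origin and \<open>b2\<close> at infinity.\<close>
  have neg: "(p + 1) * (- (1 - e0)) = - 1" using p_e0(2) by (simp only: mult_minus_right)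
  have iv: "integrable lborel (\<lambda>x. v x powr (p + 1))"
  proof (rule powr_split_integrable)
    have "(p + 1) * (b1 - e0) > (p + 1) * (- (1 - e0))"
      using b1 exps(5) p by (intro mult_strict_left_mono) auto
    then show "- 1 < (b1 - e0) * (p + 1)" unfolding neg by (simp only: mult.commute)
    have "(p + 1) * (b2 - e0) < (p + 1) * (- (1 - e0))"
      using b2 exps(5) p by (intro mult_strict_left_mono) auto
    then show "(b2 - e0) * (p + 1) < - 1" unfolding neg by (simp only: mult.commute)
    show "\<bar>v x powr (p + 1)\<bar> \<le> M1 powr (p + 1) * \<bar>x\<bar> powr ((b1 - e0) * (p + 1))" if "x \<noteq> 0" for x
      using powr_le_scaled[OF v0 abs_le_D1[OF M1(2)[OF that]] M1(1), of "p + 1"] p by simp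
    show "\<bar>v x powr (p + 1)\<bar> \<le> M2 powr (p + 1) * \<bar>x\<bar> powr ((b2 - e0) * (p + 1))" if "1 \<le> \<bar>x\<bar>" for x
    proof -
      have "x \<noteq> 0" using that by auto
      from powr_le_scaled[OF v0 abs_le_D1[OF M2(2)[OF this]] M2(1), of "p + 1"] p show ?thesis by simp
    qed
  qed measurable
  define I where "I = (LINT x|lborel. v x powr (p + 1))"
  have I: "0 < I"
  proof (rule ccontr)
    assume "\<not> 0 < I"
    moreover have "0 \<le> I" unfolding I_def by (intro Bochner_Integration.integral_nonneg) simp
    ultimately have "I = 0" by linarith
    then have "AE x in lborel. v x powr (p + 1) = 0"
      using integral_nonneg_eq_0_iff_AE[OF iv] by (simp add: I_def)
    then have "AE x in lborel. w x * v x = 0" by eventually_elim simp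
    then have "J w w = 0" unfolding J_def v_def[symmetric] by (rule integral_eq_zero_AE)
    then show False using M by (simp add: M_def)
  qed
  define z where "z x = v x powr p / I powr e0" for x
  have zp: "z x powr (1 / e0) = v x powr (p + 1) / I" for x
  proof -
    have "z x powr (1 / e0) = v x powr (p * (1 / e0)) / I powr (e0 * (1 / e0))"
      using I by (simp only: z_def powr_divide powr_powr)
    also have "\<dots> = v x powr (p + 1) / I" using exps(7) I unfolding p_e0(3) by simp
    finally show ?thesis .
  qed
  have zS: "z \<in> S"
  proof -
    have "symdec (\<lambda>x. (1 / I powr e0) * (v x powr p))"
      using v p by (intro symdec_mult symdec_powr) auto
    then have "symdec z" by (simp add: z_def[abs_def])
    moreover have "(LINT x|lborel. v x powr (p + 1) / I) = 1" using I by (simp add: I_def[symmetric])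
    ultimately show ?thesis using iv by (simp add: S_def zp)
  qed
  note az = S_adm[OF zS]
  have z0: "0 \<le> z x" for x by (simp add: z_def)
  have zm [measurable]: "z \<in> borel_measurable borel" by (rule adm_borel[OF az])
  have "adm (\<lambda>x. z x - w x)"
    unfolding adm_def
  proof (intro conjI allI impI)
    fix x :: real assume "x \<noteq> 0"
    then have "z x \<le> W x" "w x \<le> W x" using az aw by (auto simp: adm_def abs_le_iff)
    then show "\<bar>z x - w x\<bar> \<le> W x" using z0[of x] w0[of x] by linarith
  qed measurable
  \<comment> \<open>Expanding \<open>J\<close> at \<open>z - w\<close> gives
    \<open>2 * J z w \<le> J z z + J w w\<close>, and maximality of \<open>w\<close> bounds both
    terms by \<open>M\<close>.\<close>
  from J_nonneg[OF this] J_diff[OF az aw this] max[OF zS] have "J z w \<le> M"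
    by (simp add: M_def)
  moreover have "J z w = I powr (1 - e0)"
  proof -
    have "J z w = (LINT x|lborel. v x powr (p + 1) / I powr e0)"
      unfolding J_def v_def[symmetric] z_def
    proof (rule Bochner_Integration.integral_cong[OF refl])
      fix x
      show "v x powr p / I powr e0 * v x = v x powr (p + 1) / I powr e0"
        using v0[of x] by (cases "v x = 0") (simp_all add: powr_add)
    qed
    also have "\<dots> = I / I powr e0" by (simp add: I_def)
    finally show ?thesis using I by (simp add: powr_diff)
  qed
  ultimately have "(I powr (1 - e0)) powr (p + 1) \<le> M powr (p + 1)"
    using p by (intro powr_mono2) auto
  then have IM: "I \<le> M powr (p + 1)" using I p_e0(2) by (simp add: powr_powr mult.commute)
  define Y where "Y x = (v x / M) powr (p + 1)" for x
  have Ya: "Y x = v x powr (p + 1) / M powr (p + 1)" for x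
    using M v0[of x] by (simp add: Y_def powr_divide)
  have X1: "(w x powr (1 / e0)) powr e0 = w x" for x
    using w0[of x] exps(7) by (simp add: powr_powr)
  have Y1: "Y x powr (1 - e0) = v x / M" for x
    using v0[of x] M by (simp add: Y_def powr_powr p_e0(2))
  have Y2: "Y x powr e0 = (v x / M) powr p" for x
    by (simp add: Y_def powr_powr p_e0(1))
  \<comment> \<open>The defect in Young's inequality for \<open>w\<close> and \<open>v / M\<close>.
    Its integral is at most \<open>e0 + (1 - e0) - 1 = 0\<close> by the constraint on
    \<open>w\<close> and by \<open>IM\<close>; being nonnegative, it vanishes almost
    everywhere.\<close>
  define h where "h x = e0 * w x powr (1 / e0) + (1 - e0) * Y x - w x * (v x / M)" for x
  have Y0: "0 \<le> Y x" for x by (simp add: Y_def)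
  have h0: "0 \<le> h x" for x
    using young_eq(1)[OF exps(7,4), of "w x powr (1 / e0)" "Y x"] Y0[of x] unfolding X1 Y1 h_def by simp
  have iY: "integrable lborel Y" unfolding Ya[abs_def] using iv by simp
  have iwv: "integrable lborel (\<lambda>x. w x * v x)"
    unfolding v_def by (rule adm_J_integrable[OF aw aw])
  have ih: "integrable lborel h" unfolding h_def[abs_def] using w(2) iY iwv by simp
  have "(LINT x|lborel. h x) = e0 * (LINT x|lborel. w x powr (1 / e0)) + (1 - e0) * (LINT x|lborel. Y x) - (LINT x|lborel. w x * v x) / M"
    unfolding h_def using w(2) iY iwv by simp
  also have "(LINT x|lborel. Y x) = I / M powr (p + 1)" unfolding Ya by (simp add: I_def)
  also have "(LINT x|lborel. w x * v x) = M" by (simp add: M_def J_def v_def)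
  also have "e0 * (LINT x|lborel. w x powr (1 / e0)) + (1 - e0) * (I / M powr (p + 1)) - M / M \<le> e0 * 1 + (1 - e0) * 1 - 1"
    using w(3) exps(4,7) IM M by (intro diff_mono add_mono mult_left_mono) auto
  finally have "(LINT x|lborel. h x) = 0"
    using Bochner_Integration.integral_nonneg[of lborel h] h0 by fastforce
  then have "AE x in lborel. h x = 0"
    using integral_nonneg_eq_0_iff_AE[OF ih] h0 by simp
  then have wv: "AE x in lborel. w x = (v x / M) powr p"
  proof eventually_elim
    case (elim x)
    have "w x powr (1 / e0) = Y x"
      using young_eq(2)[OF exps(7,4), of "w x powr (1 / e0)" "Y x"] Y0[of x] elim unfolding X1 Y1 h_def by simp
    then show ?case using X1[of x] Y2[of x] by simp
  qed
  \<comment> \<open>The solution of \<open>cc powr p * M powr p = cc\<close>, the scaling for which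
    \<open>w = (v / M) powr p\<close> becomes \<open>V powr p = cc * w\<close>.\<close>
  define cc where "cc = M powr (- p / (p - 1))"
  have cc: "0 < cc" using M by (simp add: cc_def)
  have ccp: "cc powr p * M powr p = cc"
  proof -
    have "cc powr p * M powr p = M powr (- p / (p - 1) * p + p)"
      by (simp only: cc_def powr_powr powr_add)
    also have "- p / (p - 1) * p + p = - p / (p - 1)" using p by (simp add: field_simps)
    finally show ?thesis by (simp add: cc_def)
  qed
  define V where "V x = cc * v x" for x
  have "sol V"
    unfolding sol_def
  proof (intro conjI allI)
    show "symdec V" unfolding V_def[abs_def] using v cc by (intro symdec_mult) auto
    have Vp: "AE y in lborel. V y powr p = cc * w y"
      using wv
    proof eventually_elim
      case (elim y)
      have "V y powr p = cc powr p * M powr p * (v y / M) powr p"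
        using cc v0[of y] M by (simp add: V_def powr_mult powr_divide)
      then show ?case unfolding ccp elim[symmetric] .
    qed
    fix x
    have "conv g (\<lambda>y. V y powr p) x = (LINT y|lborel. cc * (g (x - y) * w y))"
      unfolding conv_def
    proof (rule integral_cong_AE)
      show "AE y in lborel. g (x - y) * V y powr p = cc * (g (x - y) * w y)"
        using Vp by eventually_elim simp
    qed (unfold V_def, measurable)
    then show "V x = conv g (\<lambda>y. V y powr p) x" by (simp add: V_def v_def conv_def)
  next
    show "integrable lborel (\<lambda>x. V x powr (p + 1))"
      unfolding V_def using iv cc v0 by (simp add: powr_mult)
    show "\<not> (AE x in lborel. V x = 0)"
    proof
      assume "AE x in lborel. V x = 0"
      then have "AE x in lborel. v x powr (p + 1) = 0"
        by eventually_elim (use cc in \<open>simp add: V_def\<close>)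
      then have "I = 0" unfolding I_def by (rule integral_eq_zero_AE)
      then show False using I by simp
    qed
  qed
  then show ?thesis by blast
qed

section \<open>A priori bounds for fixed points\<close>

lemma sol_powr_decay:
  assumes V: "sol V"
  shows "\<exists>D. \<forall>x. x \<noteq> 0 \<longrightarrow> V x powr p \<le> D * \<bar>x\<bar> powr (- e0)"
proof -
  have s1: "symdec V" "integrable lborel (\<lambda>x. V x powr (p + 1))" using solD[OF V] by blast+
  have sp: "symdec (\<lambda>x. V x powr (p + 1))" using s1(1) p by (intro symdec_powr) auto
  define I where "I = (LINT x|lborel. V x powr (p + 1))"
  have "V x powr p \<le> I powr e0 * \<bar>x\<bar> powr (- e0)" if x: "x \<noteq> 0" for x
  proof -
    have "2 * \<bar>x\<bar> * V x powr (p + 1) \<le> mass (\<lambda>x. V x powr (p + 1)) \<bar>x\<bar>"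
      using x by (intro symdec_le_mass[OF sp] integrable_times_indicator s1(2)) auto
    also have "\<dots> \<le> I" unfolding I_def by (rule mass_le_integral[OF sp s1(2)])
    finally have 1: "2 * (\<bar>x\<bar> * V x powr (p + 1)) \<le> I" by simp
    have "0 \<le> \<bar>x\<bar> * V x powr (p + 1)" by simp
    with 1 have "\<bar>x\<bar> * V x powr (p + 1) \<le> I" by linarith
    then have 2: "V x powr (p + 1) \<le> I * \<bar>x\<bar> powr (-1)"
      using x by (simp add: powr_minus field_simps)
    have "0 \<le> I" unfolding I_def by (intro Bochner_Integration.integral_nonneg) simp
    then have "(V x powr (p + 1)) powr e0 \<le> I powr e0 * \<bar>x\<bar> powr (-1 * e0)"
      using exps(7) 2 by (intro powr_le_scaled) auto
    then show ?thesis by (simp add: powr_powr p_e0(1))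
  qed
  then show ?thesis by blast
qed

lemma sol_conv_bound:
  assumes V: "sol V" and "0 < \<beta>" "\<beta> \<le> b" "\<beta> < e" "e < 1"
    and f: "\<And>x. x \<noteq> 0 \<Longrightarrow> V x powr p \<le> D * \<bar>x\<bar> powr (- e)"
  shows "\<exists>M\<ge>0. \<forall>x. x \<noteq> 0 \<longrightarrow> V x \<le> M * \<bar>x\<bar> powr (\<beta> - e)"
proof -
  have s1: "symdec V" "\<And>x. V x = conv g (\<lambda>y. V y powr p) x" using solD[OF V] by blast+
  have [measurable]: "V \<in> borel_measurable borel" by (rule symdec_borel[OF s1(1)])
  have "(\<lambda>y. V y powr p) \<in> borel_measurable borel" by measurable
  moreover have "\<And>y. y \<noteq> 0 \<Longrightarrow> \<bar>V y powr p\<bar> \<le> D * \<bar>y\<bar> powr (- e)" using f by simp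
  ultimately obtain M where "0 \<le> M" "\<And>x. x \<noteq> 0 \<Longrightarrow> \<bar>conv g (\<lambda>y. V y powr p) x\<bar> \<le> M * \<bar>x\<bar> powr (\<beta> - e)"
    using g_conv_bound_ex[OF assms(2-5)] by metis
  then show ?thesis using s1(2) by (metis abs_le_D1)
qed

text \<open>Each application of the convolution bound improves the decay exponent of \<open>V\<^sup>p\<close>
  at the origin from \<open>e\<close> to \<open>p (e - b1)\<close>, that is, by at least \<open>p (b1 - th)\<close>.\<close>

lemma sol_bootstrap:
  assumes V: "sol V"
  shows "\<exists>D. \<forall>x. x \<noteq> 0 \<longrightarrow> V x powr p \<le> D * \<bar>x\<bar> powr (- (b1 / 2))"
proof -
  define P where "P e \<longleftrightarrow> (\<exists>D. \<forall>x. x \<noteq> 0 \<longrightarrow> V x powr p \<le> D * \<bar>x\<bar> powr (- e))" for e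
  have V0: "0 \<le> V x" for x by (rule symdec_nonneg[OF solD(1)[OF V]])
  have P0: "P e0" unfolding P_def by (rule sol_powr_decay[OF V])
  \<comment> \<open>\<open>P e\<close> asserts one power on the whole line, so a smaller
    \<open>e\<close> is better at the origin and worse at infinity. Using \<open>P e\<close> inside
    the unit interval and \<open>P e0\<close> outside gives every exponent in between.\<close>
  have up: "P t" if Pe: "P e" and "e \<le> t" "t \<le> e0" for e t
  proof -
    obtain D where D: "\<And>x. x \<noteq> 0 \<Longrightarrow> V x powr p \<le> D * \<bar>x\<bar> powr (- e)" using Pe by (auto simp: P_def)
    obtain D0 where D0: "\<And>x. x \<noteq> 0 \<Longrightarrow> V x powr p \<le> D0 * \<bar>x\<bar> powr (- e0)" using P0 by (auto simp: P_def)
    have nn: "0 \<le> D" "0 \<le> D0" using order_trans[OF powr_ge_zero D[of 1]] order_trans[OF powr_ge_zero D0[of 1]] by auto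
    have "V x powr p \<le> (D + D0) * \<bar>x\<bar> powr (- t)" if x: "x \<noteq> 0" for x
    proof (cases "\<bar>x\<bar> \<le> 1")
      case True
      have "V x powr p \<le> D * \<bar>x\<bar> powr (- e)" by (rule D[OF x])
      also have "\<dots> \<le> (D + D0) * \<bar>x\<bar> powr (- t)"
        using nn x True that \<open>e \<le> t\<close> by (intro mult_mono powr_mono') auto
      finally show ?thesis .
    next
      case False
      have "V x powr p \<le> D0 * \<bar>x\<bar> powr (- e0)" by (rule D0[OF x])
      also have "\<dots> \<le> (D + D0) * \<bar>x\<bar> powr (- t)"
        using nn x False that \<open>t \<le> e0\<close> by (intro mult_mono powr_mono) auto
      finally show ?thesis .
    qed
    then show ?thesis unfolding P_def by blast
  qed
  define \<eta> where "\<eta> = p * (b1 - th)"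
  have \<eta>: "0 < \<eta>" using p b1 by (simp add: \<eta>_def)
  have pth: "(p - 1) * e0 = p * th" by (simp add: e0_def th_def)
  have step: "P (max (e - \<eta>) (b1 / 2))" if Pe: "P e" and e: "b1 / 2 \<le> e" "e \<le> e0" for e
  proof -
    \<comment> \<open>The convolution bound asks for an exponent above \<open>b1\<close>. When
      \<open>e\<close> is too close to \<open>b1\<close> or below it, it is raised to at most
      \<open>b1 + b1 / (2 * p)\<close>, for which the outcome \<open>p * (e' - b1)\<close> does not
      exceed the target \<open>b1 / 2\<close>.\<close>
    define e' where "e' = max e (min e0 (b1 + b1 / (2 * p)))"
    have pp: "0 < b1 / (2 * p)" using b1 p by simp
    have e': "e \<le> e'" "e' \<le> e0" "b1 < e'" using e b1 pp by (auto simp: e'_def)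
    have "P e'" by (rule up[OF Pe e'(1,2)])
    then obtain D where D: "\<And>x. x \<noteq> 0 \<Longrightarrow> V x powr p \<le> D * \<bar>x\<bar> powr (- e')" by (auto simp: P_def)
    have "e' < 1" using e' exps(4) by simp
    from sol_conv_bound[OF V b1(1,2) e'(3) this D]
    obtain M where M: "0 \<le> M" "\<And>x. x \<noteq> 0 \<Longrightarrow> V x \<le> M * \<bar>x\<bar> powr (b1 - e')" by auto
    have "V x powr p \<le> M powr p * \<bar>x\<bar> powr (- (p * (e' - b1)))" if "x \<noteq> 0" for x
      using powr_le_scaled[OF V0 M(2)[OF that] M(1), of p] p by (simp add: algebra_simps)
    then have Q: "P (p * (e' - b1))" unfolding P_def by blast
    have "p * (e' - b1) \<le> max (e - \<eta>) (b1 / 2)"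
    proof (cases "e' = e")
      case True
      have "(p - 1) * e \<le> (p - 1) * e0" using e p by (intro mult_left_mono) auto
      then have "p * (e - b1) \<le> e - \<eta>" using pth unfolding \<eta>_def by (simp add: algebra_simps)
      then show ?thesis using True by simp
    next
      case False
      then have "e' \<le> b1 + b1 / (2 * p)" by (auto simp: e'_def max_def split: if_splits)
      then have "p * (e' - b1) \<le> p * (b1 / (2 * p))" using p by (intro mult_left_mono) auto
      also have "\<dots> = b1 / 2" using p by simp
      finally show ?thesis by simp
    qed
    moreover have "max (e - \<eta>) (b1 / 2) \<le> e0" using e \<eta> b1 by auto
    ultimately show ?thesis using up[OF Q] by blast
  qed
  have "P (max (e0 - real n * \<eta>) (b1 / 2))" for n
  proof (induction n)
    case 0
    have "max (e0 - real 0 * \<eta>) (b1 / 2) = e0" using b1 by simp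
    then show ?case using P0 by simp
  next
    case (Suc n)
    have "max (e0 - real n * \<eta>) (b1 / 2) \<le> e0" using b1 \<eta> by simp
    from step[OF Suc _ this] have 1: "P (max (max (e0 - real n * \<eta>) (b1 / 2) - \<eta>) (b1 / 2))" by simp
    have "max (max (e0 - real n * \<eta>) (b1 / 2) - \<eta>) (b1 / 2) = max (e0 - real (Suc n) * \<eta>) (b1 / 2)"
      using \<eta> by (simp add: max_def algebra_simps)
    then show ?case using 1 by simp
  qed
  moreover obtain n where "e0 < real n * \<eta>" using \<eta> reals_Archimedean3 by blast
  ultimately have "P (b1 / 2)" using b1 by (metis max_absorb2 diff_le_0_iff_le less_imp_le half_gt_zero order_trans)
  then show ?thesis unfolding P_def .
qed

text \<open>At the origin \<open>V powr p\<close> has order \<open>- b1 / 2\<close> and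
  \<open>g\<close> has order \<open>b1 - 1\<close>; the sum exceeds \<open>-1\<close>, so the
  convolution converges at 0 as well and \<open>conv_decreasing\<close> compares every point with
  the origin.\<close>

lemma sol_bounded:
  assumes V: "sol V"
  shows "V x \<le> V 0"
proof -
  have s1: "symdec V" "\<And>x. V x = conv g (\<lambda>y. V y powr p) x" using solD[OF V] by blast+
  have Vm [measurable]: "V \<in> borel_measurable borel" by (rule symdec_borel[OF s1(1)])
  have sp: "symdec (\<lambda>y. V y powr p)" using s1(1) p by (intro symdec_powr) auto
  obtain D where D: "\<And>x. x \<noteq> 0 \<Longrightarrow> V x powr p \<le> D * \<bar>x\<bar> powr (- (b1 / 2))" using sol_bootstrap[OF V] by blast
  obtain D0 where D0: "\<And>x. x \<noteq> 0 \<Longrightarrow> V x powr p \<le> D0 * \<bar>x\<bar> powr (- e0)" using sol_powr_decay[OF V] by blast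
  obtain B where B: "0 < B" "\<And>x. x \<noteq> 0 \<Longrightarrow> g x \<le> B * \<bar>x\<bar> powr (b1 - 1)" using g_le_powr[OF b1(1,2)] by blast
  obtain B2 where B2: "0 < B2" "\<And>x. x \<noteq> 0 \<Longrightarrow> g x \<le> B2 * \<bar>x\<bar> powr (b2 - 1)" using g_le_powr[OF b2(1,2)] by blast
  have g0: "0 \<le> g y" for y by (rule symdec_nonneg[OF g])
  have i0: "integrable lborel (\<lambda>y. g (0 - y) * V y powr p)"
  proof (rule powr_split_integrable)
    show "- 1 < b1 / 2 - 1" "b2 - 1 - e0 < - 1" using b1 b2 by auto
    show "\<bar>g (0 - y) * V y powr p\<bar> \<le> B * D * \<bar>y\<bar> powr (b1 / 2 - 1)" if y: "y \<noteq> 0" for y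
    proof -
      have "g y * V y powr p \<le> (B * \<bar>y\<bar> powr (b1 - 1)) * (D * \<bar>y\<bar> powr (- (b1 / 2)))"
        using B D[OF y] y g0 by (intro mult_mono) auto
      also have "\<dots> = B * D * (\<bar>y\<bar> powr (b1 - 1) * \<bar>y\<bar> powr (- (b1 / 2)))" by simp
      also have "\<bar>y\<bar> powr (b1 - 1) * \<bar>y\<bar> powr (- (b1 / 2)) = \<bar>y\<bar> powr (b1 / 2 - 1)"
        by (simp add: powr_add[symmetric])
      finally show ?thesis using g g0 by (simp add: abs_mult)
    qed
    show "\<bar>g (0 - y) * V y powr p\<bar> \<le> B2 * D0 * \<bar>y\<bar> powr (b2 - 1 - e0)" if "1 \<le> \<bar>y\<bar>" for y
    proof -
      have y: "y \<noteq> 0" using that by auto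
      have "g y * V y powr p \<le> (B2 * \<bar>y\<bar> powr (b2 - 1)) * (D0 * \<bar>y\<bar> powr (- e0))"
        using B2 D0[OF y] y g0 by (intro mult_mono) auto
      also have "\<dots> = B2 * D0 * (\<bar>y\<bar> powr (b2 - 1) * \<bar>y\<bar> powr (- e0))" by simp
      also have "\<bar>y\<bar> powr (b2 - 1) * \<bar>y\<bar> powr (- e0) = \<bar>y\<bar> powr (b2 - 1 - e0)"
        by (simp add: powr_add[symmetric])
      finally show ?thesis using g g0 by (simp add: abs_mult)
    qed
  qed measurable
  show ?thesis
  proof (cases "x = 0")
    case False
    have pm: "(\<lambda>y. V y powr p) \<in> borel_measurable borel" by measurable
    have pD: "\<And>y. y \<noteq> 0 \<Longrightarrow> \<bar>V y powr p\<bar> \<le> D0 * \<bar>y\<bar> powr (- e0)" using D0 by simp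
    have ix: "integrable lborel (\<lambda>y. g (x - y) * V y powr p)"
    proof (rule g_conv_bound[OF b1(1-3) exps(4) pm pD])
      assume "\<And>x. x \<noteq> 0 \<Longrightarrow> integrable lborel (\<lambda>y. g (x - y) * V y powr p)"
      then show ?thesis using False by blast
    qed
    have "conv g (\<lambda>y. V y powr p) x \<le> conv g (\<lambda>y. V y powr p) 0"
      by (rule conv_decreasing[OF g sp _ i0 ix]) simp
    then show ?thesis using s1(2) by metis
  qed simp
qed

lemma sol_decay:
  assumes V: "sol V"
  shows "\<exists>M\<ge>0. \<forall>x. x \<noteq> 0 \<longrightarrow> V x \<le> M * \<bar>x\<bar> powr (b2 - e0)"
proof -
  obtain D0 where D0: "\<And>x. x \<noteq> 0 \<Longrightarrow> V x powr p \<le> D0 * \<bar>x\<bar> powr (- e0)" using sol_powr_decay[OF V] by blast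
  show ?thesis by (rule sol_conv_bound[OF V b2(1-3) exps(4) D0])
qed

end

section \<open>Regularity and positivity\<close>

lemma powr_lipschitz:
  fixes a b U p :: real
  assumes "1 < p" "0 \<le> a" "a \<le> b" "b \<le> U"
  shows "b powr p - a powr p \<le> p * U powr (p - 1) * (b - a)"
proof (cases "a = b")
  case False
  then have ab: "a < b" using assms by simp
  have "continuous_on {a..b} (\<lambda>x. x powr p)"
    using assms by (intro continuous_on_powr' continuous_intros) auto
  moreover have "((\<lambda>x. x powr p) has_derivative (\<lambda>h. (p * x powr (p - 1)) * h)) (at x)" if "a < x" "x < b" for x
    using has_real_derivative_powr[of x p] that assms by (auto simp: has_field_derivative_def)
  ultimately obtain \<xi> where \<xi>: "a < \<xi>" "\<xi> < b" "b powr p - a powr p = p * \<xi> powr (p - 1) * (b - a)"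
    by (rule mvt[OF ab])
  then show ?thesis using assms by (auto intro!: mult_right_mono mult_left_mono powr_mono2)
qed simp

text \<open>Bounded variation replaces integrability: cutting \<open>f\<close> to
  \<open>[- n, n]\<close> keeps it \<open>symdec\<close>, and the bound by twice the mass on
  \<open>[- h, h]\<close> sees only the supremum \<open>F\<close>.\<close>

lemma nn_integral_symdec_diff:
  assumes f: "symdec f" and F: "\<And>x. f x \<le> F" and h: "0 \<le> h"
  shows "(\<integral>\<^sup>+x. ennreal \<bar>f (x + h) - f x\<bar> \<partial>lborel) \<le> ennreal (4 * F * h)"
proof -
  have fm [measurable]: "f \<in> borel_measurable borel" by (rule symdec_borel[OF f])
  have F0: "0 \<le> F" using F[of 0] symdec_nonneg[OF f, of 0] by linarith
  define fn where "fn n x = f x * indicator {- real n..real n} x" for n x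
  have sym: "symdec (fn n)" for n
    unfolding fn_def[abs_def] by (intro symdec_times f symdec_indicator)
  have [measurable]: "fn n \<in> borel_measurable borel" for n by (rule symdec_borel[OF sym])
  have fnF: "fn n x \<le> F" for n x using F[of x] F0 by (auto simp: fn_def split: split_indicator)
  have int: "integrable lborel (fn n)" for n
  proof (rule Bochner_Integration.integrable_bound)
    show "integrable lborel (\<lambda>x. F * indicator {- real n..real n} x)" by simp
    show "AE x in lborel. norm (fn n x) \<le> norm (F * indicator {- real n..real n} x)"
      using F symdec_nonneg[OF f] F0 by (intro AE_I2) (auto simp: fn_def split: split_indicator)
  qed measurable
  have lim: "(\<lambda>n. fn n x) \<longlonglongrightarrow> f x" for x
  proof -
    obtain m where m: "\<bar>x\<bar> \<le> real m" using real_arch_simple by blast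
    have "eventually (\<lambda>n. fn n x = f x) sequentially"
      using eventually_ge_at_top[of m]
      by eventually_elim (use m in \<open>auto simp: fn_def abs_le_iff split: split_indicator\<close>)
    then show ?thesis by (rule tendsto_eventually)
  qed
  have "(\<integral>\<^sup>+x. ennreal \<bar>f (x + h) - f x\<bar> \<partial>lborel) = (\<integral>\<^sup>+x. liminf (\<lambda>n. ennreal \<bar>fn n (x + h) - fn n x\<bar>) \<partial>lborel)"
  proof (rule nn_integral_cong)
    fix x
    have "(\<lambda>n. ennreal \<bar>fn n (x + h) - fn n x\<bar>) \<longlonglongrightarrow> ennreal \<bar>f (x + h) - f x\<bar>"
      by (intro tendsto_ennrealI tendsto_intros lim)
    then show "ennreal \<bar>f (x + h) - f x\<bar> = liminf (\<lambda>n. ennreal \<bar>fn n (x + h) - fn n x\<bar>)"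
      by (metis lim_imp_Liminf sequentially_bot)
  qed
  also have "\<dots> \<le> liminf (\<lambda>n. \<integral>\<^sup>+x. ennreal \<bar>fn n (x + h) - fn n x\<bar> \<partial>lborel)"
    by (intro nn_integral_liminf) measurable
  also have "\<dots> \<le> liminf (\<lambda>n. ennreal (4 * F * h))"
  proof (intro Liminf_mono always_eventually allI)
    fix n
    have "(\<integral>\<^sup>+x. ennreal \<bar>fn n (x + h) - fn n x\<bar> \<partial>lborel) = ennreal (LINT x|lborel. \<bar>fn n (x + h) - fn n x\<bar>)"
      using int by (intro nn_integral_eq_integral integrable_abs Bochner_Integration.integrable_diff)
        (auto simp: lborel_integrable_translate_iff)
    also have "\<dots> \<le> ennreal (4 * F * h)"
    proof (rule ennreal_leI)
      have "(LINT x|lborel. \<bar>fn n (x + h) - fn n x\<bar>) \<le> 2 * mass (fn n) h"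
        by (rule symdec_diff_L1[OF sym int h])
      also have "mass (fn n) h \<le> (LINT x|lborel. F * indicator {-h..h} x)"
        unfolding mass_def
      proof (rule integral_mono)
        show "integrable lborel (\<lambda>x. fn n x * indicator {-h..h} x)" by (rule integrable_times_indicator[OF int]) simp
        show "fn n x * indicator {-h..h} x \<le> F * indicator {-h..h} x" for x
          by (rule mult_right_mono[OF fnF]) simp
      qed simp
      also have "\<dots> = 2 * F * h" using h by (simp add: measure_def)
      finally show "(LINT x|lborel. \<bar>fn n (x + h) - fn n x\<bar>) \<le> 4 * F * h" by simp
    qed
    finally show "(\<integral>\<^sup>+x. ennreal \<bar>fn n (x + h) - fn n x\<bar> \<partial>lborel) \<le> ennreal (4 * F * h)" .
  qed
  finally show ?thesis by (simp add: Liminf_const)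
qed

text \<open>The L1 counterpart of \<open>conv_sdiff_le\<close>. The difference of \<open>f\<close>
  is integrated over \<open>x\<close> by Tonelli and costs one full power of \<open>y\<close>, where
  its supremum would cost only a Hoelder power.\<close>

lemma nn_integral_conv_sdiff:
  assumes G: "symdec G" "integrable lborel G" and f: "symdec f" and F: "\<And>x. f x \<le> F" and y: "0 \<le> y"
  shows "(\<integral>\<^sup>+x. ennreal \<bar>sdiff (conv G f) x y\<bar> \<partial>lborel) \<le> ennreal (2 * mass G y * (4 * F * y))"
proof -
  have [measurable]: "f \<in> borel_measurable borel" by (rule symdec_borel[OF f])
  have [measurable]: "G \<in> borel_measurable borel" by (rule symdec_borel[OF G(1)])
  have fa: "\<bar>f x\<bar> \<le> F" for x using F[of x] symdec_nonneg[OF f, of x] by simp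
  have F0: "0 \<le> F" using fa[of 0] by simp
  have iG: "integrable lborel (\<lambda>w. \<bar>G (w + y) - G w\<bar>)"
    using G(2) by (intro integrable_abs Bochner_Integration.integrable_diff) (auto simp: lborel_integrable_translate_iff)
  have "ennreal \<bar>sdiff (conv G f) x y\<bar> \<le> (\<integral>\<^sup>+w. ennreal \<bar>G (w + y) - G w\<bar> * ennreal \<bar>f (x - w) - f (x - y - w)\<bar> \<partial>lborel)" for x
  proof -
    have fm: "f \<in> borel_measurable borel" by measurable
    note S = conv_sdiff[OF G(2) fm fa, where x=x and y=y]
    have "\<bar>sdiff (conv G f) x y\<bar> \<le> (LINT w|lborel. \<bar>(G (w + y) - G w) * (f (x - w) - f (x - y - w))\<bar>)"
      unfolding S(2) abs_minus_cancel by (rule integral_abs_bound)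
    then have "ennreal \<bar>sdiff (conv G f) x y\<bar> \<le> ennreal (LINT w|lborel. \<bar>(G (w + y) - G w) * (f (x - w) - f (x - y - w))\<bar>)"
      by (rule ennreal_leI)
    also have "\<dots> = (\<integral>\<^sup>+w. ennreal \<bar>(G (w + y) - G w) * (f (x - w) - f (x - y - w))\<bar> \<partial>lborel)"
      using S(1) by (intro nn_integral_eq_integral[symmetric]) auto
    also have "\<dots> = (\<integral>\<^sup>+w. ennreal \<bar>G (w + y) - G w\<bar> * ennreal \<bar>f (x - w) - f (x - y - w)\<bar> \<partial>lborel)"
      by (simp add: abs_mult ennreal_mult)
    finally show ?thesis .
  qed
  then have "(\<integral>\<^sup>+x. ennreal \<bar>sdiff (conv G f) x y\<bar> \<partial>lborel) \<le>
     (\<integral>\<^sup>+x. \<integral>\<^sup>+w. ennreal \<bar>G (w + y) - G w\<bar> * ennreal \<bar>f (x - w) - f (x - y - w)\<bar> \<partial>lborel \<partial>lborel)"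
    by (intro nn_integral_mono)
  also have "\<dots> = (\<integral>\<^sup>+w. \<integral>\<^sup>+x. ennreal \<bar>G (w + y) - G w\<bar> * ennreal \<bar>f (x - w) - f (x - y - w)\<bar> \<partial>lborel \<partial>lborel)"
    by (rule lborel_pair.Fubini') measurable
  also have "\<dots> \<le> (\<integral>\<^sup>+w. ennreal \<bar>G (w + y) - G w\<bar> * ennreal (4 * F * y) \<partial>lborel)"
  proof (rule nn_integral_mono)
    fix w
    have "(\<integral>\<^sup>+x. ennreal \<bar>f (x - w) - f (x - y - w)\<bar> \<partial>lborel) = (\<integral>\<^sup>+x. ennreal \<bar>f (x + y) - f x\<bar> \<partial>lborel)"
      using nn_integral_translate[of "\<lambda>x. ennreal \<bar>f (x + y) - f x\<bar>" "- y - w"]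
      by (simp add: algebra_simps)
    also have "\<dots> \<le> ennreal (4 * F * y)" by (rule nn_integral_symdec_diff[OF f F y])
    finally have "ennreal \<bar>G (w + y) - G w\<bar> * (\<integral>\<^sup>+x. ennreal \<bar>f (x - w) - f (x - y - w)\<bar> \<partial>lborel)
        \<le> ennreal \<bar>G (w + y) - G w\<bar> * ennreal (4 * F * y)" by (rule mult_left_mono) simp
    then show "(\<integral>\<^sup>+x. ennreal \<bar>G (w + y) - G w\<bar> * ennreal \<bar>f (x - w) - f (x - y - w)\<bar> \<partial>lborel)
        \<le> ennreal \<bar>G (w + y) - G w\<bar> * ennreal (4 * F * y)"
      by (subst nn_integral_cmult) auto
  qed
  also have "\<dots> = ennreal (LINT w|lborel. \<bar>G (w + y) - G w\<bar>) * ennreal (4 * F * y)"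
    by (subst nn_integral_multc) (auto simp: nn_integral_eq_integral[OF iG])
  also have "\<dots> \<le> ennreal (2 * mass G y) * ennreal (4 * F * y)"
    by (intro mult_right_mono ennreal_leI symdec_diff_L1[OF G y]) auto
  also have "\<dots> = ennreal (2 * mass G y * (4 * F * y))"
    using mass_nonneg[OF G(1)] F0 y by (intro ennreal_mult[symmetric]) auto
  finally show ?thesis .
qed

locale green_solution = green_problem K s A c C d G g b p for K s A c C d G g b p +
  fixes V :: "real \<Rightarrow> real"
  assumes V: "sol V" and Kpos: "\<And>t. t \<noteq> 0 \<Longrightarrow> 0 < K t"
begin

lemma V_sym: "symdec V" by (rule solD(1)[OF V])
lemma V_nn: "0 \<le> V x" by (rule symdec_nonneg[OF V_sym])
lemma V_borel [measurable]: "V \<in> borel_measurable borel" by (rule symdec_borel[OF V_sym])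
lemma V_le: "V x \<le> V 0" by (rule sol_bounded[OF V])
lemma V_abs: "\<bar>V x\<bar> \<le> V 0" using V_le[of x] V_nn[of x] by simp

definition f where "f x = V x powr p"

lemma f_sym: "symdec f" unfolding f_def[abs_def] using V_sym p by (intro symdec_powr) auto
lemma f_borel [measurable]: "f \<in> borel_measurable borel" by (rule symdec_borel[OF f_sym])
lemma f_le: "f x \<le> f 0" unfolding f_def using V_le V_nn p by (intro powr_mono2) auto
lemma f_abs: "\<bar>f x\<bar> \<le> f 0" using f_le[of x] symdec_nonneg[OF f_sym, of x] by simp

lemma V_conv: "V = conv g f"
  using solD(2)[OF V] unfolding f_def[abs_def] by blast

lemma K_nn: "0 \<le> K t" by (rule symdec_nonneg[OF K])

lemma V2_int: "integrable lborel (\<lambda>x. (V x)\<^sup>2)"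
proof -
  obtain M where M: "0 \<le> M" "\<And>x. x \<noteq> 0 \<Longrightarrow> V x \<le> M * \<bar>x\<bar> powr (b2 - e0)"
    using sol_decay[OF V] by blast
  show ?thesis
  proof (rule powr_split_integrable)
    show "- 1 < (0::real)" "2 * (b2 - e0) < - 1" using b2 by auto
    show "\<bar>(V x)\<^sup>2\<bar> \<le> (V 0)\<^sup>2 * \<bar>x\<bar> powr 0" if "x \<noteq> 0" for x
      using V_le[of x] V_nn[of x] that by (simp add: power_mono)
    show "\<bar>(V x)\<^sup>2\<bar> \<le> M\<^sup>2 * \<bar>x\<bar> powr (2 * (b2 - e0))" if "1 \<le> \<bar>x\<bar>" for x
    proof -
      have "(V x)\<^sup>2 \<le> (M * \<bar>x\<bar> powr (b2 - e0))\<^sup>2" using M(2)[of x] V_nn[of x] that by (intro power_mono) auto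
      also have "\<dots> = M\<^sup>2 * \<bar>x\<bar> powr (2 * (b2 - e0))"
        using that by (simp add: power_mult_distrib powr_power mult.commute)
      finally show ?thesis by simp
    qed
  qed measurable
qed

lemma f2_int: "integrable lborel (\<lambda>x. (f x)\<^sup>2)"
proof -
  obtain D where D: "\<And>x. x \<noteq> 0 \<Longrightarrow> f x \<le> D * \<bar>x\<bar> powr (- e0)"
    using sol_powr_decay[OF V] unfolding f_def by blast
  show ?thesis
  proof (rule powr_split_integrable)
    show "- 1 < (0::real)" "2 * (- e0) < - 1" using exps(6) by auto
    show "\<bar>(f x)\<^sup>2\<bar> \<le> (f 0)\<^sup>2 * \<bar>x\<bar> powr 0" if "x \<noteq> 0" for x
      using f_le[of x] symdec_nonneg[OF f_sym, of x] that by (simp add: power_mono)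
    show "\<bar>(f x)\<^sup>2\<bar> \<le> D\<^sup>2 * \<bar>x\<bar> powr (2 * (- e0))" if "1 \<le> \<bar>x\<bar>" for x
    proof -
      have "(f x)\<^sup>2 \<le> (D * \<bar>x\<bar> powr (- e0))\<^sup>2"
        using D[of x] symdec_nonneg[OF f_sym, of x] that by (intro power_mono) auto
      also have "\<dots> = D\<^sup>2 * \<bar>x\<bar> powr (2 * (- e0))"
        using that by (simp add: power_mult_distrib powr_power mult.commute)
      finally show ?thesis by simp
    qed
  qed measurable
qed

text \<open>\<open>f\<close> is bounded and the L1 modulus of continuity of \<open>g\<close> has
  order \<open>b\<close>.\<close>

lemma V_holder:
  obtains H where "0 \<le> H" "\<And>x h. 0 \<le> h \<Longrightarrow> \<bar>V (x + h) - V x\<bar> \<le> H * h powr b"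
proof -
  obtain B where B: "0 < B" "\<And>h. 0 \<le> h \<Longrightarrow> mass g h \<le> B * h powr b" using mass_g by blast
  have f0: "0 \<le> f 0" using f_abs[of 0] by simp
  have "\<bar>V (x + h) - V x\<bar> \<le> (2 * f 0 * B) * h powr b" if h: "0 \<le> h" for x h
  proof -
    have "\<bar>V (x + h) - V x\<bar> \<le> 2 * f 0 * mass g h"
      using conv_diff_le[OF g g_int f_borel f_abs h, of x] unfolding V_conv[symmetric] .
    also have "\<dots> \<le> 2 * f 0 * (B * h powr b)" using B(2)[OF h] f0 by (intro mult_left_mono) auto
    finally show ?thesis by simp
  qed
  then show ?thesis using that[of "2 * f 0 * B"] f0 B(1) by simp
qed

lemma f_holder:
  obtains H where "0 \<le> H" "\<And>x h. 0 \<le> h \<Longrightarrow> \<bar>f (x + h) - f x\<bar> \<le> H * h powr b"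
proof -
  obtain H where H: "0 \<le> H" "\<And>x h. 0 \<le> h \<Longrightarrow> \<bar>V (x + h) - V x\<bar> \<le> H * h powr b" using V_holder by blast
  define L where "L = p * V 0 powr (p - 1)"
  have L: "0 \<le> L" using p by (simp add: L_def)
  have Lf: "\<bar>f x - f y\<bar> \<le> L * \<bar>V x - V y\<bar>" for x y
  proof (cases "V x \<le> V y")
    case True
    then have "f x \<le> f y" unfolding f_def using V_nn p by (intro powr_mono2) auto
    then show ?thesis using powr_lipschitz[OF p V_nn True V_le] True by (simp add: f_def L_def)
  next
    case False
    then have F: "V y \<le> V x" by simp
    then have "f y \<le> f x" unfolding f_def using V_nn p by (intro powr_mono2) auto
    then show ?thesis using powr_lipschitz[OF p V_nn F V_le] F by (simp add: f_def L_def)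
  qed
  have "\<bar>f (x + h) - f x\<bar> \<le> (L * H) * h powr b" if "0 \<le> h" for x h
    unfolding mult.assoc by (rule order_trans[OF Lf mult_left_mono[OF H(2)[OF that] L]])
  then show ?thesis using that[of "L * H"] L H(1) by simp
qed

lemma V_equation:
  "integrable lborel (\<lambda>y. sdiff V x y * K y)"
  "A * V x + 1 / 2 * (LINT y|lborel. sdiff V x y * K y) = f x"
proof -
  obtain H where H: "0 \<le> H" "\<And>x h. 0 \<le> h \<Longrightarrow> \<bar>f (x + h) - f x\<bar> \<le> H * h powr b" using f_holder by blast
  show "integrable lborel (\<lambda>y. sdiff V x y * K y)"
  "A * V x + 1 / 2 * (LINT y|lborel. sdiff V x y * K y) = f x"
    using green_equation[OF f_borel f_abs f2_int H(2), of x] by (simp_all add: V_conv[symmetric])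
qed

text \<open>Strong maximum principle: at a zero of \<open>V\<close> the equation leaves a
  nonnegative integrand with integral 0, and \<open>K > 0\<close> spreads the zero to almost the
  whole line.\<close>

lemma V_pos: "0 < V x"
proof (rule ccontr)
  assume "\<not> 0 < V x"
  then have Vx: "V x = 0" using V_nn[of x] by linarith
  define S where "S y = (V (x - y) + V (x + y)) * K y" for y
  have iS: "integrable lborel S" "(LINT y|lborel. S y) = 0"
  proof -
    have e: "(\<lambda>y. sdiff V x y * K y) = (\<lambda>y. - S y)" by (auto simp: S_def sdiff_def Vx algebra_simps)
    show "integrable lborel S" using V_equation(1)[of x] unfolding e by simp
    show "(LINT y|lborel. S y) = 0" using V_equation(2)[of x] p unfolding e by (simp add: Vx f_def)
  qed
  have "AE y in lborel. S y = 0"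
    using integral_nonneg_eq_0_iff_AE[OF iS(1)] iS(2) V_nn K_nn by (simp add: S_def)
  then have "AE y in lborel. V (x - y) = 0"
    using AE_nonzero
  proof eventually_elim
    case (elim y)
    then have "V (x - y) + V (x + y) = 0" using Kpos[of y] by (simp add: S_def)
    then show ?case using V_nn[of "x - y"] V_nn[of "x + y"] by linarith
  qed
  then have "(\<integral>\<^sup>+y. ennreal (V (x - y)) \<partial>lborel) = 0"
    by (subst nn_integral_0_iff_AE) auto
  then have "(\<integral>\<^sup>+y. ennreal (V y) \<partial>lborel) = 0"
    using nn_integral_reflect[of "\<lambda>y. ennreal (V y)" x] by simp
  then have "AE y in lborel. V y = 0"
    by (subst (asm) nn_integral_0_iff_AE) (auto elim!: eventually_mono simp: V_nn intro: antisym)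
  then show False using solD(4)[OF V] by blast
qed

lemma V_continuous: "continuous_on UNIV V"
proof -
  obtain H where H: "0 \<le> H" "\<And>x h. 0 \<le> h \<Longrightarrow> \<bar>V (x + h) - V x\<bar> \<le> H * h powr b" using V_holder by blast
  have le: "norm (V y - V x) \<le> H * \<bar>y - x\<bar> powr b" for x y
    using H(2)[of "y - x" x] H(2)[of "x - y" y] by (cases "x \<le> y") (auto simp: abs_minus_commute)
  have "(V \<longlongrightarrow> V x) (at x)" for x
  proof -
    have "((\<lambda>y. H * \<bar>y - x\<bar> powr b) \<longlongrightarrow> H * \<bar>x - x\<bar> powr b) (at x)"
      using b s by (intro tendsto_intros tendsto_powr') auto
    then have "((\<lambda>y. H * \<bar>y - x\<bar> powr b) \<longlongrightarrow> 0) (at x)" by simp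
    then have "((\<lambda>y. V y - V x) \<longlongrightarrow> 0) (at x)"
      by (rule Lim_null_comparison[rotated]) (intro always_eventually allI le)
    then show ?thesis by (rule LIM_zero_cancel)
  qed
  then show ?thesis by (simp add: continuous_on_def)
qed

lemma V_set_integrable:
  assumes "0 < \<epsilon>"
  shows "set_integrable lborel {\<tau>. \<bar>\<kappa> - \<tau>\<bar> > \<epsilon>} (\<lambda>\<tau>. (V \<kappa> - V \<tau>) * K (\<kappa> - \<tau>))"
proof -
  have "integrable lborel (\<lambda>\<tau>. K (\<kappa> - \<tau>) * indicator {t. \<epsilon> \<le> \<bar>t\<bar>} (\<kappa> - \<tau>))"
    using K_tail_integrable[OF assms] by (subst lborel_integrable_reflect_iff)
  then have "integrable lborel (\<lambda>\<tau>. (K (\<kappa> - \<tau>) * indicator {t. \<epsilon> \<le> \<bar>t\<bar>} (\<kappa> - \<tau>)) * ((V \<kappa> - V \<tau>) * indicator {\<tau>. \<bar>\<kappa> - \<tau>\<bar> > \<epsilon>} \<tau>))"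
  proof (rule integrable_mult_bounded)
    show "\<bar>(V \<kappa> - V \<tau>) * indicator {\<tau>. \<bar>\<kappa> - \<tau>\<bar> > \<epsilon>} \<tau>\<bar> \<le> V 0" for \<tau>
      using V_le[of \<kappa>] V_le[of \<tau>] V_nn[of \<kappa>] V_nn[of \<tau>] by (auto split: split_indicator)
  qed measurable
  also have "(\<lambda>\<tau>. (K (\<kappa> - \<tau>) * indicator {t. \<epsilon> \<le> \<bar>t\<bar>} (\<kappa> - \<tau>)) * ((V \<kappa> - V \<tau>) * indicator {\<tau>. \<bar>\<kappa> - \<tau>\<bar> > \<epsilon>} \<tau>))
     = (\<lambda>\<tau>. indicator {\<tau>. \<bar>\<kappa> - \<tau>\<bar> > \<epsilon>} \<tau> *\<^sub>R ((V \<kappa> - V \<tau>) * K (\<kappa> - \<tau>)))"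
    by (auto split: split_indicator)
  finally show ?thesis by (simp add: set_integrable_def)
qed

text \<open>The excluded interval is symmetric about \<open>\<kappa>\<close>. Folding turns the
  truncated integral into half the integral of \<open>sdiff V \<kappa> y * K y\<close> over
  \<open>\<bar>y\<bar> > \<epsilon>\<close>, and that integrand is absolutely integrable on the
  whole line.\<close>

lemma V_pv:
  "((\<lambda>\<epsilon>. LINT \<tau> : {\<tau>. \<bar>\<kappa> - \<tau>\<bar> > \<epsilon>} | lborel. (V \<kappa> - V \<tau>) * K (\<kappa> - \<tau>))
    \<longlongrightarrow> 1 / 2 * (LINT y|lborel. sdiff V \<kappa> y * K y)) (at_right 0)"
proof -
  define T where "T \<epsilon> = (LINT \<tau> : {\<tau>. \<bar>\<kappa> - \<tau>\<bar> > \<epsilon>} | lborel. (V \<kappa> - V \<tau>) * K (\<kappa> - \<tau>))" for \<epsilon>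
  have T: "T \<epsilon> = 1 / 2 * (LINT y|lborel. sdiff V \<kappa> y * K y * indicator {y. \<bar>y\<bar> > \<epsilon>} y)" if "0 < \<epsilon>" for \<epsilon>
  proof -
    define q where "q y = (V \<kappa> - V (\<kappa> - y)) * K y * indicator {y. \<bar>y\<bar> > \<epsilon>} y" for y
    have e1: "(\<lambda>\<tau>. indicator {\<tau>. \<bar>\<kappa> - \<tau>\<bar> > \<epsilon>} \<tau> *\<^sub>R ((V \<kappa> - V \<tau>) * K (\<kappa> - \<tau>))) = (\<lambda>\<tau>. q (\<kappa> - \<tau>))"
      by (auto simp: q_def split: split_indicator)
    have iq: "integrable lborel q"
      using V_set_integrable[OF that, of \<kappa>] unfolding set_integrable_def e1
      by (simp add: lborel_integrable_reflect_iff)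
    have iq': "integrable lborel (\<lambda>y. q (0 - y))"
      using iq by (subst lborel_integrable_reflect_iff)
    have "T \<epsilon> = (LINT y|lborel. q y)"
      unfolding T_def set_lebesgue_integral_def e1 by (rule lborel_integral_reflect)
    also have "\<dots> = 1 / 2 * (LINT y|lborel. q y + q (0 - y))"
      using iq iq' lborel_integral_reflect[of q 0] by simp
    also have "(\<lambda>y. q y + q (0 - y)) = (\<lambda>y. sdiff V \<kappa> y * K y * indicator {y. \<bar>y\<bar> > \<epsilon>} y)"
      using symdec_minus[OF K] by (auto simp: q_def sdiff_def algebra_simps split: split_indicator)
    finally show ?thesis .
  qed
  have "(T \<longlongrightarrow> 1 / 2 * (LINT y|lborel. sdiff V \<kappa> y * K y)) (at_right 0)"
    unfolding tendsto_at_iff_sequentially comp_def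
  proof (intro allI impI)
    fix X :: "nat \<Rightarrow> real" assume X: "\<forall>i. X i \<in> {0<..} - {0}" "X \<longlonglongrightarrow> 0"
    have "(\<lambda>n. LINT y|lborel. sdiff V \<kappa> y * K y * indicator {y. \<bar>y\<bar> > X n} y) \<longlonglongrightarrow> (LINT y|lborel. sdiff V \<kappa> y * K y)"
    proof (rule integral_dominated_convergence)
      show "integrable lborel (\<lambda>y. \<bar>sdiff V \<kappa> y * K y\<bar>)" using V_equation(1) by (rule integrable_abs)
      show "AE y in lborel. (\<lambda>n. sdiff V \<kappa> y * K y * indicator {y. \<bar>y\<bar> > X n} y) \<longlonglongrightarrow> sdiff V \<kappa> y * K y"
        using AE_nonzero
      proof eventually_elim
        case (elim y)
        have "eventually (\<lambda>n. X n < \<bar>y\<bar>) sequentially"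
          using X(2) by (rule order_tendstoD) (use elim in auto)
        then have "eventually (\<lambda>n. sdiff V \<kappa> y * K y * indicator {y. \<bar>y\<bar> > X n} y = sdiff V \<kappa> y * K y) sequentially"
          by eventually_elim simp
        then show ?case by (rule tendsto_eventually)
      qed
      show "AE y in lborel. norm (sdiff V \<kappa> y * K y * indicator {y. \<bar>y\<bar> > X n} y) \<le> \<bar>sdiff V \<kappa> y * K y\<bar>" for n
        by (intro AE_I2) (auto split: split_indicator)
    qed (unfold sdiff_def, measurable)
    then have "(\<lambda>n. 1 / 2 * (LINT y|lborel. sdiff V \<kappa> y * K y * indicator {y. \<bar>y\<bar> > X n} y)) \<longlonglongrightarrow> 1 / 2 * (LINT y|lborel. sdiff V \<kappa> y * K y)"
      by (intro tendsto_intros)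
    moreover have "T (X n) = 1 / 2 * (LINT y|lborel. sdiff V \<kappa> y * K y * indicator {y. \<bar>y\<bar> > X n} y)" for n
      by (rule T) (use X(1) in auto)
    ultimately show "(\<lambda>n. T (X n)) \<longlonglongrightarrow> 1 / 2 * (LINT y|lborel. sdiff V \<kappa> y * K y)"
      by presburger
  qed
  then show ?thesis unfolding T_def .
qed

lemma V_classical:
  "\<exists>Tv. (\<forall>\<epsilon>>0. set_integrable lborel {\<tau>. \<bar>\<kappa> - \<tau>\<bar> > \<epsilon>} (\<lambda>\<tau>. (V \<kappa> - V \<tau>) * K (\<kappa> - \<tau>))) \<and>
     ((\<lambda>\<epsilon>. LINT \<tau> : {\<tau>. \<bar>\<kappa> - \<tau>\<bar> > \<epsilon>} | lborel. (V \<kappa> - V \<tau>) * K (\<kappa> - \<tau>)) \<longlongrightarrow> Tv) (at_right 0) \<and>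
     Tv + A * V \<kappa> = V \<kappa> powr p"
  using V_set_integrable V_pv[of \<kappa>] V_equation(2)[of \<kappa>]
  by (intro exI[of _ "1 / 2 * (LINT y|lborel. sdiff V \<kappa> y * K y)"]) (auto simp: f_def)

end

section \<open>Finite energy and the weak formulation\<close>

lemma abs_mult_le_squares: "\<bar>a * b\<bar> \<le> a\<^sup>2 + b\<^sup>2" for a b :: real
proof -
  have "2 * (\<bar>a\<bar> * \<bar>b\<bar>) \<le> a\<^sup>2 + b\<^sup>2" using sum_squares_bound[of "\<bar>a\<bar>" "\<bar>b\<bar>"] by simp
  moreover have "0 \<le> \<bar>a\<bar> * \<bar>b\<bar>" by simp
  ultimately show ?thesis unfolding abs_mult by linarith
qed

lemma integrable_mult_L2:
  fixes u v :: "real \<Rightarrow> real"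
  assumes [measurable]: "u \<in> borel_measurable borel" "v \<in> borel_measurable borel"
    and u: "integrable lborel (\<lambda>x. (u x)\<^sup>2)" and v: "integrable lborel (\<lambda>x. (v x)\<^sup>2)"
  shows "integrable lborel (\<lambda>x. u x * v x)"
proof (rule Bochner_Integration.integrable_bound)
  show "integrable lborel (\<lambda>x. (u x)\<^sup>2 + (v x)\<^sup>2)" using u v by simp
  have "\<bar>u x * v x\<bar> \<le> (u x)\<^sup>2 + (v x)\<^sup>2" for x
    by (rule abs_mult_le_squares)
  then show "AE x in lborel. norm (u x * v x) \<le> norm ((u x)\<^sup>2 + (v x)\<^sup>2)" by simp
qed measurable

context green_solution
begin

lemma V_diff_abs:
  obtains H where "0 \<le> H" "\<And>x y. \<bar>V x - V (x - y)\<bar> \<le> H * \<bar>y\<bar> powr b"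
proof -
  obtain H where H: "0 \<le> H" "\<And>x h. 0 \<le> h \<Longrightarrow> \<bar>V (x + h) - V x\<bar> \<le> H * h powr b" using V_holder by blast
  have "\<bar>V x - V (x - y)\<bar> \<le> H * \<bar>y\<bar> powr b" for x y
    using H(2)[of y "x - y"] H(2)[of "- y" x] by (cases "0 \<le> y") (auto simp: abs_minus_commute)
  then show ?thesis using that H(1) by blast
qed

lemma V_diff_L1: "(\<integral>\<^sup>+x. ennreal \<bar>V x - V (x - y)\<bar> \<partial>lborel) \<le> ennreal (4 * V 0 * \<bar>y\<bar>)"
proof (cases "0 \<le> y")
  case True
  have "(\<integral>\<^sup>+x. ennreal \<bar>V x - V (x - y)\<bar> \<partial>lborel) = (\<integral>\<^sup>+x. ennreal \<bar>V (x + y) - V x\<bar> \<partial>lborel)"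
    using nn_integral_translate[of "\<lambda>x. ennreal \<bar>V (x + y) - V x\<bar>" "- y"] by simp
  then show ?thesis using nn_integral_symdec_diff[OF V_sym V_le True] True by simp
next
  case False
  then have "(\<integral>\<^sup>+x. ennreal \<bar>V (x + (- y)) - V x\<bar> \<partial>lborel) \<le> ennreal (4 * V 0 * (- y))"
    by (intro nn_integral_symdec_diff[OF V_sym V_le]) simp
  then show ?thesis using False by (simp add: abs_minus_commute)
qed

text \<open>For short jumps one factor of the square is bounded by the Hoelder estimate and the
  other in L1 over \<open>x\<close>; the Hoelder bound on both would give no decay in
  \<open>x\<close>. This leaves the power \<open>b - 2 * s\<close>, integrable since
  \<open>b > s > 2 * s - 1\<close>. Long jumps use that \<open>V\<close> is square
  integrable.\<close>

lemma V_energy: "(\<integral>\<^sup>+ \<kappa>. \<integral>\<^sup>+ \<tau>. ennreal ((V \<kappa> - V \<tau>)\<^sup>2 * K (\<kappa> - \<tau>)) \<partial>lborel \<partial>lborel) < \<infinity>"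
proof -
  obtain H where H: "0 \<le> H" "\<And>x y. \<bar>V x - V (x - y)\<bar> \<le> H * \<bar>y\<bar> powr b" using V_diff_abs by blast
  define I where "I = (LINT x|lborel. (V x)\<^sup>2)"
  have I: "0 \<le> I" unfolding I_def by (intro Bochner_Integration.integral_nonneg) simp
  have V00: "0 \<le> V 0" by (rule V_nn)
  define w where "w y = 4 * V 0 * H * C * (\<bar>y\<bar> powr (b - 2 * s) * indicator {-1..1} y)
     + 4 * I * C * (\<bar>y\<bar> powr (-1 - 2 * s) * indicator {y. 1 \<le> \<bar>y\<bar>} y)" for y
  have iw: "integrable lborel w"
    unfolding w_def[abs_def] using b s
    by (intro Bochner_Integration.integrable_add integrable_mult_right powr_near_zero_integrable powr_at_infinity_integrable) auto
  have w0: "0 \<le> w y" for y using V00 H(1) C I by (simp add: w_def)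
  have le: "(\<integral>\<^sup>+x. ennreal ((V x - V (x - y))\<^sup>2 * K y) \<partial>lborel) \<le> ennreal (w y)" if y: "y \<noteq> 0" for y
  proof (cases "\<bar>y\<bar> \<le> 1")
    case True
    define q where "q = H * \<bar>y\<bar> powr b * (C * \<bar>y\<bar> powr (-1 - 2 * s))"
    have q: "0 \<le> q" using H(1) C by (simp add: q_def)
    have "(V x - V (x - y))\<^sup>2 * K y \<le> q * \<bar>V x - V (x - y)\<bar>" for x
    proof -
      have "(V x - V (x - y))\<^sup>2 * K y = \<bar>V x - V (x - y)\<bar> * K y * \<bar>V x - V (x - y)\<bar>"
        by (simp add: power2_eq_square mult_ac flip: abs_mult)
      also have "\<dots> \<le> q * \<bar>V x - V (x - y)\<bar>"
        unfolding q_def using H(2) K_upper_abs[OF y] K_nn H(1) by (intro mult_right_mono mult_mono) auto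
      finally show ?thesis .
    qed
    then have "(\<integral>\<^sup>+x. ennreal ((V x - V (x - y))\<^sup>2 * K y) \<partial>lborel) \<le> (\<integral>\<^sup>+x. ennreal q * ennreal \<bar>V x - V (x - y)\<bar> \<partial>lborel)"
      using q by (intro nn_integral_mono) (simp add: ennreal_mult[symmetric] ennreal_leI)
    also have "\<dots> = ennreal q * (\<integral>\<^sup>+x. ennreal \<bar>V x - V (x - y)\<bar> \<partial>lborel)"
      by (intro nn_integral_cmult) measurable
    also have "\<dots> \<le> ennreal q * ennreal (4 * V 0 * \<bar>y\<bar>)" by (intro mult_left_mono V_diff_L1) simp
    also have "\<dots> = ennreal (q * (4 * V 0 * \<bar>y\<bar>))" using q V00 by (intro ennreal_mult[symmetric]) auto
    also have "q * (4 * V 0 * \<bar>y\<bar>) = 4 * V 0 * H * C * (\<bar>y\<bar> powr b * \<bar>y\<bar> powr (-1 - 2 * s) * \<bar>y\<bar> powr 1)"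
      using y by (simp add: q_def)
    also have "\<bar>y\<bar> powr b * \<bar>y\<bar> powr (-1 - 2 * s) * \<bar>y\<bar> powr 1 = \<bar>y\<bar> powr (b - 2 * s)"
      by (simp only: powr_add[symmetric]) simp
    also have "4 * V 0 * H * C * \<bar>y\<bar> powr (b - 2 * s) \<le> w y"
    proof -
      have "y \<in> {-1..1}" using True by auto
      then show ?thesis using I C by (simp add: w_def)
    qed
    finally show ?thesis by (simp add: ennreal_leI)
  next
    case False
    have "(V x - V (x - y))\<^sup>2 * K y \<le> 2 * K y * ((V x)\<^sup>2 + (V (x - y))\<^sup>2)" for x
    proof -
      have "0 \<le> (V x + V (x - y))\<^sup>2" by simp
      then have "(V x - V (x - y))\<^sup>2 \<le> 2 * ((V x)\<^sup>2 + (V (x - y))\<^sup>2)" by (simp add: power2_eq_square algebra_simps)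
      then have "(V x - V (x - y))\<^sup>2 * K y \<le> 2 * ((V x)\<^sup>2 + (V (x - y))\<^sup>2) * K y" using K_nn by (rule mult_right_mono)
      then show ?thesis by (simp add: mult_ac)
    qed
    then have "(\<integral>\<^sup>+x. ennreal ((V x - V (x - y))\<^sup>2 * K y) \<partial>lborel) \<le> (\<integral>\<^sup>+x. ennreal (2 * K y * ((V x)\<^sup>2 + (V (x - y))\<^sup>2)) \<partial>lborel)"
      by (intro nn_integral_mono ennreal_leI)
    also have "\<dots> = ennreal (LINT x|lborel. 2 * K y * ((V x)\<^sup>2 + (V (x - y))\<^sup>2))"
      using V2_int lborel_integrable_translate_iff[of "\<lambda>x. (V x)\<^sup>2" "- y"] K_nn
      by (intro nn_integral_eq_integral) auto
    also have "(LINT x|lborel. 2 * K y * ((V x)\<^sup>2 + (V (x - y))\<^sup>2)) = 4 * K y * I"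
      using V2_int lborel_integrable_translate_iff[of "\<lambda>x. (V x)\<^sup>2" "- y"] lborel_integral_translate[of "\<lambda>x. (V x)\<^sup>2" "- y"]
      by (simp add: I_def)
    also have "4 * K y * I \<le> 4 * (C * \<bar>y\<bar> powr (-1 - 2 * s)) * I"
      using K_upper_abs[OF y] I by (intro mult_right_mono mult_left_mono) auto
    also have "\<dots> = w y"
    proof -
      have "y \<notin> {-1..1}" "1 \<le> \<bar>y\<bar>" using False by auto
      then show ?thesis by (simp add: w_def)
    qed
    finally show ?thesis by (simp add: ennreal_leI)
  qed
  have "(\<integral>\<^sup>+ \<kappa>. \<integral>\<^sup>+ \<tau>. ennreal ((V \<kappa> - V \<tau>)\<^sup>2 * K (\<kappa> - \<tau>)) \<partial>lborel \<partial>lborel)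
     = (\<integral>\<^sup>+ \<kappa>. \<integral>\<^sup>+ y. ennreal ((V \<kappa> - V (\<kappa> - y))\<^sup>2 * K y) \<partial>lborel \<partial>lborel)"
  proof (rule nn_integral_cong)
    fix \<kappa>
    show "(\<integral>\<^sup>+ \<tau>. ennreal ((V \<kappa> - V \<tau>)\<^sup>2 * K (\<kappa> - \<tau>)) \<partial>lborel) = (\<integral>\<^sup>+ y. ennreal ((V \<kappa> - V (\<kappa> - y))\<^sup>2 * K y) \<partial>lborel)"
      using nn_integral_reflect[of "\<lambda>y. ennreal ((V \<kappa> - V (\<kappa> - y))\<^sup>2 * K y)" \<kappa>] by simp
  qed
  also have "\<dots> = (\<integral>\<^sup>+ y. \<integral>\<^sup>+ \<kappa>. ennreal ((V \<kappa> - V (\<kappa> - y))\<^sup>2 * K y) \<partial>lborel \<partial>lborel)"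
    by (rule lborel_pair.Fubini') measurable
  also have "\<dots> \<le> (\<integral>\<^sup>+ y. ennreal (w y) \<partial>lborel)"
  proof (rule nn_integral_mono_AE)
    show "AE y in lborel. (\<integral>\<^sup>+ \<kappa>. ennreal ((V \<kappa> - V (\<kappa> - y))\<^sup>2 * K y) \<partial>lborel) \<le> ennreal (w y)"
      using AE_nonzero by eventually_elim (rule le)
  qed
  also have "\<dots> = ennreal (LINT y|lborel. w y)"
    using iw w0 by (intro nn_integral_eq_integral) auto
  also have "\<dots> < \<infinity>" by simp
  finally show ?thesis .
qed

text \<open>Jumps up to length 1 are kept as second differences, since only their cancellation makes
  them integrable against \<open>K\<close>. For longer jumps, in \<open>F2\<close>, the terms are
  separated into a multiple of \<open>V\<close> and a convolution with an integrable kernel.\<close>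

definition F1 where "F1 x = (LINT y|lborel. \<bar>sdiff V x y\<bar> * K y * indicator {-1..1} y)"
definition K1 where "K1 y = K y * indicator {y. 1 \<le> \<bar>y\<bar>} y"
definition F2 where "F2 x = 2 * (LINT y|lborel. K1 y) * V x + 2 * conv K1 V x"

lemma F1_borel [measurable]: "F1 \<in> borel_measurable borel"
  unfolding F1_def[abs_def] sdiff_def by measurable

lemma K1_borel [measurable]: "K1 \<in> borel_measurable borel"
  unfolding K1_def[abs_def] by measurable

lemma F2_borel [measurable]: "F2 \<in> borel_measurable borel"
  unfolding F2_def[abs_def] by measurable

lemma K1_int: "integrable lborel K1"
  unfolding K1_def[abs_def] by (rule K_tail_integrable) simp

lemma K1_nn: "0 \<le> K1 y" using K_nn by (simp add: K1_def)

lemma sdiffK_int: "integrable lborel (\<lambda>y. \<bar>sdiff V x y\<bar> * K y)"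
proof -
  have "integrable lborel (\<lambda>y. \<bar>sdiff V x y * K y\<bar>)" using V_equation(1) by (rule integrable_abs)
  then show ?thesis using K_nn by (simp add: abs_mult)
qed

lemma F1_nn: "0 \<le> F1 x"
  unfolding F1_def using K_nn by (intro Bochner_Integration.integral_nonneg) simp

text \<open>\<open>F1\<close> is bounded and integrable. Both estimates place one difference on
  \<open>g\<close>; the other difference, on \<open>f\<close>, is bounded uniformly by its Hoelder
  modulus in one case and in L1 in the other.\<close>

lemma F1_sq_int: "integrable lborel (\<lambda>x. (F1 x)\<^sup>2)"
proof -
  obtain H where H: "0 \<le> H" "\<And>x h. 0 \<le> h \<Longrightarrow> \<bar>f (x + h) - f x\<bar> \<le> H * h powr b" using f_holder by blast
  obtain B where B: "0 < B" "\<And>h. 0 \<le> h \<Longrightarrow> mass g h \<le> B * h powr b" using mass_g by blast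
  have f0: "0 \<le> f 0" using f_abs[of 0] by simp
  have i1: "integrable lborel (\<lambda>y. 2 * H * B * C * (\<bar>y\<bar> powr (2 * b - 1 - 2 * s) * indicator {-1..1} y))"
    using b s by (intro integrable_mult_right powr_near_zero_integrable) auto
  define B1 where "B1 = (LINT y|lborel. 2 * H * B * C * (\<bar>y\<bar> powr (2 * b - 1 - 2 * s) * indicator {-1..1} y))"
  have F1B: "\<bar>F1 x\<bar> \<le> B1" for x
  proof -
    have "F1 x \<le> B1"
      unfolding F1_def B1_def
    proof (rule integral_mono_AE[OF integrable_times_indicator[OF sdiffK_int] i1])
      show "AE y in lborel. \<bar>sdiff V x y\<bar> * K y * indicator {-1..1} y \<le> 2 * H * B * C * (\<bar>y\<bar> powr (2 * b - 1 - 2 * s) * indicator {-1..1} y)"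
        using AE_nonzero
      proof eventually_elim
        case (elim y)
        have "\<bar>sdiff V x y\<bar> = \<bar>sdiff (conv g f) x \<bar>y\<bar>\<bar>" by (simp add: sdiff_abs V_conv[symmetric])
        also have "\<dots> \<le> 2 * (H * \<bar>y\<bar> powr b) * mass g \<bar>y\<bar>"
          by (rule conv_sdiff_le[OF g g_int f_borel f_abs _ H(2)]) auto
        also have "\<dots> \<le> 2 * (H * \<bar>y\<bar> powr b) * (B * \<bar>y\<bar> powr b)"
          using B(2)[of "\<bar>y\<bar>"] H(1) by (intro mult_left_mono) auto
        finally have "\<bar>sdiff V x y\<bar> * K y \<le> 2 * (H * \<bar>y\<bar> powr b) * (B * \<bar>y\<bar> powr b) * (C * \<bar>y\<bar> powr (-1 - 2 * s))"
          using K_upper_abs[OF elim] K_nn H(1) B(1) by (intro mult_mono) auto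
        also have "\<dots> = 2 * H * B * C * (\<bar>y\<bar> powr b * \<bar>y\<bar> powr b * \<bar>y\<bar> powr (-1 - 2 * s))" by simp
        also have "\<bar>y\<bar> powr b * \<bar>y\<bar> powr b * \<bar>y\<bar> powr (-1 - 2 * s) = \<bar>y\<bar> powr (2 * b - 1 - 2 * s)"
          by (simp only: powr_add[symmetric]) (simp add: add_diff_eq)
        finally have "\<bar>sdiff V x y\<bar> * K y \<le> 2 * H * B * C * \<bar>y\<bar> powr (2 * b - 1 - 2 * s)" .
        then show ?case by (auto split: split_indicator)
      qed
    qed simp
    then show ?thesis using F1_nn[of x] by simp
  qed
  have i2: "integrable lborel (\<lambda>y. 8 * B * f 0 * C * (\<bar>y\<bar> powr (b - 2 * s) * indicator {-1..1} y))"
    using b s by (intro integrable_mult_right powr_near_zero_integrable) auto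
  have "(\<integral>\<^sup>+x. ennreal (F1 x) \<partial>lborel) = (\<integral>\<^sup>+x. \<integral>\<^sup>+y. ennreal (\<bar>sdiff V x y\<bar> * K y * indicator {-1..1} y) \<partial>lborel \<partial>lborel)"
    unfolding F1_def using K_nn
    by (intro nn_integral_cong nn_integral_eq_integral[symmetric] integrable_times_indicator sdiffK_int) auto
  also have "\<dots> = (\<integral>\<^sup>+y. \<integral>\<^sup>+x. ennreal (\<bar>sdiff V x y\<bar> * K y * indicator {-1..1} y) \<partial>lborel \<partial>lborel)"
    unfolding sdiff_def by (rule lborel_pair.Fubini') measurable
  also have "\<dots> \<le> (\<integral>\<^sup>+y. ennreal (8 * B * f 0 * C * (\<bar>y\<bar> powr (b - 2 * s) * indicator {-1..1} y)) \<partial>lborel)"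
  proof (rule nn_integral_mono_AE)
    show "AE y in lborel. (\<integral>\<^sup>+x. ennreal (\<bar>sdiff V x y\<bar> * K y * indicator {-1..1} y) \<partial>lborel)
       \<le> ennreal (8 * B * f 0 * C * (\<bar>y\<bar> powr (b - 2 * s) * indicator {-1..1} y))"
      using AE_nonzero
    proof eventually_elim
      case (elim y)
      have "(\<integral>\<^sup>+x. ennreal (\<bar>sdiff V x y\<bar> * K y) \<partial>lborel) \<le> ennreal (8 * B * f 0 * C * \<bar>y\<bar> powr (b - 2 * s))"
      proof -
        have "(\<integral>\<^sup>+x. ennreal (\<bar>sdiff V x y\<bar> * K y) \<partial>lborel) = (\<integral>\<^sup>+x. ennreal \<bar>sdiff V x \<bar>y\<bar>\<bar> * ennreal (K y) \<partial>lborel)"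
          using K_nn by (simp add: ennreal_mult sdiff_abs)
        also have "\<dots> = (\<integral>\<^sup>+x. ennreal \<bar>sdiff V x \<bar>y\<bar>\<bar> \<partial>lborel) * ennreal (K y)"
          unfolding sdiff_def by (intro nn_integral_multc) measurable
        also have "\<dots> \<le> ennreal (2 * mass g \<bar>y\<bar> * (4 * f 0 * \<bar>y\<bar>)) * ennreal (K y)"
          using nn_integral_conv_sdiff[OF g g_int f_sym f_le, of "\<bar>y\<bar>"]
          by (intro mult_right_mono) (simp_all add: V_conv[symmetric])
        also have "\<dots> = ennreal (2 * mass g \<bar>y\<bar> * (4 * f 0 * \<bar>y\<bar>) * K y)"
          using mass_nonneg[OF g] f0 K_nn by (intro ennreal_mult[symmetric]) auto
        also have "2 * mass g \<bar>y\<bar> * (4 * f 0 * \<bar>y\<bar>) * K y \<le> 2 * (B * \<bar>y\<bar> powr b) * (4 * f 0 * \<bar>y\<bar>) * (C * \<bar>y\<bar> powr (-1 - 2 * s))"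
          using B(2)[of "\<bar>y\<bar>"] mass_nonneg[OF g, of "\<bar>y\<bar>"] f0 K_nn B(1) K_upper_abs[OF elim]
          by (intro mult_mono) auto
        also have "\<dots> = 8 * B * f 0 * C * (\<bar>y\<bar> powr b * \<bar>y\<bar> powr (-1 - 2 * s) * \<bar>y\<bar> powr 1)"
          using elim by simp
        also have "\<bar>y\<bar> powr b * \<bar>y\<bar> powr (-1 - 2 * s) * \<bar>y\<bar> powr 1 = \<bar>y\<bar> powr (b - 2 * s)"
          by (simp only: powr_add[symmetric]) simp
        finally show ?thesis by (simp add: ennreal_leI)
      qed
      then show ?case by (auto split: split_indicator)
    qed
  qed
  also have "\<dots> = ennreal (LINT y|lborel. 8 * B * f 0 * C * (\<bar>y\<bar> powr (b - 2 * s) * indicator {-1..1} y))"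
    using i2 B(1) f0 C by (intro nn_integral_eq_integral) auto
  finally have nn: "(\<integral>\<^sup>+x. ennreal (F1 x) \<partial>lborel) \<le> ennreal (LINT y|lborel. 8 * B * f 0 * C * (\<bar>y\<bar> powr (b - 2 * s) * indicator {-1..1} y))" .
  have "integrable lborel F1"
    by (intro integrableI_bounded) (auto simp: F1_nn order_le_less_trans[OF nn])
  then show ?thesis
    unfolding power2_eq_square by (rule integrable_mult_bounded[OF _ F1_borel F1B])
qed

text \<open>\<open>K1\<close> vanishes near the origin and decays fast, so it lies below a multiple
  of the power \<open>b3 - 1\<close>. Convolution with it costs \<open>V\<close> the decay
  \<open>b3 = b2 / 2\<close>, small enough that \<open>2 * (e0 - b2 - b3) > 1\<close> remains
  true.\<close>

lemma F2_sq_int: "integrable lborel (\<lambda>x. (F2 x)\<^sup>2)"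
proof -
  define b3 where "b3 = b2 / 2"
  have b3: "0 < b3" "b3 < e0 - b2" "e0 - b2 < 1" "2 * (e0 - b2 - b3) > 1"
    using exps b2 by (auto simp: b3_def b2_def)
  obtain M where M: "0 \<le> M" "\<And>x. x \<noteq> 0 \<Longrightarrow> V x \<le> M * \<bar>x\<bar> powr (b2 - e0)"
    using sol_decay[OF V] by blast
  have 1: "\<bar>K1 z\<bar> \<le> C * \<bar>z\<bar> powr (b3 - 1)" if z: "z \<noteq> 0" for z
  proof (cases "1 \<le> \<bar>z\<bar>")
    case True
    have "K z \<le> C * \<bar>z\<bar> powr (-1 - 2 * s)" by (rule K_upper_abs[OF z])
    also have "\<dots> \<le> C * \<bar>z\<bar> powr (b3 - 1)" using True b3 s C by (intro mult_left_mono powr_mono) auto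
    finally show ?thesis using True K_nn by (simp add: K1_def)
  qed (use C in \<open>simp add: K1_def\<close>)
  have 2: "\<bar>V y\<bar> \<le> M * \<bar>y\<bar> powr (- (e0 - b2))" if "y \<noteq> 0" for y using M(2)[OF that] V_nn[of y] by simp
  have "\<exists>M'\<ge>0. \<forall>x. x \<noteq> 0 \<longrightarrow> \<bar>conv K1 V x\<bar> \<le> M' * \<bar>x\<bar> powr (b3 - (e0 - b2))"
  proof (rule conv_power_bound[OF b3(1-3) K1_borel V_borel 1 2])
    fix M' assume "0 \<le> M'" "\<And>x. x \<noteq> 0 \<Longrightarrow> \<bar>conv K1 V x\<bar> \<le> M' * \<bar>x\<bar> powr (b3 - (e0 - b2))"
    then show ?thesis by blast
  qed
  then obtain M' where M': "0 \<le> M'" "\<And>x. x \<noteq> 0 \<Longrightarrow> \<bar>conv K1 V x\<bar> \<le> M' * \<bar>x\<bar> powr (b3 - (e0 - b2))" by blast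
  define Kt where "Kt = (LINT y|lborel. \<bar>K1 y\<bar>)"
  have cb: "\<bar>conv K1 V x\<bar> \<le> V 0 * Kt" for x
    unfolding Kt_def by (rule conv_bdd_le[OF K1_int V_borel V_abs])
  have ci: "integrable lborel (\<lambda>x. (conv K1 V x)\<^sup>2)"
  proof (rule powr_split_integrable)
    show "- 1 < (0::real)" "2 * (b3 - (e0 - b2)) < - 1" using b3 by auto
    show "\<bar>(conv K1 V x)\<^sup>2\<bar> \<le> (V 0 * Kt)\<^sup>2 * \<bar>x\<bar> powr 0" if "x \<noteq> 0" for x
      using power_mono[OF cb[of x], of 2] that by simp
    show "\<bar>(conv K1 V x)\<^sup>2\<bar> \<le> M'\<^sup>2 * \<bar>x\<bar> powr (2 * (b3 - (e0 - b2)))" if "1 \<le> \<bar>x\<bar>" for x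
    proof -
      have x: "x \<noteq> 0" using that by auto
      have "\<bar>conv K1 V x\<bar>\<^sup>2 \<le> (M' * \<bar>x\<bar> powr (b3 - (e0 - b2)))\<^sup>2" using M'(2)[OF x] by (intro power_mono) auto
      also have "\<dots> = M'\<^sup>2 * \<bar>x\<bar> powr (2 * (b3 - (e0 - b2)))"
        using x by (simp add: power_mult_distrib powr_power mult.commute)
      finally show ?thesis by simp
    qed
  qed measurable
  define k1 where "k1 = (LINT y|lborel. K1 y)"
  show ?thesis
  proof (rule Bochner_Integration.integrable_bound)
    show "integrable lborel (\<lambda>x. 8 * k1\<^sup>2 * (V x)\<^sup>2 + 8 * (conv K1 V x)\<^sup>2)" using V2_int ci by simp
    have "(F2 x)\<^sup>2 \<le> 8 * k1\<^sup>2 * (V x)\<^sup>2 + 8 * (conv K1 V x)\<^sup>2" for x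
    proof -
      have "0 \<le> (2 * (k1 * V x) - 2 * conv K1 V x)\<^sup>2" by simp
      moreover have "F2 x = 2 * (k1 * V x) + 2 * conv K1 V x" by (simp add: F2_def k1_def)
      ultimately show ?thesis by (simp add: power2_eq_square algebra_simps)
    qed
    then show "AE x in lborel. norm ((F2 x)\<^sup>2) \<le> norm (8 * k1\<^sup>2 * (V x)\<^sup>2 + 8 * (conv K1 V x)\<^sup>2)" by simp
  qed measurable
qed

lemma sdiffK_le: "(LINT y|lborel. \<bar>sdiff V x y\<bar> * K y) \<le> F1 x + F2 x"
proof -
  have iK1: "integrable lborel (\<lambda>y. V (x - y) * K1 y)"
    using conv_bdd_integrable[OF K1_int V_borel V_abs, where x=x]
      lborel_integrable_reflect_iff[of "\<lambda>y. K1 (x - y) * V y" x] by (simp add: mult.commute)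
  have K1m: "K1 (- y) = K1 y" for y using symdec_minus[OF K] by (simp add: K1_def indicator_def)
  have iK1': "integrable lborel (\<lambda>y. V (x + y) * K1 y)"
    using iK1 lborel_integrable_reflect_iff[of "\<lambda>y. V (x - y) * K1 y" 0] by (simp add: K1m)
  have c1: "(LINT y|lborel. V (x - y) * K1 y) = conv K1 V x"
    unfolding conv_alt by (simp add: mult.commute)
  have c2: "(LINT y|lborel. V (x + y) * K1 y) = conv K1 V x"
    using c1 lborel_integral_reflect[of "\<lambda>y. V (x - y) * K1 y" 0] by (simp add: K1m)
  have "(LINT y|lborel. \<bar>sdiff V x y\<bar> * K y) \<le> (LINT y|lborel. \<bar>sdiff V x y\<bar> * K y * indicator {-1..1} y
      + (2 * V x * K1 y + V (x - y) * K1 y + V (x + y) * K1 y))"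
  proof (rule integral_mono[OF sdiffK_int])
    show "integrable lborel (\<lambda>y. \<bar>sdiff V x y\<bar> * K y * indicator {-1..1} y
      + (2 * V x * K1 y + V (x - y) * K1 y + V (x + y) * K1 y))"
      using K1_int iK1 iK1'
      by (intro Bochner_Integration.integrable_add integrable_times_indicator sdiffK_int) auto
    fix y
    show "\<bar>sdiff V x y\<bar> * K y \<le> \<bar>sdiff V x y\<bar> * K y * indicator {-1..1} y
      + (2 * V x * K1 y + V (x - y) * K1 y + V (x + y) * K1 y)"
    proof (cases "y \<in> {-1..1}")
      case True
      then show ?thesis using V_nn K1_nn by simp
    next
      case False
      then have "1 \<le> \<bar>y\<bar>" by auto
      then have K1y: "K1 y = K y" by (simp add: K1_def)
      have "\<bar>sdiff V x y\<bar> \<le> 2 * V x + V (x - y) + V (x + y)"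
        using V_nn[of x] V_nn[of "x - y"] V_nn[of "x + y"] unfolding sdiff_def by linarith
      then have "\<bar>sdiff V x y\<bar> * K y \<le> (2 * V x + V (x - y) + V (x + y)) * K y"
        using K_nn by (rule mult_right_mono)
      then show ?thesis using False unfolding K1y by (simp add: distrib_right)
    qed
  qed
  also have "\<dots> = F1 x + F2 x"
    using K1_int iK1 iK1' integrable_times_indicator[OF sdiffK_int] by (simp add: F1_def F2_def c1 c2)
  finally show ?thesis .
qed

definition Tn where "Tn n x = k (d n) * V x - conv (Kd (d n)) V x"

lemma Tn_eq: "Tn n x = 1 / 2 * (LINT y|lborel. sdiff V x y * Kd (d n) y)"
  using Kd_sdiff_integral[OF d(1) V_borel V_abs] by (simp add: Tn_def)

lemma sdiff_Kd_le: "\<bar>sdiff V x y * Kd (d n) y\<bar> \<le> \<bar>sdiff V x y\<bar> * K y"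
proof (cases "y = 0")
  case False
  then show ?thesis using Kd_le_K[OF d(1) False, of n] Kd_nn by (simp add: abs_mult mult_left_mono)
qed (simp add: sdiff_def)

lemma Tn_lim: "(\<lambda>n. Tn n x) \<longlonglongrightarrow> f x - A * V x"
proof -
  have "(\<lambda>n. LINT y|lborel. sdiff V x y * Kd (d n) y) \<longlonglongrightarrow> (LINT y|lborel. sdiff V x y * K y)"
  proof (rule integral_dominated_convergence[OF _ _ sdiffK_int])
    show "AE y in lborel. norm (sdiff V x y * Kd (d n) y) \<le> \<bar>sdiff V x y\<bar> * K y" for n
      using sdiff_Kd_le by simp
    show "AE y in lborel. (\<lambda>n. sdiff V x y * Kd (d n) y) \<longlonglongrightarrow> sdiff V x y * K y"
      using AE_nonzero by eventually_elim (intro tendsto_intros tendsto_eventually Kd_ev)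
  qed (unfold sdiff_def, measurable)
  then have "(\<lambda>n. 1 / 2 * (LINT y|lborel. sdiff V x y * Kd (d n) y)) \<longlonglongrightarrow> 1 / 2 * (LINT y|lborel. sdiff V x y * K y)"
    by (intro tendsto_intros)
  moreover have e: "1 / 2 * (LINT y|lborel. sdiff V x y * K y) = f x - A * V x" using V_equation(2)[of x] by linarith
  ultimately show ?thesis unfolding Tn_eq e by blast
qed

lemma Tn_le: "\<bar>Tn n x\<bar> \<le> F1 x + F2 x"
proof -
  have "\<bar>LINT y|lborel. sdiff V x y * Kd (d n) y\<bar> \<le> (LINT y|lborel. \<bar>sdiff V x y * Kd (d n) y\<bar>)"
    by (rule integral_abs_bound)
  also have "\<dots> \<le> (LINT y|lborel. \<bar>sdiff V x y\<bar> * K y)"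
    using K_nn by (intro integral_mono'[OF sdiffK_int] sdiff_Kd_le) simp
  also have "\<dots> \<le> F1 x + F2 x" by (rule sdiffK_le)
  finally show ?thesis unfolding Tn_eq by simp
qed

lemma integrable_energy_pair:
  fixes u :: "real \<Rightarrow> real"
  assumes [measurable]: "u \<in> borel_measurable borel"
    and fin: "(\<integral>\<^sup>+ \<kappa>. \<integral>\<^sup>+ \<tau>. ennreal ((u \<kappa> - u \<tau>)\<^sup>2 * K (\<kappa> - \<tau>)) \<partial>lborel \<partial>lborel) < \<infinity>"
  shows "integrable (lborel \<Otimes>\<^sub>M lborel) (\<lambda>(x, y). (u x - u y)\<^sup>2 * K (x - y))"
proof (rule integrableI_bounded)
  show "(\<lambda>(x, y). (u x - u y)\<^sup>2 * K (x - y)) \<in> borel_measurable (lborel \<Otimes>\<^sub>M lborel)" by measurable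
  have "(\<integral>\<^sup>+z. ennreal (norm (case z of (x, y) \<Rightarrow> (u x - u y)\<^sup>2 * K (x - y))) \<partial>(lborel \<Otimes>\<^sub>M lborel))
    = (\<integral>\<^sup>+ \<kappa>. \<integral>\<^sup>+ \<tau>. ennreal (norm (case (\<kappa>, \<tau>) of (x, y) \<Rightarrow> (u x - u y)\<^sup>2 * K (x - y))) \<partial>lborel \<partial>lborel)"
    by (rule lborel.nn_integral_fst[symmetric]) measurable
  then show "(\<integral>\<^sup>+z. ennreal (norm (case z of (x, y) \<Rightarrow> (u x - u y)\<^sup>2 * K (x - y))) \<partial>(lborel \<Otimes>\<^sub>M lborel)) < \<infinity>"
    using fin K_nn by (simp add: abs_mult)
qed

text \<open>For the bounded kernels \<open>Kd\<close> the weak form is Fubini's theorem; the limit uses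
  \<open>\<bar>Tn\<bar> \<le> F1 + F2\<close>, a square integrable majorant.\<close>

lemma V_weak:
  assumes \<phi>m [measurable]: "\<phi> \<in> borel_measurable borel" and \<phi>2: "integrable lborel (\<lambda>x. (\<phi> x)\<^sup>2)"
    and fin: "(\<integral>\<^sup>+ \<kappa>. \<integral>\<^sup>+ \<tau>. ennreal ((\<phi> \<kappa> - \<phi> \<tau>)\<^sup>2 * K (\<kappa> - \<tau>)) \<partial>lborel \<partial>lborel) < \<infinity>"
  shows "1 / 2 * (LINT \<kappa>|lborel. LINT \<tau>|lborel. (V \<kappa> - V \<tau>) * (\<phi> \<kappa> - \<phi> \<tau>) * K (\<kappa> - \<tau>))
      + A * (LINT \<kappa>|lborel. V \<kappa> * \<phi> \<kappa>) = (LINT \<kappa>|lborel. V \<kappa> powr p * \<phi> \<kappa>)"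
proof -
  define E where "E = (\<lambda>(x, y). (V x - V y) * (\<phi> x - \<phi> y) * K (x - y))"
  define En where "En n = (\<lambda>(x, y). (V x - V y) * (\<phi> x - \<phi> y) * Kd (d n) (x - y))" for n
  define Q where "Q = (\<lambda>(x, y). (V x - V y)\<^sup>2 * K (x - y) + (\<phi> x - \<phi> y)\<^sup>2 * K (x - y))"
  have [measurable]: "E \<in> borel_measurable (lborel \<Otimes>\<^sub>M lborel)" "En n \<in> borel_measurable (lborel \<Otimes>\<^sub>M lborel)" for n
    unfolding E_def En_def by measurable
  have Q: "integrable (lborel \<Otimes>\<^sub>M lborel) Q"
    using Bochner_Integration.integrable_add[OF integrable_energy_pair[OF V_borel V_energy] integrable_energy_pair[OF \<phi>m fin]]
    by (simp add: Q_def case_prod_unfold)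
  have le: "\<bar>(V x - V y) * (\<phi> x - \<phi> y)\<bar> \<le> (V x - V y)\<^sup>2 + (\<phi> x - \<phi> y)\<^sup>2" for x y
    by (rule abs_mult_le_squares)
  have EnQ: "norm (En n z) \<le> Q z" for n z
  proof (cases z)
    case (Pair x y)
    show ?thesis
    proof (cases "x = y")
      case False
      then have kk: "Kd (d n) (x - y) \<le> K (x - y)" by (intro Kd_le_K d(1)) simp
      have "norm (En n z) = \<bar>(V x - V y) * (\<phi> x - \<phi> y)\<bar> * Kd (d n) (x - y)"
        using Kd_nn by (simp add: En_def Pair abs_mult)
      also have "\<dots> \<le> ((V x - V y)\<^sup>2 + (\<phi> x - \<phi> y)\<^sup>2) * K (x - y)"
        using le kk Kd_nn by (intro mult_mono) auto
      finally show ?thesis by (simp add: Q_def Pair distrib_right)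
    qed (simp add: En_def Q_def Pair)
  qed
  have Elim: "(\<lambda>n. En n z) \<longlonglongrightarrow> E z" for z
  proof (cases z)
    case (Pair x y)
    show ?thesis
    proof (cases "x = y")
      case False
      then have "x - y \<noteq> 0" by simp
      then show ?thesis unfolding En_def E_def Pair prod.case
        by (intro tendsto_intros tendsto_eventually Kd_ev)
    qed (simp add: En_def E_def Pair)
  qed
  have lim1: "(\<lambda>n. integral\<^sup>L (lborel \<Otimes>\<^sub>M lborel) (En n)) \<longlonglongrightarrow> integral\<^sup>L (lborel \<Otimes>\<^sub>M lborel) E"
    by (rule integral_dominated_convergence[OF _ _ Q]) (use EnQ Elim in auto)
  have iE: "integrable (lborel \<Otimes>\<^sub>M lborel) E"
    by (rule integrable_dominated_convergence[OF _ _ Q, where s=En]) (use EnQ Elim in auto)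
  \<comment> \<open>Before the limit the terms with \<open>\<phi> x\<close> and
    \<open>\<phi> y\<close> are integrable separately, dominated through \<open>h\<close>.
    Exchanging the variables maps one to minus the other, whence the factor 2.\<close>
  have En2: "integral\<^sup>L (lborel \<Otimes>\<^sub>M lborel) (En n) = 2 * (LINT x|lborel. \<phi> x * Tn n x)" for n
  proof -
    define h where "h x = (V x)\<^sup>2 + (\<phi> x)\<^sup>2" for x
    have h: "integrable lborel h" unfolding h_def[abs_def] using V2_int \<phi>2 by simp
    note iK = Kd_integrable[OF d(1)[of n]]
    have Ksw: "Kd (d n) (x - y) = Kd (d n) (y - x)" for x y by (rule symdec_swap[OF symdec_Kd[OF d(1)]])
    have P1: "integrable (lborel \<Otimes>\<^sub>M lborel) (\<lambda>(x, y). Kd (d n) (x - y) * h x)"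
      using pair_integrable_conv[OF iK h] by (simp add: Ksw)
    have P2: "integrable (lborel \<Otimes>\<^sub>M lborel) (\<lambda>(x, y). Kd (d n) (x - y) * h y)"
      using lborel_pair.integrable_product_swap[OF pair_integrable_conv[OF iK h]] by (simp add: case_prod_unfold)
    define a1 where "a1 x y = (V x - V y) * \<phi> x * Kd (d n) (x - y)" for x y
    define a2 where "a2 x y = (V x - V y) * \<phi> y * Kd (d n) (x - y)" for x y
    have m: "case_prod a1 \<in> borel_measurable (lborel \<Otimes>\<^sub>M lborel)" "case_prod a2 \<in> borel_measurable (lborel \<Otimes>\<^sub>M lborel)"
      unfolding a1_def a2_def by measurable
    have bnd: "\<bar>(V x - V y) * t\<bar> \<le> h x + h y" if "t = \<phi> x \<or> t = \<phi> y" for x y t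
    proof -
      have "\<bar>(V x - V y) * t\<bar> \<le> \<bar>V x * t\<bar> + \<bar>V y * t\<bar>" by (simp add: left_diff_distrib abs_triangle_ineq4)
      also have "\<dots> \<le> ((V x)\<^sup>2 + t\<^sup>2) / 2 + ((V y)\<^sup>2 + t\<^sup>2) / 2"
        using sum_squares_bound[of "\<bar>V x\<bar>" "\<bar>t\<bar>"] sum_squares_bound[of "\<bar>V y\<bar>" "\<bar>t\<bar>"]
        by (intro add_mono) (simp_all add: abs_mult)
      also have "\<dots> = ((V x)\<^sup>2 + (V y)\<^sup>2) / 2 + t\<^sup>2" by (simp add: field_simps)
      also have "\<dots> \<le> h x + h y" using that by (auto simp: h_def)
      finally show ?thesis .
    qed
    have ia: "integrable (lborel \<Otimes>\<^sub>M lborel) (case_prod a1)" "integrable (lborel \<Otimes>\<^sub>M lborel) (case_prod a2)"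
    proof -
      have i: "integrable (lborel \<Otimes>\<^sub>M lborel) (\<lambda>z. (case z of (x, y) \<Rightarrow> Kd (d n) (x - y) * h x) + (case z of (x, y) \<Rightarrow> Kd (d n) (x - y) * h y))"
        using P1 P2 by (rule Bochner_Integration.integrable_add)
      have 1: "\<bar>a1 x y\<bar> \<le> Kd (d n) (x - y) * h x + Kd (d n) (x - y) * h y" for x y
        using mult_left_mono[OF bnd[of "\<phi> x" x y] Kd_nn[of n "x - y"]] Kd_nn[of n "x - y"]
        by (simp add: a1_def abs_mult distrib_left distrib_right mult_ac)
      have 2: "\<bar>a2 x y\<bar> \<le> Kd (d n) (x - y) * h x + Kd (d n) (x - y) * h y" for x y
        using mult_left_mono[OF bnd[of "\<phi> y" x y] Kd_nn[of n "x - y"]] Kd_nn[of n "x - y"]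
        by (simp add: a2_def abs_mult distrib_left distrib_right mult_ac)
      show "integrable (lborel \<Otimes>\<^sub>M lborel) (case_prod a1)"
        by (rule Bochner_Integration.integrable_bound[OF i m(1)])
          (use order_trans[OF 1 abs_ge_self] in auto)
      show "integrable (lborel \<Otimes>\<^sub>M lborel) (case_prod a2)"
        by (rule Bochner_Integration.integrable_bound[OF i m(2)])
          (use order_trans[OF 2 abs_ge_self] in auto)
    qed
    have iVK: "integrable lborel (\<lambda>y. Kd (d n) (x - y) * V y)" for x
      by (rule conv_bdd_integrable[OF iK V_borel V_abs])
    have iKx: "integrable lborel (\<lambda>y. Kd (d n) (x - y))" for x
      using iK by (subst lborel_integrable_reflect_iff)
    have TT: "(LINT y|lborel. (V x - V y) * Kd (d n) (x - y)) = Tn n x" for x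
    proof -
      have "(LINT y|lborel. (V x - V y) * Kd (d n) (x - y)) = (LINT y|lborel. V x * Kd (d n) (x - y) - Kd (d n) (x - y) * V y)"
        by (intro Bochner_Integration.integral_cong) (simp_all add: algebra_simps)
      also have "\<dots> = V x * k (d n) - conv (Kd (d n)) V x"
        using iVK[of x] iKx[of x] lborel_integral_reflect[of "Kd (d n)" x] by (simp add: conv_def k_def)
      finally show ?thesis by (simp add: Tn_def mult.commute)
    qed
    have e: "En n = (\<lambda>z. case_prod a1 z - case_prod a2 z)"
      by (auto simp: En_def a1_def a2_def algebra_simps)
    have "integral\<^sup>L (lborel \<Otimes>\<^sub>M lborel) (En n) = integral\<^sup>L (lborel \<Otimes>\<^sub>M lborel) (case_prod a1) - integral\<^sup>L (lborel \<Otimes>\<^sub>M lborel) (case_prod a2)"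
      unfolding e by (rule Bochner_Integration.integral_diff[OF ia])
    also have "integral\<^sup>L (lborel \<Otimes>\<^sub>M lborel) (case_prod a1) = (LINT x|lborel. LINT y|lborel. a1 x y)"
      using lborel_pair.integral_fst'[OF ia(1)] by simp
    also have "\<dots> = (LINT x|lborel. \<phi> x * Tn n x)"
    proof (rule Bochner_Integration.integral_cong[OF refl])
      fix x
      have "(LINT y|lborel. a1 x y) = (LINT y|lborel. \<phi> x * ((V x - V y) * Kd (d n) (x - y)))"
        by (simp add: a1_def mult_ac)
      then show "(LINT y|lborel. a1 x y) = \<phi> x * Tn n x" by (simp add: TT)
    qed
    also have "integral\<^sup>L (lborel \<Otimes>\<^sub>M lborel) (case_prod a2) = (LINT y|lborel. LINT x|lborel. a2 x y)"
      using lborel_pair.integral_snd[OF ia(2)] by simp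
    also have "\<dots> = (LINT y|lborel. - (\<phi> y * Tn n y))"
    proof (rule Bochner_Integration.integral_cong[OF refl])
      fix y
      have "(LINT x|lborel. a2 x y) = (LINT x|lborel. - \<phi> y * ((V y - V x) * Kd (d n) (y - x)))"
        by (intro Bochner_Integration.integral_cong) (simp_all add: a2_def Ksw[of _ y] algebra_simps)
      then show "(LINT x|lborel. a2 x y) = - (\<phi> y * Tn n y)" by (simp add: TT)
    qed
    finally show ?thesis by simp
  qed
  have Tm: "Tn n \<in> borel_measurable borel" for n unfolding Tn_def[abs_def] by measurable
  have lim2: "(\<lambda>n. LINT x|lborel. \<phi> x * Tn n x) \<longlonglongrightarrow> (LINT x|lborel. \<phi> x * (f x - A * V x))"
  proof (rule integral_dominated_convergence)
    show "integrable lborel (\<lambda>x. (\<phi> x)\<^sup>2 + 2 * (F1 x)\<^sup>2 + 2 * (F2 x)\<^sup>2)" using \<phi>2 F1_sq_int F2_sq_int by simp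
    show "AE x in lborel. (\<lambda>n. \<phi> x * Tn n x) \<longlonglongrightarrow> \<phi> x * (f x - A * V x)"
      by (intro AE_I2 tendsto_intros Tn_lim)
    show "AE x in lborel. norm (\<phi> x * Tn n x) \<le> (\<phi> x)\<^sup>2 + 2 * (F1 x)\<^sup>2 + 2 * (F2 x)\<^sup>2" for n
    proof (rule AE_I2)
      fix x
      have "norm (\<phi> x * Tn n x) \<le> \<bar>\<phi> x\<bar> * (F1 x + F2 x)"
        using Tn_le[of n x] by (simp add: abs_mult mult_left_mono)
      also have "\<bar>\<phi> x\<bar> * (F1 x + F2 x) \<le> (\<phi> x)\<^sup>2 + (F1 x + F2 x)\<^sup>2"
        using order_trans[OF abs_ge_self abs_mult_le_squares[of "\<bar>\<phi> x\<bar>" "F1 x + F2 x"]] by simp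
      also have "(F1 x + F2 x)\<^sup>2 \<le> 2 * (F1 x)\<^sup>2 + 2 * (F2 x)\<^sup>2"
        using zero_le_power2[of "F1 x - F2 x"] by (simp add: power2_eq_square algebra_simps)
      finally show "norm (\<phi> x * Tn n x) \<le> (\<phi> x)\<^sup>2 + 2 * (F1 x)\<^sup>2 + 2 * (F2 x)\<^sup>2" by simp
    qed
  qed (use Tm in measurable)
  have "(\<lambda>n. 2 * (LINT x|lborel. \<phi> x * Tn n x)) \<longlonglongrightarrow> 2 * (LINT x|lborel. \<phi> x * (f x - A * V x))"
    by (intro tendsto_intros lim2)
  with lim1 have "integral\<^sup>L (lborel \<Otimes>\<^sub>M lborel) E = 2 * (LINT x|lborel. \<phi> x * (f x - A * V x))"
    unfolding En2 by (rule LIMSEQ_unique)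
  moreover have "integral\<^sup>L (lborel \<Otimes>\<^sub>M lborel) E = (LINT \<kappa>|lborel. LINT \<tau>|lborel. (V \<kappa> - V \<tau>) * (\<phi> \<kappa> - \<phi> \<tau>) * K (\<kappa> - \<tau>))"
    using lborel_pair.integral_fst'[OF iE] by (simp add: E_def)
  moreover have "(LINT x|lborel. \<phi> x * (f x - A * V x)) = (LINT x|lborel. f x * \<phi> x) - A * (LINT x|lborel. V x * \<phi> x)"
  proof -
    have "(LINT x|lborel. \<phi> x * (f x - A * V x)) = (LINT x|lborel. f x * \<phi> x - A * (V x * \<phi> x))"
      by (intro Bochner_Integration.integral_cong) (simp_all add: algebra_simps)
    then show ?thesis
      using integrable_mult_L2[OF f_borel \<phi>m f2_int \<phi>2] integrable_mult_L2[OF V_borel \<phi>m V2_int \<phi>2] by simp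
  qed
  ultimately show ?thesis unfolding f_def by linarith
qed

end

section \<open>The kernel on the sphere\<close>

lemma ball_finite: "emeasure lborel (ball (x :: 'a::euclidean_space) r) < top"
  using emeasure_lborel_ball_finite[of x r] by (simp add: infinity_ennreal_def)

lemma ball_sets_borel [measurable]: "ball (x :: 'a::euclidean_space) r \<in> sets borel"
  by simp

lemma ball_fmeasurable: "ball (x :: 'a::euclidean_space) r \<in> fmeasurable lborel"
  using ball_finite[of x r] by (intro fmeasurableI) auto

text \<open>The chord on the sphere between \<open>\<theta>\<close> and the direction of
  \<open>x\<close>. Its square replaces the inner product in the kernel.\<close>

definition angd :: "real^'n \<Rightarrow> real^'n \<Rightarrow> real" where
  "angd \<theta> x = norm (x /\<^sub>R norm x - \<theta>)"

lemma angd_borel [measurable]: "angd \<theta> \<in> borel_measurable borel"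
  unfolding angd_def[abs_def] by measurable

lemma angd_nonneg [simp]: "0 \<le> angd \<theta> x"
  by (simp add: angd_def)

lemma angd_eq:
  assumes "norm \<theta> = 1" "x \<noteq> 0"
  shows "(angd \<theta> x)\<^sup>2 = 2 - 2 * (\<theta> \<bullet> (x /\<^sub>R norm x))"
proof -
  have "norm (x /\<^sub>R norm x) = 1" using assms(2) by simp
  then have "(x /\<^sub>R norm x) \<bullet> (x /\<^sub>R norm x) = 1" by (simp only: dot_square_norm power_one)
  moreover have "\<theta> \<bullet> \<theta> = 1" using assms(1) by (simp add: dot_square_norm)
  ultimately show ?thesis
    unfolding angd_def power2_norm_eq_inner
    by (simp add: inner_diff_left inner_diff_right inner_commute)
qed

lemma angd_norm:
  assumes "x \<noteq> 0" shows "norm (x - norm x *\<^sub>R \<theta>) = norm x * angd \<theta> x"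
proof -
  have "x - norm x *\<^sub>R \<theta> = norm x *\<^sub>R (x /\<^sub>R norm x - \<theta>)"
    using assms by (simp add: scaleR_diff_right)
  then show ?thesis by (simp add: angd_def)
qed

text \<open>The solid cone over a spherical cap. With the polar form of \<open>sphere_int\<close>,
  its volume is the surface measure of that cap divided by the dimension.\<close>

definition cap :: "real^'n \<Rightarrow> real \<Rightarrow> (real^'n) set" where
  "cap \<theta> r = {x \<in> ball 0 1. angd \<theta> x \<le> r}"

lemma cap_sets [measurable]: "cap \<theta> r \<in> sets borel"
  unfolding cap_def by measurable

lemma cap_subset: "cap \<theta> r \<subseteq> ball 0 1"
  by (auto simp: cap_def)

lemma cap_fmeasurable: "cap \<theta> r \<in> fmeasurable lborel"
  by (rule fmeasurableI2[OF ball_fmeasurable cap_subset]) simp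

text \<open>The cone lies within distance \<open>r\<close> of the segment from 0 to
  \<open>\<theta>\<close>, so about \<open>1 / r\<close> balls of radius \<open>2 * r\<close>
  centred on the segment cover it. For \<open>r \<ge> 1\<close> the volume of the whole ball
  suffices.\<close>

lemma cap_upper:
  fixes \<theta> :: "real^'n"
  assumes th: "norm \<theta> = 1"
  obtains B where "0 < B" "\<And>r. 0 < r \<Longrightarrow> measure lborel (cap \<theta> r) \<le> B * r powr (real CARD('n) - 1)"
proof -
  define N where "N = CARD('n)"
  have N: "1 \<le> N" unfolding N_def by (simp add: Suc_leI)
  define u where "u = unit_ball_vol (real N)"
  have u: "0 < u" unfolding u_def by simp
  have ball: "measure lborel (ball x r) = u * r ^ N" if "0 \<le> r" for x :: "real^'n" and r
    using that by (simp add: content_ball u_def N_def)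
  define B where "B = 2 * u * 2 ^ N"
  have uB: "u \<le> B" and B: "0 < B"
  proof -
    have "1 \<le> (2::real) ^ N" by simp
    then have "u * 1 \<le> u * (2 * 2 ^ N)" using u by (intro mult_left_mono) linarith+
    then show "u \<le> B" by (simp add: B_def)
    show "0 < B" using u by (simp add: B_def)
  qed
  have "measure lborel (cap \<theta> r) \<le> B * r powr (real N - 1)" if r: "0 < r" for r
  proof (cases "1 \<le> r")
    case True
    have "measure lborel (cap \<theta> r) \<le> measure lborel (ball (0::real^'n) 1)"
      by (intro measure_mono_fmeasurable cap_subset) (auto simp: ball_fmeasurable)
    also have "\<dots> = u" using ball[of 1] by simp
    also have "\<dots> \<le> B * r powr (real N - 1)"
      using uB B ge_one_powr_ge_zero[OF True, of "real N - 1"] N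
      by (intro order_trans[OF uB]) simp
    finally show ?thesis .
  next
    case False
    define m where "m = nat \<lfloor>1 / r\<rfloor>"
    have m: "real m \<le> 1 / r" using r by (simp add: m_def)
    have "cap \<theta> r \<subseteq> (\<Union>j\<in>{..m}. ball ((real j * r) *\<^sub>R \<theta>) (2 * r))"
    proof
      fix x assume x: "x \<in> cap \<theta> r"
      define j where "j = nat \<lfloor>norm x / r\<rfloor>"
      have jr: "real j \<le> norm x / r" "norm x / r < real j + 1" using r by (auto simp: j_def)
      have xr: "norm x / r \<le> 1 / r" using x r by (intro divide_right_mono) (auto simp: cap_def)
      have "j \<le> m" unfolding j_def m_def using xr by (intro nat_mono floor_mono)
      moreover have "norm (x - norm x *\<^sub>R \<theta>) \<le> r"
      proof (cases "x = 0")
        case False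
        have "norm x * angd \<theta> x \<le> 1 * r" using x r by (intro mult_mono) (auto simp: cap_def)
        then show ?thesis using angd_norm[OF False] by simp
      qed (use r in simp)
      moreover have "norm (norm x *\<^sub>R \<theta> - (real j * r) *\<^sub>R \<theta>) < r"
      proof -
        have "norm (norm x *\<^sub>R \<theta> - (real j * r) *\<^sub>R \<theta>) = \<bar>norm x - real j * r\<bar>"
          using th by (simp add: scaleR_left_diff_distrib[symmetric])
        moreover have "real j * r \<le> norm x" "norm x < (real j + 1) * r" using jr r by (auto simp: field_simps)
        ultimately show ?thesis by (simp add: distrib_right)
      qed
      ultimately have "norm (x - (real j * r) *\<^sub>R \<theta>) < 2 * r"
        using norm_triangle_ineq[of "x - norm x *\<^sub>R \<theta>" "norm x *\<^sub>R \<theta> - (real j * r) *\<^sub>R \<theta>"] by simp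
      then have "x \<in> ball ((real j * r) *\<^sub>R \<theta>) (2 * r)" by (simp add: dist_norm norm_minus_commute)
      then show "x \<in> (\<Union>j\<in>{..m}. ball ((real j * r) *\<^sub>R \<theta>) (2 * r))" using \<open>j \<le> m\<close> by auto
    qed
    then have "measure lborel (cap \<theta> r) \<le> measure lborel (\<Union>j\<in>{..m}. ball ((real j * r) *\<^sub>R \<theta>) (2 * r))"
      by (intro measure_mono_fmeasurable fmeasurable.finite_UN) (auto simp: ball_fmeasurable)
    also have "\<dots> \<le> (\<Sum>j\<in>{..m}. measure lborel (ball ((real j * r) *\<^sub>R \<theta>) (2 * r)))"
      by (intro measure_UNION_le) auto
    also have "\<dots> = (real m + 1) * (u * (2 * r) ^ N)" using r by (simp add: ball)
    also have "\<dots> \<le> (2 / r) * (u * (2 * r) ^ N)"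
    proof (rule mult_right_mono)
      have "1 \<le> 1 / r" using False r by (simp add: field_simps)
      then show "real m + 1 \<le> 2 / r" using m by simp
    qed (use u r in simp)
    also have "\<dots> = B * (r powr real N / r powr 1)"
      using r by (simp add: B_def power_mult_distrib powr_realpow)
    also have "r powr real N / r powr 1 = r powr (real N - 1)" by (simp only: powr_diff)
    finally show ?thesis .
  qed
  then show ?thesis using that[OF B] unfolding N_def by blast
qed

text \<open>With \<open>h = r / 8\<close>, about \<open>1 / (2 * h)\<close> disjoint balls of radius
  \<open>h / 2\<close> fit along the outer half of the segment from 0 to \<open>\<theta>\<close>.
  There \<open>norm x \<ge> 1 / 4\<close>, so deviation at most \<open>h\<close> from the ray means
  chord at most \<open>4 * h\<close>, which is below \<open>r\<close>.\<close>

lemma cap_lower: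
  fixes \<theta> :: "real^'n"
  assumes th: "norm \<theta> = 1"
  obtains B where "0 < B" "\<And>r. 0 < r \<Longrightarrow> r \<le> 2 \<Longrightarrow> B * r powr (real CARD('n) - 1) \<le> measure lborel (cap \<theta> r)"
proof -
  define N where "N = CARD('n)"
  define u where "u = unit_ball_vol (real N)"
  have u: "0 < u" unfolding u_def by simp
  have ball: "measure lborel (ball x r) = u * r ^ N" if "0 \<le> r" for x :: "real^'n" and r
    using that by (simp add: content_ball u_def N_def)
  have "u / 16 ^ N * r powr (real N - 1) \<le> measure lborel (cap \<theta> r)" if r: "0 < r" "r \<le> 2" for r
  proof -
    define h where "h = r / 8"
    have h: "0 < h" "h \<le> 1 / 4" "8 * h = r" using r by (auto simp: h_def)
    define m where "m = nat \<lfloor>1 / (2 * h)\<rfloor>"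
    have m: "real m \<le> 1 / (2 * h)" "1 / (2 * h) < real m + 1" using h by (auto simp: m_def)
    have mh: "real m * h \<le> 1 / 2" using m(1) h by (simp add: field_simps)
    have m4: "1 / (4 * h) \<le> real m"
    proof -
      have "1 / (2 * h) = 1 / (4 * h) + 1 / (4 * h)" using h by (simp add: field_simps)
      moreover have "1 \<le> 1 / (4 * h)" using h by (simp add: field_simps)
      ultimately show ?thesis using m(2) by linarith
    qed
    define c where "c j = 1 / 2 + real j * h" for j :: nat
    define D where "D j = ball (c j *\<^sub>R \<theta>) (h / 2)" for j
    have D1: "\<bar>c j - norm x\<bar> < h / 2" "norm (x - c j *\<^sub>R \<theta>) < h / 2" if "x \<in> D j" for x j
    proof -
      show 1: "norm (x - c j *\<^sub>R \<theta>) < h / 2" using that by (simp add: D_def dist_norm norm_minus_commute)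
      have "norm (c j *\<^sub>R \<theta>) = c j" using th h by (simp add: c_def)
      then show "\<bar>c j - norm x\<bar> < h / 2"
        using norm_triangle_ineq3[of x "c j *\<^sub>R \<theta>"] 1 by (simp add: abs_minus_commute)
    qed
    have disj: "disjoint_family_on D {..<m}"
      unfolding disjoint_family_on_def
    proof (intro ballI impI)
      fix i j :: nat assume ij: "i \<noteq> j"
      show "D i \<inter> D j = {}"
      proof (rule ccontr)
        assume "D i \<inter> D j \<noteq> {}"
        then obtain x where x: "x \<in> D i" "x \<in> D j" by blast
        have "\<bar>c i - c j\<bar> < h" using D1(1)[OF x(1)] D1(1)[OF x(2)] by linarith
        moreover have "\<bar>c i - c j\<bar> = \<bar>real i - real j\<bar> * h"
          using h by (simp add: c_def abs_mult left_diff_distrib[symmetric])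
        moreover have "1 \<le> \<bar>real i - real j\<bar>" using ij by linarith
        ultimately show False using h mult_right_mono[of 1 "\<bar>real i - real j\<bar>" h] by simp
      qed
    qed
    have sub: "D j \<subseteq> cap \<theta> r" if j: "j < m" for j
    proof
      fix x assume x: "x \<in> D j"
      have "real j * h + h \<le> real m * h" using j h mult_right_mono[of "real j + 1" "real m" h] by (simp add: distrib_right)
      then have c1: "c j + h \<le> 1" using mh by (simp add: c_def)
      have c2: "1 / 2 \<le> c j" using h by (simp add: c_def)
      have nx: "norm x < 1" "1 / 4 \<le> norm x" using D1(1)[OF x] c1 c2 h by linarith+
      then have x0: "x \<noteq> 0" by auto
      have "norm (x - norm x *\<^sub>R \<theta>) \<le> norm (x - c j *\<^sub>R \<theta>) + norm (c j *\<^sub>R \<theta> - norm x *\<^sub>R \<theta>)"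
        using norm_triangle_ineq[of "x - c j *\<^sub>R \<theta>" "c j *\<^sub>R \<theta> - norm x *\<^sub>R \<theta>"] by simp
      also have "norm (c j *\<^sub>R \<theta> - norm x *\<^sub>R \<theta>) = \<bar>c j - norm x\<bar>"
        using th by (simp add: scaleR_left_diff_distrib[symmetric])
      finally have "norm x * angd \<theta> x \<le> h" using D1[OF x] angd_norm[OF x0] by simp
      moreover have "1 / 4 * angd \<theta> x \<le> norm x * angd \<theta> x" using nx by (intro mult_right_mono) auto
      ultimately have "angd \<theta> x \<le> 4 * h" by linarith
      then have "angd \<theta> x \<le> r" using h by linarith
      then show "x \<in> cap \<theta> r" using nx by (simp add: cap_def)
    qed
    have "u / 16 ^ N * r powr (real N - 1) = u * (r / 16) ^ N * (1 / r)"
      using r by (simp add: powr_diff powr_realpow power_divide)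
    also have "\<dots> \<le> u * (h / 2) ^ N * real m"
    proof (rule mult_mono)
      have "1 / r \<le> 1 / (4 * h)" using h by (intro divide_left_mono) auto
      then show "1 / r \<le> real m" using m4 by simp
    qed (use u h r in \<open>auto simp: h_def\<close>)
    also have "\<dots> = (\<Sum>j<m. measure lborel (D j))" using h by (simp add: D_def ball)
    also have "\<dots> = measure lborel (\<Union>j<m. D j)"
    proof (rule measure_finite_Union[symmetric])
      show "emeasure lborel (D j) \<noteq> \<infinity>" for j
        using ball_finite[of "c j *\<^sub>R \<theta>" "h / 2"] by (simp add: D_def infinity_ennreal_def)
      show "D ` {..<m} \<subseteq> sets lborel" by (auto simp: D_def)
    qed (use disj in simp_all)
    also have "\<dots> \<le> measure lborel (cap \<theta> r)"
      using sub by (intro measure_mono_fmeasurable cap_fmeasurable) (auto simp: D_def)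
    finally show ?thesis .
  qed
  then show ?thesis using that[of "u / 16 ^ N"] u unfolding N_def by simp
qed

text \<open>The sphere integral of the power \<open>- M\<close> of \<open>a\<close> plus the squared
  chord. In this form the monotonicity of the kernel reduces to monotonicity in
  \<open>a\<close>.\<close>

definition zonal :: "real \<Rightarrow> real^'n \<Rightarrow> real \<Rightarrow> real" where
  "zonal M \<theta> a = real CARD('n) * (LINT x : ball 0 1 | lborel. (a + (angd \<theta> x)\<^sup>2) powr (- M))"

lemma zonal_integrable:
  fixes \<theta> :: "real^'n"
  assumes "0 < a" "0 \<le> M"
  shows "set_integrable lborel (ball (0::real^'n) 1) (\<lambda>x. (a + (angd \<theta> x)\<^sup>2) powr (- M))"
  unfolding set_integrable_def
proof (rule Bochner_Integration.integrable_bound)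
  show "integrable lborel (\<lambda>x::real^'n. a powr (- M) * indicator (ball 0 1) x)"
    by (intro integrable_mult_right integrable_real_indicator) (auto simp: ball_finite)
  show "AE x in lborel. norm (indicator (ball 0 1) x *\<^sub>R (a + (angd \<theta> x)\<^sup>2) powr (- M))
      \<le> norm (a powr (- M) * indicator (ball 0 1) x)"
    using assms by (intro AE_I2) (auto split: split_indicator intro!: powr_mono2')
qed measurable

lemma zonal_antimono:
  assumes "0 < a" "a \<le> b" "0 \<le> M"
  shows "zonal M \<theta> b \<le> zonal M \<theta> a"
  unfolding zonal_def
proof (rule mult_left_mono)
  show "(LINT x : ball 0 1 | lborel. (b + (angd \<theta> x)\<^sup>2) powr (- M)) \<le> (LINT x : ball 0 1 | lborel. (a + (angd \<theta> x)\<^sup>2) powr (- M))"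
    using assms by (intro set_integral_mono zonal_integrable powr_mono2') (auto intro: add_pos_nonneg)
qed simp

lemma zonal_nonneg: "0 \<le> zonal M \<theta> a"
  unfolding zonal_def set_lebesgue_integral_def
  by (intro mult_nonneg_nonneg Bochner_Integration.integral_nonneg) auto

lemma zonal_ge:
  fixes \<theta> :: "real^'n"
  assumes "0 < a" "0 \<le> M" "0 \<le> r"
  shows "real CARD('n) * ((a + r\<^sup>2) powr (- M) * measure lborel (cap \<theta> r)) \<le> zonal M \<theta> a"
  unfolding zonal_def
proof (rule mult_left_mono)
  have "(a + r\<^sup>2) powr (- M) * measure lborel (cap \<theta> r) = (LINT x|lborel. (a + r\<^sup>2) powr (- M) * indicator (cap \<theta> r) x)"
    by simp
  also have "\<dots> \<le> (LINT x : ball 0 1 | lborel. (a + (angd \<theta> x)\<^sup>2) powr (- M))"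
    unfolding set_lebesgue_integral_def
  proof (rule integral_mono)
    show "integrable lborel (\<lambda>x. (a + r\<^sup>2) powr (- M) * indicator (cap \<theta> r) x)"
      using cap_fmeasurable[of \<theta> r] by (intro integrable_mult_right integrable_real_indicator) (auto simp: fmeasurable_def)
    show "integrable lborel (\<lambda>x. indicator (ball 0 1) x *\<^sub>R (a + (angd \<theta> x)\<^sup>2) powr (- M))"
      using zonal_integrable[OF assms(1,2)] by (simp add: set_integrable_def)
    show "(a + r\<^sup>2) powr (- M) * indicator (cap \<theta> r) x \<le> indicator (ball 0 1) x *\<^sub>R (a + (angd \<theta> x)\<^sup>2) powr (- M)" for x
      using assms by (auto simp: cap_def split: split_indicator intro!: powr_mono2' add_pos_nonneg power_mono)
  qed
  finally show "(a + r\<^sup>2) powr (- M) * measure lborel (cap \<theta> r) \<le> (LINT x : ball 0 1 | lborel. (a + (angd \<theta> x)\<^sup>2) powr (- M))" .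
qed simp

lemma zonal_pos:
  fixes \<theta> :: "real^'n"
  assumes "norm \<theta> = 1" "0 < a" "0 \<le> M"
  shows "0 < zonal M \<theta> a"
proof -
  obtain B where B: "0 < B" "\<And>r. 0 < r \<Longrightarrow> r \<le> 2 \<Longrightarrow> B * r powr (real CARD('n) - 1) \<le> measure lborel (cap \<theta> r)"
    using cap_lower[OF assms(1)] by blast
  have "0 < measure lborel (cap \<theta> 1)" using B(2)[of 1] B(1) by simp
  then have "0 < real CARD('n) * ((a + 1\<^sup>2) powr (- M) * measure lborel (cap \<theta> 1))" using assms by simp
  also have "\<dots> \<le> zonal M \<theta> a" using assms by (intro zonal_ge) auto
  finally show ?thesis .
qed

lemma zonal_le_powr:
  fixes \<theta> :: "real^'n"
  assumes "0 < a" "0 \<le> M"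
  shows "zonal M \<theta> a \<le> real CARD('n) * measure lborel (ball (0::real^'n) 1) * a powr (- M)"
proof -
  have "(LINT x : ball 0 1 | lborel. (a + (angd \<theta> x)\<^sup>2) powr (- M)) \<le> (LINT x : ball (0::real^'n) 1 | lborel. a powr (- M))"
    using assms by (intro set_integral_mono zonal_integrable powr_mono2')
      (auto simp: set_integrable_def ball_finite intro!: integrable_mult_left integrable_real_indicator)
  also have "\<dots> = measure lborel (ball (0::real^'n) 1) * a powr (- M)"
    by (simp add: set_lebesgue_integral_def)
  finally show ?thesis unfolding zonal_def by (simp add: mult.assoc mult_left_mono)
qed

text \<open>At \<open>r = a powr (1 / 2)\<close> the two summands under the power balance. The cap
  of that size contributes \<open>a powr (- M) * r powr (N - 1)\<close> with \<open>N\<close> the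
  dimension, and \<open>(N - 1) / 2 - M = - (1 + 2 * s) / 2\<close>. The range
  \<open>a \<le> 4\<close> keeps \<open>r\<close> at most 2, the diameter of the sphere.\<close>

lemma zonal_lower:
  fixes \<theta> :: "real^'n"
  assumes th: "norm \<theta> = 1" and s: "0 < s" and M: "M = (real CARD('n) + 2 * s) / 2"
  obtains B where "0 < B" "\<And>a. 0 < a \<Longrightarrow> a \<le> 4 \<Longrightarrow> B * a powr (- (1 + 2 * s) / 2) \<le> zonal M \<theta> a"
proof -
  obtain B where B: "0 < B" "\<And>r. 0 < r \<Longrightarrow> r \<le> 2 \<Longrightarrow> B * r powr (real CARD('n) - 1) \<le> measure lborel (cap \<theta> r)"
    using cap_lower[OF th] by blast
  have M0: "0 \<le> M" using M s by simp
  define D where "D = real CARD('n) * 2 powr (- M) * B"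
  have "D * a powr (- (1 + 2 * s) / 2) \<le> zonal M \<theta> a" if a: "0 < a" "a \<le> 4" for a
  proof -
    define r where "r = a powr (1 / 2)"
    have r: "0 < r" "r\<^sup>2 = a" using a by (auto simp: r_def powr_power)
    have "r\<^sup>2 \<le> 2\<^sup>2" using r a by simp
    then have r2: "r \<le> 2" by (rule power2_le_imp_le) simp
    have "D * a powr (- (1 + 2 * s) / 2) = real CARD('n) * ((2 powr (- M) * a powr (- M)) * (B * r powr (real CARD('n) - 1)))"
    proof -
      have "a powr (- M) * r powr (real CARD('n) - 1) = a powr (- (1 + 2 * s) / 2)"
        unfolding r_def powr_powr powr_add[symmetric] M by (rule arg_cong[where f="\<lambda>e. a powr e"]) (simp add: field_simps)
      then show ?thesis unfolding D_def by (simp add: mult_ac)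
    qed
    also have "\<dots> \<le> real CARD('n) * ((2 powr (- M) * a powr (- M)) * measure lborel (cap \<theta> r))"
      using B(2)[OF r(1) r2] by (intro mult_left_mono) auto
    also have "2 powr (- M) * a powr (- M) = (a + r\<^sup>2) powr (- M)"
      unfolding r(2) using a by (simp add: powr_mult[symmetric])
    also have "real CARD('n) * ((a + r\<^sup>2) powr (- M) * measure lborel (cap \<theta> r)) \<le> zonal M \<theta> a"
      using a M0 r by (intro zonal_ge) auto
    finally show ?thesis .
  qed
  moreover have "0 < D" using B(1) by (simp add: D_def)
  ultimately show ?thesis using that by blast
qed

text \<open>Layer cake: with \<open>\<rho>\<close> the larger of \<open>a powr (1 / 2)\<close> and
  the chord, \<open>\<rho> powr (- 2 * M)\<close> is the integral of
  \<open>2 * M * t powr (- 2 * M - 1)\<close> over \<open>t \<ge> \<rho>\<close>. After Tonelli the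
  inner integral is the measure of a cap, bounded by \<open>cap_upper\<close>.\<close>

lemma zonal_upper:
  fixes \<theta> :: "real^'n"
  assumes th: "norm \<theta> = 1" and s: "0 < s" and M: "M = (real CARD('n) + 2 * s) / 2"
  obtains B where "0 < B" "\<And>a. 0 < a \<Longrightarrow> zonal M \<theta> a \<le> B * a powr (- (1 + 2 * s) / 2)"
proof -
  obtain B where B: "0 < B" "\<And>r. 0 < r \<Longrightarrow> measure lborel (cap \<theta> r) \<le> B * r powr (real CARD('n) - 1)"
    using cap_upper[OF th] by blast
  have M0: "0 < M" using M s by (simp add: add_pos_pos)
  define D where "D = 2 * M * B / (1 + 2 * s)"
  have D: "0 < D" using B(1) M0 s by (simp add: D_def)
  have tail: "(\<integral>\<^sup>+t. ennreal (c * t powr e) * indicator {r..} t \<partial>lborel) = ennreal (c * (- (r powr (e + 1)) / (e + 1)))"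
    if "0 < r" "e < - 1" "0 \<le> c" for r e c :: real
  proof -
    define L where "L = - (r powr (e + 1)) / (e + 1)"
    have 1: "(\<integral>\<^sup>+t. ennreal (indicator {r..} t * t powr e) \<partial>lborel) = L"
      unfolding L_def using that by (intro nn_integral_has_integral_lebesgue[OF _ has_integral_powr_to_inf]) auto
    have "0 \<le> L" unfolding L_def using that by (intro divide_nonpos_neg) auto
    have "(\<integral>\<^sup>+t. ennreal (c * t powr e) * indicator {r..} t \<partial>lborel) = (\<integral>\<^sup>+t. ennreal c * ennreal (indicator {r..} t * t powr e) \<partial>lborel)"
      using that by (intro nn_integral_cong) (auto split: split_indicator simp: ennreal_mult)
    also have "\<dots> = ennreal c * (\<integral>\<^sup>+t. ennreal (indicator {r..} t * t powr e) \<partial>lborel)"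
      by (rule nn_integral_cmult) measurable
    also have "\<dots> = ennreal (c * L)" unfolding 1 using that \<open>0 \<le> L\<close> by (intro ennreal_mult[symmetric]) auto
    finally show ?thesis unfolding L_def .
  qed
  have "(LINT x : ball 0 1 | lborel. (a + (angd \<theta> x)\<^sup>2) powr (- M)) \<le> D * a powr (- (1 + 2 * s) / 2)" if a: "0 < a" for a
  proof -
    define r where "r = a powr (1 / 2)"
    have r: "0 < r" "r\<^sup>2 = a" using a by (auto simp: r_def powr_power)
    define \<Psi> where "\<Psi> x t = ennreal (2 * M * t powr (- 2 * M - 1)) * indicator {max r (angd \<theta> x)..} t" for x t
    have pw: "ennreal (indicator (ball 0 1) x *\<^sub>R (a + (angd \<theta> x)\<^sup>2) powr (- M)) \<le> (\<integral>\<^sup>+t. indicator (ball 0 1) x * \<Psi> x t \<partial>lborel)" for x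
    proof (cases "x \<in> ball 0 1")
      case True
      define \<rho> where "\<rho> = max r (angd \<theta> x)"
      have \<rho>: "0 < \<rho>" using r by (simp add: \<rho>_def)
      have "\<rho>\<^sup>2 \<le> a + (angd \<theta> x)\<^sup>2" using r(2) a by (auto simp: \<rho>_def max_def)
      then have "(a + (angd \<theta> x)\<^sup>2) powr (- M) \<le> (\<rho>\<^sup>2) powr (- M)" using \<rho> M0 by (intro powr_mono2') auto
      also have "(\<rho>\<^sup>2) powr (- M) = \<rho> powr (- 2 * M)"
        using \<rho> powr_powr[of \<rho> 2 "- M"] by (simp add: powr_numeral)
      also have "\<dots> = 2 * M * (- (\<rho> powr ((- 2 * M - 1) + 1)) / ((- 2 * M - 1) + 1))" using M0 by simp
      finally have "ennreal ((a + (angd \<theta> x)\<^sup>2) powr (- M)) \<le> (\<integral>\<^sup>+t. \<Psi> x t \<partial>lborel)"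
        unfolding \<Psi>_def \<rho>_def[symmetric] using M0 \<rho> by (subst tail) (auto intro: ennreal_leI)
      then show ?thesis using True by simp
    qed simp
    have \<Psi>m: "(\<lambda>(x, t). indicator (ball 0 1) x * \<Psi> x t) \<in> borel_measurable (lborel \<Otimes>\<^sub>M lborel)"
    proof -
      have "(\<lambda>(x, t). indicator (ball 0 1) x * (ennreal (2 * M * t powr (- 2 * M - 1)) * (if max r (angd \<theta> x) \<le> t then 1 else 0))) \<in> borel_measurable (lborel \<Otimes>\<^sub>M lborel)"
        by measurable
      also have "(\<lambda>(x, t). indicator (ball 0 1) x * (ennreal (2 * M * t powr (- 2 * M - 1)) * (if max r (angd \<theta> x) \<le> t then 1 else 0)))
        = (\<lambda>(x, t). indicator (ball 0 1) x * \<Psi> x t)"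
        by (auto simp: \<Psi>_def fun_eq_iff)
      finally show ?thesis .
    qed
    have "ennreal (LINT x : ball 0 1 | lborel. (a + (angd \<theta> x)\<^sup>2) powr (- M))
       = (\<integral>\<^sup>+x. ennreal (indicator (ball 0 1) x *\<^sub>R (a + (angd \<theta> x)\<^sup>2) powr (- M)) \<partial>lborel)"
      unfolding set_lebesgue_integral_def
      using zonal_integrable[OF a less_imp_le[OF M0], of \<theta>]
      by (intro nn_integral_eq_integral[symmetric]) (auto simp: set_integrable_def)
    also have "\<dots> \<le> (\<integral>\<^sup>+x. \<integral>\<^sup>+t. indicator (ball 0 1) x * \<Psi> x t \<partial>lborel \<partial>lborel)"
      by (intro nn_integral_mono pw)
    also have "\<dots> = (\<integral>\<^sup>+t. \<integral>\<^sup>+x. indicator (ball 0 1) x * \<Psi> x t \<partial>lborel \<partial>lborel)"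
      using lborel_pair.Fubini'[of "\<lambda>t x. indicator (ball 0 1) x * \<Psi> x t"] measurable_pair_swap[OF \<Psi>m]
      by (simp add: case_prod_unfold)
    also have "\<dots> \<le> (\<integral>\<^sup>+t. ennreal (2 * M * B * t powr (- 2 - 2 * s)) * indicator {r..} t \<partial>lborel)"
    proof (rule nn_integral_mono)
      fix t
      show "(\<integral>\<^sup>+x. indicator (ball 0 1) x * \<Psi> x t \<partial>lborel) \<le> ennreal (2 * M * B * t powr (- 2 - 2 * s)) * indicator {r..} t"
      proof (cases "r \<le> t")
        case False
        then have "(\<lambda>x. indicator (ball 0 1) x * \<Psi> x t) = (\<lambda>x. 0)" by (auto simp: \<Psi>_def)
        then show ?thesis by simp
      next
        case True
        have "(\<lambda>x. indicator (ball 0 1) x * \<Psi> x t) = (\<lambda>x. ennreal (2 * M * t powr (- 2 * M - 1)) * indicator (cap \<theta> t) x)"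
          using True by (auto simp: \<Psi>_def cap_def fun_eq_iff split: split_indicator)
        then have "(\<integral>\<^sup>+x. indicator (ball 0 1) x * \<Psi> x t \<partial>lborel) = ennreal (2 * M * t powr (- 2 * M - 1)) * emeasure lborel (cap \<theta> t)"
          by (simp add: nn_integral_cmult)
        also have "emeasure lborel (cap \<theta> t) = ennreal (measure lborel (cap \<theta> t))"
          using cap_fmeasurable by (intro emeasure_eq_measure2) auto
        also have "ennreal (2 * M * t powr (- 2 * M - 1)) * ennreal (measure lborel (cap \<theta> t))
           = ennreal (2 * M * t powr (- 2 * M - 1) * measure lborel (cap \<theta> t))"
          using M0 by (intro ennreal_mult[symmetric]) auto
        also have "\<dots> \<le> ennreal (2 * M * t powr (- 2 * M - 1) * (B * t powr (real CARD('n) - 1)))"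
          using M0 B(2)[of t] True r by (intro ennreal_leI mult_left_mono) auto
        also have "2 * M * t powr (- 2 * M - 1) * (B * t powr (real CARD('n) - 1)) = 2 * M * B * (t powr (- 2 * M - 1) * t powr (real CARD('n) - 1))"
          by simp
        also have "t powr (- 2 * M - 1) * t powr (real CARD('n) - 1) = t powr (- 2 - 2 * s)"
          unfolding powr_add[symmetric] M by (rule arg_cong[where f="\<lambda>e. t powr e"]) (simp add: field_simps)
        finally show ?thesis using True by simp
      qed
    qed
    also have "\<dots> = ennreal (2 * M * B * (- (r powr ((- 2 - 2 * s) + 1)) / ((- 2 - 2 * s) + 1)))"
      using r M0 B(1) s by (intro tail) auto
    also have "2 * M * B * (- (r powr ((- 2 - 2 * s) + 1)) / ((- 2 - 2 * s) + 1)) = D * r powr (- 1 - 2 * s)"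
    proof -
      have e: "(- 2 - 2 * s) + 1 = - (1 + 2 * s)" "- 1 - 2 * s = - (1 + 2 * s)" by simp_all
      have "2 * M * B * (- (r powr (- q)) / (- q)) = 2 * M * B / q * r powr (- q)" for q by simp
      then show ?thesis unfolding D_def e .
    qed
    also have "r powr (- 1 - 2 * s) = a powr (- (1 + 2 * s) / 2)"
      unfolding r_def powr_powr by (rule arg_cong[where f="\<lambda>e. a powr e"]) (simp add: field_simps)
    finally show ?thesis using D by simp
  qed
  then have "zonal M \<theta> a \<le> real CARD('n) * (D * a powr (- (1 + 2 * s) / 2))" if "0 < a" for a
    unfolding zonal_def using that by (intro mult_left_mono) auto
  then show ?thesis using that[of "real CARD('n) * D"] D by (simp add: mult.assoc)
qed

lemma (in levy_kernel) solution_exists: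
  assumes Kpos: "\<And>t. t \<noteq> 0 \<Longrightarrow> 0 < K t" and p: "1 < p" and sub: "(p - 1) / (p + 1) < 2 * s"
  shows "\<exists>V. continuous_on UNIV V \<and> (\<forall>x. 0 < V x) \<and> integrable lborel (\<lambda>x. (V x)\<^sup>2) \<and>
    (\<integral>\<^sup>+ \<kappa>. \<integral>\<^sup>+ \<tau>. ennreal ((V \<kappa> - V \<tau>)\<^sup>2 * K (\<kappa> - \<tau>)) \<partial>lborel \<partial>lborel) < \<infinity> \<and>
    (\<forall>\<phi>. \<phi> \<in> borel_measurable borel \<longrightarrow> integrable lborel (\<lambda>x. (\<phi> x)\<^sup>2) \<longrightarrow>
      (\<integral>\<^sup>+ \<kappa>. \<integral>\<^sup>+ \<tau>. ennreal ((\<phi> \<kappa> - \<phi> \<tau>)\<^sup>2 * K (\<kappa> - \<tau>)) \<partial>lborel \<partial>lborel) < \<infinity> \<longrightarrow>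
      1 / 2 * (LINT \<kappa>|lborel. LINT \<tau>|lborel. (V \<kappa> - V \<tau>) * (\<phi> \<kappa> - \<phi> \<tau>) * K (\<kappa> - \<tau>))
        + A * (LINT \<kappa>|lborel. V \<kappa> * \<phi> \<kappa>) = (LINT \<kappa>|lborel. V \<kappa> powr p * \<phi> \<kappa>)) \<and>
    (\<forall>\<kappa>. \<exists>Tv. (\<forall>\<epsilon>>0. set_integrable lborel {\<tau>. \<bar>\<kappa> - \<tau>\<bar> > \<epsilon>} (\<lambda>\<tau>. (V \<kappa> - V \<tau>) * K (\<kappa> - \<tau>))) \<and>
      ((\<lambda>\<epsilon>. LINT \<tau> : {\<tau>. \<bar>\<kappa> - \<tau>\<bar> > \<epsilon>} | lborel. (V \<kappa> - V \<tau>) * K (\<kappa> - \<tau>)) \<longlongrightarrow> Tv) (at_right 0) \<and>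
      Tv + A * V \<kappa> = V \<kappa> powr p)"
proof -
  define t where "t = (p - 1) / (p + 1)"
  have t: "t < 2 * s" "t < 1" using sub p by (auto simp: t_def)
  \<comment> \<open>The midpoint of the interval of admissible exponents, nonempty because
    \<open>t\<close> is below both 1 and \<open>2 * s\<close>.\<close>
  define b where "b = (max s t + min 1 (2 * s)) / 2"
  have b: "s < b" "b < 1" "b \<le> 2 * s" "t < b" using s t by (auto simp: b_def max_def min_def)
  obtain d G g where "green_limit K s A c C d G g b"
    using green_limit_exists[OF b(1-3)] by blast
  then interpret gl: green_limit K s A c C d G g b .
  interpret gp: green_problem K s A c C d G g b p
    by unfold_locales (use p b(4) in \<open>auto simp: t_def\<close>)
  obtain V where "gp.sol V" using gp.sol_exists by blast
  then interpret gs: green_solution K s A c C d G g b p V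
    by unfold_locales (use Kpos in auto)
  show ?thesis
    using gs.V_continuous gs.V_pos gs.V2_int gs.V_energy gs.V_weak gs.V_classical
    by (intro exI[of _ V]) blast
qed

lemma sphere_int_cmult: "sphere_int (\<lambda>\<sigma>. c * f \<sigma>) = c * sphere_int f"
  unfolding sphere_int_def by simp

text \<open>With \<open>y\<close> the inner product, \<open>1 + r^2 - 2 * r * y\<close> equals
  \<open>r\<close> times \<open>(r + 1 / r - 2) + (2 - 2 * y)\<close>, and the last bracket is the
  squared chord.\<close>

lemma sphere_int_zonal:
  fixes \<theta> :: "real^'n"
  assumes th: "norm \<theta> = 1" and r: "0 < r"
  shows "sphere_int (\<lambda>\<sigma>. \<bar>1 + r\<^sup>2 - 2 * r * (\<theta> \<bullet> \<sigma>)\<bar> powr (- M)) = r powr (- M) * zonal M \<theta> (r + 1 / r - 2)"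
proof -
  define a where "a = r + 1 / r - 2"
  have ra: "a = (1 - r)\<^sup>2 / r" using r by (simp add: a_def power2_eq_square field_simps)
  have a0: "0 \<le> a" unfolding ra using r by simp
  have "(LINT x : ball 0 1 | lborel. \<bar>1 + r\<^sup>2 - 2 * r * (\<theta> \<bullet> (x /\<^sub>R norm x))\<bar> powr (- M))
      = (LINT x : ball 0 1 | lborel. r powr (- M) * (a + (angd \<theta> x)\<^sup>2) powr (- M))"
    unfolding set_lebesgue_integral_def
  proof (rule integral_cong_AE)
    have "AE x in lborel. x \<noteq> (0::real^'n)"
      using AE_not_in[OF countable_imp_null_set_lborel, of "{0::real^'n}"] by simp
    then show "AE x in lborel. indicator (ball 0 1) x *\<^sub>R \<bar>1 + r\<^sup>2 - 2 * r * (\<theta> \<bullet> (x /\<^sub>R norm x))\<bar> powr (- M)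
       = indicator (ball 0 1) x *\<^sub>R (r powr (- M) * (a + (angd \<theta> x)\<^sup>2) powr (- M))"
    proof eventually_elim
      case (elim x)
      define y where "y = \<theta> \<bullet> (x /\<^sub>R norm x)"
      have d: "(angd \<theta> x)\<^sup>2 = 2 - 2 * y" unfolding y_def by (rule angd_eq[OF th elim])
      have "1 + r\<^sup>2 - 2 * r * y = r * (a + (angd \<theta> x)\<^sup>2)"
        unfolding d a_def using r by (simp add: power2_eq_square field_simps)
      moreover have "0 \<le> r * (a + (angd \<theta> x)\<^sup>2)" using r a0 by simp
      ultimately show ?case unfolding y_def[symmetric] using r a0 by (simp add: powr_mult)
    qed
  qed measurable
  then show ?thesis unfolding sphere_int_def zonal_def a_def[symmetric] by simp
qed

text \<open>For \<open>r = exp (- t)\<close> the exponential prefactor cancels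
  \<open>r powr (- M)\<close>, and \<open>r + 1 / r - 2\<close> is \<open>2 * cosh t - 2\<close>.
  This exposes the evenness of the kernel and its monotonicity in
  \<open>\<bar>t\<bar>\<close>.\<close>

lemma kernK_zonal:
  fixes \<theta> :: "real^'n"
  assumes th: "norm \<theta> = 1"
  shows "kernK s \<theta> t = zonal ((real CARD('n) + 2 * s) / 2) \<theta> (2 * cosh t - 2)"
proof -
  define M where "M = (real CARD('n) + 2 * s) / 2"
  have e: "exp (- 2 * t) = (exp (- t))\<^sup>2" by (simp add: exp_double[symmetric])
  have c: "exp (- t) + 1 / exp (- t) - 2 = 2 * cosh t - 2" by (simp add: cosh_def exp_minus field_simps)
  have m: "- (real CARD('n) + 2 * s) / 2 = - M" by (simp only: M_def minus_divide_left)
  have "kernK s \<theta> t = exp (- t * M) * (exp (- t) powr (- M) * zonal M \<theta> (2 * cosh t - 2))"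
    unfolding kernK_def e m M_def[symmetric] sphere_int_zonal[OF th exp_gt_zero] c ..
  also have "\<dots> = exp (- t * M) * exp (t * M) * zonal M \<theta> (2 * cosh t - 2)"
    by (simp add: powr_def mult.commute)
  also have "exp (- t * M) * exp (t * M) = 1" by (simp add: exp_add[symmetric])
  finally show ?thesis by (simp add: M_def)
qed

section \<open>Elementary bounds for the hyperbolic cosine\<close>

lemma cosh_aux: "2 * cosh t - 2 = (exp (t / 2) - exp (- (t / 2)))\<^sup>2" for t :: real
proof -
  have "exp (t / 2) * exp (- (t / 2)) = 1" by (simp add: exp_add[symmetric])
  moreover have "(exp (t / 2))\<^sup>2 = exp t" "(exp (- (t / 2)))\<^sup>2 = exp (- t)" by (simp_all add: exp_double[symmetric])
  moreover have "2 * cosh t = exp t + exp (- t)" by (simp add: cosh_def)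
  ultimately show ?thesis unfolding power2_diff by (simp add: mult.assoc)
qed

lemma cosh_aux_ge: "t\<^sup>2 / 4 \<le> 2 * cosh t - 2" if "0 \<le> t" for t :: real
proof -
  have "1 + t / 2 \<le> exp (t / 2)" by (rule exp_ge_add_one_self)
  moreover have "exp (- (t / 2)) \<le> 1" using that by simp
  ultimately have "t / 2 \<le> exp (t / 2) - exp (- (t / 2))" by linarith
  then have "(t / 2)\<^sup>2 \<le> (exp (t / 2) - exp (- (t / 2)))\<^sup>2" using that by (intro power_mono) auto
  then show ?thesis unfolding cosh_aux by (simp add: power_divide)
qed

lemma exp_diff_le: "exp x - exp (- x) \<le> 2 * x * exp x" if "0 \<le> x" for x :: real
proof -
  have "1 + (- (2 * x)) \<le> exp (- (2 * x))" by (rule exp_ge_add_one_self)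
  then have "exp x * (1 - exp (- (2 * x))) \<le> exp x * (2 * x)" by (intro mult_left_mono) auto
  then show ?thesis by (simp add: right_diff_distrib exp_add[symmetric] mult.commute)
qed

lemma cosh_aux_le: "2 * cosh t - 2 \<le> t\<^sup>2 * exp t" if "0 \<le> t" for t :: real
proof -
  have "exp (t / 2) - exp (- (t / 2)) \<le> t * exp (t / 2)" using exp_diff_le[of "t / 2"] that by simp
  moreover have "exp (- (t / 2)) \<le> exp (t / 2)" using that by simp
  ultimately have "(exp (t / 2) - exp (- (t / 2)))\<^sup>2 \<le> (t * exp (t / 2))\<^sup>2" by (intro power_mono) auto
  also have "\<dots> = t\<^sup>2 * exp t" by (simp add: power_mult_distrib exp_double[symmetric])
  finally show ?thesis unfolding cosh_aux .
qed

text \<open>\<open>2 * cosh t - 2\<close> is at least \<open>t^2 / 4\<close> for all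
  \<open>t\<close>, and at most \<open>3 * t^2\<close> on the unit interval, so the power bounds for
  \<open>zonal\<close> carry over with halved exponents. The exponential bound is for
  \<open>A_const\<close>, whose integrand contains a growing exponential.\<close>

lemma kernK_facts:
  fixes \<theta> :: "real^'n"
  assumes th: "norm \<theta> = 1" and s: "0 < s"
  obtains c C C2 where "0 < c" "symdec (kernK s \<theta>)" "\<And>t. t \<noteq> 0 \<Longrightarrow> 0 < kernK s \<theta> t"
    "\<And>t. 0 < t \<Longrightarrow> t \<le> 1 \<Longrightarrow> c * t powr (-1 - 2 * s) \<le> kernK s \<theta> t"
    "\<And>t. 0 < t \<Longrightarrow> kernK s \<theta> t \<le> C * t powr (-1 - 2 * s)"
    "\<And>t. 1 \<le> t \<Longrightarrow> kernK s \<theta> t \<le> C2 * exp (- (real CARD('n) + 2 * s) / 2 * t)"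
proof -
  define M where "M = (real CARD('n) + 2 * s) / 2"
  have M: "0 \<le> M" using s by (simp add: M_def)
  have K: "kernK s \<theta> t = zonal M \<theta> (2 * cosh t - 2)" for t
    unfolding M_def by (rule kernK_zonal[OF th])
  have apos: "0 < 2 * cosh t - 2" if "t \<noteq> 0" for t :: real
  proof -
    have "0 < \<bar>t\<bar>\<^sup>2 / 4" using that by simp
    also have "\<dots> \<le> 2 * cosh \<bar>t\<bar> - 2" by (rule cosh_aux_ge) simp
    finally show ?thesis by simp
  qed
  obtain B1 where B1: "0 < B1" "\<And>a. 0 < a \<Longrightarrow> a \<le> 4 \<Longrightarrow> B1 * a powr (- (1 + 2 * s) / 2) \<le> zonal M \<theta> a"
    using zonal_lower[OF th s M_def] by blast
  obtain B2 where B2: "0 < B2" "\<And>a. 0 < a \<Longrightarrow> zonal M \<theta> a \<le> B2 * a powr (- (1 + 2 * s) / 2)"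
    using zonal_upper[OF th s M_def] by blast
  have sq: "(q * t\<^sup>2) powr (- (1 + 2 * s) / 2) = q powr (- (1 + 2 * s) / 2) * t powr (-1 - 2 * s)" if "0 < t" "0 < q" for t q :: real
  proof -
    have "(t\<^sup>2) powr e = t powr (2 * e)" for e
      using that powr_powr[of t 2 e] by (simp add: powr_numeral)
    moreover have "2 * (- (1 + 2 * s) / 2) = - 1 - 2 * s" by simp
    ultimately have "(t\<^sup>2) powr (- (1 + 2 * s) / 2) = t powr (- 1 - 2 * s)" by metis
    then show ?thesis by (simp only: powr_mult)
  qed
  show ?thesis
  proof (rule that)
    show "0 < B1 * 3 powr (- (1 + 2 * s) / 2)" using B1(1) by simp
    show "symdec (kernK s \<theta>)"
      unfolding symdec_def
    proof (intro conjI allI impI)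
      show "0 \<le> kernK s \<theta> x" for x unfolding K by (rule zonal_nonneg)
      fix x y :: real assume x: "x \<noteq> 0" "\<bar>x\<bar> \<le> \<bar>y\<bar>"
      have "cosh \<bar>x\<bar> \<le> cosh \<bar>y\<bar>" using x by (subst cosh_real_nonneg_le_iff) auto
      then show "kernK s \<theta> y \<le> kernK s \<theta> x"
        unfolding K using apos[OF x(1)] M by (intro zonal_antimono) auto
    qed
    show "0 < kernK s \<theta> t" if "t \<noteq> 0" for t
      unfolding K using apos[OF that] M by (intro zonal_pos th) auto
    show "B1 * 3 powr (- (1 + 2 * s) / 2) * t powr (-1 - 2 * s) \<le> kernK s \<theta> t" if t: "0 < t" "t \<le> 1" for t
    proof -
      have "exp t \<le> exp 1" using t by simp
      also have "exp (1::real) \<le> 3" by (rule exp_le)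
      finally have "t\<^sup>2 * exp t \<le> t\<^sup>2 * 3" by (intro mult_left_mono) auto
      then have a: "2 * cosh t - 2 \<le> 3 * t\<^sup>2" using cosh_aux_le[of t] t by linarith
      have "t\<^sup>2 \<le> 1\<^sup>2" using t by (intro power_mono) auto
      then have t4: "3 * t\<^sup>2 \<le> 4" by simp
      have "B1 * 3 powr (- (1 + 2 * s) / 2) * t powr (-1 - 2 * s) = B1 * (3 * t\<^sup>2) powr (- (1 + 2 * s) / 2)"
        using sq[of t 3] t by simp
      also have "\<dots> \<le> zonal M \<theta> (3 * t\<^sup>2)" using t t4 by (intro B1(2)) auto
      also have "\<dots> \<le> kernK s \<theta> t" unfolding K using a apos[of t] t M by (intro zonal_antimono) auto
      finally show ?thesis .
    qed
    show "kernK s \<theta> t \<le> B2 * (1 / 4) powr (- (1 + 2 * s) / 2) * t powr (-1 - 2 * s)" if t: "0 < t" for t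
    proof -
      have "kernK s \<theta> t \<le> zonal M \<theta> (1 / 4 * t\<^sup>2)"
        unfolding K using cosh_aux_ge[of t] t M by (intro zonal_antimono) auto
      also have "\<dots> \<le> B2 * (1 / 4 * t\<^sup>2) powr (- (1 + 2 * s) / 2)" using t by (intro B2(2)) auto
      also have "\<dots> = B2 * (1 / 4) powr (- (1 + 2 * s) / 2) * t powr (-1 - 2 * s)"
        using sq[of t "1 / 4"] t by simp
      finally show ?thesis .
    qed
    define u where "u = real CARD('n) * measure lborel (ball (0::real^'n) 1)"
    have u: "0 \<le> u" by (simp add: u_def)
    show "kernK s \<theta> t \<le> u * (1 / 4) powr (- M) * exp (- (real CARD('n) + 2 * s) / 2 * t)" if t: "1 \<le> t" for t
    proof -
      have "(2::real) \<le> exp 1" using exp_ge_add_one_self[of 1] by simp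
      also have "exp 1 \<le> exp t" using t by simp
      finally have e: "2 \<le> exp t" .
      have "2 * cosh t = exp t + exp (- t)" by (simp add: cosh_def)
      moreover have "exp t + exp (- t) - 2 = exp t * (1 - exp (- t))\<^sup>2"
        by (simp add: power2_eq_square algebra_simps exp_add[symmetric])
      moreover have "exp t * (1 / 2)\<^sup>2 \<le> exp t * (1 - exp (- t))\<^sup>2"
      proof (intro mult_left_mono power_mono)
        have "exp (- t) \<le> 1 / 2" using e by (simp add: exp_minus field_simps)
        then show "1 / 2 \<le> 1 - exp (- t)" by simp
      qed auto
      ultimately have a: "1 / 4 * exp t \<le> 2 * cosh t - 2" by (simp add: power_divide)
      have "kernK s \<theta> t \<le> zonal M \<theta> (1 / 4 * exp t)" unfolding K using a M by (intro zonal_antimono) auto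
      also have "\<dots> \<le> u * (1 / 4 * exp t) powr (- M)" unfolding u_def using M by (intro zonal_le_powr) auto
      also have "(1 / 4 * exp t) powr (- M) = (1 / 4) powr (- M) * exp t powr (- M)" by (rule powr_mult)
      also have "exp t powr (- M) = exp (- (real CARD('n) + 2 * s) / 2 * t)"
      proof -
        have "- (real CARD('n) + 2 * s) / 2 = - M" by (simp only: M_def minus_divide_left)
        then show ?thesis by (simp add: powr_def)
      qed
      finally show ?thesis by (simp add: mult.assoc)
    qed
  qed
qed

section \<open>Positivity of the constant and the main theorem\<close>

text \<open>With \<gamma> and \<open>M\<close> as in the proof, the dimension minus 1 minus
  \<open>M\<close> equals \<open>\<gamma> - 1\<close>, so the radial weight and the factor from
  \<open>sphere_int_zonal\<close> combine to \<open>(r powr \<gamma> - 1) / r\<close>. The factor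
  \<open>\<bar>1 / r\<bar>\<close> is the Jacobian of \<open>ln\<close>, split off for the
  substitution.\<close>

lemma A_const_integrand:
  fixes \<theta> :: "real^'n"
  assumes th: "norm \<theta> = 1" and r: "0 < r"
  shows "sphere_int (\<lambda>\<sigma>. r ^ (CARD('n) - 1) * (1 - r powr (- (real CARD('n) - 2 * s) / 2))
            / \<bar>1 + r\<^sup>2 - 2 * r * (\<theta> \<bullet> \<sigma>)\<bar> powr ((real CARD('n) + 2 * s) / 2))
      = \<bar>1 / r\<bar> * ((exp ((real CARD('n) - 2 * s) / 2 * ln r) - 1) * kernK s \<theta> (ln r))"
proof -
  define M where "M = (real CARD('n) + 2 * s) / 2"
  define \<gamma> where "\<gamma> = (real CARD('n) - 2 * s) / 2"
  have m: "- (real CARD('n) - 2 * s) / 2 = - \<gamma>" by (simp only: \<gamma>_def minus_divide_left)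
  define Z where "Z = zonal M \<theta> (r + 1 / r - 2)"
  have "2 * cosh (ln r) - 2 = r + 1 / r - 2" using r by (simp add: cosh_ln_real inverse_eq_divide)
  then have KZ: "kernK s \<theta> (ln r) = Z" unfolding kernK_zonal[OF th] Z_def M_def by simp
  define q where "q = r ^ (CARD('n) - 1) * (1 - r powr (- \<gamma>))"
  have "sphere_int (\<lambda>\<sigma>. q / \<bar>1 + r\<^sup>2 - 2 * r * (\<theta> \<bullet> \<sigma>)\<bar> powr M)
      = sphere_int (\<lambda>\<sigma>. q * \<bar>1 + r\<^sup>2 - 2 * r * (\<theta> \<bullet> \<sigma>)\<bar> powr (- M))"
    by (simp add: powr_minus divide_inverse)
  also have "\<dots> = q * (r powr (- M) * Z)"
    unfolding sphere_int_cmult Z_def sphere_int_zonal[OF th r] ..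
  also have "q * (r powr (- M) * Z) = (r powr (\<gamma> - 1) - r powr (- 1)) * Z"
  proof -
    have "r ^ (CARD('n) - 1) = r powr (real CARD('n) - 1)"
      using r by (simp add: powr_realpow[symmetric] of_nat_diff Suc_leI)
    then have "q * r powr (- M) = r powr (real CARD('n) - 1) * r powr (- M) - r powr (real CARD('n) - 1) * r powr (- \<gamma>) * r powr (- M)"
      by (simp add: q_def algebra_simps)
    also have "\<dots> = r powr (real CARD('n) - 1 + (- M)) - r powr (real CARD('n) - 1 + (- \<gamma>) + (- M))"
      by (simp only: powr_add)
    also have "real CARD('n) - 1 + (- M) = \<gamma> - 1" by (simp add: M_def \<gamma>_def field_simps)
    also have "real CARD('n) - 1 + (- \<gamma>) + (- M) = - 1" by (simp add: M_def \<gamma>_def field_simps)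
    finally show ?thesis by (simp only: mult.assoc[symmetric])
  qed
  also have "r powr (\<gamma> - 1) - r powr (- 1) = \<bar>1 / r\<bar> * (exp (\<gamma> * ln r) - 1)"
  proof -
    have "r powr (\<gamma> - 1) = r powr \<gamma> / r" using r by (simp add: powr_diff)
    moreover have "r powr \<gamma> = exp (\<gamma> * ln r)" using r by (simp add: powr_def)
    moreover have "r powr (- 1) = 1 / r" using r by (simp add: powr_minus_divide)
    ultimately show ?thesis using r by (simp add: right_diff_distrib)
  qed
  finally show ?thesis unfolding m M_def[symmetric] \<gamma>_def[symmetric] KZ q_def by (simp only: mult.assoc)
qed

lemma set_integral_exp_substitution:
  fixes h :: "real \<Rightarrow> real"
  assumes [measurable]: "h \<in> borel_measurable borel"
    and i: "set_integrable lborel {t. \<bar>exp t - 1\<bar> > \<epsilon>} h"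
  shows "(LINT r : {r. 0 < r \<and> \<bar>r - 1\<bar> > \<epsilon>} | lborel. \<bar>1 / r\<bar> * h (ln r)) = (LINT t : {t. \<bar>exp t - 1\<bar> > \<epsilon>} | lborel. h t)"
proof -
  define S where "S = {r::real. 0 < r \<and> \<bar>r - 1\<bar> > \<epsilon>}"
  define T where "T = {t::real. \<bar>exp t - 1\<bar> > \<epsilon>}"
  have [measurable]: "S \<in> sets borel" "T \<in> sets borel" unfolding S_def T_def by measurable
  have img: "ln ` S = T"
  proof
    show "ln ` S \<subseteq> T" by (auto simp: S_def T_def)
    show "T \<subseteq> ln ` S"
    proof
      fix t assume "t \<in> T"
      then have "exp t \<in> S" "t = ln (exp t)" by (auto simp: S_def T_def)
      then show "t \<in> ln ` S" by blast
    qed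
  qed
  have iT: "integrable lborel (\<lambda>t. indicator T t *\<^sub>R h t)" using i by (simp add: set_integrable_def T_def)
  have absT: "h absolutely_integrable_on T"
    unfolding set_integrable_def using iT by (subst integrable_completion) auto
  have eqT: "(LINT t:T|lborel. h t) = integral T h"
    using iT by (intro set_borel_integral_eq_integral) (simp add: set_integrable_def)
  have "(\<lambda>r. \<bar>1 / r\<bar> * h (ln r)) absolutely_integrable_on S \<and> integral S (\<lambda>r. \<bar>1 / r\<bar> * h (ln r)) = integral T h
    \<longleftrightarrow> h absolutely_integrable_on (ln ` S) \<and> integral (ln ` S) h = integral T h"
  proof (rule has_absolute_integral_change_of_variables_1')
    show "S \<in> sets lebesgue" by (simp add: sets_completionI_sets)
    show "(ln has_field_derivative 1 / x) (at x within S)" if "x \<in> S" for x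
      using that by (auto simp: S_def intro!: DERIV_subset[OF DERIV_ln_divide])
    show "inj_on ln S" by (auto simp: inj_on_def S_def)
  qed
  then have S: "(\<lambda>r. \<bar>1 / r\<bar> * h (ln r)) absolutely_integrable_on S" "integral S (\<lambda>r. \<bar>1 / r\<bar> * h (ln r)) = integral T h"
    using absT img by auto
  have "integrable lborel (\<lambda>r. indicator S r *\<^sub>R (\<bar>1 / r\<bar> * h (ln r)))"
    using S(1) unfolding set_integrable_def by (subst (asm) integrable_completion) auto
  then have "(LINT r:S|lborel. \<bar>1 / r\<bar> * h (ln r)) = integral S (\<lambda>r. \<bar>1 / r\<bar> * h (ln r))"
    by (intro set_borel_integral_eq_integral) (simp add: set_integrable_def)
  then show ?thesis using S(2) eqT unfolding S_def T_def by simp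
qed

lemma exp_minus_one_le: "exp x - 1 \<le> x * exp x" for x :: real
proof -
  have "exp x * (1 + (- x)) \<le> exp x * exp (- x)" by (intro mult_left_mono exp_ge_add_one_self) auto
  then show ?thesis by (simp add: exp_add[symmetric] algebra_simps)
qed

text \<open>Exponential decay is traded for a power so that \<open>powr_split_integrable\<close>
  applies; the constant comes from the quadratic Taylor bound for \<open>exp (2 * y)\<close> at
  \<open>y = s * t\<close>.\<close>

lemma exp_decay_le: "exp (- (2 * s * t)) \<le> (1 / (2 * s\<^sup>2)) * t powr (- 2)" if "0 < s" "0 < t" for s t :: real
proof -
  define y where "y = s * t"
  have y: "0 < y" using that by (simp add: y_def)
  have "2 * y\<^sup>2 \<le> exp y * exp y"
  proof -
    have "1 + 2 * y + (2 * y)\<^sup>2 / 2 \<le> exp (2 * y)" using exp_lower_Taylor_quadratic[of "2 * y"] y by simp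
    then have "2 * y\<^sup>2 \<le> exp (2 * y)" using y by (simp add: power_mult_distrib)
    then show ?thesis by (simp add: exp_add[symmetric])
  qed
  then have "1 / exp (2 * y) \<le> 1 / (2 * y\<^sup>2)"
    using y by (intro divide_left_mono) (auto simp: exp_add[symmetric])
  moreover have "exp (- (2 * s * t)) = 1 / exp (2 * y)" by (simp add: y_def exp_minus inverse_eq_divide mult.assoc)
  moreover have "1 / (2 * y\<^sup>2) = (1 / (2 * s\<^sup>2)) * t powr (- 2)"
    using that by (simp add: y_def power_mult_distrib powr_minus powr_numeral field_simps)
  ultimately show ?thesis by simp
qed

text \<open>In the variable \<open>t = ln \<rho>\<close> the integrand of \<open>A_const\<close> is \<open>(exp (\<gamma> t) - 1) K(t)\<close>; since \<open>K\<close> is even,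
  folding \<open>t \<mapsto> - t\<close> leaves the positive integrand \<open>(exp (\<gamma> t) + exp (- \<gamma> t) - 2) K(t)\<close> on \<open>t > 0\<close>, up to
  the interval \<open>(ln (1 + \<epsilon>), - ln (1 - \<epsilon>)]\<close> of length \<open>O(\<epsilon>\<^sup>2)\<close>, whose contribution is \<open>O(\<epsilon> powr (2 - 2 s))\<close>.\<close>

lemma A_const_pos:
  fixes \<theta> :: "real^'n"
  assumes th: "norm \<theta> = 1" and s: "0 < s" "s < 1" and N: "real CARD('n) > 2 * s"
  shows "0 < A_const s \<theta>"
proof -
  define \<gamma> where "\<gamma> = (real CARD('n) - 2 * s) / 2"
  define M where "M = (real CARD('n) + 2 * s) / 2"
  have g0: "0 < \<gamma>" using N by (simp add: \<gamma>_def)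
  have gM: "\<gamma> - M = - 2 * s" by (simp add: \<gamma>_def M_def field_simps)
  define K where "K = kernK s \<theta>"
  obtain c C C2 where K: "symdec K" and Kpos: "\<And>t. t \<noteq> 0 \<Longrightarrow> 0 < K t"
    and Kup: "\<And>t. 0 < t \<Longrightarrow> K t \<le> C * t powr (-1 - 2 * s)"
    and Kexp': "\<And>t. 1 \<le> t \<Longrightarrow> K t \<le> C2 * exp (- (real CARD('n) + 2 * s) / 2 * t)"
    unfolding K_def using kernK_facts[OF th s(1)] by metis
  have Kexp: "K t \<le> C2 * exp (- M * t)" if "1 \<le> t" for t
  proof -
    have "- (real CARD('n) + 2 * s) / 2 = - M" by (simp only: M_def minus_divide_left)
    then show ?thesis using Kexp'[OF that] by simp
  qed
  have K0: "0 \<le> K t" for t by (rule symdec_nonneg[OF K])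
  have [measurable]: "K \<in> borel_measurable borel" by (rule symdec_borel[OF K])
  have C: "0 \<le> C" using Kup[of 1] K0[of 1] by simp
  have C2: "0 \<le> C2" using order_trans[OF K0 Kexp[of 1]] by (simp add: zero_le_mult_iff)
  define h where "h t = (exp (\<gamma> * t) - 1) * K t" for t
  have hm [measurable]: "h \<in> borel_measurable borel" unfolding h_def[abs_def] by measurable
  define H where "H t = (exp (\<gamma> * t) + exp (- (\<gamma> * t)) - 2) * K t" for t
  have Hm [measurable]: "H \<in> borel_measurable borel" unfolding H_def[abs_def] by measurable
  have Hh: "H t = h t + h (- t)" for t using symdec_minus[OF K] by (simp add: H_def h_def algebra_simps)
  have Hc: "exp (\<gamma> * t) + exp (- (\<gamma> * t)) - 2 = 2 * cosh (\<gamma> * t) - 2" for t by (simp add: cosh_def)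
  have Hpos: "0 < H t" if "0 < t" for t
  proof -
    have "0 < (\<gamma> * t)\<^sup>2 / 4" using that g0 by simp
    also have "\<dots> \<le> 2 * cosh (\<gamma> * t) - 2" using that g0 by (intro cosh_aux_ge) auto
    finally show ?thesis unfolding H_def Hc using Kpos[of t] that by simp
  qed
  \<comment> \<open>Since \<open>\<gamma> - M = - 2 * s\<close>, the decay of \<open>K\<close> beats
    the growing exponential by the factor \<open>exp (- (2 * s * t))\<close>.\<close>
  have far: "exp (\<gamma> * t) * K t \<le> C2 / (2 * s\<^sup>2) * t powr (- 2)" if t: "1 \<le> t" for t
  proof -
    have "exp (\<gamma> * t) * K t \<le> exp (\<gamma> * t) * (C2 * exp (- M * t))" using Kexp[OF t] by (intro mult_left_mono) auto
    also have "\<dots> = C2 * exp ((\<gamma> - M) * t)" by (simp add: exp_add[symmetric] algebra_simps)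
    also have "\<dots> = C2 * exp (- (2 * s * t))" unfolding gM by simp
    also have "\<dots> \<le> C2 * ((1 / (2 * s\<^sup>2)) * t powr (- 2))" using C2 t s by (intro mult_left_mono exp_decay_le) auto
    finally show ?thesis by simp
  qed
  \<comment> \<open>The folded factor vanishes to second order at 0, which leaves the power
    \<open>2 - 1 - 2 * s\<close>, above \<open>-1\<close> for \<open>s < 1\<close>.\<close>
  have iH: "integrable lborel (\<lambda>t. H t * indicator {0<..} t)"
  proof (rule powr_split_integrable)
    show "- 1 < 1 - 2 * s" "(- 2::real) < - 1" using s by auto
    show "\<bar>H t * indicator {0<..} t\<bar> \<le> \<gamma>\<^sup>2 * exp \<gamma> * C * \<bar>t\<bar> powr (1 - 2 * s)" if "t \<noteq> 0" "\<bar>t\<bar> \<le> 1" for t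
    proof (cases "0 < t")
      case True
      have "2 * cosh (\<gamma> * t) - 2 \<le> (\<gamma> * t)\<^sup>2 * exp (\<gamma> * t)" using True g0 by (intro cosh_aux_le) auto
      also have "\<dots> \<le> (\<gamma> * t)\<^sup>2 * exp \<gamma>" using that True g0 by (intro mult_left_mono) auto
      finally have "H t \<le> (\<gamma> * t)\<^sup>2 * exp \<gamma> * (C * t powr (-1 - 2 * s))"
        unfolding H_def Hc using Kup[OF True] K0 by (intro mult_mono) auto
      also have "\<dots> = \<gamma>\<^sup>2 * exp \<gamma> * C * (t powr 2 * t powr (-1 - 2 * s))"
        using True by (simp add: power_mult_distrib powr_numeral)
      also have "t powr 2 * t powr (-1 - 2 * s) = t powr (1 - 2 * s)" by (simp add: powr_add[symmetric])
      finally show ?thesis using True Hpos[OF True] by simp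
    qed (use C in simp)
    show "\<bar>H t * indicator {0<..} t\<bar> \<le> 2 * (C2 / (2 * s\<^sup>2)) * \<bar>t\<bar> powr (- 2)" if "1 \<le> \<bar>t\<bar>" for t
    proof (cases "0 < t")
      case True
      then have t: "1 \<le> t" using that by simp
      have "exp (- (\<gamma> * t)) \<le> exp (\<gamma> * t)" using t g0 by simp
      then have "exp (\<gamma> * t) + exp (- (\<gamma> * t)) - 2 \<le> 2 * exp (\<gamma> * t)" by linarith
      then have "H t \<le> (2 * exp (\<gamma> * t)) * K t" unfolding H_def using K0 by (rule mult_right_mono)
      also have "\<dots> = 2 * (exp (\<gamma> * t) * K t)" by simp
      also have "\<dots> \<le> 2 * (C2 / (2 * s\<^sup>2) * t powr (- 2))" using far[OF t] by (intro mult_left_mono) auto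
      finally show ?thesis using True Hpos[OF True] by simp
    qed (use C2 in simp)
  qed measurable
  define A0 where "A0 = (LINT t|lborel. H t * indicator {0<..} t)"
  have A0: "0 < A0"
  proof (rule ccontr)
    assume "\<not> 0 < A0"
    have nn: "0 \<le> H t * indicator {0<..} t" for t using Hpos[of t] by (auto split: split_indicator)
    then have "0 \<le> A0" unfolding A0_def by (rule Bochner_Integration.integral_nonneg)
    with \<open>\<not> 0 < A0\<close> have "A0 = 0" by simp
    then have "AE t in lborel. H t * indicator {0<..} t = 0"
      using integral_nonneg_eq_0_iff_AE[OF iH] nn by (simp add: A0_def)
    from AE_exists_between[OF this, of 0 1] obtain t where "0 < t" "H t * indicator {0<..} t = 0" by auto
    then show False using Hpos[of t] by simp
  qed
  define \<Phi> where "\<Phi> \<epsilon> = (LINT \<rho> : {\<rho>. 0 < \<rho> \<and> \<bar>\<rho> - 1\<bar> > \<epsilon>} | lborel.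
       sphere_int (\<lambda>\<sigma>. \<rho> ^ (CARD('n) - 1) * (1 - \<rho> powr (- (real CARD('n) - 2 * s) / 2))
                     / \<bar>1 + \<rho>\<^sup>2 - 2 * \<rho> * (\<theta> \<bullet> \<sigma>)\<bar> powr ((real CARD('n) + 2 * s) / 2)))" for \<epsilon>
  \<comment> \<open>The limit at 0 is taken along arbitrary positive sequences, which may begin with
    \<open>\<epsilon> \<ge> 1\<close>. \<open>max 0\<close> keeps the integrand below that of
    \<open>A0\<close> in that case too.\<close>
  define P where "P \<epsilon> = (LINT t|lborel. H t * indicator {max 0 (- ln (1 - \<epsilon>))<..} t)" for \<epsilon>
  have habs: "\<bar>h t\<bar> \<le> exp (\<gamma> * \<bar>t\<bar>) * K \<bar>t\<bar>" for t
  proof -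
    have 1: "1 \<le> exp (\<gamma> * \<bar>t\<bar>)" using g0 by simp
    have "exp (\<gamma> * t) \<le> exp (\<gamma> * \<bar>t\<bar>)" using g0 by simp
    then have "\<bar>exp (\<gamma> * t) - 1\<bar> \<le> exp (\<gamma> * \<bar>t\<bar>)" using 1 exp_gt_zero[of "\<gamma> * t"] by linarith
    then show ?thesis unfolding h_def using K0 symdec_abs[OF K] by (simp add: abs_mult mult_right_mono)
  qed
  have ih: "integrable lborel (\<lambda>t. h t * indicator S t)" if S: "S \<in> sets borel" "0 < \<delta>" "\<And>t. t \<in> S \<Longrightarrow> \<delta> \<le> \<bar>t\<bar>" for S \<delta>
  proof (rule powr_split_integrable)
    show "(\<lambda>t. h t * indicator S t) \<in> borel_measurable borel" using S(1) by measurable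
    show "- 1 < (0::real)" "(- 2::real) < - 1" by auto
    show "\<bar>h t * indicator S t\<bar> \<le> exp \<gamma> * (C * \<delta> powr (-1 - 2 * s)) * \<bar>t\<bar> powr 0" if "t \<noteq> 0" "\<bar>t\<bar> \<le> 1" for t
    proof (cases "t \<in> S")
      case True
      have "\<bar>h t\<bar> \<le> exp \<gamma> * (C * \<delta> powr (-1 - 2 * s))"
      proof (rule order_trans[OF habs mult_mono])
        show "exp (\<gamma> * \<bar>t\<bar>) \<le> exp \<gamma>" using that g0 by (simp add: mult_left_le)
        have "K \<bar>t\<bar> \<le> C * \<bar>t\<bar> powr (-1 - 2 * s)" using that by (intro Kup) simp
        also have "\<dots> \<le> C * \<delta> powr (-1 - 2 * s)" using S(2) S(3)[OF True] C s by (intro mult_left_mono powr_mono2') auto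
        finally show "K \<bar>t\<bar> \<le> C * \<delta> powr (-1 - 2 * s)" .
      qed (use K0 in auto)
      then show ?thesis using True that by simp
    qed (use C in simp)
    show "\<bar>h t * indicator S t\<bar> \<le> C2 / (2 * s\<^sup>2) * \<bar>t\<bar> powr (- 2)" if "1 \<le> \<bar>t\<bar>" for t
      using order_trans[OF habs[of t] far[OF that]] C2 by (auto split: split_indicator)
  qed
  define R where "R \<epsilon> = (LINT t|lborel. h t * indicator {ln (1 + \<epsilon>)<..- ln (1 - \<epsilon>)} t)" for \<epsilon>
  have split: "\<Phi> \<epsilon> = P \<epsilon> + R \<epsilon>" if e: "0 < \<epsilon>" "\<epsilon> < 1" for \<epsilon>
  proof -
    define \<alpha> where "\<alpha> = ln (1 + \<epsilon>)"
    define \<beta> where "\<beta> = - ln (1 - \<epsilon>)"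
    have a0: "0 < \<alpha>" using e by (simp add: \<alpha>_def)
    have "0 < (1 + \<epsilon>) * (1 - \<epsilon>)" "(1 + \<epsilon>) * (1 - \<epsilon>) \<le> 1"
      using e by (simp, simp add: algebra_simps)
    then have "ln ((1 + \<epsilon>) * (1 - \<epsilon>)) \<le> 0" by (simp only: ln_le_zero_iff)
    then have ab: "\<alpha> \<le> \<beta>" using e unfolding \<alpha>_def \<beta>_def by (simp add: ln_mult)
    define T where "T = {t. \<bar>exp t - 1\<bar> > \<epsilon>}"
    have T: "t \<in> T \<longleftrightarrow> \<alpha> < t \<or> t < - \<beta>" for t
    proof -
      have "\<alpha> < t \<longleftrightarrow> 1 + \<epsilon> < exp t" unfolding \<alpha>_def using e ln_less_cancel_iff[of "1 + \<epsilon>" "exp t"] by simp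
      moreover have "t < - \<beta> \<longleftrightarrow> exp t < 1 - \<epsilon>" unfolding \<beta>_def using e ln_less_cancel_iff[of "exp t" "1 - \<epsilon>"] by simp
      ultimately show ?thesis by (auto simp: T_def)
    qed
    have [measurable]: "T \<in> sets borel" unfolding T_def by measurable
    have iT: "integrable lborel (\<lambda>t. h t * indicator T t)"
      by (rule ih[of T \<alpha>]) (use a0 ab T in auto)
    have "\<Phi> \<epsilon> = (LINT \<rho> : {\<rho>. 0 < \<rho> \<and> \<bar>\<rho> - 1\<bar> > \<epsilon>} | lborel. \<bar>1 / \<rho>\<bar> * h (ln \<rho>))"
      unfolding \<Phi>_def
    proof (rule set_lebesgue_integral_cong)
      show "{\<rho>. 0 < \<rho> \<and> \<bar>\<rho> - 1\<bar> > \<epsilon>} \<in> sets lborel" by measurable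
    qed (unfold h_def K_def \<gamma>_def, intro allI impI A_const_integrand[OF th], simp)
    also have "\<dots> = (LINT t : T | lborel. h t)"
      unfolding T_def
      by (rule set_integral_exp_substitution[OF hm]) (use iT in \<open>simp add: set_integrable_def T_def mult.commute\<close>)
    also have "\<dots> = (LINT t|lborel. h t * indicator T t)"
      by (simp add: set_lebesgue_integral_def mult.commute)
    also have "(\<lambda>t. h t * indicator T t) = (\<lambda>t. (h t * indicator {\<alpha><..\<beta>} t + h t * indicator {\<beta><..} t) + h t * indicator {..<- \<beta>} t)"
      using T a0 ab by (auto simp: fun_eq_iff split: split_indicator)
    also have "(LINT t|lborel. (h t * indicator {\<alpha><..\<beta>} t + h t * indicator {\<beta><..} t) + h t * indicator {..<- \<beta>} t)
       = ((LINT t|lborel. h t * indicator {\<alpha><..\<beta>} t) + (LINT t|lborel. h t * indicator {\<beta><..} t)) + (LINT t|lborel. h t * indicator {..<- \<beta>} t)"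
    proof -
      have "integrable lborel (\<lambda>t. h t * indicator {\<alpha><..\<beta>} t)" "integrable lborel (\<lambda>t. h t * indicator {\<beta><..} t)"
        "integrable lborel (\<lambda>t. h t * indicator {..<- \<beta>} t)"
        by (rule ih[of _ \<alpha>]; use a0 ab in auto)+
      then show ?thesis by simp
    qed
    also have "(LINT t|lborel. h t * indicator {..<- \<beta>} t) = (LINT t|lborel. h (- t) * indicator {\<beta><..} t)"
    proof -
      have "(\<lambda>t. h (0 - t) * indicator {..<- \<beta>} (0 - t)) = (\<lambda>t. h (- t) * indicator {\<beta><..} t)"
        by (auto simp: fun_eq_iff split: split_indicator)
      then show ?thesis using lborel_integral_reflect[of "\<lambda>t. h t * indicator {..<- \<beta>} t" 0] by simp
    qed
    also have "((LINT t|lborel. h t * indicator {\<alpha><..\<beta>} t) + (LINT t|lborel. h t * indicator {\<beta><..} t)) + (LINT t|lborel. h (- t) * indicator {\<beta><..} t)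
      = P \<epsilon> + R \<epsilon>"
    proof -
      have i1: "integrable lborel (\<lambda>t. h t * indicator {\<beta><..} t)" by (rule ih[of _ \<alpha>]) (use a0 ab in auto)
      have "integrable lborel (\<lambda>t. h t * indicator {..<- \<beta>} t)" by (rule ih[of _ \<alpha>]) (use a0 ab in auto)
      then have "integrable lborel (\<lambda>t. h (0 - t) * indicator {..<- \<beta>} (0 - t))" by (subst lborel_integrable_reflect_iff)
      moreover have "(\<lambda>t. h (0 - t) * indicator {..<- \<beta>} (0 - t)) = (\<lambda>t. h (- t) * indicator {\<beta><..} t)"
        by (auto simp: fun_eq_iff split: split_indicator)
      ultimately have i2: "integrable lborel (\<lambda>t. h (- t) * indicator {\<beta><..} t)" by simp
      have "max 0 \<beta> = \<beta>" using a0 ab by simp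
      then have "P \<epsilon> = (LINT t|lborel. h t * indicator {\<beta><..} t + h (- t) * indicator {\<beta><..} t)"
        unfolding P_def \<beta>_def[symmetric] Hh by (simp add: distrib_right)
      also have "\<dots> = (LINT t|lborel. h t * indicator {\<beta><..} t) + (LINT t|lborel. h (- t) * indicator {\<beta><..} t)"
        using i1 i2 by simp
      finally show ?thesis unfolding R_def \<alpha>_def[symmetric] \<beta>_def[symmetric] by simp
    qed
    finally show ?thesis .
  qed
  define D where "D = \<gamma> * exp \<gamma> * C * (1 / 2) powr (- 2 * s) * 3"
  have R: "norm (R \<epsilon>) \<le> D * \<epsilon> powr (2 - 2 * s)" if e: "0 < \<epsilon>" "\<epsilon> < 1 / 4" for \<epsilon>
  proof -
    define \<alpha> where "\<alpha> = ln (1 + \<epsilon>)"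
    define \<beta> where "\<beta> = - ln (1 - \<epsilon>)"
    have sq: "\<epsilon>\<^sup>2 \<le> \<epsilon> / 4" using e by (simp add: power2_eq_square)
    have a: "\<epsilon> - \<epsilon>\<^sup>2 \<le> \<alpha>" unfolding \<alpha>_def using e by (intro ln_one_plus_pos_lower_bound) auto
    have b: "\<beta> \<le> \<epsilon> + 2 * \<epsilon>\<^sup>2" unfolding \<beta>_def using ln_one_minus_pos_lower_bound[of \<epsilon>] e by simp
    have a2: "\<epsilon> / 2 \<le> \<alpha>" using a sq e by linarith
    have b1: "\<beta> \<le> 1" using b sq e by linarith
    have "0 < (1 + \<epsilon>) * (1 - \<epsilon>)" "(1 + \<epsilon>) * (1 - \<epsilon>) \<le> 1"
      using e by (simp, simp add: algebra_simps)
    then have "ln ((1 + \<epsilon>) * (1 - \<epsilon>)) \<le> 0" by (simp only: ln_le_zero_iff)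
    then have ab: "\<alpha> \<le> \<beta>" using e unfolding \<alpha>_def \<beta>_def by (simp add: ln_mult)
    \<comment> \<open>A bound for \<open>h\<close> on the unbalanced interval:
      \<open>exp (\<gamma> * t) - 1\<close> takes one power off the singularity of \<open>K\<close>,
      and \<open>t \<ge> \<epsilon> / 2\<close> there.\<close>
    define Q where "Q = \<gamma> * exp \<gamma> * C * (\<epsilon> / 2) powr (- 2 * s)"
    have Q: "0 \<le> Q" using g0 C by (simp add: Q_def)
    have hQ: "\<bar>h t\<bar> \<le> Q" if t: "\<alpha> < t" "t \<le> \<beta>" for t
    proof -
      have t0: "0 < t" "t \<le> 1" "\<epsilon> / 2 \<le> t" using t a2 b1 e by auto
      have "exp (\<gamma> * t) - 1 \<le> \<gamma> * t * exp (\<gamma> * t)" by (rule exp_minus_one_le)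
      also have "\<dots> \<le> \<gamma> * t * exp \<gamma>" using t0 g0 by (intro mult_left_mono) auto
      finally have "h t \<le> (\<gamma> * t * exp \<gamma>) * (C * t powr (-1 - 2 * s))"
        unfolding h_def using Kup[OF t0(1)] K0 g0 t0 by (intro mult_mono) auto
      also have "\<dots> = \<gamma> * exp \<gamma> * C * (t powr 1 * t powr (-1 - 2 * s))" using t0 by simp
      also have "t powr 1 * t powr (-1 - 2 * s) = t powr (- 2 * s)" by (simp only: powr_add[symmetric]) simp
      also have "\<gamma> * exp \<gamma> * C * t powr (- 2 * s) \<le> Q"
        unfolding Q_def using t0 g0 C s e by (intro mult_left_mono powr_mono2') auto
      finally have "h t \<le> Q" .
      moreover have "0 \<le> h t" unfolding h_def using g0 t0 K0 by simp
      ultimately show ?thesis by simp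
    qed
    have "norm (R \<epsilon>) \<le> (LINT t|lborel. \<bar>h t * indicator {\<alpha><..\<beta>} t\<bar>)"
      unfolding R_def \<alpha>_def \<beta>_def real_norm_def by (rule integral_abs_bound)
    also have "\<dots> \<le> (LINT t|lborel. Q * indicator {\<alpha><..\<beta>} t)"
    proof (rule integral_mono')
      show "integrable lborel (\<lambda>t. Q * indicator {\<alpha><..\<beta>} t)"
        using ab by (intro integrable_mult_right integrable_real_indicator) auto
    qed (use hQ Q in \<open>auto split: split_indicator\<close>)
    also have "\<dots> = Q * (\<beta> - \<alpha>)" using ab by (simp add: measure_def)
    also have "\<dots> \<le> Q * (3 * \<epsilon>\<^sup>2)" using Q a b by (intro mult_left_mono) auto
    also have "\<dots> = D * (\<epsilon> powr (- 2 * s) * \<epsilon> powr 2)"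
    proof -
      have "(\<epsilon> / 2) powr (- 2 * s) = (1 / 2) powr (- 2 * s) * \<epsilon> powr (- 2 * s)"
        using powr_mult[of "1 / 2" \<epsilon> "- 2 * s"] by simp
      moreover have "\<epsilon> powr 2 = \<epsilon>\<^sup>2" using e by (simp add: powr_numeral)
      ultimately show ?thesis unfolding Q_def D_def by (simp only: mult_ac)
    qed
    also have "\<epsilon> powr (- 2 * s) * \<epsilon> powr 2 = \<epsilon> powr (2 - 2 * s)" by (simp only: powr_add[symmetric]) simp
    finally show ?thesis .
  qed
  have Rlim: "(R \<longlongrightarrow> 0) (at_right 0)"
  proof (rule Lim_null_comparison)
    show "eventually (\<lambda>\<epsilon>. norm (R \<epsilon>) \<le> D * \<epsilon> powr (2 - 2 * s)) (at_right 0)"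
      unfolding eventually_at_right_field by (intro exI[of _ "1 / 4"]) (use R in auto)
    have "((\<lambda>\<epsilon>. D * \<epsilon> powr (2 - 2 * s)) \<longlongrightarrow> D * 0 powr (2 - 2 * s)) (at_right 0)"
      using s by (intro tendsto_intros tendsto_powr' tendsto_ident_at) (auto simp: eventually_at_right_field intro: exI[of _ 1])
    then show "((\<lambda>\<epsilon>. D * \<epsilon> powr (2 - 2 * s)) \<longlongrightarrow> 0) (at_right 0)" by simp
  qed
  have Plim: "(P \<longlongrightarrow> A0) (at_right 0)"
    unfolding tendsto_at_iff_sequentially comp_def
  proof (intro allI impI)
    fix X :: "nat \<Rightarrow> real" assume X: "\<forall>i. X i \<in> {0<..} - {0}" "X \<longlonglongrightarrow> 0"
    show "(\<lambda>n. P (X n)) \<longlonglongrightarrow> A0"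
      unfolding P_def A0_def
    proof (rule integral_dominated_convergence[OF _ _ iH])
      have "(\<lambda>n. max 0 (- ln (1 - X n))) \<longlonglongrightarrow> max 0 (- ln (1 - 0))"
        by (intro tendsto_intros X) auto
      then have l: "(\<lambda>n. max 0 (- ln (1 - X n))) \<longlonglongrightarrow> 0" by simp
      show "AE t in lborel. (\<lambda>n. H t * indicator {max 0 (- ln (1 - X n))<..} t) \<longlonglongrightarrow> H t * indicator {0<..} t"
      proof (rule AE_I2)
        fix t
        show "(\<lambda>n. H t * indicator {max 0 (- ln (1 - X n))<..} t) \<longlonglongrightarrow> H t * indicator {0<..} t"
        proof (cases "0 < t")
          case True
          have "eventually (\<lambda>n. max 0 (- ln (1 - X n)) < t) sequentially" using l True by (rule order_tendstoD)
          then have "eventually (\<lambda>n. H t * indicator {max 0 (- ln (1 - X n))<..} t = H t * indicator {0<..} t) sequentially"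
            by eventually_elim (use True in simp)
          then show ?thesis by (rule tendsto_eventually)
        next
          case False
          then have "(\<lambda>n. H t * indicator {max 0 (- ln (1 - X n))<..} t) = (\<lambda>n. 0)" "H t * indicator {0<..} t = 0"
            by (auto simp: fun_eq_iff)
          then show ?thesis by (simp only: tendsto_const)
        qed
      qed
      show "AE t in lborel. norm (H t * indicator {max 0 (- ln (1 - X n))<..} t) \<le> H t * indicator {0<..} t" for n
        using Hpos by (intro AE_I2) (auto split: split_indicator simp: less_imp_le)
    qed measurable
  qed
  have "((\<lambda>\<epsilon>. P \<epsilon> + R \<epsilon>) \<longlongrightarrow> A0 + 0) (at_right 0)" by (intro tendsto_intros Plim Rlim)
  then have "(\<Phi> \<longlongrightarrow> A0 + 0) (at_right 0)"
  proof (rule Lim_transform_eventually)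
    show "eventually (\<lambda>\<epsilon>. P \<epsilon> + R \<epsilon> = \<Phi> \<epsilon>) (at_right 0)"
      unfolding eventually_at_right_field by (intro exI[of _ 1]) (use split in auto)
  qed
  then have "Lim (at_right 0) \<Phi> = A0" by (intro tendsto_Lim) auto
  then show ?thesis using A0 by (simp add: A_const_def \<Phi>_def[abs_def])
qed

theorem theorem4p4:
  fixes \<theta> :: "real^'n" and s \<alpha> p :: real
  assumes "norm \<theta> = 1"
    and "0 < s" and "s < 1" and "real CARD('n) > 2 * s"
    and "p = (real CARD('n) + 2 * \<alpha> + 2 * s) / (real CARD('n) - 2 * s)"
    and "(1/2 \<le> s \<and> \<alpha> > - 2 * s) \<or>
         (s < 1/2 \<and> - 2 * s < \<alpha> \<and> \<alpha> < 2 * s * (real CARD('n) - 1) / (1 - 2 * s))"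
  shows "\<exists>v. variational_solution s \<theta> p v \<and> (\<forall>\<kappa>. v \<kappa> \<ge> 0) \<and> \<not> (AE x in lborel. v x = 0)
            \<and> classical_solution s \<theta> p v \<and> (\<forall>\<kappa>. v \<kappa> > 0)"
proof -
  define N where "N = real CARD('n)"
  have N: "0 < N - 2 * s" using assms(4) by (simp add: N_def)
  have pm: "p - 1 = (2 * \<alpha> + 4 * s) / (N - 2 * s)" and pp: "p + 1 = (2 * N + 2 * \<alpha>) / (N - 2 * s)"
    using N unfolding assms(5) N_def[symmetric] by (auto simp: field_simps)
  have al: "- 2 * s < \<alpha>" using assms(6) by auto
  then have "0 < p - 1" unfolding pm using N by simp
  then have p: "1 < p" by simp
  have pN: "0 < 2 * N + 2 * \<alpha>" using N al by simp
  \<comment> \<open>With \<open>N\<close> the dimension, clearing denominators gives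
    \<open>\<alpha> * (1 - 2 * s) < 2 * s * (N - 1)\<close>. For \<open>s < 1 / 2\<close> this is
    the assumed upper bound on \<open>\<alpha>\<close>; for \<open>s \<ge> 1 / 2\<close> the
    quotient is below 1 and hence below \<open>2 * s\<close>.\<close>
  have "(p - 1) / (p + 1) < 2 * s"
  proof (cases "1 / 2 \<le> s")
    case True
    have "(p - 1) / (p + 1) < 1" using p by simp
    then show ?thesis using True by linarith
  next
    case False
    then have "\<alpha> * (1 - 2 * s) < 2 * s * (N - 1)" using assms(6) by (auto simp: N_def field_simps)
    then have "2 * \<alpha> + 4 * s < 2 * s * (2 * N + 2 * \<alpha>)" by (simp add: algebra_simps)
    then have "(2 * \<alpha> + 4 * s) / (2 * N + 2 * \<alpha>) < 2 * s" using pN by (simp add: field_simps)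
    moreover have "(p - 1) / (p + 1) = (2 * \<alpha> + 4 * s) / (2 * N + 2 * \<alpha>)" unfolding pm pp using N by simp
    ultimately show ?thesis by simp
  qed
  note sub = this
  obtain c C C2 where c: "0 < c" and K: "symdec (kernK s \<theta>)" and Kpos: "\<And>t. t \<noteq> 0 \<Longrightarrow> 0 < kernK s \<theta> t"
    and low: "\<And>t. 0 < t \<Longrightarrow> t \<le> 1 \<Longrightarrow> c * t powr (-1 - 2 * s) \<le> kernK s \<theta> t"
    and up: "\<And>t. 0 < t \<Longrightarrow> kernK s \<theta> t \<le> C * t powr (-1 - 2 * s)"
    using kernK_facts[OF assms(1,2)] by metis
  interpret levy_kernel "kernK s \<theta>" s "A_const s \<theta>" c C
    by unfold_locales (use K assms(2,3) A_const_pos[OF assms(1-4)] c low up in auto)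
  obtain V where V: "continuous_on UNIV V" "\<And>x. 0 < V x" "integrable lborel (\<lambda>x. (V x)\<^sup>2)"
    "(\<integral>\<^sup>+ \<kappa>. \<integral>\<^sup>+ \<tau>. ennreal ((V \<kappa> - V \<tau>)\<^sup>2 * kernK s \<theta> (\<kappa> - \<tau>)) \<partial>lborel \<partial>lborel) < \<infinity>"
    "\<And>\<phi>. \<phi> \<in> borel_measurable borel \<Longrightarrow> integrable lborel (\<lambda>x. (\<phi> x)\<^sup>2) \<Longrightarrow>
      (\<integral>\<^sup>+ \<kappa>. \<integral>\<^sup>+ \<tau>. ennreal ((\<phi> \<kappa> - \<phi> \<tau>)\<^sup>2 * kernK s \<theta> (\<kappa> - \<tau>)) \<partial>lborel \<partial>lborel) < \<infinity> \<Longrightarrow>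
      1 / 2 * (LINT \<kappa>|lborel. LINT \<tau>|lborel. (V \<kappa> - V \<tau>) * (\<phi> \<kappa> - \<phi> \<tau>) * kernK s \<theta> (\<kappa> - \<tau>))
        + A_const s \<theta> * (LINT \<kappa>|lborel. V \<kappa> * \<phi> \<kappa>) = (LINT \<kappa>|lborel. V \<kappa> powr p * \<phi> \<kappa>)"
    "\<forall>\<kappa>. \<exists>Tv. (\<forall>\<epsilon>>0. set_integrable lborel {\<tau>. \<bar>\<kappa> - \<tau>\<bar> > \<epsilon>} (\<lambda>\<tau>. (V \<kappa> - V \<tau>) * kernK s \<theta> (\<kappa> - \<tau>))) \<and>
      ((\<lambda>\<epsilon>. LINT \<tau> : {\<tau>. \<bar>\<kappa> - \<tau>\<bar> > \<epsilon>} | lborel. (V \<kappa> - V \<tau>) * kernK s \<theta> (\<kappa> - \<tau>)) \<longlongrightarrow> Tv) (at_right 0) \<and>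
      Tv + A_const s \<theta> * V \<kappa> = V \<kappa> powr p"
    using solution_exists[OF Kpos p sub] by auto
  have "V \<in> borel_measurable lborel"
    using borel_measurable_continuous_onI[OF V(1)] by simp
  then have "V \<in> HsK s \<theta>" using V(3,4) by (simp add: HsK_def)
  then have "variational_solution s \<theta> p V"
    unfolding variational_solution_def using V(5) by (auto simp: HsK_def)
  moreover have "classical_solution s \<theta> p V"
    unfolding classical_solution_def using V(1,6) by blast
  moreover have "\<not> (AE x in lborel. V x = 0)"
  proof
    assume "AE x in lborel. V x = 0"
    from AE_exists_between[OF this, of 0 1] obtain y where "V y = 0" by auto
    then show False using V(2)[of y] by simp
  qed
  ultimately show ?thesis using V(2) by (intro exI[of _ V]) (auto simp: less_imp_le)
qed

end
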